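(* Let $(X_i,Y_i,Z_i)_{i=1}^\infty$ be $\mathbb R\times\mathbb R\times\mathbb R^d$-valued triplets, i.i.d. under every $\mathsf P\in\mathcal P$, and let $\mathcal P_0\subseteq\mathcal P$ be a class of distributions under each of which $X\perp\!\!\!\perp Y\mid Z$ and which satisfies the following three assumptions. (1) For some $\delta>0$, $$\sup_{\mathsf P\in\mathcal P_0}\sqrt{\mathbb E_{\mathsf P}\|\widehat\mu_n^x-\mu^x\|_{L_2(\mathsf P)}^2}\cdot\sqrt{\mathbb E_{\mathsf P}\|\widehat\mu_n^y-\mu^y\|_{L_2(\mathsf P)}^2}=O\left(\frac1{\sqrt{n\log^{2+\delta}(n)}}\right).$$ (2) For some $\delta>0$, $$\sup_{\mathsf P\in\mathcal P_0}\mathrm{Var}_{\mathsf P}\left(\{\widehat\mu_n^x(Z)-\mu^x(Z)\}\cdot\xi^y\right)=O\left(\frac1{(\log n)^{2+\delta}}\right)\quad\text{and}\quad\sup_{\mathsf P\in\mathcal P_0}\mathrm{Var}_{\mathsf P}\left(\{\widehat\mu_n^y(Z)-\mu^y(Z)\}\cdot\xi^x\right)=O\left(\frac1{(\log n)^{2+\delta}}\right).$$ (3) For some $\delta>0$, $\sup_{\mathsf P\in\mathcal P_0}\mathbb E_{\mathsf P}|\xi^x\xi^y|^{2+\delta}<\infty$ and $\inf_{\mathsf P\in\mathcal P_0}\mathrm{Var}_{\mathsf P}(\xi^x\xi^y)>0$. Define, for $k\ge m\ge1$, $$\overline p_{k,m}^{\mathrm{GCM}}:=1-\Psi\left(k\left(\overline{\mathrm{GCM}}_k\right)^2-\log(k/m)\right).$$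 Then $$\lim_{m\to\infty}\sup_{\mathsf P\in\mathcal P_0}\sup_{\alpha\in(0,1)}\left|\mathsf P\left(\exists k\ge m:\overline p_{k,m}^{\mathrm{GCM}}\le\alpha\right)-\alpha\right|=0 .$$
   Context: $\mathcal P$ is a collection of probability measures on a measurable space $(\Omega,\mathcal F)$. $(X,Y,Z)$ denotes a generic triplet with the same law as $(X_1,Y_1,Z_1)$ and independent of the training data. $\mu^x(z):=\mathbb E_{\mathsf P}(X\mid Z=z)$, $\mu^y(z):=\mathbb E_{\mathsf P}(Y\mid Z=z)$ (they depend on $\mathsf P$), $\xi^x:=X-\mu^x(Z)$, $\xi^y:=Y-\mu^y(Z)$. Regression estimators: $\widehat\mu_n^x,\widehat\mu_n^y:\mathbb R^d\to\mathbb R$ are estimators of $\mu^x,\mu^y$ built from an independent training sample. Concretely, at each time $n$ a second (training) triplet, an independent copy of $(X_n,Y_n,Z_n)$, is also observed; $\widehat\mu_n^x,\widehat\mu_n^y$ are functions of the first $n$ training triplets, and the whole training sequence is independent of $(X_i,Y_i,Z_i)_{i\ge1}$. For such an estimator $\widehat f$ of $f$, $\|\widehat f-f\|_{L_2(\mathsf P)}^2:=\int(\widehat f(z)-f(z))^2\,d\mathsf P(z)$, the integral being over the law of $Z$ under $\mathsf P$ conditionally on the training data, and $\mathbb E_{\mathsf P}$ of it averages over the training data. Test statistic: $R_i:=\{X_i-\widehat\mu_i^x(Z_i)\}\{Y_i-\widehat\mu_i^y(Z_i)\}$, $\widehat\sigma_n^2:=\frac1n\sum_{i=1}^nR_i^2-\left(\frac1n\sum_{i=1}^nR_i\right)^2$,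 and $\overline{\mathrm{GCM}}_n:=\frac1{n\widehat\sigma_n}\sum_{i=1}^nR_i$. The notation $O(\cdot)$ refers to sequences of (finite) real numbers as $n\to\infty$. $\Phi$ and $\phi$ are the standard Gaussian CDF and density. The two-sided Robbins-Siegmund CDF is $\Psi(x)=1-2\left[1-\Phi(\sqrt x)+\sqrt x\,\phi(\sqrt x)\right]$ for $x\ge0$ and $\Psi(x)=0$ for $x<0$. *)

theory Defs
  imports "HOL-Probability.Probability" "HOL-Library.Landau_Symbols"
begin

section \<open>Conditional expectation and conditional independence\<close>

definition sigma_rv :: "'w measure \<Rightarrow> ('w \<Rightarrow> 'b::topological_space) \<Rightarrow> 'w measure" where
  "sigma_rv P Z = vimage_algebra (space P) Z borel"

text \<open>\<open>f\<close> is a version of \<open>z \<mapsto> E(X | Z = z)\<close>.\<close>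

definition is_regression_function ::
  "'w measure \<Rightarrow> ('w \<Rightarrow> real) \<Rightarrow> ('w \<Rightarrow> 'b::topological_space) \<Rightarrow> ('b \<Rightarrow> real) \<Rightarrow> bool" where
  "is_regression_function P X Z f \<longleftrightarrow>
     integrable P X \<and> f \<in> borel_measurable borel \<and>
     (AE \<omega> in P. f (Z \<omega>) = real_cond_exp P (sigma_rv P Z) X \<omega>)"

definition cond_indep_given ::
  "'w measure \<Rightarrow> ('w \<Rightarrow> 'a::topological_space) \<Rightarrow> ('w \<Rightarrow> 'b::topological_space) \<Rightarrow>
   ('w \<Rightarrow> 'c::topological_space) \<Rightarrow> bool" where
  "cond_indep_given P X Y Z \<longleftrightarrow>
     (\<forall>A\<in>sets borel. \<forall>B\<in>sets borel. AE \<omega> in P.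
        real_cond_exp P (sigma_rv P Z) (indicator {w. X w \<in> A \<and> Y w \<in> B}) \<omega> =
        real_cond_exp P (sigma_rv P Z) (indicator {w. X w \<in> A}) \<omega> *
        real_cond_exp P (sigma_rv P Z) (indicator {w. Y w \<in> B}) \<omega>)"

section \<open>Sampling scheme\<close>

text \<open>Sequences of observations are indexed by \<open>i \<ge> 1\<close>; their value at index \<open>0\<close> is irrelevant.\<close>

definition iid_seq :: "'w measure \<Rightarrow> (nat \<Rightarrow> 'w \<Rightarrow> 'b::topological_space) \<Rightarrow> bool" where
  "iid_seq P W \<longleftrightarrow>
     prob_space.indep_vars P (\<lambda>_. borel) W {1..} \<and>
     (\<forall>i\<ge>1. distr P borel (W i) = distr P borel (W 1))"

definition training_copy ::
  "'w measure \<Rightarrow> (nat \<Rightarrow> 'w \<Rightarrow> 'b::topological_space) \<Rightarrow> (nat \<Rightarrow> 'w \<Rightarrow> 'b) \<Rightarrow> bool" where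
  "training_copy P W W' \<longleftrightarrow>
     iid_seq P W' \<and> distr P borel (W' 1) = distr P borel (W 1) \<and>
     prob_space.indep_var P
       (PiM {1..} (\<lambda>_. borel)) (\<lambda>\<omega>. \<lambda>i\<in>{1..}. W i \<omega>)
       (PiM {1..} (\<lambda>_. borel)) (\<lambda>\<omega>. \<lambda>i\<in>{1..}. W' i \<omega>)"

definition training_data :: "(nat \<Rightarrow> 'w \<Rightarrow> 'b) \<Rightarrow> nat \<Rightarrow> 'w \<Rightarrow> (nat \<Rightarrow> 'b)" where
  "training_data W' n \<omega> = (\<lambda>i\<in>{1..n}. W' i \<omega>)"

text \<open>A regression estimator maps the time \<open>n\<close>, the first \<open>n\<close> training observations and a
  point \<open>z\<close> to a prediction. It does not depend on the underlying distribution.\<close>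

type_synonym ('b, 'c) estimator = "nat \<Rightarrow> (nat \<Rightarrow> 'b) \<Rightarrow> 'c \<Rightarrow> real"

definition measurable_estimator ::
  "('b::topological_space, 'c::topological_space) estimator \<Rightarrow> bool" where
  "measurable_estimator h \<longleftrightarrow>
     (\<forall>n\<ge>1. (\<lambda>(D, z). h n D z) \<in> borel_measurable (PiM {1..n} (\<lambda>_. borel) \<Otimes>\<^sub>M borel))"

section \<open>Moments with values in the extended nonnegative reals\<close>

definition ennsqrt :: "ennreal \<Rightarrow> ennreal" where
  "ennsqrt x = (if x = \<infinity> then \<infinity> else ennreal (sqrt (enn2real x)))"

text \<open>The variance of a non-integrable variable is \<open>\<infinity>\<close>; the Bochner integral, and hence the
  library's variance, would silently be \<open>0\<close> for a variable without second moment.\<close>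

definition ext_variance :: "'w measure \<Rightarrow> ('w \<Rightarrow> real) \<Rightarrow> ennreal" where
  "ext_variance P V =
     (if integrable P V then \<integral>\<^sup>+\<omega>. ennreal ((V \<omega> - (\<integral>w. V w \<partial>P))\<^sup>2) \<partial>P else \<infinity>)"

text \<open>The expected squared error of an estimator \<open>h\<close> of \<open>f\<close>. The inner integral is over the law
  of \<open>Z\<close>, which by independence is also its conditional law given the training data; the outer
  integral averages over the training data \<open>D\<close>.\<close>

definition expected_L2_error ::
  "'w measure \<Rightarrow> ('w \<Rightarrow> 'c::topological_space) \<Rightarrow> ('w \<Rightarrow> 'd) \<Rightarrow> ('d \<Rightarrow> 'c \<Rightarrow> real) \<Rightarrow>
   ('c \<Rightarrow> real) \<Rightarrow> ennreal" where
  "expected_L2_error P Z D h f =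
     (\<integral>\<^sup>+\<omega>. (\<integral>\<^sup>+z. ennreal ((h (D \<omega>) z - f z)\<^sup>2) \<partial>(distr P borel Z)) \<partial>P)"

text \<open>\<open>O(g)\<close> for a sequence indexed by \<open>n \<ge> 1\<close> all of whose members, not only those with large
  index, are required to be finite.\<close>

definition finite_bigo :: "(nat \<Rightarrow> ennreal) \<Rightarrow> (nat \<Rightarrow> real) \<Rightarrow> bool" where
  "finite_bigo f g \<longleftrightarrow> (\<forall>n\<ge>1. f n < \<infinity>) \<and> (\<lambda>n. enn2real (f n)) \<in> O(g)"

section \<open>The test statistic and its p-value\<close>

definition robbins_siegmund_cdf :: "real \<Rightarrow> real" where
  "robbins_siegmund_cdf x =
     (if x \<ge> 0
      then 1 - 2 * (1 - cdf std_normal_distribution (sqrt x) + sqrt x * std_normal_density (sqrt x))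
      else 0)"

definition residual_product ::
  "(nat \<Rightarrow> 'w \<Rightarrow> real) \<Rightarrow> (nat \<Rightarrow> 'w \<Rightarrow> real) \<Rightarrow> (nat \<Rightarrow> 'w \<Rightarrow> 'c) \<Rightarrow> (nat \<Rightarrow> 'w \<Rightarrow> 'b) \<Rightarrow>
   ('b, 'c) estimator \<Rightarrow> ('b, 'c) estimator \<Rightarrow> nat \<Rightarrow> 'w \<Rightarrow> real" where
  "residual_product X Y Z W' hx hy i \<omega> =
     (X i \<omega> - hx i (training_data W' i \<omega>) (Z i \<omega>)) *
     (Y i \<omega> - hy i (training_data W' i \<omega>) (Z i \<omega>))"

definition sample_variance :: "(nat \<Rightarrow> 'w \<Rightarrow> real) \<Rightarrow> nat \<Rightarrow> 'w \<Rightarrow> real" where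
  "sample_variance R n \<omega> =
     (1 / real n) * (\<Sum>i=1..n. (R i \<omega>)\<^sup>2) - ((1 / real n) * (\<Sum>i=1..n. R i \<omega>))\<^sup>2"

text \<open>Division by zero makes the statistic \<open>0\<close> on the event that the sample variance vanishes.\<close>

definition gcm_stat :: "(nat \<Rightarrow> 'w \<Rightarrow> real) \<Rightarrow> nat \<Rightarrow> 'w \<Rightarrow> real" where
  "gcm_stat R n \<omega> = 1 / (real n * sqrt (sample_variance R n \<omega>)) * (\<Sum>i=1..n. R i \<omega>)"

definition gcm_pvalue :: "(nat \<Rightarrow> 'w \<Rightarrow> real) \<Rightarrow> nat \<Rightarrow> nat \<Rightarrow> 'w \<Rightarrow> real" where
  "gcm_pvalue R k m \<omega> =
     1 - robbins_siegmund_cdf (real k * (gcm_stat R k \<omega>)\<^sup>2 - ln (real k / real m))"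

end

theory Submission
  imports Defs "HOL-Library.Log_Nat" "HOL-Real_Asymp.Real_Asymp"
begin

text \<open>
  Why the theorem is true. Write \<open>\<xi> i\<close> for the product of the two true regression residuals at time \<open>i\<close>. The
  observed product \<open>R i\<close> differs from \<open>\<xi> i\<close> by a bias term, the product of the two estimation errors, and by two
  cross terms, each an estimation error times a true residual. Conditional independence makes \<open>\<xi> i\<close> centred
  (\<open>cond_indep_residual_product\<close>), and given the training data the cross terms are independent and centred. The
  rate conditions make the series of \<open>E \<bar>bias i\<bar> / sqrt i\<close> and of \<open>Var (cross i) / i\<close> converge, so that maximal
  inequalities give \<open>\<bar>\<Sum>i\<le>k. R i - \<xi> i\<bar> = o(sqrt k)\<close> uniformly in \<open>k \<ge> m\<close> as \<open>m\<close> grows, and with a law of large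
  numbers also convergence of the sample variance, uniformly in \<open>k \<ge> m\<close> (\<open>perturbation_event\<close>). All bounds depend
  on the distribution only through the constants in the three conditions.

  It remains to find the probability that a standardised random walk \<open>S\<close> satisfies
  \<open>(S k)\<^sup>2 / k - ln (k / m) \<ge> a\<^sup>2\<close> for some \<open>k \<ge> m\<close>. In the
  rescaled time \<open>t = k / m\<close> and space \<open>x = S k / sqrt m\<close> the event says that \<open>heat t x = exp (x\<^sup>2 / (2 t)) / sqrt t\<close>
  reaches the level \<open>B = exp (a\<^sup>2 / 2)\<close>. This function solves the backward heat equation, so along the walk, stopped
  when it crosses the level, its expectation is preserved up to an error that vanishes as \<open>m\<close> grows
  (\<open>alive_step\<close>, \<open>crossing_bounds\<close>). At the crossing its value is about \<open>B\<close>, and on paths that do not cross up to time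
  \<open>T * m\<close> it is close to \<open>0\<close> for large \<open>T\<close> (\<open>survivors\<close>). Hence the crossing probability is close to
  \<open>P(heat \<ge> B) + E(heat; heat < B) / B\<close> at time \<open>m\<close>, and by the central limit theorem (\<open>walk_clt\<close>) this tends to
  \<open>2 (1 - \<Phi> a) + 2 a \<phi> a\<close>, the tail of the Robbins--Siegmund distribution. Crossings after time \<open>T * m\<close> are excluded by
  moments of an order larger than two (\<open>far_tail\<close>).

  Uniformity over the class is equivalent to convergence along every selection of one distribution
  for each \<open>m\<close> (\<open>uniform_limit_by_selections\<close>), so all limit theorems are stated for arrays of walks, one probability
  space for each \<open>m\<close>. Uniformity in the level follows from monotonicity.
\<close>

section \<open>Maximal inequalities for independent summands\<close>

context prob_space
begin

text \<open>At the first time \<open>k\<close> at which the partial sum exceeds \<open>2 * l\<close>, the remaining increment is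
  independent of the past and smaller than \<open>l\<close> with probability at least one half, and then the
  final sum still exceeds \<open>l\<close>.\<close>

lemma ottaviani:
  fixes X :: "nat \<Rightarrow> 'a \<Rightarrow> real"
  assumes indep: "indep_vars (\<lambda>_. borel) X {a<..b}"
    and half: "\<And>k. k \<in> {a<..b} \<Longrightarrow> prob {\<omega> \<in> space M. l \<le> \<bar>\<Sum>i\<in>{k<..b}. X i \<omega>\<bar>} \<le> 1 / 2"
  shows "prob {\<omega> \<in> space M. \<exists>k\<in>{a<..b}. 2 * l \<le> \<bar>\<Sum>i\<in>{a<..k}. X i \<omega>\<bar>}
    \<le> 2 * prob {\<omega> \<in> space M. l \<le> \<bar>\<Sum>i\<in>{a<..b}. X i \<omega>\<bar>}"
proof -
  have rv [measurable]: "i \<in> {a<..b} \<Longrightarrow> random_variable borel (X i)" for i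
    using indep unfolding indep_vars_def2 by auto
  define first where "first k = {\<omega> \<in> space M. 2 * l \<le> \<bar>\<Sum>i\<in>{a<..k}. X i \<omega>\<bar> \<and>
     (\<forall>j\<in>{a<..<k}. \<bar>\<Sum>i\<in>{a<..j}. X i \<omega>\<bar> < 2 * l)}" for k
  define small where "small k = {\<omega> \<in> space M. \<bar>\<Sum>i\<in>{k<..b}. X i \<omega>\<bar> < l}" for k
  have meas: "(\<lambda>\<omega>. \<Sum>i\<in>{j<..k}. X i \<omega>) \<in> borel_measurable M" if "a \<le> j" "k \<le> b" for j k
    using that by (intro borel_measurable_sum rv) auto
  have first_ev [measurable]: "first k \<in> events" if "k \<in> {a<..b}" for k
  proof -
    have [measurable]: "(\<lambda>\<omega>. \<Sum>i\<in>{a<..j}. X i \<omega>) \<in> borel_measurable M" if "j \<in> insert k {a<..<k}" for j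
      using that \<open>k \<in> _\<close> by (intro meas) auto
    show ?thesis unfolding first_def by measurable
  qed
  have small_ev [measurable]: "small k \<in> events" if "k \<in> {a<..b}" for k
  proof -
    have [measurable]: "(\<lambda>\<omega>. \<Sum>i\<in>{k<..b}. X i \<omega>) \<in> borel_measurable M"
      using that by (intro meas) auto
    show ?thesis unfolding small_def by measurable
  qed
  have [measurable]: "(\<lambda>\<omega>. \<Sum>i\<in>{a<..b}. X i \<omega>) \<in> borel_measurable M"
    by (intro meas) auto
  have ind: "prob (first k \<inter> small k) = prob (first k) * prob (small k)" if k: "k \<in> {a<..b}" for k
  proof -
    have iv: "indep_var (PiM {a<..k} (\<lambda>_. borel)) (\<lambda>\<omega>. restrict (\<lambda>i. X i \<omega>) {a<..k})
                   (PiM {k<..b} (\<lambda>_. borel)) (\<lambda>\<omega>. restrict (\<lambda>i. X i \<omega>) {k<..b})"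
      using k by (intro indep_var_restrict[OF indep]) auto
    define P where "P = (\<lambda>x::nat\<Rightarrow>real. 2 * l \<le> \<bar>\<Sum>i\<in>{a<..k}. x i\<bar> \<and>
     (\<forall>j\<in>{a<..<k}. \<bar>\<Sum>i\<in>{a<..j}. x i\<bar> < 2 * l))"
    define Q where "Q = (\<lambda>x::nat\<Rightarrow>real. \<bar>\<Sum>i\<in>{k<..b}. x i\<bar> < l)"
    have m1: "(\<lambda>x::nat\<Rightarrow>real. \<Sum>i\<in>{a<..j}. x i) \<in> borel_measurable (PiM {a<..k} (\<lambda>_. borel))"
      if "j \<le> k" for j
      using that by (intro borel_measurable_sum measurable_component_singleton) auto
    have "{x \<in> space (PiM {a<..k} (\<lambda>_. borel)). P x} \<in> sets (PiM {a<..k} (\<lambda>_. borel))"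
    proof -
      have [measurable]: "(\<lambda>x::nat\<Rightarrow>real. \<Sum>i\<in>{a<..j}. x i) \<in> borel_measurable (PiM {a<..k} (\<lambda>_. borel))"
        if "j \<in> insert k {a<..<k}" for j using that by (intro m1) auto
      show ?thesis unfolding P_def by measurable
    qed
    moreover have "{x \<in> space (PiM {k<..b} (\<lambda>_. borel)). Q x} \<in> sets (PiM {k<..b} (\<lambda>_. borel))"
    proof -
      have [measurable]: "(\<lambda>x::nat\<Rightarrow>real. \<Sum>i\<in>{k<..b}. x i) \<in> borel_measurable (PiM {k<..b} (\<lambda>_. borel))"
        by (intro borel_measurable_sum measurable_component_singleton) auto
      show ?thesis unfolding Q_def by measurable
    qed
    ultimately have eq: "prob ((\<lambda>\<omega>. (restrict (\<lambda>i. X i \<omega>) {a<..k}, restrict (\<lambda>i. X i \<omega>) {k<..b})) -`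
         ({x \<in> space (PiM {a<..k} (\<lambda>_. borel)). P x} \<times> {x \<in> space (PiM {k<..b} (\<lambda>_. borel)). Q x}) \<inter> space M)
      = prob ((\<lambda>\<omega>. restrict (\<lambda>i. X i \<omega>) {a<..k}) -` {x \<in> space (PiM {a<..k} (\<lambda>_. borel)). P x} \<inter> space M)
      * prob ((\<lambda>\<omega>. restrict (\<lambda>i. X i \<omega>) {k<..b}) -` {x \<in> space (PiM {k<..b} (\<lambda>_. borel)). Q x} \<inter> space M)"
      by (intro indep_varD[OF iv])
    have p: "P (restrict (\<lambda>i. X i \<omega>) {a<..k}) = P (\<lambda>i. X i \<omega>)" for \<omega>
      unfolding P_def by (intro arg_cong2[where f="(\<and>)"] ball_cong refl arg_cong2[where f="(\<le>)"]
        arg_cong2[where f="(<)"] arg_cong[where f=abs] sum.cong) auto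
    have q: "Q (restrict (\<lambda>i. X i \<omega>) {k<..b}) = Q (\<lambda>i. X i \<omega>)" for \<omega>
      unfolding Q_def by (intro arg_cong2[where f="(<)"] arg_cong[where f=abs] refl sum.cong) auto
    have "(\<lambda>\<omega>. restrict (\<lambda>i. X i \<omega>) {a<..k}) -` {x \<in> space (PiM {a<..k} (\<lambda>_. borel)). P x} \<inter> space M = first k"
      unfolding first_def by (auto simp: p space_PiM) (auto simp: P_def)
    moreover have "(\<lambda>\<omega>. restrict (\<lambda>i. X i \<omega>) {k<..b}) -` {x \<in> space (PiM {k<..b} (\<lambda>_. borel)). Q x} \<inter> space M = small k"
      unfolding small_def by (auto simp: q space_PiM) (auto simp: Q_def)
    moreover have "(\<lambda>\<omega>. (restrict (\<lambda>i. X i \<omega>) {a<..k}, restrict (\<lambda>i. X i \<omega>) {k<..b})) -`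
         ({x \<in> space (PiM {a<..k} (\<lambda>_. borel)). P x} \<times> {x \<in> space (PiM {k<..b} (\<lambda>_. borel)). Q x}) \<inter> space M
       = first k \<inter> small k"
      using calculation by blast
    ultimately show ?thesis using eq by simp
  qed
  have sm: "1 / 2 \<le> prob (small k)" if k: "k \<in> {a<..b}" for k
  proof -
    have "small k = space M - {\<omega> \<in> space M. l \<le> \<bar>\<Sum>i\<in>{k<..b}. X i \<omega>\<bar>}"
      unfolding small_def by auto
    moreover have "{\<omega> \<in> space M. l \<le> \<bar>\<Sum>i\<in>{k<..b}. X i \<omega>\<bar>} \<in> events"
      using meas[of k b] k by simp
    ultimately show ?thesis using half[OF k] by (simp add: prob_compl)
  qed
  have disj: "disjoint_family_on first {a<..b}"
  proof -
    have "first j \<inter> first k = {}" if "j < k" "j \<in> {a<..b}" for j k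
    proof -
      have "j \<in> {a<..<k}" using that by auto
      then show ?thesis unfolding first_def by fastforce
    qed
    then show ?thesis unfolding disjoint_family_on_def by (metis inf_commute linorder_neqE_nat)
  qed
  have cover: "{\<omega> \<in> space M. \<exists>k\<in>{a<..b}. 2 * l \<le> \<bar>\<Sum>i\<in>{a<..k}. X i \<omega>\<bar>} = (\<Union>k\<in>{a<..b}. first k)"
  proof (intro set_eqI iffI)
    fix \<omega> assume "\<omega> \<in> {\<omega> \<in> space M. \<exists>k\<in>{a<..b}. 2 * l \<le> \<bar>\<Sum>i\<in>{a<..k}. X i \<omega>\<bar>}"
    then have w: "\<omega> \<in> space M" and ex: "\<exists>k. k \<in> {a<..b} \<and> 2 * l \<le> \<bar>\<Sum>i\<in>{a<..k}. X i \<omega>\<bar>" by auto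
    define k where "k = (LEAST k. k \<in> {a<..b} \<and> 2 * l \<le> \<bar>\<Sum>i\<in>{a<..k}. X i \<omega>\<bar>)"
    have k: "k \<in> {a<..b}" "2 * l \<le> \<bar>\<Sum>i\<in>{a<..k}. X i \<omega>\<bar>"
      using LeastI_ex[OF ex] unfolding k_def by auto
    have "\<not> 2 * l \<le> \<bar>\<Sum>i\<in>{a<..j}. X i \<omega>\<bar>" if "j \<in> {a<..<k}" for j
      using not_less_Least[of j "\<lambda>k. k \<in> {a<..b} \<and> 2 * l \<le> \<bar>\<Sum>i\<in>{a<..k}. X i \<omega>\<bar>"] that k
      unfolding k_def[symmetric] by auto
    then show "\<omega> \<in> (\<Union>k\<in>{a<..b}. first k)" using k w unfolding first_def by (force simp: not_le)
  qed (auto simp: first_def)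
  have "prob (\<Union>k\<in>{a<..b}. first k) = (\<Sum>k\<in>{a<..b}. prob (first k))"
    by (intro finite_measure_finite_Union) (auto simp: disj)
  also have "\<dots> \<le> (\<Sum>k\<in>{a<..b}. 2 * prob (first k \<inter> small k))"
  proof (intro sum_mono)
    fix k assume k: "k \<in> {a<..b}"
    have "prob (first k) * 1 \<le> prob (first k) * (2 * prob (small k))"
      using sm[OF k] by (intro mult_left_mono) auto
    then show "prob (first k) \<le> 2 * prob (first k \<inter> small k)" by (simp add: ind[OF k])
  qed
  also have "\<dots> = 2 * prob (\<Union>k\<in>{a<..b}. first k \<inter> small k)"
    unfolding sum_distrib_left[symmetric] using disj
    by (subst finite_measure_finite_Union) (auto simp: disjoint_family_on_def)
  also have "\<dots> \<le> 2 * prob {\<omega> \<in> space M. l \<le> \<bar>\<Sum>i\<in>{a<..b}. X i \<omega>\<bar>}"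
  proof (intro mult_left_mono finite_measure_mono subsetI)
    fix \<omega> assume "\<omega> \<in> (\<Union>k\<in>{a<..b}. first k \<inter> small k)"
    then obtain k where k: "k \<in> {a<..b}" "\<omega> \<in> first k" "\<omega> \<in> small k" by auto
    have "(\<Sum>i\<in>{a<..b}. X i \<omega>) = (\<Sum>i\<in>{a<..k}. X i \<omega>) + (\<Sum>i\<in>{k<..b}. X i \<omega>)"
      using k(1) by (subst sum.union_disjoint[symmetric]) (auto intro!: sum.cong)
    then show "\<omega> \<in> {\<omega> \<in> space M. l \<le> \<bar>\<Sum>i\<in>{a<..b}. X i \<omega>\<bar>}"
      using k(2,3) unfolding first_def small_def by auto
  qed auto
  finally show ?thesis unfolding cover .
qed

lemma indep_mean_zero_second_moment:
  fixes X :: "nat \<Rightarrow> 'a \<Rightarrow> real"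
  assumes "finite I" and indep: "indep_vars (\<lambda>_. borel) X I"
    and int: "\<And>i. i \<in> I \<Longrightarrow> integrable M (X i)"
    and sq: "\<And>i. i \<in> I \<Longrightarrow> integrable M (\<lambda>\<omega>. (X i \<omega>)\<^sup>2)"
    and mean: "\<And>i. i \<in> I \<Longrightarrow> expectation (X i) = 0"
  shows "integrable M (\<lambda>\<omega>. (\<Sum>i\<in>I. X i \<omega>)\<^sup>2)"
    and "expectation (\<lambda>\<omega>. (\<Sum>i\<in>I. X i \<omega>)\<^sup>2) = (\<Sum>i\<in>I. expectation (\<lambda>\<omega>. (X i \<omega>)\<^sup>2))"
proof -
  have pair: "integrable M (\<lambda>\<omega>. X i \<omega> * X j \<omega>)"
    "expectation (\<lambda>\<omega>. X i \<omega> * X j \<omega>) = (if i = j then expectation (\<lambda>\<omega>. (X i \<omega>)\<^sup>2) else 0)"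
    if ij: "i \<in> I" "j \<in> I" for i j
  proof -
    have "integrable M (\<lambda>\<omega>. X i \<omega> * X j \<omega>) \<and>
      expectation (\<lambda>\<omega>. X i \<omega> * X j \<omega>) = (if i = j then expectation (\<lambda>\<omega>. (X i \<omega>)\<^sup>2) else 0)"
    proof (cases "i = j")
      case True
      then show ?thesis using sq[OF ij(1)] by (simp add: power2_eq_square)
    next
      case False
      then have "indep_var borel (X i) borel (X j)"
        using indep_vars_sum[of "{j}" i X] indep_vars_subset[OF indep, of "{i,j}"] ij by auto
      note iv = indep_var_integrable[OF this int[OF ij(1)] int[OF ij(2)]]
        indep_var_lebesgue_integral[OF this int[OF ij(1)] int[OF ij(2)]]
      show ?thesis using iv False by (simp add: mean[OF ij(1)])
    qed
    then show "integrable M (\<lambda>\<omega>. X i \<omega> * X j \<omega>)"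
    "expectation (\<lambda>\<omega>. X i \<omega> * X j \<omega>) = (if i = j then expectation (\<lambda>\<omega>. (X i \<omega>)\<^sup>2) else 0)" by auto
  qed
  have eq: "(\<Sum>i\<in>I. X i \<omega>)\<^sup>2 = (\<Sum>i\<in>I. \<Sum>j\<in>I. X i \<omega> * X j \<omega>)" for \<omega>
    by (simp add: power2_eq_square sum_product)
  show "integrable M (\<lambda>\<omega>. (\<Sum>i\<in>I. X i \<omega>)\<^sup>2)"
    unfolding eq by (intro Bochner_Integration.integrable_sum pair)
  have "expectation (\<lambda>\<omega>. (\<Sum>i\<in>I. X i \<omega>)\<^sup>2) = (\<Sum>i\<in>I. \<Sum>j\<in>I. expectation (\<lambda>\<omega>. X i \<omega> * X j \<omega>))"
    unfolding eq by (simp add: pair Bochner_Integration.integrable_sum)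
  also have "\<dots> = (\<Sum>i\<in>I. expectation (\<lambda>\<omega>. (X i \<omega>)\<^sup>2))"
    using \<open>finite I\<close> by (intro sum.cong refl) (simp add: pair sum.delta)
  finally show "expectation (\<lambda>\<omega>. (\<Sum>i\<in>I. X i \<omega>)\<^sup>2) = (\<Sum>i\<in>I. expectation (\<lambda>\<omega>. (X i \<omega>)\<^sup>2))" .
qed

lemma second_moment_tail:
  fixes Y :: "'a \<Rightarrow> real"
  assumes [measurable]: "Y \<in> borel_measurable M" and "integrable M (\<lambda>\<omega>. (Y \<omega>)\<^sup>2)" and "0 < l"
  shows "prob {\<omega> \<in> space M. l \<le> \<bar>Y \<omega>\<bar>} \<le> expectation (\<lambda>\<omega>. (Y \<omega>)\<^sup>2) / l\<^sup>2"
proof -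
  have "{\<omega> \<in> space M. l \<le> \<bar>Y \<omega>\<bar>} = {\<omega> \<in> space M. l\<^sup>2 \<le> (Y \<omega>)\<^sup>2}"
    using \<open>0 < l\<close> by (auto simp: abs_le_square_iff[symmetric])
  then show ?thesis
    using integral_Markov_inequality_measure[OF assms(2), of "{}" "l\<^sup>2"] \<open>0 < l\<close> by simp
qed

text \<open>If the bound is at most one then all tail sums have variance at most half of \<open>l\<^sup>2\<close>, so that
  Ottaviani's inequality applies; otherwise there is nothing to show.\<close>

lemma kolmogorov_finite:
  fixes X :: "nat \<Rightarrow> 'a \<Rightarrow> real"
  assumes indep: "indep_vars (\<lambda>_. borel) X {a<..b}"
    and int: "\<And>i. i \<in> {a<..b} \<Longrightarrow> integrable M (X i)"
    and sq: "\<And>i. i \<in> {a<..b} \<Longrightarrow> integrable M (\<lambda>\<omega>. (X i \<omega>)\<^sup>2)"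
    and mean: "\<And>i. i \<in> {a<..b} \<Longrightarrow> expectation (X i) = 0"
    and "0 < l"
  shows "prob {\<omega> \<in> space M. \<exists>k\<in>{a<..b}. 2 * l \<le> \<bar>\<Sum>i\<in>{a<..k}. X i \<omega>\<bar>}
    \<le> 2 * (\<Sum>i\<in>{a<..b}. expectation (\<lambda>\<omega>. (X i \<omega>)\<^sup>2)) / l\<^sup>2"
proof -
  let ?v = "\<lambda>i. expectation (\<lambda>\<omega>. (X i \<omega>)\<^sup>2)"
  have tail: "prob {\<omega> \<in> space M. l \<le> \<bar>\<Sum>i\<in>{k<..b}. X i \<omega>\<bar>} \<le> (\<Sum>i\<in>{a<..b}. ?v i) / l\<^sup>2" if "a \<le> k" for k
  proof -
    have sub: "{k<..b} \<subseteq> {a<..b}" using that by auto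
    have "prob {\<omega> \<in> space M. l \<le> \<bar>\<Sum>i\<in>{k<..b}. X i \<omega>\<bar>} \<le> expectation (\<lambda>\<omega>. (\<Sum>i\<in>{k<..b}. X i \<omega>)\<^sup>2) / l\<^sup>2"
      using sub \<open>0 < l\<close>
      by (intro second_moment_tail borel_measurable_sum borel_measurable_integrable int
            indep_mean_zero_second_moment indep_vars_subset[OF indep] sq mean) auto
    also have "\<dots> = (\<Sum>i\<in>{k<..b}. ?v i) / l\<^sup>2"
      using sub by (subst indep_mean_zero_second_moment(2))
        (auto intro: indep_vars_subset[OF indep] int sq mean)
    also have "\<dots> \<le> (\<Sum>i\<in>{a<..b}. ?v i) / l\<^sup>2"
      using sub by (intro divide_right_mono sum_mono2) auto
    finally show ?thesis .
  qed
  show ?thesis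
  proof (cases "(\<Sum>i\<in>{a<..b}. ?v i) / l\<^sup>2 \<le> 1 / 2")
    case True
    have "prob {\<omega> \<in> space M. \<exists>k\<in>{a<..b}. 2 * l \<le> \<bar>\<Sum>i\<in>{a<..k}. X i \<omega>\<bar>}
      \<le> 2 * prob {\<omega> \<in> space M. l \<le> \<bar>\<Sum>i\<in>{a<..b}. X i \<omega>\<bar>}"
      by (intro ottaviani[OF indep] order_trans[OF tail True]) auto
    with tail[of a] show ?thesis by simp
  next
    case False
    then have "1 \<le> 2 * ((\<Sum>i\<in>{a<..b}. ?v i) / l\<^sup>2)" by linarith
    then have "1 \<le> 2 * (\<Sum>i\<in>{a<..b}. ?v i) / l\<^sup>2" by simp
    with prob_le_1 show ?thesis by (rule order_trans)
  qed
qed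

end

text \<open>Summation by parts, in the quantitative form of Kronecker's lemma.\<close>

lemma partial_sum_by_weighted_partial_sums:
  fixes x w :: "nat \<Rightarrow> real"
  assumes w: "\<And>i. a < i \<Longrightarrow> 0 < w i" and mono: "\<And>i j. a < i \<Longrightarrow> i \<le> j \<Longrightarrow> w i \<le> w j"
    and bound: "\<And>j. j \<in> {a<..k} \<Longrightarrow> \<bar>\<Sum>i\<in>{a<..j}. x i / w i\<bar> \<le> e" and "a < k"
  shows "\<bar>\<Sum>i\<in>{a<..k}. x i\<bar> \<le> 2 * e * w k"
proof -
  define N where "N j = (\<Sum>i\<in>{a<..j}. x i / w i)" for j
  have "\<bar>(\<Sum>i\<in>{a<..j}. x i) - w j * N j\<bar> \<le> e * w j" if "a < j" "j \<le> k" for j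
    using that
  proof (induction j)
    case (Suc j)
    have e: "0 \<le> e" using bound[of "Suc j"] Suc.prems by fastforce
    show ?case
    proof (cases "a < j")
      case True
      have s: "{a<..Suc j} = insert (Suc j) {a<..j}" using True by auto
      have N: "N (Suc j) = N j + x (Suc j) / w (Suc j)" unfolding N_def s by simp
      have "w (Suc j) \<noteq> 0" using w[of "Suc j"] True by auto
      then have eq: "(\<Sum>i\<in>{a<..Suc j}. x i) - w (Suc j) * N (Suc j)
        = ((\<Sum>i\<in>{a<..j}. x i) - w j * N j) - (w (Suc j) - w j) * N j"
        unfolding N unfolding s by (simp add: algebra_simps)
      have "\<bar>(w (Suc j) - w j) * N j\<bar> \<le> (w (Suc j) - w j) * e"
        using mono[of j "Suc j"] bound[of j] True Suc.prems
        unfolding N_def abs_mult by (intro mult_mono) auto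
      then show ?thesis unfolding eq using Suc.IH True Suc.prems by (simp add: algebra_simps)
    next
      case False
      then have "{a<..Suc j} = {Suc j}" using Suc.prems by auto
      then show ?thesis using w[of "Suc j"] Suc.prems e by (simp add: N_def)
    qed
  qed simp
  from this[of k] have 1: "\<bar>(\<Sum>i\<in>{a<..k}. x i) - w k * N k\<bar> \<le> e * w k" using \<open>a < k\<close> by simp
  have "\<bar>w k * N k\<bar> \<le> w k * e"
    using w[of k] bound[of k] \<open>a < k\<close> unfolding N_def abs_mult by (intro mult_mono) auto
  with 1 show ?thesis by (simp add: algebra_simps)
qed

context prob_space
begin

text \<open>A maximal inequality of Hajek--Renyi type. Its right-hand side is linear in the variances, so that it
  can be averaged over further randomness. The first \<open>m\<close> summands are controlled at time
  \<open>m\<close>, the later ones by Kolmogorov's inequality for the normalised summands \<open>X i / w i\<close>.\<close>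

lemma weighted_partial_sums_tail:
  fixes X :: "nat \<Rightarrow> 'a \<Rightarrow> real"
  assumes indep: "indep_vars (\<lambda>_. borel) X {1..}"
    and int: "\<And>i. 1 \<le> i \<Longrightarrow> integrable M (X i)"
    and sq: "\<And>i. 1 \<le> i \<Longrightarrow> integrable M (\<lambda>\<omega>. (X i \<omega>)\<^sup>2)"
    and mean: "\<And>i. 1 \<le> i \<Longrightarrow> expectation (X i) = 0"
    and w: "\<And>i. 1 \<le> i \<Longrightarrow> 0 < w i" and mono: "\<And>i j. 1 \<le> i \<Longrightarrow> i \<le> j \<Longrightarrow> w i \<le> w j"
    and e: "0 < e" and m: "1 \<le> m"
  shows "ennreal (prob {\<omega> \<in> space M. \<exists>k\<ge>m. 5 * e * w k < \<bar>\<Sum>i\<in>{1..k}. X i \<omega>\<bar>})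
    \<le> (\<Sum>i. if 1 \<le> i then ennreal (2 / e\<^sup>2 * expectation (\<lambda>\<omega>. (X i \<omega>)\<^sup>2) / (max (w i) (w m))\<^sup>2) else 0)"
    (is "_ \<le> (\<Sum>i. ?t i)")
proof -
  let ?v = "\<lambda>i. expectation (\<lambda>\<omega>. (X i \<omega>)\<^sup>2)"
  define c where "c i = 2 / e\<^sup>2 * ?v i / (max (w i) (w m))\<^sup>2" for i
  have c0: "0 \<le> c i" for i unfolding c_def by simp
  have rv [measurable]: "1 \<le> i \<Longrightarrow> random_variable borel (X i)" for i
    using int by (rule borel_measurable_integrable)
  define H where "H = {\<omega> \<in> space M. e * w m \<le> \<bar>\<Sum>i\<in>{1..m}. X i \<omega>\<bar>}"
  define A where "A b = {\<omega> \<in> space M. \<exists>k\<in>{m<..b}. 2 * e \<le> \<bar>\<Sum>i\<in>{m<..k}. X i \<omega> / w i\<bar>}" for b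
  have [measurable]: "H \<in> events" unfolding H_def by measurable
  have [measurable]: "A b \<in> events" for b
  proof -
    have [measurable]: "(\<lambda>\<omega>. \<Sum>i\<in>{m<..k}. X i \<omega> / w i) \<in> borel_measurable M" for k
      using m by (intro borel_measurable_sum borel_measurable_divide rv) auto
    show ?thesis unfolding A_def by measurable
  qed
  have w0: "0 < w m" using w m by auto
  have "prob H \<le> expectation (\<lambda>\<omega>. (\<Sum>i\<in>{1..m}. X i \<omega>)\<^sup>2) / (e * w m)\<^sup>2"
    unfolding H_def using w0 e
    by (intro second_moment_tail indep_mean_zero_second_moment(1) indep_vars_subset[OF indep] int sq mean) auto
  also have "\<dots> = (\<Sum>i\<in>{1..m}. ?v i / (e * w m)\<^sup>2)"
    unfolding sum_divide_distrib[symmetric]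
    by (subst indep_mean_zero_second_moment(2)) (auto intro: indep_vars_subset[OF indep] int sq mean)
  also have "\<dots> \<le> (\<Sum>i\<in>{1..m}. c i)"
  proof (intro sum_mono)
    fix i assume i: "i \<in> {1..m}"
    have "max (w i) (w m) = w m" using mono[of i m] i by auto
    then have "c i = 2 * (?v i / (e * w m)\<^sup>2)" unfolding c_def by (simp add: power_mult_distrib)
    moreover have "0 \<le> ?v i / (e * w m)\<^sup>2" by simp
    ultimately show "?v i / (e * w m)\<^sup>2 \<le> c i" by linarith
  qed
  finally have PH: "prob H \<le> (\<Sum>i\<in>{1..m}. c i)" .
  have PA: "prob (A b) \<le> (\<Sum>i\<in>{m<..b}. c i)" for b
  proof -
    have wi: "w i \<noteq> 0" if "m < i" for i using w[of i] that m by auto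
    have "prob (A b) \<le> 2 * (\<Sum>i\<in>{m<..b}. expectation (\<lambda>\<omega>. (X i \<omega> / w i)\<^sup>2)) / e\<^sup>2"
      unfolding A_def using m e
      by (intro kolmogorov_finite indep_vars_compose2[OF indep_vars_subset[OF indep]])
         (auto simp: power_divide intro!: int sq mean)
    also have "\<dots> = (\<Sum>i\<in>{m<..b}. c i)"
      unfolding sum_distrib_left sum_divide_distrib
    proof (intro sum.cong refl)
      fix i assume i: "i \<in> {m<..b}"
      have "max (w i) (w m) = w i" using mono[of m i] i m by auto
      then show "2 * expectation (\<lambda>\<omega>. (X i \<omega> / w i)\<^sup>2) / e\<^sup>2 = c i"
        unfolding c_def by (simp add: power_divide)
    qed
    finally show ?thesis .
  qed
  have bound: "ennreal (prob (H \<union> A b)) \<le> (\<Sum>i. ?t i)" for b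
  proof -
    have "prob (H \<union> A b) \<le> prob H + prob (A b)" by (intro measure_Un_le) auto
    also have "\<dots> \<le> (\<Sum>i\<in>{1..m}. c i) + (\<Sum>i\<in>{m<..b}. c i)" using PH PA by (intro add_mono)
    also have "\<dots> = (\<Sum>i\<in>{1..m} \<union> {m<..b}. c i)" by (intro sum.union_disjoint[symmetric]) auto
    finally have "ennreal (prob (H \<union> A b)) \<le> ennreal (\<Sum>i\<in>{1..m} \<union> {m<..b}. c i)"
      by (intro ennreal_leI)
    also have "\<dots> = (\<Sum>i\<in>{1..m} \<union> {m<..b}. ennreal (c i))"
      by (intro sum_ennreal[symmetric] c0)
    also have "\<dots> = (\<Sum>i\<in>{1..m} \<union> {m<..b}. ?t i)"
      unfolding c_def using m by (intro sum.cong) auto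
    also have "\<dots> \<le> (\<Sum>i. ?t i)" by (intro sum_le_suminf) auto
    finally show ?thesis .
  qed
  have "(\<lambda>b. prob (H \<union> A b)) \<longlonglongrightarrow> prob (\<Union>b. H \<union> A b)"
    by (intro finite_Lim_measure_incseq) (auto simp: incseq_def A_def)
  then have "ennreal (prob (\<Union>b. H \<union> A b)) \<le> (\<Sum>i. ?t i)"
    by (rule LIMSEQ_le_const2[OF tendsto_ennrealI]) (intro exI[of _ 0] allI impI bound)
  moreover have "prob {\<omega> \<in> space M. \<exists>k\<ge>m. 5 * e * w k < \<bar>\<Sum>i\<in>{1..k}. X i \<omega>\<bar>} \<le> prob (\<Union>b. H \<union> A b)"
  proof (intro finite_measure_mono subsetI)
    fix \<omega> assume "\<omega> \<in> {\<omega> \<in> space M. \<exists>k\<ge>m. 5 * e * w k < \<bar>\<Sum>i\<in>{1..k}. X i \<omega>\<bar>}"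
    then obtain k where k: "m \<le> k" "5 * e * w k < \<bar>\<Sum>i\<in>{1..k}. X i \<omega>\<bar>" and w': "\<omega> \<in> space M" by auto
    \<comment> \<open>The factor \<open>5\<close>: one \<open>e\<close> for the sum up to \<open>m\<close>, and \<open>2 * (2 * e)\<close> from summation by parts.\<close>
    show "\<omega> \<in> (\<Union>b. H \<union> A b)"
    proof (rule ccontr)
      assume n: "\<omega> \<notin> (\<Union>b. H \<union> A b)"
      then have h: "\<bar>\<Sum>i\<in>{1..m}. X i \<omega>\<bar> < e * w m" using w' unfolding H_def by auto
      have a: "\<bar>\<Sum>i\<in>{m<..j}. X i \<omega> / w i\<bar> < 2 * e" if "m < j" for j
        using n w' that unfolding A_def by (force simp: not_le)
      have wk: "w m \<le> w k" using mono m k by auto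
      have "\<bar>\<Sum>i\<in>{m<..k}. X i \<omega>\<bar> \<le> 2 * (2 * e) * w k"
      proof (cases "m < k")
        case True
        then show ?thesis using m w mono
          by (intro partial_sum_by_weighted_partial_sums less_imp_le[OF a]) auto
      next
        case False
        then show ?thesis using w[of k] e m k by auto
      qed
      moreover have "(\<Sum>i\<in>{1..k}. X i \<omega>) = (\<Sum>i\<in>{1..m}. X i \<omega>) + (\<Sum>i\<in>{m<..k}. X i \<omega>)"
        using k by (subst sum.union_disjoint[symmetric]) (auto intro!: sum.cong)
      moreover have "e * w m \<le> e * w k" using wk e by simp
      ultimately show False using h k(2) by (simp add: algebra_simps)
    qed
  qed auto
  ultimately show ?thesis by (meson ennreal_leI order_trans)
qed

text \<open>For \<open>k \<ge> m\<close> and \<open>i \<le> k\<close> the weight \<open>w k\<close> is at least \<open>max (w i) (w m)\<close>, so all normalised partial sums are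
  dominated by a single random series, to which Markov's inequality applies.\<close>

lemma nonneg_partial_sums_tail:
  fixes b :: "nat \<Rightarrow> 'a \<Rightarrow> real"
  assumes [measurable]: "\<And>i. 1 \<le> i \<Longrightarrow> b i \<in> borel_measurable M"
    and nn: "\<And>i \<omega>. 1 \<le> i \<Longrightarrow> 0 \<le> b i \<omega>"
    and w: "\<And>i. 1 \<le> i \<Longrightarrow> 0 < w i" and mono: "\<And>i j. 1 \<le> i \<Longrightarrow> i \<le> j \<Longrightarrow> w i \<le> w j"
    and e: "0 < e" and m: "1 \<le> m"
  shows "ennreal (prob {\<omega> \<in> space M. \<exists>k\<ge>m. e * w k < (\<Sum>i\<in>{1..k}. b i \<omega>)})
    \<le> (\<Sum>i. if 1 \<le> i then ennreal (1 / (e * max (w i) (w m))) * (\<integral>\<^sup>+\<omega>. ennreal (b i \<omega>) \<partial>M) else 0)"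
proof -
  define g where "g \<omega> = (\<Sum>i. if 1 \<le> i then ennreal (1 / max (w i) (w m)) * ennreal (b i \<omega>) else 0)" for \<omega>
  have meas [measurable]: "(\<lambda>\<omega>. if 1 \<le> i then ennreal (1 / max (w i) (w m)) * ennreal (b i \<omega>) else 0)
      \<in> borel_measurable M" for i
    by (cases "1 \<le> i") auto
  have [measurable]: "g \<in> borel_measurable M" unfolding g_def by measurable
  have "ennreal (prob {\<omega> \<in> space M. \<exists>k\<ge>m. e * w k < (\<Sum>i\<in>{1..k}. b i \<omega>)})
    \<le> emeasure M {\<omega> \<in> space M. 1 \<le> ennreal (1 / e) * g \<omega>}"
    unfolding emeasure_eq_measure
  proof (intro ennreal_leI finite_measure_mono subsetI)
    fix \<omega> assume "\<omega> \<in> {\<omega> \<in> space M. \<exists>k\<ge>m. e * w k < (\<Sum>i\<in>{1..k}. b i \<omega>)}"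
    then obtain k where k: "m \<le> k" "e * w k < (\<Sum>i\<in>{1..k}. b i \<omega>)" and w': "\<omega> \<in> space M" by auto
    have wk: "0 < w k" using w k m by auto
    have "ennreal e \<le> ennreal ((\<Sum>i\<in>{1..k}. b i \<omega>) / w k)"
      using k wk by (intro ennreal_leI) (simp add: field_simps)
    also have "\<dots> = (\<Sum>i\<in>{1..k}. ennreal (b i \<omega> / w k))"
      unfolding sum_divide_distrib using nn wk by (intro sum_ennreal[symmetric]) auto
    also have "\<dots> \<le> (\<Sum>i\<in>{1..k}. if 1 \<le> i then ennreal (1 / max (w i) (w m)) * ennreal (b i \<omega>) else 0)"
    proof (intro sum_mono)
      fix i assume i: "i \<in> {1..k}"
      have "max (w i) (w m) \<le> w k" "0 < max (w i) (w m)"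
        using mono[of i k] mono[of m k] k m i w[of i] by auto
      then have "b i \<omega> / w k \<le> b i \<omega> / max (w i) (w m)" using nn[of i \<omega>] i
        by (intro divide_left_mono) (use wk in auto)
      then show "ennreal (b i \<omega> / w k) \<le> (if 1 \<le> i then ennreal (1 / max (w i) (w m)) * ennreal (b i \<omega>) else 0)"
        using i nn[of i \<omega>] by (simp add: ennreal_mult''[symmetric] ennreal_leI)
    qed
    also have "\<dots> \<le> g \<omega>" unfolding g_def by (intro sum_le_suminf) auto
    finally have "ennreal (1 / e) * ennreal e \<le> ennreal (1 / e) * g \<omega>" by (intro mult_left_mono) auto
    also have "ennreal (1 / e) * ennreal e = 1" using e by (simp add: ennreal_mult[symmetric])
    finally show "\<omega> \<in> {\<omega> \<in> space M. 1 \<le> ennreal (1 / e) * g \<omega>}" using w' by auto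
  qed measurable
  also have "\<dots> \<le> ennreal (1 / e) * (\<integral>\<^sup>+\<omega>. g \<omega> \<partial>M)"
  proof -
    have "(\<integral>\<^sup>+\<omega>. g \<omega> * indicator (space M) \<omega> \<partial>M) = (\<integral>\<^sup>+\<omega>. g \<omega> \<partial>M)"
      by (intro nn_integral_cong) simp
    moreover have "(\<lambda>\<omega>. g \<omega> * indicator (space M) \<omega>) \<in> borel_measurable M" by measurable
    ultimately show ?thesis
      using nn_integral_Markov_inequality[of g "space M" M "ennreal (1 / e)"] by (metis sets.top)
  qed
  also have "(\<integral>\<^sup>+\<omega>. g \<omega> \<partial>M) = (\<Sum>i. \<integral>\<^sup>+\<omega>. (if 1 \<le> i then ennreal (1 / max (w i) (w m)) * ennreal (b i \<omega>) else 0) \<partial>M)"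
    unfolding g_def by (intro nn_integral_suminf meas)
  also have "ennreal (1 / e) * \<dots> = (\<Sum>i. ennreal (1 / e) * (\<integral>\<^sup>+\<omega>. (if 1 \<le> i then ennreal (1 / max (w i) (w m)) * ennreal (b i \<omega>) else 0) \<partial>M))"
    by (rule ennreal_suminf_cmult[symmetric])
  also have "\<dots> = (\<Sum>i. if 1 \<le> i then ennreal (1 / (e * max (w i) (w m))) * (\<integral>\<^sup>+\<omega>. ennreal (b i \<omega>) \<partial>M) else 0)"
  proof (intro suminf_cong)
    fix i
    show "ennreal (1 / e) * (\<integral>\<^sup>+\<omega>. (if 1 \<le> i then ennreal (1 / max (w i) (w m)) * ennreal (b i \<omega>) else 0) \<partial>M)
      = (if 1 \<le> i then ennreal (1 / (e * max (w i) (w m))) * (\<integral>\<^sup>+\<omega>. ennreal (b i \<omega>) \<partial>M) else 0)"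
      using w[of i] e
      by (auto simp: nn_integral_cmult mult.assoc[symmetric] ennreal_mult''[symmetric] max_def)
  qed
  finally show ?thesis .
qed

end

section \<open>Standardised random walks\<close>

definition psum :: "(nat \<Rightarrow> 'a \<Rightarrow> real) \<Rightarrow> nat \<Rightarrow> 'a \<Rightarrow> real" where
  "psum X k \<omega> = (\<Sum>i\<in>{1..k}. X i \<omega>)"

text \<open>Independent and identically distributed steps with mean \<open>0\<close> and variance \<open>1\<close>. The bound \<open>K\<close> on a moment of order \<open>p > 2\<close>
  is the only further information on the law of the steps that enters the estimates; they are therefore uniform over
  all walks with the same \<open>p\<close> and \<open>K\<close>.\<close>

locale std_walk = prob_space M for M :: "'a measure" +
  fixes X :: "nat \<Rightarrow> 'a \<Rightarrow> real" and p K :: real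
  assumes indep: "indep_vars (\<lambda>_. borel) X {1..}"
    and ident: "\<And>i. 1 \<le> i \<Longrightarrow> distr M borel (X i) = distr M borel (X 1)"
    and square_integrable_1: "integrable M (\<lambda>\<omega>. (X 1 \<omega>)\<^sup>2)"
    and mean_1: "expectation (X 1) = 0"
    and second_moment_1: "expectation (\<lambda>\<omega>. (X 1 \<omega>)\<^sup>2) = 1"
    and p: "2 < p" "p \<le> 3"
    and moment_integrable_1: "integrable M (\<lambda>\<omega>. \<bar>X 1 \<omega>\<bar> powr p)"
    and moment_1: "expectation (\<lambda>\<omega>. \<bar>X 1 \<omega>\<bar> powr p) \<le> K"
begin

abbreviation "S \<equiv> psum X"

lemma X_measurable [measurable]: "1 \<le> i \<Longrightarrow> X i \<in> borel_measurable M"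
  using indep unfolding indep_vars_def2 by auto

lemma S_measurable [measurable]: "S k \<in> borel_measurable M"
  unfolding psum_def by (intro borel_measurable_sum X_measurable) auto

lemma S_Suc: "S (Suc k) \<omega> = S k \<omega> + X (Suc k) \<omega>"
  unfolding psum_def by simp

lemma same_expectation:
  fixes g :: "real \<Rightarrow> real"
  assumes [measurable]: "g \<in> borel_measurable borel" and "1 \<le> i"
  shows "integrable M (\<lambda>\<omega>. g (X i \<omega>)) \<longleftrightarrow> integrable M (\<lambda>\<omega>. g (X 1 \<omega>))"
    and "expectation (\<lambda>\<omega>. g (X i \<omega>)) = expectation (\<lambda>\<omega>. g (X 1 \<omega>))"
proof -
  have m: "X i \<in> borel_measurable M" "X 1 \<in> borel_measurable M"
    using \<open>1 \<le> i\<close> by (auto intro: X_measurable)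
  show "integrable M (\<lambda>\<omega>. g (X i \<omega>)) \<longleftrightarrow> integrable M (\<lambda>\<omega>. g (X 1 \<omega>))"
    unfolding integrable_distr_eq[OF m(1) assms(1), symmetric] integrable_distr_eq[OF m(2) assms(1), symmetric]
    unfolding ident[OF \<open>1 \<le> i\<close>] ..
  show "expectation (\<lambda>\<omega>. g (X i \<omega>)) = expectation (\<lambda>\<omega>. g (X 1 \<omega>))"
    unfolding integral_distr[OF m(1) assms(1), symmetric] integral_distr[OF m(2) assms(1), symmetric]
    unfolding ident[OF \<open>1 \<le> i\<close>] ..
qed

lemma
  assumes "1 \<le> i"
  shows square_integrable: "integrable M (\<lambda>\<omega>. (X i \<omega>)\<^sup>2)"
    and second_moment: "expectation (\<lambda>\<omega>. (X i \<omega>)\<^sup>2) = 1"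
    and moment_integrable: "integrable M (\<lambda>\<omega>. \<bar>X i \<omega>\<bar> powr p)"
    and moment: "expectation (\<lambda>\<omega>. \<bar>X i \<omega>\<bar> powr p) \<le> K"
    and X_integrable: "integrable M (X i)"
    and mean: "expectation (X i) = 0"
proof -
  have sq: "(\<lambda>x::real. x\<^sup>2) \<in> borel_measurable borel" and pw: "(\<lambda>x::real. \<bar>x\<bar> powr p) \<in> borel_measurable borel"
    and idm: "(\<lambda>x::real. x) \<in> borel_measurable borel"
    by measurable
  show si: "integrable M (\<lambda>\<omega>. (X i \<omega>)\<^sup>2)"
    by (rule same_expectation(1)[OF sq assms, THEN iffD2, OF square_integrable_1])
  show "expectation (\<lambda>\<omega>. (X i \<omega>)\<^sup>2) = 1"
    by (rule trans[OF same_expectation(2)[OF sq assms] second_moment_1])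
  show "integrable M (X i)"
    by (rule square_integrable_imp_integrable[OF X_measurable[OF assms] si])
  show "expectation (X i) = 0"
    by (rule trans[OF same_expectation(2)[OF idm assms] mean_1])
  show "integrable M (\<lambda>\<omega>. \<bar>X i \<omega>\<bar> powr p)"
    by (rule same_expectation(1)[OF pw assms, THEN iffD2, OF moment_integrable_1])
  show "expectation (\<lambda>\<omega>. \<bar>X i \<omega>\<bar> powr p) \<le> K"
    by (rule ord_eq_le_trans[OF same_expectation(2)[OF pw assms] moment_1])
qed

lemma K_nonneg: "0 \<le> K"
  using moment_1 by (rule order_trans[rotated]) simp

lemma S_second_moment: "integrable M (\<lambda>\<omega>. (S k \<omega>)\<^sup>2)" "expectation (\<lambda>\<omega>. (S k \<omega>)\<^sup>2) = real k"
proof -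
  have iv: "indep_vars (\<lambda>_. borel) X {1..k}" by (rule indep_vars_subset[OF indep]) auto
  show "integrable M (\<lambda>\<omega>. (S k \<omega>)\<^sup>2)" unfolding psum_def
    by (intro indep_mean_zero_second_moment iv) (auto intro: X_integrable square_integrable mean)
  show "expectation (\<lambda>\<omega>. (S k \<omega>)\<^sup>2) = real k" unfolding psum_def
    by (subst indep_mean_zero_second_moment(2)[OF _ iv])
       (auto intro: X_integrable square_integrable mean simp: second_moment)
qed

text \<open>Independence of the past and the next step, in the form needed for functionals of the path.\<close>

lemma indep_past_next:
  fixes F :: "(nat \<Rightarrow> real) \<Rightarrow> real" and g :: "real \<Rightarrow> real"
  assumes F: "F \<in> borel_measurable (PiM {1..k} (\<lambda>_. borel))" and g: "g \<in> borel_measurable borel"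
    and local: "\<And>x. F (restrict x {1..k}) = F x"
    and int: "integrable M (\<lambda>\<omega>. F (\<lambda>i. X i \<omega>))" "integrable M (\<lambda>\<omega>. g (X (Suc k) \<omega>))"
  shows "integrable M (\<lambda>\<omega>. F (\<lambda>i. X i \<omega>) * g (X (Suc k) \<omega>))"
    and "expectation (\<lambda>\<omega>. F (\<lambda>i. X i \<omega>) * g (X (Suc k) \<omega>))
      = expectation (\<lambda>\<omega>. F (\<lambda>i. X i \<omega>)) * expectation (\<lambda>\<omega>. g (X (Suc k) \<omega>))"
proof -
  have "indep_var (PiM {1..k} (\<lambda>_. borel)) (\<lambda>\<omega>. restrict (\<lambda>i. X i \<omega>) {1..k})
     (PiM {Suc k} (\<lambda>_. borel)) (\<lambda>\<omega>. restrict (\<lambda>i. X i \<omega>) {Suc k})"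
    by (rule indep_var_restrict[OF indep]) auto
  then have "indep_var borel (F \<circ> (\<lambda>\<omega>. restrict (\<lambda>i. X i \<omega>) {1..k}))
     borel ((\<lambda>x. g (x (Suc k))) \<circ> (\<lambda>\<omega>. restrict (\<lambda>i. X i \<omega>) {Suc k}))"
    by (rule indep_var_compose) (use F g in auto)
  then have "indep_var borel (\<lambda>\<omega>. F (\<lambda>i. X i \<omega>)) borel (\<lambda>\<omega>. g (X (Suc k) \<omega>))"
    unfolding comp_def local by simp
  from indep_var_integrable[OF this int] indep_var_lebesgue_integral[OF this int]
  show "integrable M (\<lambda>\<omega>. F (\<lambda>i. X i \<omega>) * g (X (Suc k) \<omega>))"
    "expectation (\<lambda>\<omega>. F (\<lambda>i. X i \<omega>) * g (X (Suc k) \<omega>))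
      = expectation (\<lambda>\<omega>. F (\<lambda>i. X i \<omega>)) * expectation (\<lambda>\<omega>. g (X (Suc k) \<omega>))" by auto
qed

lemma indep_S_next:
  fixes f g :: "real \<Rightarrow> real"
  assumes [measurable]: "f \<in> borel_measurable borel" "g \<in> borel_measurable borel"
    and int: "integrable M (\<lambda>\<omega>. f (S k \<omega>))" "integrable M (\<lambda>\<omega>. g (X (Suc k) \<omega>))"
  shows "integrable M (\<lambda>\<omega>. f (S k \<omega>) * g (X (Suc k) \<omega>))"
    and "expectation (\<lambda>\<omega>. f (S k \<omega>) * g (X (Suc k) \<omega>))
      = expectation (\<lambda>\<omega>. f (S k \<omega>)) * expectation (\<lambda>\<omega>. g (X (Suc k) \<omega>))"
proof -
  have [measurable]: "(\<lambda>x::nat\<Rightarrow>real. \<Sum>i\<in>{1..k}. x i) \<in> borel_measurable (PiM {1..k} (\<lambda>_. borel))"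
    by (intro borel_measurable_sum measurable_component_singleton)
  have F: "(\<lambda>x. f (\<Sum>i\<in>{1..k}. x i)) \<in> borel_measurable (PiM {1..k} (\<lambda>_. borel))" by measurable
  from indep_past_next[OF F, of g] int
  show "integrable M (\<lambda>\<omega>. f (S k \<omega>) * g (X (Suc k) \<omega>))"
    "expectation (\<lambda>\<omega>. f (S k \<omega>) * g (X (Suc k) \<omega>))
      = expectation (\<lambda>\<omega>. f (S k \<omega>)) * expectation (\<lambda>\<omega>. g (X (Suc k) \<omega>))"
    unfolding psum_def by auto
qed

end

section \<open>Moment growth and the far tail of the walk\<close>

text \<open>A smooth substitute for \<open>\<bar>x\<bar> powr p\<close>, for which a second order Taylor expansion is available at
  every point.\<close>

lemma smooth_power_Taylor:
  fixes p x y :: real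
  assumes p: "2 < p" "p \<le> 3"
  shows "(1 + (x + y)\<^sup>2) powr (p / 2) \<le> (1 + x\<^sup>2) powr (p / 2) + p * x * (1 + x\<^sup>2) powr (p / 2 - 1) * y
    + 6 * ((1 + x\<^sup>2) powr (p / 2 - 1) * y\<^sup>2 + \<bar>y\<bar> powr p)"
proof -
  define q where "q = p / 2 - 1"
  have q: "0 < q" "q \<le> 1 / 2" "p / 2 = q + 1" using p unfolding q_def by auto
  define D where "D n z = (if n = 0 then (1 + (x + z)\<^sup>2) powr (p / 2)
     else if n = 1 then p * (x + z) * (1 + (x + z)\<^sup>2) powr q
     else p * (1 + (x + z)\<^sup>2) powr q + p * (p - 2) * (x + z)\<^sup>2 * (1 + (x + z)\<^sup>2) powr (q - 1))" for n :: nat and z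
  have pos: "0 < 1 + z\<^sup>2" for z :: real using zero_le_power2[of z] by linarith
  have nz: "1 + z\<^sup>2 \<noteq> 0" for z :: real using pos[of z] by linarith
  have d0: "(D 0 has_real_derivative D (Suc 0) z) (at z)" for z
    unfolding D_def using pos[of "x + z"] q
    by (auto intro!: derivative_eq_intros simp: powr_diff field_simps powr_add nz)
  have d1: "(D (Suc 0) has_real_derivative D (Suc (Suc 0)) z) (at z)" for z
    unfolding D_def using pos[of "x + z"]
    by (auto intro!: derivative_eq_intros simp: powr_diff field_simps power2_eq_square q_def nz)
  have "\<exists>t. \<bar>t\<bar> \<le> \<bar>y\<bar> \<and> D 0 y = (\<Sum>m<2. D m 0 / fact m * y ^ m) + D 2 t / fact 2 * y ^ 2"
  proof (rule Maclaurin_bi_le)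
    show "\<forall>m t. m < 2 \<and> \<bar>t\<bar> \<le> \<bar>y\<bar> \<longrightarrow> (D m has_real_derivative D (Suc m) t) (at t)"
      using d0 d1 by (auto simp: less_2_cases_iff)
  qed simp
  then obtain t where t: "\<bar>t\<bar> \<le> \<bar>y\<bar>" "D 0 y = D 0 0 + D 1 0 * y + D 2 t / 2 * y\<^sup>2"
    by (auto simp: numeral_2_eq_2)
  define z where "z = x + t"
  have "D 2 t \<le> p * (p - 1) * (1 + z\<^sup>2) powr q"
  proof -
    have "(1 + z\<^sup>2) powr q = (1 + z\<^sup>2) * (1 + z\<^sup>2) powr (q - 1)"
      using pos[of z] by (simp add: powr_diff)
    moreover have "z\<^sup>2 * (1 + z\<^sup>2) powr (q - 1) \<le> (1 + z\<^sup>2) * (1 + z\<^sup>2) powr (q - 1)"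
      by (intro mult_right_mono) auto
    ultimately have "p * (p - 2) * (z\<^sup>2 * (1 + z\<^sup>2) powr (q - 1)) \<le> p * (p - 2) * (1 + z\<^sup>2) powr q"
      using p by (intro mult_left_mono) auto
    then show ?thesis unfolding D_def z_def by (simp add: algebra_simps)
  qed
  also have "\<dots> \<le> 6 * (1 + z\<^sup>2) powr q"
  proof (intro mult_right_mono)
    have "p * (p - 1) \<le> 3 * 2" using p by (intro mult_mono) auto
    then show "p * (p - 1) \<le> 6" by simp
  qed simp
  also have "(1 + z\<^sup>2) powr q \<le> 2 * ((1 + x\<^sup>2) powr q + \<bar>y\<bar> powr (p - 2))"
  proof -
    define w where "w = max (1 + x\<^sup>2) (y\<^sup>2)"
    have w: "0 < w" using pos[of x] unfolding w_def by linarith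
    have "z\<^sup>2 \<le> (\<bar>x\<bar> + \<bar>y\<bar>)\<^sup>2" unfolding z_def using t(1)
      by (intro abs_le_square_iff[THEN iffD1]) auto
    also have "\<dots> \<le> 2 * x\<^sup>2 + 2 * y\<^sup>2"
      using sum_squares_bound[of "\<bar>x\<bar>" "\<bar>y\<bar>"] by (simp add: power2_sum)
    finally have "1 + z\<^sup>2 \<le> 2 * (1 + x\<^sup>2) + 2 * y\<^sup>2" by simp
    also have "\<dots> \<le> 4 * w"
    proof -
      have "1 + x\<^sup>2 \<le> w" "y\<^sup>2 \<le> w" unfolding w_def by auto
      from add_mono[OF this] show ?thesis by simp
    qed
    finally have "(1 + z\<^sup>2) powr q \<le> (4 * w) powr q" using pos[of z] q by (intro powr_mono2) auto
    also have "\<dots> = 4 powr q * w powr q" using w by (simp add: powr_mult)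
    also have "\<dots> \<le> 2 * w powr q"
    proof (intro mult_right_mono)
      have "(4::real) powr q \<le> 4 powr (1 / 2)" using q by (intro powr_mono) auto
      also have "(4::real) powr (1 / 2) = 2" by (simp add: powr_half_sqrt)
      finally show "(4::real) powr q \<le> 2" .
    qed simp
    also have "w powr q \<le> (1 + x\<^sup>2) powr q + (y\<^sup>2) powr q"
      unfolding w_def max_def by auto
    also have "(y\<^sup>2) powr q = \<bar>y\<bar> powr (p - 2)"
    proof -
      have "(\<bar>y\<bar>\<^sup>2) powr q = \<bar>y\<bar> powr (2 * q)"
        by (cases "y = 0") (auto simp: powr_powr[symmetric] powr_numeral)
      then show ?thesis unfolding q_def by simp
    qed
    finally show ?thesis by simp
  qed
  finally have "D 2 t / 2 * y\<^sup>2 \<le> (6 * (2 * ((1 + x\<^sup>2) powr q + \<bar>y\<bar> powr (p - 2)))) / 2 * y\<^sup>2"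
    by (intro mult_right_mono divide_right_mono) auto
  also have "\<dots> = 6 * ((1 + x\<^sup>2) powr q * y\<^sup>2 + \<bar>y\<bar> powr (p - 2) * \<bar>y\<bar> powr 2)"
    by (simp add: algebra_simps powr_numeral)
  also have "\<bar>y\<bar> powr (p - 2) * \<bar>y\<bar> powr 2 = \<bar>y\<bar> powr p" by (subst powr_add[symmetric]) simp
  finally show ?thesis using t(2) unfolding q_def[symmetric] by (simp add: D_def)
qed

context std_walk
begin

text \<open>In the Taylor expansion of one step the linear term has expectation \<open>0\<close>, and the second order term contributes at most a
  multiple of \<open>n powr (p / 2 - 1)\<close>; summing over \<open>n\<close> steps gives the diffusive order \<open>n powr (p / 2)\<close>.\<close>

lemma smooth_moment_growth:
  assumes "1 \<le> n" "k \<le> n"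
  shows "integrable M (\<lambda>\<omega>. (1 + (S k \<omega>)\<^sup>2) powr (p / 2)) \<and>
    expectation (\<lambda>\<omega>. (1 + (S k \<omega>)\<^sup>2) powr (p / 2))
      \<le> 1 + 6 * real k * (3 * real n powr (p / 2 - 1) + K)"
  using \<open>k \<le> n\<close>
proof (induction k)
  case 0
  then show ?case by (simp add: psum_def prob_space)
next
  case (Suc k)
  define q where "q = p / 2 - 1"
  have q: "0 < q" "q \<le> 1 / 2" using p unfolding q_def by auto
  let ?f = "\<lambda>s::real. (1 + s\<^sup>2) powr (p / 2)"
  let ?A = "\<lambda>\<omega>. p * S k \<omega> * (1 + (S k \<omega>)\<^sup>2) powr q"
  let ?B = "\<lambda>\<omega>. (1 + (S k \<omega>)\<^sup>2) powr q"
  have pow_le: "a powr r \<le> 1 + a" if "0 \<le> a" "0 \<le> r" "r \<le> 1" for a r :: real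
  proof (cases "a \<le> 1")
    case True
    then have "a powr r \<le> 1" using that by (intro powr_le1) auto
    with that show ?thesis by simp
  next
    case False
    then have "a powr r \<le> a powr 1" using that by (intro powr_mono) auto
    with that show ?thesis by simp
  qed
  have Aint: "integrable M ?A"
  proof (rule Bochner_Integration.integrable_bound[of M "\<lambda>\<omega>. 3 * (2 + (S k \<omega>)\<^sup>2)"])
    show "integrable M (\<lambda>\<omega>. 3 * (2 + (S k \<omega>)\<^sup>2))" using S_second_moment by auto
    show "AE \<omega> in M. norm (?A \<omega>) \<le> norm (3 * (2 + (S k \<omega>)\<^sup>2))"
    proof (intro AE_I2)
      fix \<omega>
      have "\<bar>S k \<omega>\<bar> \<le> (1 + (S k \<omega>)\<^sup>2) powr (1 / 2)"
        by (subst powr_half_sqrt) (auto intro!: real_le_rsqrt)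
      then have "\<bar>S k \<omega>\<bar> * ?B \<omega> \<le> (1 + (S k \<omega>)\<^sup>2) powr (1 / 2) * ?B \<omega>"
        by (intro mult_right_mono) auto
      also have "\<dots> = (1 + (S k \<omega>)\<^sup>2) powr (1 / 2 + q)" by (simp add: powr_add)
      also have "\<dots> \<le> 1 + (1 + (S k \<omega>)\<^sup>2)" using q by (intro pow_le) auto
      finally have "\<bar>S k \<omega>\<bar> * ?B \<omega> \<le> 2 + (S k \<omega>)\<^sup>2" by simp
      then have "p * (\<bar>S k \<omega>\<bar> * ?B \<omega>) \<le> 3 * (2 + (S k \<omega>)\<^sup>2)" using p by (intro mult_mono) auto
      then show "norm (?A \<omega>) \<le> norm (3 * (2 + (S k \<omega>)\<^sup>2))" using p by (simp add: abs_mult mult.assoc)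
    qed
  qed measurable
  have Bint: "integrable M ?B"
  proof (rule Bochner_Integration.integrable_bound[of M "\<lambda>\<omega>. 2 + (S k \<omega>)\<^sup>2"])
    show "integrable M (\<lambda>\<omega>. 2 + (S k \<omega>)\<^sup>2)" using S_second_moment by auto
    show "AE \<omega> in M. norm (?B \<omega>) \<le> norm (2 + (S k \<omega>)\<^sup>2)"
      using pow_le[of "1 + (S k _)\<^sup>2" q] q by (intro AE_I2) simp
  qed measurable
  have Bexp: "expectation ?B \<le> 3 * real n powr q"
  proof -
    have "expectation ?B \<le> expectation (\<lambda>\<omega>. real n powr q * (1 + (1 + (S k \<omega>)\<^sup>2) / real n))"
    proof (intro integral_mono Bint)
      show "integrable M (\<lambda>\<omega>. real n powr q * (1 + (1 + (S k \<omega>)\<^sup>2) / real n))"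
        using S_second_moment by auto
      fix \<omega>
      have "?B \<omega> = (real n * ((1 + (S k \<omega>)\<^sup>2) / real n)) powr q" using \<open>1 \<le> n\<close> by simp
      also have "\<dots> = real n powr q * ((1 + (S k \<omega>)\<^sup>2) / real n) powr q"
        by (intro powr_mult)
      also have "\<dots> \<le> real n powr q * (1 + (1 + (S k \<omega>)\<^sup>2) / real n)"
        using q by (intro mult_left_mono pow_le) auto
      finally show "?B \<omega> \<le> real n powr q * (1 + (1 + (S k \<omega>)\<^sup>2) / real n)" .
    qed
    also have "\<dots> = real n powr q * (1 + (1 + real k) / real n)"
      using S_second_moment by (simp add: prob_space)
    also have "\<dots> \<le> real n powr q * 3"
      using \<open>1 \<le> n\<close> Suc.prems by (intro mult_left_mono) (auto simp: field_simps)
    finally show ?thesis by simp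
  qed
  have fm: "(\<lambda>s. p * s * (1 + s\<^sup>2) powr q) \<in> borel_measurable borel" "(\<lambda>s::real. (1 + s\<^sup>2) powr q) \<in> borel_measurable borel"
    "(\<lambda>s::real. s\<^sup>2) \<in> borel_measurable borel" "(\<lambda>s::real. s) \<in> borel_measurable borel"
    by measurable
  have X: "integrable M (\<lambda>\<omega>. X (Suc k) \<omega>)" "integrable M (\<lambda>\<omega>. (X (Suc k) \<omega>)\<^sup>2)"
    "integrable M (\<lambda>\<omega>. \<bar>X (Suc k) \<omega>\<bar> powr p)"
    by (auto intro: X_integrable square_integrable moment_integrable)
  note AX = indep_S_next[OF fm(1) fm(4) Aint X(1)] and BX = indep_S_next[OF fm(2) fm(3) Bint X(2)]
  define G where "G \<omega> = ?f (S k \<omega>) + ?A \<omega> * X (Suc k) \<omega>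
     + 6 * (?B \<omega> * (X (Suc k) \<omega>)\<^sup>2 + \<bar>X (Suc k) \<omega>\<bar> powr p)" for \<omega>
  have IH: "integrable M (\<lambda>\<omega>. ?f (S k \<omega>))"
    "expectation (\<lambda>\<omega>. ?f (S k \<omega>)) \<le> 1 + 6 * real k * (3 * real n powr q + K)"
    using Suc unfolding q_def by auto
  have Gint: "integrable M G" unfolding G_def using IH AX BX X by auto
  have le: "?f (S (Suc k) \<omega>) \<le> G \<omega>" for \<omega>
    using smooth_power_Taylor[OF p, of "S k \<omega>" "X (Suc k) \<omega>"] unfolding S_Suc G_def q_def by simp
  have int: "integrable M (\<lambda>\<omega>. ?f (S (Suc k) \<omega>))"
    by (rule Bochner_Integration.integrable_bound[OF Gint]) (auto intro!: AE_I2 order_trans[OF le])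
  have "expectation (\<lambda>\<omega>. ?f (S (Suc k) \<omega>)) \<le> expectation G"
    by (intro integral_mono int Gint le)
  also have "\<dots> = expectation (\<lambda>\<omega>. ?f (S k \<omega>))
      + 6 * (expectation ?B + expectation (\<lambda>\<omega>. \<bar>X (Suc k) \<omega>\<bar> powr p))"
    unfolding G_def using IH AX BX X by (simp add: mean second_moment)
  also have "\<dots> \<le> (1 + 6 * real k * (3 * real n powr q + K)) + 6 * (3 * real n powr q + K)"
    using IH Bexp moment[of "Suc k"] by (intro add_mono mult_left_mono) auto
  finally show ?case using int unfolding q_def by (simp add: algebra_simps)
qed

lemma S_moment_tail:
  assumes "1 \<le> n" "0 < l"
  shows "prob {\<omega> \<in> space M. l \<le> \<bar>S n \<omega>\<bar>} \<le> (19 + 6 * K) * (real n / l\<^sup>2) powr (p / 2)"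
proof -
  let ?f = "\<lambda>\<omega>. (1 + (S n \<omega>)\<^sup>2) powr (p / 2)"
  note g = smooth_moment_growth[OF \<open>1 \<le> n\<close> order_refl]
  have "prob {\<omega> \<in> space M. l \<le> \<bar>S n \<omega>\<bar>} \<le> prob {\<omega> \<in> space M. (l\<^sup>2) powr (p / 2) \<le> ?f \<omega>}"
  proof (intro finite_measure_mono subsetI)
    fix \<omega> assume "\<omega> \<in> {\<omega> \<in> space M. l \<le> \<bar>S n \<omega>\<bar>}"
    then have "\<omega> \<in> space M" "l\<^sup>2 \<le> (S n \<omega>)\<^sup>2" using \<open>0 < l\<close> by (auto simp: abs_le_square_iff[symmetric])
    then show "\<omega> \<in> {\<omega> \<in> space M. (l\<^sup>2) powr (p / 2) \<le> ?f \<omega>}" using p by (auto intro!: powr_mono2)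
  qed measurable
  also have "\<dots> \<le> expectation ?f / (l\<^sup>2) powr (p / 2)"
    using integral_Markov_inequality_measure[of M ?f "{}" "(l\<^sup>2) powr (p / 2)"] g \<open>0 < l\<close> by simp
  also have "\<dots> \<le> ((19 + 6 * K) * real n powr (p / 2)) / (l\<^sup>2) powr (p / 2)"
  proof (intro divide_right_mono)
    have "real n * real n powr (p / 2 - 1) = real n powr (p / 2)"
      using \<open>1 \<le> n\<close> by (simp add: powr_diff)
    moreover have "1 \<le> real n powr (p / 2)" using \<open>1 \<le> n\<close> p by (intro ge_one_powr_ge_zero) auto
    moreover have "real n * K \<le> real n powr (p / 2) * K"
    proof (intro mult_right_mono K_nonneg)
      have "real n powr 1 \<le> real n powr (p / 2)" using \<open>1 \<le> n\<close> p by (intro powr_mono) auto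
      then show "real n \<le> real n powr (p / 2)" by simp
    qed
    ultimately have "1 + 6 * real n * (3 * real n powr (p / 2 - 1) + K) \<le> (19 + 6 * K) * real n powr (p / 2)"
      by (simp add: algebra_simps)
    with g show "expectation ?f \<le> (19 + 6 * K) * real n powr (p / 2)" by linarith
  qed simp
  also have "\<dots> = (19 + 6 * K) * (real n / l\<^sup>2) powr (p / 2)" by (simp add: powr_divide)
  finally show ?thesis .
qed

lemma S_max_moment_tail:
  assumes "1 \<le> n" "0 < l" "real n / l\<^sup>2 \<le> 1 / 2"
  shows "prob {\<omega> \<in> space M. \<exists>k\<in>{1..n}. 2 * l \<le> \<bar>S k \<omega>\<bar>} \<le> 2 * (19 + 6 * K) * (real n / l\<^sup>2) powr (p / 2)"
proof -
  have iv: "indep_vars (\<lambda>_. borel) X {0<..n}" by (rule indep_vars_subset[OF indep]) auto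
  have eq: "{0<..k} = {1..k}" for k :: nat by auto
  have "prob {\<omega> \<in> space M. \<exists>k\<in>{0<..n}. 2 * l \<le> \<bar>\<Sum>i\<in>{0<..k}. X i \<omega>\<bar>}
      \<le> 2 * prob {\<omega> \<in> space M. l \<le> \<bar>\<Sum>i\<in>{0<..n}. X i \<omega>\<bar>}"
  proof (rule ottaviani[OF iv])
    fix k assume "k \<in> {0<..n}"
    have iv': "indep_vars (\<lambda>_. borel) X {k<..n}" by (rule indep_vars_subset[OF indep]) auto
    have "prob {\<omega> \<in> space M. l \<le> \<bar>\<Sum>i\<in>{k<..n}. X i \<omega>\<bar>}
        \<le> expectation (\<lambda>\<omega>. (\<Sum>i\<in>{k<..n}. X i \<omega>)\<^sup>2) / l\<^sup>2"
      using \<open>0 < l\<close> by (intro second_moment_tail borel_measurable_sum X_measurable indep_mean_zero_second_moment iv')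
        (auto intro: X_integrable square_integrable mean)
    also have "expectation (\<lambda>\<omega>. (\<Sum>i\<in>{k<..n}. X i \<omega>)\<^sup>2) = real (n - k)"
      by (subst indep_mean_zero_second_moment(2)[OF _ iv'])
         (auto intro: X_integrable square_integrable mean simp: second_moment)
    also have "real (n - k) / l\<^sup>2 \<le> real n / l\<^sup>2" by (intro divide_right_mono) auto
    also note assms(3)
    finally show "prob {\<omega> \<in> space M. l \<le> \<bar>\<Sum>i\<in>{k<..n}. X i \<omega>\<bar>} \<le> 1 / 2" .
  qed
  then have "prob {\<omega> \<in> space M. \<exists>k\<in>{1..n}. 2 * l \<le> \<bar>S k \<omega>\<bar>} \<le> 2 * prob {\<omega> \<in> space M. l \<le> \<bar>S n \<omega>\<bar>}"
    unfolding psum_def eq by simp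
  also have "\<dots> \<le> 2 * ((19 + 6 * K) * (real n / l\<^sup>2) powr (p / 2))"
    using assms by (intro mult_left_mono S_moment_tail) auto
  finally show ?thesis by (simp only: mult.assoc)
qed

text \<open>On the dyadic block \<open>[2 ^ j * m, 2 ^ Suc j * m]\<close> the boundary is of order \<open>sqrt (2 ^ j * m * j)\<close>, so the
  \<open>p\<close>-th moment gives probability \<open>j powr (- p / 2)\<close>. This is summable because \<open>p > 2\<close>; second
  moments alone would only give the harmonic series.\<close>

lemma far_tail:
  assumes c: "0 < c" and m: "1 \<le> m" and J: "1 \<le> J" "16 / (c * ln 2) \<le> real J"
  shows "prob {\<omega> \<in> space M. \<exists>k\<ge>2 ^ J * m. c * real k * ln (real k / real m) \<le> (S k \<omega>)\<^sup>2}
    \<le> (\<Sum>j. 2 * (19 + 6 * K) * (8 / (c * ln 2)) powr (p / 2) * real (j + J) powr (- (p / 2)))"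
    (is "_ \<le> (\<Sum>j. ?b j)")
proof -
  define l where "l j = sqrt (c * 2 ^ j * real m * real j * ln 2) / 2" for j
  define E where "E j = {\<omega> \<in> space M. \<exists>k\<in>{1..2 ^ Suc j * m}. 2 * l j \<le> \<bar>S k \<omega>\<bar>}" for j
  have [measurable]: "E j \<in> events" for j unfolding E_def by measurable
  have E: "prob (E (j + J)) \<le> ?b j" for j
  proof -
    let ?j = "j + J"
    have l0: "0 < l ?j" unfolding l_def using c m J by (auto intro!: mult_pos_pos)
    have l2: "real (2 ^ Suc ?j * m) / (l ?j)\<^sup>2 = 8 / (c * ln 2) / real ?j"
    proof -
      define x where "x = (2::real) ^ ?j * real m"
      have "0 < x" unfolding x_def using m by simp
      have "(l ?j)\<^sup>2 = c * x * real ?j * ln 2 / 4"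
        unfolding l_def x_def using c by (simp add: power_divide)
      moreover have "real (2 ^ Suc ?j * m) = 2 * x" unfolding x_def by simp
      moreover have "2 * x / (c * x * real ?j * ln 2 / 4) = 8 / (c * ln 2) / real ?j"
        using \<open>0 < x\<close> c J by (simp add: divide_simps)
      ultimately show ?thesis by (simp only:)
    qed
    also have "\<dots> \<le> 1 / 2"
    proof -
      have c': "0 < c * ln 2" using c by simp
      have "16 / (c * ln 2) \<le> real ?j" using J by simp
      then have "16 \<le> real ?j * (c * ln 2)" unfolding pos_divide_le_eq[OF c'] .
      then show ?thesis using c' J by (simp add: field_simps)
    qed
    finally have "real (2 ^ Suc ?j * m) / (l ?j)\<^sup>2 \<le> 1 / 2" .
    then have "prob (E ?j) \<le> 2 * (19 + 6 * K) * (real (2 ^ Suc ?j * m) / (l ?j)\<^sup>2) powr (p / 2)"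
      unfolding E_def using l0 m by (intro S_max_moment_tail) auto
    also have "\<dots> = ?b j" unfolding l2 powr_divide[of "8 / (c * ln 2)"] by (simp add: powr_minus_divide)
    finally show ?thesis .
  qed
  have sumb: "summable ?b"
  proof (intro summable_mult)
    have "summable (\<lambda>j. real j powr (- (p / 2)))" using p by (simp add: summable_real_powr_iff)
    from summable_ignore_initial_segment[OF this, of J]
    show "summable (\<lambda>j. real (j + J) powr (- (p / 2)))" by simp
  qed
  have sumE: "summable (\<lambda>j. prob (E (j + J)))"
    by (rule summable_comparison_test'[OF sumb, of 0]) (use E in auto)
  have "prob {\<omega> \<in> space M. \<exists>k\<ge>2 ^ J * m. c * real k * ln (real k / real m) \<le> (S k \<omega>)\<^sup>2} \<le> prob (\<Union>j. E (j + J))"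
  proof (intro finite_measure_mono subsetI)
    fix \<omega> assume "\<omega> \<in> {\<omega> \<in> space M. \<exists>k\<ge>2 ^ J * m. c * real k * ln (real k / real m) \<le> (S k \<omega>)\<^sup>2}"
    then obtain k where k: "2 ^ J * m \<le> k" "c * real k * ln (real k / real m) \<le> (S k \<omega>)\<^sup>2" and w: "\<omega> \<in> space M"
      by auto
    \<comment> \<open>The dyadic block that contains \<open>k\<close>.\<close>
    define j where "j = floorlog 2 (k div m) - 1"
    have km: "2 ^ J \<le> k div m" using k(1) m by (simp add: less_eq_div_iff_mult_less_eq)
    then have kpos: "0 < k div m" by (metis less_le_trans zero_less_numeral zero_less_power)
    have fl: "2 ^ (floorlog 2 (k div m) - 1) \<le> k div m" "k div m < 2 ^ floorlog 2 (k div m)"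
      using floorlog_bounds[OF kpos, of 2] by auto
    have f1: "floorlog 2 (k div m) = Suc j" using kpos unfolding j_def by (simp add: floorlog_def)
    have lo: "2 ^ j \<le> k div m" and hi: "k div m < 2 ^ Suc j" using fl unfolding f1 by auto
    have "J \<le> j"
    proof -
      have "(2::nat) ^ J < 2 ^ Suc j" using km hi by linarith
      then have "J < Suc j" by (rule power_less_imp_less_exp[rotated]) simp
      then show ?thesis by simp
    qed
    have klo: "2 ^ j * m \<le> k" using lo m by (simp add: less_eq_div_iff_mult_less_eq)
    have khi: "k \<le> 2 ^ Suc j * m" using hi m by (simp add: div_less_iff_less_mult)
    have "real (2 ^ j * m) \<le> real k" using klo by (simp only: of_nat_le_iff)
    then have klo': "2 ^ j * real m \<le> real k" by simp
    then have "2 ^ j \<le> real k / real m" using m by (simp add: le_divide_eq)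
    then have "ln (2 ^ j) \<le> ln (real k / real m)" by (intro ln_mono) auto
    then have lnk: "real j * ln 2 \<le> ln (real k / real m)" by (simp add: ln_realpow)
    have "(2 * l j)\<^sup>2 = c * (2 ^ j * real m) * (real j * ln 2)"
      unfolding l_def using c by (simp add: power_mult_distrib power_divide algebra_simps)
    also have "\<dots> \<le> c * real k * ln (real k / real m)"
      using c klo' lnk by (intro mult_mono mult_left_mono) auto
    also have "\<dots> \<le> (S k \<omega>)\<^sup>2" by (rule k(2))
    finally have "2 * l j \<le> \<bar>S k \<omega>\<bar>"
      unfolding abs_le_square_iff[symmetric] by linarith
    then have "\<omega> \<in> E j"
    proof -
      have "0 < 2 ^ j * m" using m by simp
      then have "0 < k" using klo by linarith
      then have "k \<in> {1..2 ^ Suc j * m}" using khi by simp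
      then show ?thesis using \<open>2 * l j \<le> \<bar>S k \<omega>\<bar>\<close> w unfolding E_def by blast
    qed
    then show "\<omega> \<in> (\<Union>j. E (j + J))" using \<open>J \<le> j\<close> by (auto intro!: exI[of _ "j - J"])
  qed measurable
  also have "\<dots> \<le> (\<Sum>j. prob (E (j + J)))"
    by (intro finite_measure_subadditive_countably sumE) auto
  also have "\<dots> \<le> (\<Sum>j. ?b j)" by (intro suminf_le E sumE sumb)
  finally show ?thesis .
qed

end

section \<open>The backward heat equation\<close>

text \<open>Up to a constant factor, this is the mixture \<open>\<integral> exp (\<theta> * x - \<theta>\<^sup>2 * t / 2) d\<theta>\<close> of exponential martingales of
  Brownian motion. It reaches \<open>exp (c / 2)\<close> exactly when \<open>x\<^sup>2 / t - ln t\<close> reaches \<open>c\<close>.\<close>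

definition heat :: "real \<Rightarrow> real \<Rightarrow> real" where
  "heat t x = exp (x\<^sup>2 / (2 * t)) / sqrt t"

definition heat_x :: "real \<Rightarrow> real \<Rightarrow> real" where "heat_x t x = x / t * heat t x"
definition heat_xx :: "real \<Rightarrow> real \<Rightarrow> real" where "heat_xx t x = (1 / t + x\<^sup>2 / t\<^sup>2) * heat t x"
definition heat_xxx :: "real \<Rightarrow> real \<Rightarrow> real" where "heat_xxx t x = (3 * x / t\<^sup>2 + x ^ 3 / t ^ 3) * heat t x"
definition heat_tt :: "real \<Rightarrow> real \<Rightarrow> real" where
  "heat_tt t x = ((1 / t\<^sup>2 + 2 * x\<^sup>2 / t ^ 3) + (1 / t + x\<^sup>2 / t\<^sup>2)\<^sup>2 / 2) / 2 * heat t x"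

lemma heat_measurable [measurable]:
  "(\<lambda>x. heat t x) \<in> borel_measurable borel" "(\<lambda>x. heat_x t x) \<in> borel_measurable borel"
  "(\<lambda>x. heat_xx t x) \<in> borel_measurable borel"
  unfolding heat_def heat_x_def heat_xx_def by measurable

lemma heat_pos: "0 < t \<Longrightarrow> 0 < heat t x"
  unfolding heat_def by simp

lemma heat_ge_iff:
  assumes "0 < t"
  shows "exp (c / 2) \<le> heat t x \<longleftrightarrow> c \<le> x\<^sup>2 / t - ln t"
proof -
  have "heat t x = exp (x\<^sup>2 / (2 * t)) / exp (ln t / 2)"
    unfolding heat_def using assms by (simp add: ln_sqrt[symmetric] exp_ln)
  also have "\<dots> = exp ((x\<^sup>2 / t - ln t) / 2)" by (simp add: exp_diff[symmetric] diff_divide_distrib mult.commute)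
  finally show ?thesis by simp
qed

lemma heat_derivatives:
  assumes "0 < t"
  shows "((\<lambda>x. heat t x) has_real_derivative heat_x t x) (at x)"
    and "((\<lambda>x. heat_x t x) has_real_derivative heat_xx t x) (at x)"
    and "((\<lambda>x. heat_xx t x) has_real_derivative heat_xxx t x) (at x)"
    and "((\<lambda>t. heat t x) has_real_derivative - heat_xx t x / 2) (at t)"
    and "((\<lambda>t. - heat_xx t x / 2) has_real_derivative heat_tt t x) (at t)"
proof -
  have t: "t \<noteq> 0" "sqrt t \<noteq> 0" "sqrt t * sqrt t = t" using assms by auto
  show 1: "((\<lambda>x. heat t x) has_real_derivative heat_x t x) (at x)" for x
    unfolding heat_def heat_x_def using t
    by (auto intro!: derivative_eq_intros simp: field_simps)
  show 2: "((\<lambda>x. heat_x t x) has_real_derivative heat_xx t x) (at x)"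
    unfolding heat_x_def[abs_def]
    by (rule DERIV_cong[OF DERIV_mult[OF DERIV_cdivide[OF DERIV_ident] 1]])
       (use t in \<open>auto simp: heat_xx_def heat_x_def field_simps power2_eq_square\<close>)
  show 3: "((\<lambda>x. heat_xx t x) has_real_derivative heat_xxx t x) (at x)"
  proof -
    have r: "((\<lambda>x. 1 / t + x\<^sup>2 / t\<^sup>2) has_real_derivative 2 * x / t\<^sup>2) (at x)"
      using t by (auto intro!: derivative_eq_intros simp: field_simps power2_eq_square power4_eq_xxxx)
    show ?thesis unfolding heat_xx_def[abs_def]
      by (rule DERIV_cong[OF DERIV_mult[OF r 1]])
       (use t in \<open>auto simp: heat_xxx_def heat_x_def field_simps power2_eq_square power3_eq_cube\<close>)
  qed
  show 4: "((\<lambda>t. heat t x) has_real_derivative - heat_xx t x / 2) (at t)"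
  proof -
    have "((\<lambda>t. exp (x\<^sup>2 / (2 * t)) * (1 / sqrt t)) has_real_derivative
        exp (x\<^sup>2 / (2 * t)) * (- (x\<^sup>2 / (2 * t\<^sup>2))) * (1 / sqrt t) + exp (x\<^sup>2 / (2 * t)) * (- (1 / (2 * t * sqrt t)))) (at t)"
      using assms t by (auto intro!: derivative_eq_intros simp: field_simps power2_eq_square)
    moreover have "exp (x\<^sup>2 / (2 * t)) * (- (x\<^sup>2 / (2 * t\<^sup>2))) * (1 / sqrt t) + exp (x\<^sup>2 / (2 * t)) * (- (1 / (2 * t * sqrt t)))
       = - heat_xx t x / 2"
      using t unfolding heat_xx_def heat_def by (simp add: field_simps power2_eq_square)
    ultimately show ?thesis unfolding heat_def by simp
  qed
  show "((\<lambda>t. - heat_xx t x / 2) has_real_derivative heat_tt t x) (at t)"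
  proof -
    have "((\<lambda>t. - ((1 / t + x\<^sup>2 / t\<^sup>2) * heat t x) / 2) has_real_derivative
        - ((- (1 / t\<^sup>2) - 2 * x\<^sup>2 / t ^ 3) * heat t x + (- heat_xx t x / 2) * (1 / t + x\<^sup>2 / t\<^sup>2)) / 2) (at t)"
    proof -
      have r: "((\<lambda>t. 1 / t + x\<^sup>2 / t\<^sup>2) has_real_derivative (- (1 / t\<^sup>2) - 2 * x\<^sup>2 / t ^ 3)) (at t)"
        using t by (auto intro!: derivative_eq_intros simp: field_simps power2_eq_square power3_eq_cube)
      show ?thesis by (intro DERIV_cdivide DERIV_minus DERIV_mult r 4)
    qed
    moreover have "- ((- (1 / t\<^sup>2) - 2 * x\<^sup>2 / t ^ 3) * heat t x + (- heat_xx t x / 2) * (1 / t + x\<^sup>2 / t\<^sup>2)) / 2 = heat_tt t x"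
      unfolding heat_tt_def heat_xx_def by (simp add: field_simps power2_eq_square)
    ultimately show ?thesis unfolding heat_xx_def by simp
  qed
qed

text \<open>One step of a random walk: the first and second order terms in \<open>y\<close> vanish in expectation if \<open>y\<close>
  has mean \<open>0\<close> and variance \<open>h\<close>, and the time derivative is cancelled by the second space derivative.\<close>

lemma heat_Taylor:
  assumes t: "1 \<le> t" and h: "0 < h" "h \<le> 1" and x: "\<bar>x\<bar> \<le> R" and y: "\<bar>y\<bar> \<le> 1"
    and C: "C = (4 * (R + 1) ^ 4 + 4) * exp ((R + 1)\<^sup>2 / 2)"
  shows "\<bar>heat (t + h) (x + y) - heat t x - y * heat_x (t + h) x - (y\<^sup>2 - h) / 2 * heat_xx (t + h) x\<bar>
    \<le> C * (\<bar>y\<bar> ^ 3 + h\<^sup>2)"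
    and "\<bar>heat_x (t + h) x\<bar> \<le> C" "\<bar>heat_xx (t + h) x\<bar> \<le> C"
    and "heat (t + h) (x + y) \<le> C" "heat t x \<le> C"
proof -
  \<comment> \<open>On \<open>t \<ge> 1\<close> and \<open>\<bar>x\<bar> \<le> Q\<close> the derivatives are polynomials in \<open>x\<close> of degree at most \<open>4\<close> times \<open>heat\<close>, and \<open>heat \<le> exp (Q\<^sup>2 / 2)\<close>.\<close>
  define Q where "Q = R + 1"
  have Q: "1 \<le> Q" unfolding Q_def using x by linarith
  define E where "E = exp (Q\<^sup>2 / 2)"
  have E1: "1 \<le> E" unfolding E_def by simp
  have p: "Q \<le> Q ^ 4" "Q\<^sup>2 \<le> Q ^ 4" "Q ^ 3 \<le> Q ^ 4"
    using Q power_increasing[of 1 4 Q] by (auto intro: power_increasing)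
  have C': "C = (4 * Q ^ 4 + 4) * E" unfolding C Q_def E_def ..
  have u: "0 \<le> heat s z" "heat s z \<le> E" if "1 \<le> s" "\<bar>z\<bar> \<le> Q" for s z
  proof -
    show "0 \<le> heat s z" using heat_pos[of s z] that by simp
    have "z\<^sup>2 / (2 * s) \<le> Q\<^sup>2 / 2"
    proof -
      have "z\<^sup>2 \<le> Q\<^sup>2" using that Q by (simp add: abs_le_square_iff[symmetric])
      then show ?thesis using that by (intro frac_le) auto
    qed
    then have "exp (z\<^sup>2 / (2 * s)) / sqrt s \<le> E / 1"
      unfolding E_def using that by (intro frac_le) auto
    then show "heat s z \<le> E" unfolding heat_def by simp
  qed
  have mono: "c * E \<le> C" if "c \<le> 4 * Q ^ 4 + 4" for c
    unfolding C' using that E1 by (intro mult_right_mono) auto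
  have factor: "\<bar>c * heat s z\<bar> \<le> C" if "\<bar>c\<bar> \<le> 4 * Q ^ 4 + 4" "1 \<le> s" "\<bar>z\<bar> \<le> Q" for c s z
  proof -
    have "\<bar>c * heat s z\<bar> \<le> \<bar>c\<bar> * E" unfolding abs_mult using u[OF that(2,3)] by (intro mult_left_mono) auto
    also have "\<dots> \<le> C" using that by (intro mono) auto
    finally show ?thesis .
  qed
  have frac: "\<bar>z ^ n / s ^ k\<bar> \<le> Q ^ n" if "1 \<le> s" "\<bar>z\<bar> \<le> Q" for z s :: real and n k
  proof -
    have "\<bar>z ^ n / s ^ k\<bar> = \<bar>z\<bar> ^ n / s ^ k" using that by (simp add: power_abs)
    also have "\<dots> \<le> Q ^ n / 1" using that by (intro frac_le power_mono one_le_power) auto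
    finally show ?thesis by simp
  qed
  have ux: "\<bar>heat_x s z\<bar> \<le> C" if "1 \<le> s" "\<bar>z\<bar> \<le> Q" for s z
    unfolding heat_x_def using frac[OF that, of 1 1] p Q that by (intro factor) auto
  have k1: "\<bar>1 / s + z\<^sup>2 / s\<^sup>2\<bar> \<le> 1 + Q\<^sup>2" if "1 \<le> s" "\<bar>z\<bar> \<le> Q" for s z
  proof -
    have "\<bar>1 / s\<bar> \<le> 1" "\<bar>z\<^sup>2 / s\<^sup>2\<bar> \<le> Q\<^sup>2" using frac[OF that, of 0 1] frac[OF that, of 2 2] by simp_all
    from order_trans[OF abs_triangle_ineq add_mono[OF this]] show ?thesis .
  qed
  have uxx: "\<bar>heat_xx s z\<bar> \<le> C" if "1 \<le> s" "\<bar>z\<bar> \<le> Q" for s z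
    unfolding heat_xx_def using k1[OF that] p Q that by (intro factor) auto
  have uxxx: "\<bar>heat_xxx s z\<bar> \<le> C" if "1 \<le> s" "\<bar>z\<bar> \<le> Q" for s z
    unfolding heat_xxx_def
  proof (intro factor that)
    have "\<bar>3 * z / s\<^sup>2 + z ^ 3 / s ^ 3\<bar> \<le> 3 * Q + Q ^ 3"
    proof -
      have "\<bar>3 * z / s\<^sup>2\<bar> \<le> 3 * Q" "\<bar>z ^ 3 / s ^ 3\<bar> \<le> Q ^ 3"
        using frac[OF that, of 1 2] frac[OF that, of 3 3] by (simp_all add: abs_mult)
      from order_trans[OF abs_triangle_ineq add_mono[OF this]] show ?thesis .
    qed
    then show "\<bar>3 * z / s\<^sup>2 + z ^ 3 / s ^ 3\<bar> \<le> 4 * Q ^ 4 + 4" using p by linarith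
  qed
  have utt: "\<bar>heat_tt s z\<bar> \<le> C" if "1 \<le> s" "\<bar>z\<bar> \<le> Q" for s z
    unfolding heat_tt_def
  proof (intro factor that)
    have 1: "\<bar>1 / s\<^sup>2 + 2 * z\<^sup>2 / s ^ 3\<bar> \<le> 1 + 2 * Q\<^sup>2"
    proof -
      have "\<bar>1 / s\<^sup>2\<bar> \<le> 1" "\<bar>2 * z\<^sup>2 / s ^ 3\<bar> \<le> 2 * Q\<^sup>2"
        using frac[OF that, of 0 2] frac[OF that, of 2 3] by (simp_all add: abs_mult)
      from order_trans[OF abs_triangle_ineq add_mono[OF this]] show ?thesis .
    qed
    have "(1 / s + z\<^sup>2 / s\<^sup>2)\<^sup>2 \<le> (1 + Q\<^sup>2)\<^sup>2"
      using k1[OF that] by (simp add: abs_le_square_iff[symmetric])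
    also have "(1 + Q\<^sup>2)\<^sup>2 = 1 + 2 * Q\<^sup>2 + Q ^ 4" by (simp add: power2_sum)
    finally have 2: "(1 / s + z\<^sup>2 / s\<^sup>2)\<^sup>2 \<le> 1 + 2 * Q\<^sup>2 + Q ^ 4" .
    have 3: "0 \<le> (1 / s + z\<^sup>2 / s\<^sup>2)\<^sup>2" by simp
    show "\<bar>((1 / s\<^sup>2 + 2 * z\<^sup>2 / s ^ 3) + (1 / s + z\<^sup>2 / s\<^sup>2)\<^sup>2 / 2) / 2\<bar> \<le> 4 * Q ^ 4 + 4"
      using 1 2 3 p(2) by argo
  qed
  have th: "1 \<le> t + h" "0 < t + h" using t h by auto
  have xQ: "\<bar>x\<bar> \<le> Q" "\<bar>x + y\<bar> \<le> Q" using x y unfolding Q_def by auto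
  show "\<bar>heat_x (t + h) x\<bar> \<le> C" "\<bar>heat_xx (t + h) x\<bar> \<le> C"
    using ux uxx th xQ by auto
  show "heat (t + h) (x + y) \<le> C" "heat t x \<le> C"
    using factor[of 1 "t + h" "x + y"] factor[of 1 t x] th xQ t Q p by auto
  define D where "D n z = (if n = 0 then heat (t + h) (x + z) else if n = 1 then heat_x (t + h) (x + z)
     else if n = 2 then heat_xx (t + h) (x + z) else heat_xxx (t + h) (x + z))" for n :: nat and z
  have shift: "((\<lambda>z. f (x + z)) has_real_derivative D) (at z)" if "(f has_real_derivative D) (at (x + z))" for f D z
  proof -
    have "((\<lambda>z. x + z) has_real_derivative 1) (at z)" by (auto intro!: derivative_eq_intros)
    from DERIV_chain2[OF that this] show ?thesis by simp
  qed
  have "\<exists>s. \<bar>s\<bar> \<le> \<bar>y\<bar> \<and> D 0 y = (\<Sum>m<3. D m 0 / fact m * y ^ m) + D 3 s / fact 3 * y ^ 3"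
  proof (rule Maclaurin_bi_le)
    show "\<forall>m s. m < 3 \<and> \<bar>s\<bar> \<le> \<bar>y\<bar> \<longrightarrow> (D m has_real_derivative D (Suc m) s) (at s)"
    proof (intro allI impI)
      fix m :: nat and s :: real assume "m < 3 \<and> \<bar>s\<bar> \<le> \<bar>y\<bar>"
      then have "m = 0 \<or> m = 1 \<or> m = 2" by auto
      then show "(D m has_real_derivative D (Suc m) s) (at s)"
        unfolding D_def using heat_derivatives(1,2,3)[OF th(2), of "x + s"] by (auto intro!: shift)
    qed
  qed simp
  then obtain s where s: "\<bar>s\<bar> \<le> \<bar>y\<bar>"
    "heat (t + h) (x + y) = heat (t + h) x + heat_x (t + h) x * y + heat_xx (t + h) x / 2 * y\<^sup>2
      + heat_xxx (t + h) (x + s) / 6 * y ^ 3"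
    by (auto simp: D_def numeral_3_eq_3 numeral_2_eq_2 fact_numeral)
  define F where "F n z = (if n = 0 then heat (t + h + z) x else if n = 1 then - heat_xx (t + h + z) x / 2
     else heat_tt (t + h + z) x)" for n :: nat and z
  have shift': "((\<lambda>z. f (t + h + z)) has_real_derivative D) (at z)"
    if "(f has_real_derivative D) (at (t + h + z))" for f D z
  proof -
    have "((\<lambda>z. t + h + z) has_real_derivative 1) (at z)" by (auto intro!: derivative_eq_intros)
    from DERIV_chain2[OF that this] show ?thesis by simp
  qed
  have "\<exists>r. \<bar>r\<bar> \<le> \<bar>- h\<bar> \<and> F 0 (- h) = (\<Sum>m<2. F m 0 / fact m * (- h) ^ m) + F 2 r / fact 2 * (- h) ^ 2"
  proof (rule Maclaurin_bi_le)
    show "\<forall>m r. m < 2 \<and> \<bar>r\<bar> \<le> \<bar>- h\<bar> \<longrightarrow> (F m has_real_derivative F (Suc m) r) (at r)"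
    proof (intro allI impI)
      fix m :: nat and r :: real assume mr: "m < 2 \<and> \<bar>r\<bar> \<le> \<bar>- h\<bar>"
      then have "m = 0 \<or> m = 1" and "0 < t + h + r" using t h by auto
      then show "(F m has_real_derivative F (Suc m) r) (at r)"
        unfolding F_def using heat_derivatives(4,5)[of "t + h + r" x] by (auto intro!: shift')
    qed
  qed simp
  then obtain r where r: "\<bar>r\<bar> \<le> h"
    "heat t x = heat (t + h) x + h / 2 * heat_xx (t + h) x + heat_tt (t + h + r) x / 2 * h\<^sup>2"
    using h by (auto simp: F_def numeral_2_eq_2)
  have eq: "heat (t + h) (x + y) - heat t x - y * heat_x (t + h) x - (y\<^sup>2 - h) / 2 * heat_xx (t + h) x
    = heat_xxx (t + h) (x + s) / 6 * y ^ 3 - heat_tt (t + h + r) x / 2 * h\<^sup>2"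
    unfolding s(2) r(2) by (simp add: field_simps)
  have "\<bar>heat_xxx (t + h) (x + s) / 6 * y ^ 3\<bar> \<le> C * \<bar>y\<bar> ^ 3"
  proof -
    have "\<bar>heat_xxx (t + h) (x + s)\<bar> \<le> C" using s(1) x y th by (intro uxxx) (auto simp: Q_def)
    then have "\<bar>heat_xxx (t + h) (x + s) / 6\<bar> \<le> C" by simp
    then show ?thesis unfolding abs_mult power_abs by (intro mult_right_mono) auto
  qed
  moreover have "\<bar>heat_tt (t + h + r) x / 2 * h\<^sup>2\<bar> \<le> C * h\<^sup>2"
  proof -
    have "\<bar>heat_tt (t + h + r) x\<bar> \<le> C" using r(1) t h xQ by (intro utt) auto
    then have "\<bar>heat_tt (t + h + r) x / 2\<bar> \<le> C" by simp
    then show ?thesis unfolding abs_mult by (intro mult_mono) auto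
  qed
  ultimately show "\<bar>heat (t + h) (x + y) - heat t x - y * heat_x (t + h) x - (y\<^sup>2 - h) / 2 * heat_xx (t + h) x\<bar>
    \<le> C * (\<bar>y\<bar> ^ 3 + h\<^sup>2)"
    unfolding eq by (simp add: algebra_simps)
qed

text \<open>Killing the steps larger than \<open>e\<close> costs no more than a multiple of \<open>\<bar>y\<bar> powr p\<close>, which has negligible
  expectation even after summation over all steps.\<close>

lemma heat_step:
  assumes t: "1 \<le> t" and h: "0 < h" "h \<le> 1" and x: "\<bar>x\<bar> \<le> R"
    and e: "0 < e" "e \<le> 1" and p: "2 < p" "p \<le> 3"
    and C: "C = (4 * (R + 1) ^ 4 + 4) * exp ((R + 1)\<^sup>2 / 2)"
  shows "\<bar>(if \<bar>y\<bar> \<le> e then heat (t + h) (x + y) else 0) - heat t x - y * heat_x (t + h) x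
      - (y\<^sup>2 - h) / 2 * heat_xx (t + h) x\<bar> \<le> 3 * C / e powr p * (\<bar>y\<bar> powr p + h\<^sup>2)"
    (is "\<bar>?L\<bar> \<le> _")
proof -
  have C0: "0 \<le> C" unfolding C by simp
  have ep: "0 < e powr p" "e powr p \<le> 1" using e p by (auto intro: powr_le1)
  have le: "C * z \<le> 3 * C / e powr p * z" if "0 \<le> z" for z
  proof -
    have "C \<le> C / e powr p" using C0 ep by (simp add: le_divide_eq mult_left_le)
    also have "\<dots> \<le> 3 * C / e powr p" using C0 ep by (intro divide_right_mono) auto
    finally show ?thesis using that by (intro mult_right_mono)
  qed
  note H = heat_Taylor[OF t h x _ C]
  show ?thesis
  proof (cases "\<bar>y\<bar> \<le> e")
    case True
    then have y: "\<bar>y\<bar> \<le> 1" using e by simp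
    have "\<bar>y\<bar> ^ 3 \<le> \<bar>y\<bar> powr p"
    proof (cases "y = 0")
      case False
      then have "\<bar>y\<bar> ^ 3 = \<bar>y\<bar> powr 3" by (simp add: powr_numeral)
      also have "\<dots> \<le> \<bar>y\<bar> powr p" using False y p by (intro powr_mono') auto
      finally show ?thesis .
    qed simp
    then have "C * (\<bar>y\<bar> ^ 3 + h\<^sup>2) \<le> C * (\<bar>y\<bar> powr p + h\<^sup>2)" using C0 by (intro mult_left_mono) auto
    also have "\<dots> \<le> 3 * C / e powr p * (\<bar>y\<bar> powr p + h\<^sup>2)" by (intro le) auto
    finally show ?thesis using H(1)[OF y] True by simp
  next
    case False
    define r where "r = \<bar>y\<bar> / e"
    have r: "1 \<le> r" "\<bar>y\<bar> \<le> r" using False e unfolding r_def by (auto simp: le_divide_eq mult_left_le)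
    have rp: "1 \<le> r powr p" "r \<le> r powr p" "r\<^sup>2 \<le> r powr p"
      using r p powr_mono[of 0 p r] powr_mono[of 1 p r] powr_mono[of 2 p r] by (auto simp: powr_numeral)
    have b: "\<bar>heat_x (t + h) x\<bar> \<le> C" "\<bar>heat_xx (t + h) x\<bar> \<le> C" "\<bar>heat t x\<bar> \<le> C"
      using H(2,3,5)[of 0] heat_pos[of t x] t by auto
    have "\<bar>y * heat_x (t + h) x\<bar> \<le> r powr p * C"
      unfolding abs_mult using b r rp by (intro mult_mono) auto
    moreover have "\<bar>y\<^sup>2 / 2 * heat_xx (t + h) x\<bar> \<le> r powr p / 2 * C"
    proof -
      have "y\<^sup>2 \<le> r\<^sup>2" using r by (simp add: abs_le_square_iff[symmetric])
      then show ?thesis unfolding abs_mult using b rp by (intro mult_mono) auto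
    qed
    moreover have "\<bar>h / 2 * heat_xx (t + h) x\<bar> \<le> r powr p / 2 * C"
      unfolding abs_mult using b rp h by (intro mult_mono) auto
    moreover have "C \<le> r powr p * C" using rp C0 by (simp add: mult_right_le_one_le mult_le_cancel_right1)
    ultimately have "\<bar>?L\<bar> \<le> 3 * (r powr p * C)"
      using False b(3) by (simp add: algebra_simps diff_divide_distrib)
    also have "r powr p = \<bar>y\<bar> powr p / e powr p" unfolding r_def using e by (simp add: powr_divide)
    also have "3 * (\<bar>y\<bar> powr p / e powr p * C) = 3 * C / e powr p * \<bar>y\<bar> powr p" by simp
    also have "\<dots> \<le> 3 * C / e powr p * (\<bar>y\<bar> powr p + h\<^sup>2)" using C0 by (intro mult_left_mono) auto
    finally show ?thesis .
  qed
qed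

text \<open>A path that crosses a level by a step of size at most \<open>e\<close> lands close to the level.\<close>

lemma heat_overshoot:
  assumes t: "1 \<le> t" and h: "0 < h" "h \<le> 1" and x: "\<bar>x\<bar> \<le> R"
    and e: "e \<le> 1" and y: "\<bar>y\<bar> \<le> e"
    and C: "C = (4 * (R + 1) ^ 4 + 4) * exp ((R + 1)\<^sup>2 / 2)"
  shows "heat (t + h) (x + y) \<le> heat t x + 4 * C * (e + h)"
proof -
  have y1: "\<bar>y\<bar> \<le> 1" using y e by simp
  note H = heat_Taylor[OF t h x y1 C]
  have C0: "0 \<le> C" unfolding C by simp
  have "\<bar>y * heat_x (t + h) x\<bar> \<le> e * C"
    unfolding abs_mult using H y by (intro mult_mono) auto
  moreover have "\<bar>(y\<^sup>2 - h) / 2 * heat_xx (t + h) x\<bar> \<le> (e + h) * C"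
  proof -
    have "\<bar>y\<bar> * \<bar>y\<bar> \<le> e * 1" using y y1 by (intro mult_mono) auto
    then have "y\<^sup>2 \<le> e" by (simp add: power2_eq_square)
    moreover have "\<bar>(w - h) / 2\<bar> \<le> e + h" if "0 \<le> w" "w \<le> e" for w using that h by (auto simp: abs_le_iff field_simps)
    ultimately have "\<bar>(y\<^sup>2 - h) / 2\<bar> \<le> e + h" by simp
    then show ?thesis unfolding abs_mult[of "_ / 2"] using H h y by (intro mult_mono) auto
  qed
  moreover have "C * (\<bar>y\<bar> ^ 3 + h\<^sup>2) \<le> C * (e + h)"
  proof -
    have "\<bar>y\<bar> * \<bar>y\<bar>\<^sup>2 \<le> e * 1" using y y1 by (intro mult_mono power_le_one) auto
    then have "\<bar>y\<bar> ^ 3 \<le> e" by (simp add: power3_eq_cube power2_eq_square mult.assoc)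
    moreover have "h\<^sup>2 \<le> h" using h by (simp add: power2_eq_square mult_left_le)
    ultimately show ?thesis using C0 by (intro mult_left_mono) auto
  qed
  moreover have "0 \<le> h * C" "0 \<le> e * C" using h C0 y by auto
  moreover have "4 * C * (e + h) = 4 * (e * C) + 4 * (h * C)" "C * (e + h) = e * C + h * C"
    "(e + h) * C = e * C + h * C" by (simp_all add: algebra_simps)
  ultimately show ?thesis using H(1) by linarith
qed

section \<open>Crossing probabilities on a bounded time scale\<close>

text \<open>The path has neither crossed the level \<open>B\<close> nor made a step larger than \<open>e * sqrt m\<close> between times
  \<open>m\<close> and \<open>k\<close>. This is a property of paths, so that it can be separated from the next step.\<close>

definition alive :: "nat \<Rightarrow> real \<Rightarrow> real \<Rightarrow> nat \<Rightarrow> (nat \<Rightarrow> real) \<Rightarrow> bool" where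
  "alive m e B k x \<longleftrightarrow> (\<forall>j\<in>{m..k}. heat (real j / real m) ((\<Sum>i\<in>{1..j}. x i) / sqrt (real m)) < B \<and>
     (m < j \<longrightarrow> \<bar>x j\<bar> \<le> e * sqrt (real m)))"

lemma alive_measurable:
  assumes "1 \<le> m"
  shows "Measurable.pred (PiM {1..k} (\<lambda>_. borel)) (alive m e B k)"
proof -
  have [measurable]: "(\<lambda>x::nat\<Rightarrow>real. \<Sum>i\<in>{1..j}. x i) \<in> borel_measurable (PiM {1..k} (\<lambda>_. borel))"
    "(\<lambda>x::nat\<Rightarrow>real. x j) \<in> borel_measurable (PiM {1..k} (\<lambda>_. borel))" if "j \<in> {m..k}" for j
    using that assms by (auto intro!: borel_measurable_sum measurable_component_singleton)
  show ?thesis unfolding alive_def[abs_def] by measurable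
qed

lemma alive_restrict:
  assumes "1 \<le> m"
  shows "alive m e B k (restrict x {1..k}) = alive m e B k x"
proof -
  have "(\<Sum>i\<in>{1..j}. restrict x {1..k} i) = (\<Sum>i\<in>{1..j}. x i)" if "j \<in> {m..k}" for j
    using that by (intro sum.cong) auto
  moreover have "restrict x {1..k} j = x j" if "j \<in> {m..k}" for j using that assms by auto
  ultimately show ?thesis unfolding alive_def by simp
qed

lemma alive_Suc:
  assumes "m \<le> k"
  shows "alive m e B (Suc k) x \<longleftrightarrow> alive m e B k x \<and> \<bar>x (Suc k)\<bar> \<le> e * sqrt (real m) \<and>
    heat (real (Suc k) / real m) ((\<Sum>i\<in>{1..Suc k}. x i) / sqrt (real m)) < B"
proof -
  have "{m..Suc k} = insert (Suc k) {m..k}" using assms by auto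
  then show ?thesis unfolding alive_def using assms by (simp del: sum.cl_ivl_Suc) auto
qed

lemma heat_level_bounds_space:
  assumes "1 \<le> t" "t \<le> T" "0 \<le> a" "heat t x < exp (a\<^sup>2 / 2)"
  shows "\<bar>x\<bar> \<le> sqrt (T * (a\<^sup>2 + ln T))"
proof -
  have "x\<^sup>2 / t - ln t < a\<^sup>2" using heat_ge_iff[of t "a\<^sup>2" x] assms by auto
  then have "x\<^sup>2 < (a\<^sup>2 + ln t) * t" using assms by (simp add: divide_less_eq[symmetric] field_simps)
  also have "\<dots> \<le> (a\<^sup>2 + ln T) * T" using assms by (intro mult_mono add_mono) auto
  finally have "x\<^sup>2 \<le> T * (a\<^sup>2 + ln T)" by (simp add: mult.commute)
  then have "sqrt (x\<^sup>2) \<le> sqrt (T * (a\<^sup>2 + ln T))" by (rule real_sqrt_le_mono)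
  then show ?thesis by simp
qed

context std_walk
begin

definition U :: "nat \<Rightarrow> nat \<Rightarrow> 'a \<Rightarrow> real" where
  "U m k \<omega> = heat (real k / real m) (S k \<omega> / sqrt (real m))"

lemma U_measurable [measurable]: "U m k \<in> borel_measurable M"
  unfolding U_def by measurable

lemma U_ge_iff:
  assumes "1 \<le> m" "1 \<le> k"
  shows "exp (c / 2) \<le> U m k \<omega> \<longleftrightarrow> c \<le> (S k \<omega>)\<^sup>2 / real k - ln (real k / real m)"
  unfolding U_def using assms by (subst heat_ge_iff) (auto simp: power_divide)

definition Alive :: "nat \<Rightarrow> real \<Rightarrow> real \<Rightarrow> nat \<Rightarrow> 'a set" where
  "Alive m e B k = {\<omega> \<in> space M. alive m e B k (\<lambda>i. X i \<omega>)}"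

lemma Alive_alt: "Alive m e B k = {\<omega> \<in> space M. \<forall>j\<in>{m..k}. U m j \<omega> < B \<and>
     (m < j \<longrightarrow> \<bar>X j \<omega>\<bar> \<le> e * sqrt (real m))}"
  unfolding Alive_def alive_def U_def psum_def ..

lemma Alive_measurable [measurable]: "1 \<le> m \<Longrightarrow> Alive m e B k \<in> events"
proof -
  assume m: "1 \<le> m"
  have [measurable]: "X j \<in> borel_measurable M" if "j \<in> {m..k}" for j using that m by auto
  show ?thesis unfolding Alive_alt by measurable
qed

text \<open>The function \<open>heat\<close> is an approximate martingale along the walk as long as the walk is alive: over the \<open>(T - 1) * m\<close>
  steps from \<open>m\<close> to \<open>T * m\<close> the errors add up to the order \<open>m powr (1 - p / 2)\<close>, which tends to \<open>0\<close>.\<close>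

lemma alive_step:
  assumes m: "1 \<le> m" "m \<le> k" "real k \<le> T * real m" and a: "0 \<le> a"
    and e: "0 < e" "e \<le> 1"
    and R: "R = sqrt (T * (a\<^sup>2 + ln T))"
    and C: "C = (4 * (R + 1) ^ 4 + 4) * exp ((R + 1)\<^sup>2 / 2)"
  defines "A \<equiv> Alive m e (exp (a\<^sup>2 / 2)) k"
    and "V \<equiv> \<lambda>\<omega>. if \<bar>X (Suc k) \<omega>\<bar> \<le> e * sqrt (real m) then U m (Suc k) \<omega> else 0"
  shows "integrable M (\<lambda>\<omega>. indicator A \<omega> * V \<omega>)" "integrable M (\<lambda>\<omega>. indicator A \<omega> * U m k \<omega>)"
    and "\<bar>expectation (\<lambda>\<omega>. indicator A \<omega> * V \<omega>) - expectation (\<lambda>\<omega>. indicator A \<omega> * U m k \<omega>)\<bar>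
      \<le> 3 * C / e powr p * (K * real m powr (- (p / 2)) + 1 / (real m)\<^sup>2)"
    and "\<And>\<omega>. \<omega> \<in> A \<Longrightarrow> \<bar>X (Suc k) \<omega>\<bar> \<le> e * sqrt (real m) \<Longrightarrow>
      U m (Suc k) \<omega> \<le> exp (a\<^sup>2 / 2) + 4 * C * (e + 1 / real m)"
proof -
  define h where "h = 1 / real m"
  define t where "t = real k / real m"
  define x where "x \<omega> = S k \<omega> / sqrt (real m)" for \<omega>
  define y where "y \<omega> = X (Suc k) \<omega> / sqrt (real m)" for \<omega>
  define I where "I \<omega> = (indicator A \<omega> :: real)" for \<omega>
  have h: "0 < h" "h \<le> 1" and t: "1 \<le> t" "t \<le> T" and sm: "0 < sqrt (real m)"
    using m unfolding h_def t_def by (auto simp: divide_simps)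
  have th: "real (Suc k) / real m = t + h" unfolding t_def h_def by (simp add: add_divide_distrib)
  have A_ev [measurable]: "A \<in> events" unfolding A_def using m by measurable
  have XS [measurable]: "X (Suc k) \<in> borel_measurable M" by simp
  have xm [measurable]: "x \<in> borel_measurable M" "y \<in> borel_measurable M" "V \<in> borel_measurable M" "I \<in> borel_measurable M"
    unfolding x_def y_def V_def I_def by measurable
  have Uk: "U m k \<omega> = heat t (x \<omega>)" for \<omega> unfolding U_def t_def x_def ..
  have USk: "U m (Suc k) \<omega> = heat (t + h) (x \<omega> + y \<omega>)" for \<omega>
    unfolding U_def th x_def y_def S_Suc by (simp add: add_divide_distrib)
  have ye: "\<bar>X (Suc k) \<omega>\<bar> \<le> e * sqrt (real m) \<longleftrightarrow> \<bar>y \<omega>\<bar> \<le> e" for \<omega>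
    unfolding y_def using sm by (simp add: divide_le_eq)
  have V: "V \<omega> = (if \<bar>y \<omega>\<bar> \<le> e then heat (t + h) (x \<omega> + y \<omega>) else 0)" for \<omega>
    unfolding V_def ye USk ..
  have below: "U m k \<omega> < exp (a\<^sup>2 / 2)" and xR: "\<bar>x \<omega>\<bar> \<le> R" if "\<omega> \<in> A" for \<omega>
  proof -
    show "U m k \<omega> < exp (a\<^sup>2 / 2)" using that m unfolding A_def Alive_alt by auto
    then show "\<bar>x \<omega>\<bar> \<le> R" unfolding Uk R using t a by (intro heat_level_bounds_space) auto
  qed
  have C0: "0 \<le> C" unfolding C by simp
  note Taylor = heat_Taylor[OF t(1) h xR _ C]
  have I01: "I \<omega> = 0 \<or> I \<omega> = 1 \<and> \<omega> \<in> A" for \<omega> unfolding I_def by (auto simp: indicator_def)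
  have bound: "\<bar>I \<omega> * z\<bar> \<le> C" if "\<omega> \<in> A \<Longrightarrow> \<bar>z\<bar> \<le> C" for \<omega> z
    using I01[of \<omega>] that C0 by auto
  have hx: "\<bar>I \<omega> * heat_x (t + h) (x \<omega>)\<bar> \<le> C" "\<bar>I \<omega> * heat_xx (t + h) (x \<omega>)\<bar> \<le> C"
    "\<bar>I \<omega> * U m k \<omega>\<bar> \<le> C" "\<bar>I \<omega> * V \<omega>\<bar> \<le> C" for \<omega>
  proof -
    show "\<bar>I \<omega> * heat_x (t + h) (x \<omega>)\<bar> \<le> C" "\<bar>I \<omega> * heat_xx (t + h) (x \<omega>)\<bar> \<le> C"
      using Taylor(2,3)[of \<omega> 0] by (auto intro!: bound)
    show "\<bar>I \<omega> * U m k \<omega>\<bar> \<le> C"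
      using Taylor(5)[of \<omega> 0] heat_pos[of t "x \<omega>"] t unfolding Uk by (auto intro!: bound)
    show "\<bar>I \<omega> * V \<omega>\<bar> \<le> C"
    proof (rule bound)
      assume w: "\<omega> \<in> A"
      show "\<bar>V \<omega>\<bar> \<le> C"
      proof (cases "\<bar>y \<omega>\<bar> \<le> e")
        case True
        then have "heat (t + h) (x \<omega> + y \<omega>) \<le> C" using Taylor(4)[OF w, of "y \<omega>"] e by simp
        moreover have "0 < heat (t + h) (x \<omega> + y \<omega>)" using t h by (intro heat_pos) auto
        ultimately show ?thesis unfolding V using True by simp
      qed (simp add: V C0)
    qed
  qed
  have int: "integrable M (\<lambda>\<omega>. I \<omega> * heat_x (t + h) (x \<omega>))" "integrable M (\<lambda>\<omega>. I \<omega> * heat_xx (t + h) (x \<omega>))"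
    "integrable M (\<lambda>\<omega>. I \<omega> * U m k \<omega>)" "integrable M (\<lambda>\<omega>. I \<omega> * V \<omega>)"
    by (rule integrable_const_bound[of _ C]; use hx in simp)+
  show iV: "integrable M (\<lambda>\<omega>. indicator A \<omega> * V \<omega>)" and iU: "integrable M (\<lambda>\<omega>. indicator A \<omega> * U m k \<omega>)"
    using int unfolding I_def by auto
  show "U m (Suc k) \<omega> \<le> exp (a\<^sup>2 / 2) + 4 * C * (e + 1 / real m)"
    if "\<omega> \<in> A" "\<bar>X (Suc k) \<omega>\<bar> \<le> e * sqrt (real m)" for \<omega>
    using heat_overshoot[OF t(1) h xR[OF that(1)] e(2) that(2)[unfolded ye] C] below[OF that(1)]
    unfolding USk Uk h_def by simp
  have [measurable]: "Measurable.pred (PiM {1..k} (\<lambda>_. borel)) (alive m e (exp (a\<^sup>2 / 2)) k)"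
    by (rule alive_measurable[OF m(1)])
  have [measurable]: "(\<lambda>x::nat\<Rightarrow>real. \<Sum>i\<in>{1..k}. x i) \<in> borel_measurable (PiM {1..k} (\<lambda>_. borel))"
    by (intro borel_measurable_sum measurable_component_singleton)
  have sep: "integrable M (\<lambda>\<omega>. I \<omega> * f (x \<omega>) * g (X (Suc k) \<omega>))"
    "expectation (\<lambda>\<omega>. I \<omega> * f (x \<omega>) * g (X (Suc k) \<omega>)) = 0"
    if f [measurable]: "f \<in> borel_measurable borel" and g: "g \<in> borel_measurable borel"
      and fi: "integrable M (\<lambda>\<omega>. I \<omega> * f (x \<omega>))" and gi: "integrable M (\<lambda>\<omega>. g (X (Suc k) \<omega>))"
      and g0: "expectation (\<lambda>\<omega>. g (X (Suc k) \<omega>)) = 0" for f g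
  proof -
    define F where "F z = (if alive m e (exp (a\<^sup>2 / 2)) k z then 1 else 0) * f ((\<Sum>i\<in>{1..k}. z i) / sqrt (real m))"
      for z :: "nat \<Rightarrow> real"
    have Fm: "F \<in> borel_measurable (PiM {1..k} (\<lambda>_. borel))" unfolding F_def by measurable
    have Fr: "F (restrict z {1..k}) = F z" for z
    proof -
      have "(\<Sum>i\<in>{1..k}. restrict z {1..k} i) = (\<Sum>i\<in>{1..k}. z i)" by (intro sum.cong) auto
      then show ?thesis unfolding F_def alive_restrict[OF m(1)] by (simp only:)
    qed
    have eq: "F (\<lambda>i. X i \<omega>) = I \<omega> * f (x \<omega>)" if "\<omega> \<in> space M" for \<omega>
      using that unfolding F_def I_def A_def Alive_def x_def psum_def by (simp add: indicator_def)
    have "integrable M (\<lambda>\<omega>. F (\<lambda>i. X i \<omega>))"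
      by (subst Bochner_Integration.integrable_cong[OF refl eq]) (auto intro: fi)
    note sep = indep_past_next[OF Fm g Fr this gi]
    show "integrable M (\<lambda>\<omega>. I \<omega> * f (x \<omega>) * g (X (Suc k) \<omega>))"
      by (subst Bochner_Integration.integrable_cong[OF refl, where g="\<lambda>\<omega>. F (\<lambda>i. X i \<omega>) * g (X (Suc k) \<omega>)"])
         (use sep eq in auto)
    have "expectation (\<lambda>\<omega>. I \<omega> * f (x \<omega>) * g (X (Suc k) \<omega>)) = expectation (\<lambda>\<omega>. F (\<lambda>i. X i \<omega>) * g (X (Suc k) \<omega>))"
      by (intro Bochner_Integration.integral_cong refl) (simp add: eq)
    also have "\<dots> = 0" by (subst sep(2)) (simp add: g0)
    finally show "expectation (\<lambda>\<omega>. I \<omega> * f (x \<omega>) * g (X (Suc k) \<omega>)) = 0" .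
  qed
  have Xint: "integrable M (X (Suc k))" "integrable M (\<lambda>\<omega>. (X (Suc k) \<omega>)\<^sup>2)"
    "expectation (X (Suc k)) = 0" "expectation (\<lambda>\<omega>. (X (Suc k) \<omega>)\<^sup>2) = 1"
    by (auto intro: X_integrable square_integrable mean second_moment)
  have y2: "(y \<omega>)\<^sup>2 - h = h * ((X (Suc k) \<omega>)\<^sup>2 - 1)" for \<omega>
    unfolding y_def h_def by (simp add: power_divide diff_divide_distrib)
  \<comment> \<open>The part of the Taylor polynomial that has mean \<open>0\<close> by independence of the past and the next step.\<close>
  define N where "N \<omega> = I \<omega> * heat_x (t + h) (x \<omega>) * (X (Suc k) \<omega> / sqrt (real m))
     + I \<omega> * heat_xx (t + h) (x \<omega>) * (h / 2 * ((X (Suc k) \<omega>)\<^sup>2 - 1))" for \<omega>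
  have N1: "integrable M (\<lambda>\<omega>. I \<omega> * heat_x (t + h) (x \<omega>) * (X (Suc k) \<omega> / sqrt (real m)))"
    "expectation (\<lambda>\<omega>. I \<omega> * heat_x (t + h) (x \<omega>) * (X (Suc k) \<omega> / sqrt (real m))) = 0"
    by (rule sep[of "heat_x (t + h)" "\<lambda>v. v / sqrt (real m)"]; use int Xint in \<open>simp add: heat_measurable\<close>)+
  have N2: "integrable M (\<lambda>\<omega>. I \<omega> * heat_xx (t + h) (x \<omega>) * (h / 2 * ((X (Suc k) \<omega>)\<^sup>2 - 1)))"
    "expectation (\<lambda>\<omega>. I \<omega> * heat_xx (t + h) (x \<omega>) * (h / 2 * ((X (Suc k) \<omega>)\<^sup>2 - 1))) = 0"
    by (rule sep[of "heat_xx (t + h)" "\<lambda>v. h / 2 * (v\<^sup>2 - 1)"];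
        use int Xint in \<open>simp add: heat_measurable prob_space\<close>)+
  have N: "integrable M N" "expectation N = 0" unfolding N_def using N1 N2 by auto
  let ?D = "3 * C / e powr p"
  have D0: "0 \<le> ?D" using C0 by simp
  have yp: "\<bar>y \<omega>\<bar> powr p = real m powr (- (p / 2)) * \<bar>X (Suc k) \<omega>\<bar> powr p" for \<omega>
  proof -
    have "\<bar>y \<omega>\<bar> powr p = \<bar>X (Suc k) \<omega>\<bar> powr p / sqrt (real m) powr p"
      unfolding y_def using sm by (simp add: powr_divide abs_divide)
    also have "sqrt (real m) powr p = real m powr (p / 2)"
      using m by (simp add: powr_half_sqrt[symmetric] powr_powr)
    finally show ?thesis by (simp add: powr_minus_divide)
  qed
  have pt: "\<bar>I \<omega> * V \<omega> - I \<omega> * U m k \<omega> - N \<omega>\<bar> \<le> ?D * (\<bar>y \<omega>\<bar> powr p + h\<^sup>2)" for \<omega>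
  proof (cases "I \<omega> = 0")
    case True
    then show ?thesis using mult_nonneg_nonneg[OF D0, of "\<bar>y \<omega>\<bar> powr p + h\<^sup>2"] unfolding N_def by simp
  next
    case False
    then have w: "\<omega> \<in> A" "I \<omega> = 1" using I01[of \<omega>] by auto
    have "I \<omega> * V \<omega> - I \<omega> * U m k \<omega> - N \<omega> = V \<omega> - heat t (x \<omega>) - y \<omega> * heat_x (t + h) (x \<omega>)
      - ((y \<omega>)\<^sup>2 - h) / 2 * heat_xx (t + h) (x \<omega>)"
      unfolding N_def w(2) y2 Uk by (simp add: y_def mult_ac)
    then show ?thesis using heat_step[OF t(1) h xR[OF w(1)] e p C, of "y \<omega>"] unfolding V by simp
  qed
  have ypi: "integrable M (\<lambda>\<omega>. \<bar>y \<omega>\<bar> powr p)" unfolding yp by (auto intro: moment_integrable)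
  have "\<bar>expectation (\<lambda>\<omega>. I \<omega> * V \<omega>) - expectation (\<lambda>\<omega>. I \<omega> * U m k \<omega>)\<bar>
      = \<bar>expectation (\<lambda>\<omega>. I \<omega> * V \<omega> - I \<omega> * U m k \<omega> - N \<omega>)\<bar>"
    using int N by simp
  also have "\<dots> \<le> expectation (\<lambda>\<omega>. \<bar>I \<omega> * V \<omega> - I \<omega> * U m k \<omega> - N \<omega>\<bar>)"
    by (rule integral_abs_bound)
  also have "\<dots> \<le> expectation (\<lambda>\<omega>. ?D * (\<bar>y \<omega>\<bar> powr p + h\<^sup>2))"
    using int N ypi by (intro integral_mono pt integrable_abs Bochner_Integration.integrable_diff integrable_mult_right
       Bochner_Integration.integrable_add) auto
  also have "\<dots> = ?D * (real m powr (- (p / 2)) * expectation (\<lambda>\<omega>. \<bar>X (Suc k) \<omega>\<bar> powr p) + h\<^sup>2)"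
    using ypi unfolding yp using moment_integrable[of "Suc k"] by (simp add: prob_space)
  also have "\<dots> \<le> ?D * (real m powr (- (p / 2)) * K + h\<^sup>2)"
    using moment[of "Suc k"] by (intro mult_left_mono add_mono D0) auto
  also have "\<dots> = ?D * (K * real m powr (- (p / 2)) + 1 / (real m)\<^sup>2)"
    unfolding h_def by (simp add: power_divide mult.commute)
  finally show "\<bar>expectation (\<lambda>\<omega>. indicator A \<omega> * V \<omega>) - expectation (\<lambda>\<omega>. indicator A \<omega> * U m k \<omega>)\<bar>
      \<le> 3 * C / e powr p * (K * real m powr (- (p / 2)) + 1 / (real m)\<^sup>2)"
    unfolding I_def .
qed

text \<open>Optional stopping at the first crossing: the expectation of \<open>U\<close> at time \<open>m\<close>, restricted to paths that
  start below the level, is passed on to the paths that have crossed, where \<open>U\<close> is essentially \<open>B\<close>, and to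
  the surviving ones.\<close>

lemma crossing_bounds:
  assumes m: "1 \<le> m" "m \<le> n" "real n \<le> T * real m" and a: "0 \<le> a"
    and e: "0 < e" "e \<le> 1"
    and R: "R = sqrt (T * (a\<^sup>2 + ln T))"
    and C: "C = (4 * (R + 1) ^ 4 + 4) * exp ((R + 1)\<^sup>2 / 2)"
    and B: "B = exp (a\<^sup>2 / 2)"
  defines "d \<equiv> real (n - m) * (3 * C / e powr p * (K * real m powr (- (p / 2)) + 1 / (real m)\<^sup>2))"
    and "start \<equiv> expectation (\<lambda>\<omega>. indicator {\<omega> \<in> space M. U m m \<omega> < B} \<omega> * U m m \<omega>)"
    and "surv \<equiv> expectation (\<lambda>\<omega>. indicator (Alive m e B n) \<omega> * U m n \<omega>)"
    and "Cr \<equiv> {\<omega> \<in> space M. \<exists>k\<in>{m..n}. B \<le> U m k \<omega>}"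
  shows "prob Cr \<le> prob {\<omega> \<in> space M. B \<le> U m m \<omega>} + (start + d) / B
      + real (n - m) * (K * real m powr (- (p / 2)) / e powr p)"
    and "prob Cr \<ge> prob {\<omega> \<in> space M. B \<le> U m m \<omega>} + (start - surv - d) / (B + 4 * C * (e + 1 / real m))"
proof -
  define \<delta> where "\<delta> = 3 * C / e powr p * (K * real m powr (- (p / 2)) + 1 / (real m)\<^sup>2)"
  define B' where "B' = B + 4 * C * (e + 1 / real m)"
  define A where "A k = Alive m e B k" for k
  define F where "F k = {\<omega> \<in> A (k - 1). \<bar>X k \<omega>\<bar> \<le> e * sqrt (real m) \<and> B \<le> U m k \<omega>}" for k
  have B0: "0 < B" unfolding B by simp
  have C0: "0 \<le> C" unfolding C by simp
  have BB': "B \<le> B'" "0 < B'" unfolding B'_def using B0 C0 e by (auto intro!: add_pos_nonneg)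
  have [measurable]: "A k \<in> events" for k unfolding A_def using m by measurable
  have F_ev [measurable]: "F k \<in> events" if "1 \<le> k" for k
  proof -
    have [measurable]: "X k \<in> borel_measurable M" using that by simp
    have "F k = A (k - 1) \<inter> {\<omega> \<in> space M. \<bar>X k \<omega>\<bar> \<le> e * sqrt (real m) \<and> B \<le> U m k \<omega>}"
      unfolding F_def using sets.sets_into_space[of "A (k - 1)" M] by auto
    also have "\<dots> \<in> events" by measurable
    finally show ?thesis .
  qed
  let ?E = "\<lambda>k. expectation (\<lambda>\<omega>. indicator (A k) \<omega> * U m k \<omega>)"
  have one_step: "?E k \<le> ?E (Suc k) + B' * prob (F (Suc k)) + \<delta> \<and> ?E (Suc k) + B * prob (F (Suc k)) - \<delta> \<le> ?E k"
    if k: "m \<le> k" "k < n" for k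
  proof -
    have kT: "real k \<le> T * real m" using k m by simp
    have kT': "real (Suc k) \<le> T * real m"
    proof -
      have "real (Suc k) \<le> real n" using k by linarith
      then show ?thesis using m(3) by linarith
    qed
    note st = alive_step[OF m(1) k(1) kT a e R C, folded B A_def]
    have iS: "integrable M (\<lambda>\<omega>. indicator (A (Suc k)) \<omega> * U m (Suc k) \<omega>)"
      unfolding A_def B using m k kT' by (intro alive_step(2)[OF _ _ _ a e R C]) auto
    let ?V = "\<lambda>\<omega>. if \<bar>X (Suc k) \<omega>\<bar> \<le> e * sqrt (real m) then U m (Suc k) \<omega> else 0"
    have split: "indicator (A k) \<omega> * ?V \<omega> = indicator (A (Suc k)) \<omega> * U m (Suc k) \<omega> + indicator (F (Suc k)) \<omega> * U m (Suc k) \<omega>"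
      for \<omega>
      using alive_Suc[OF k(1), of e B "\<lambda>i. X i \<omega>"]
      unfolding A_def F_def Alive_def U_def psum_def by (auto simp: indicator_def)
    have iF: "integrable M (\<lambda>\<omega>. indicator (F (Suc k)) \<omega> * U m (Suc k) \<omega>)"
      using Bochner_Integration.integrable_diff[OF st(1) iS] unfolding split by simp
    have EV: "expectation (\<lambda>\<omega>. indicator (A k) \<omega> * ?V \<omega>) = ?E (Suc k) + expectation (\<lambda>\<omega>. indicator (F (Suc k)) \<omega> * U m (Suc k) \<omega>)"
      unfolding split using iS iF by simp
    have FS [measurable]: "F (Suc k) \<in> events" by (rule F_ev) simp
    have iFc: "integrable M (\<lambda>\<omega>. indicator (F (Suc k)) \<omega> * c)" for c :: real
      by (intro integrable_mult_left integrable_real_indicator FS) (simp add: emeasure_eq_measure)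
    have EFc: "expectation (\<lambda>\<omega>. indicator (F (Suc k)) \<omega> * c) = c * prob (F (Suc k))" for c :: real
      using sets.sets_into_space[OF FS] by (simp add: mult.commute Int_absorb2)
    have "expectation (\<lambda>\<omega>. indicator (F (Suc k)) \<omega> * U m (Suc k) \<omega>) \<le> expectation (\<lambda>\<omega>. indicator (F (Suc k)) \<omega> * B')"
      using st(4) by (intro integral_mono iF iFc) (auto simp: indicator_def F_def B'_def)
    moreover have "expectation (\<lambda>\<omega>. indicator (F (Suc k)) \<omega> * B) \<le> expectation (\<lambda>\<omega>. indicator (F (Suc k)) \<omega> * U m (Suc k) \<omega>)"
      by (intro integral_mono iF iFc) (auto simp: indicator_def F_def)
    ultimately show ?thesis using st(3) unfolding EV EFc \<delta>_def by linarith
  qed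
  have tele: "?E m \<le> ?E k + B' * (\<Sum>j\<in>{m<..k}. prob (F j)) + real (k - m) * \<delta> \<and>
      ?E k + B * (\<Sum>j\<in>{m<..k}. prob (F j)) - real (k - m) * \<delta> \<le> ?E m" if "m \<le> k" "k \<le> n" for k
    using that
  proof (induction k rule: dec_induct)
    case (step k)
    have s: "{m<..Suc k} = insert (Suc k) {m<..k}" using step by auto
    have r: "real (Suc k - m) * \<delta> = real (k - m) * \<delta> + \<delta>" using step by (simp add: Suc_diff_le algebra_simps)
    from step have IH: "?E m \<le> ?E k + B' * (\<Sum>j\<in>{m<..k}. prob (F j)) + real (k - m) * \<delta>"
      "?E k + B * (\<Sum>j\<in>{m<..k}. prob (F j)) - real (k - m) * \<delta> \<le> ?E m" by auto
    have "?E k \<le> ?E (Suc k) + B' * prob (F (Suc k)) + \<delta>" "?E (Suc k) + B * prob (F (Suc k)) - \<delta> \<le> ?E k"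
      using one_step[of k] \<open>m \<le> k\<close> step.prems by auto
    with IH show ?case unfolding s r by (simp add: distrib_left)
  qed simp
  have disj: "disjoint_family_on F {m<..n}"
  proof -
    have "F j \<inter> F k = {}" if "m < j" "j < k" for j k
    proof -
      have "j \<in> {m..k - 1}" using that by auto
      then show ?thesis unfolding F_def A_def Alive_alt by fastforce
    qed
    then show ?thesis unfolding disjoint_family_on_def
      by (metis greaterThanAtMost_iff inf_commute linorder_neqE_nat)
  qed
  define G where "G = (\<Union>j\<in>{m<..n}. F j)"
  have PG: "(\<Sum>j\<in>{m<..n}. prob (F j)) = prob G"
    unfolding G_def using disj by (intro finite_measure_finite_Union[symmetric]) auto
  have [measurable]: "G \<in> events" unfolding G_def by (intro sets.finite_UN F_ev) auto
  have Am: "A m = {\<omega> \<in> space M. U m m \<omega> < B}" unfolding A_def Alive_alt by auto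
  have startE: "?E m = start" unfolding start_def Am ..
  have survE: "?E n = surv" unfolding surv_def A_def ..
  have dE: "real (n - m) * \<delta> = d" unfolding d_def \<delta>_def ..
  have T: "start \<le> surv + B' * prob G + d" "surv + B * prob G - d \<le> start"
    using tele[OF m(2) order_refl] unfolding startE survE dE PG by auto
  have surv0: "0 \<le> surv"
  proof -
    have "0 \<le> U m n \<omega>" for \<omega> unfolding U_def using m by (intro less_imp_le heat_pos) auto
    then show ?thesis unfolding surv_def by (intro Bochner_Integration.integral_nonneg mult_nonneg_nonneg) auto
  qed
  define Jump where "Jump j = {\<omega> \<in> space M. e * sqrt (real m) < \<bar>X j \<omega>\<bar>}" for j
  have [measurable]: "Jump j \<in> events" if "1 \<le> j" for j
  proof -
    have [measurable]: "X j \<in> borel_measurable M" using that by simp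
    show ?thesis unfolding Jump_def by measurable
  qed
  have PJ: "prob (Jump j) \<le> K * real m powr (- (p / 2)) / e powr p" if "1 \<le> j" for j
  proof -
    have [measurable]: "X j \<in> borel_measurable M" using that by simp
    have sp: "(e * sqrt (real m)) powr p = e powr p * real m powr (p / 2)"
      using e by (simp add: powr_mult powr_half_sqrt[symmetric] powr_powr)
    have "prob (Jump j) \<le> prob {\<omega> \<in> space M. (e * sqrt (real m)) powr p \<le> \<bar>X j \<omega>\<bar> powr p}"
      unfolding Jump_def using e p by (intro finite_measure_mono) (auto intro!: powr_mono2)
    also have "\<dots> \<le> expectation (\<lambda>\<omega>. \<bar>X j \<omega>\<bar> powr p) / (e * sqrt (real m)) powr p"
      using integral_Markov_inequality_measure[OF moment_integrable[OF that], of "{}" "(e * sqrt (real m)) powr p"] e m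
      by simp
    also have "\<dots> \<le> K / (e * sqrt (real m)) powr p" using moment[OF that] by (intro divide_right_mono) auto
    finally show ?thesis unfolding sp by (simp add: powr_minus_divide mult.commute)
  qed
  have [measurable]: "Cr \<in> events" unfolding Cr_def by measurable
  let ?S = "{\<omega> \<in> space M. B \<le> U m m \<omega>}"
  have "prob Cr \<le> prob (?S \<union> G \<union> (\<Union>j\<in>{m<..n}. Jump j))"
  proof (intro finite_measure_mono subsetI)
    fix \<omega> assume "\<omega> \<in> Cr"
    then have w: "\<omega> \<in> space M" and ex: "\<exists>k. k \<in> {m..n} \<and> B \<le> U m k \<omega>" unfolding Cr_def by auto
    define k where "k = (LEAST k. k \<in> {m..n} \<and> B \<le> U m k \<omega>)"
    have k: "k \<in> {m..n}" "B \<le> U m k \<omega>" using LeastI_ex[OF ex] unfolding k_def by auto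
    have below: "U m j \<omega> < B" if "j \<in> {m..<k}" for j
      using not_less_Least[of j "\<lambda>k. k \<in> {m..n} \<and> B \<le> U m k \<omega>"] that k unfolding k_def[symmetric] by auto
    show "\<omega> \<in> ?S \<union> G \<union> (\<Union>j\<in>{m<..n}. Jump j)"
    proof (rule ccontr)
      assume no: "\<omega> \<notin> ?S \<union> G \<union> (\<Union>j\<in>{m<..n}. Jump j)"
      then have "k \<noteq> m" using k w by auto
      then have km: "m < k" "k \<le> n" using k by auto
      have jump: "\<bar>X j \<omega>\<bar> \<le> e * sqrt (real m)" if "m < j" "j \<le> n" for j
        using no w that unfolding Jump_def by force
      have "\<omega> \<in> A (k - 1)" unfolding A_def Alive_alt using w below jump km by auto
      then have "\<omega> \<in> F k" unfolding F_def using jump km k by auto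
      then show False using no km unfolding G_def by auto
    qed
  next
    show "?S \<union> G \<union> (\<Union>j\<in>{m<..n}. Jump j) \<in> events"
      by (intro sets.Un sets.finite_UN) (auto intro: \<open>\<And>j. 1 \<le> j \<Longrightarrow> Jump j \<in> events\<close>)
  qed
  also have "\<dots> \<le> prob ?S + prob G + (\<Sum>j\<in>{m<..n}. prob (Jump j))"
  proof -
    have J: "(\<Union>j\<in>{m<..n}. Jump j) \<in> events"
      by (intro sets.finite_UN) (auto intro: \<open>\<And>j. 1 \<le> j \<Longrightarrow> Jump j \<in> events\<close>)
    have "prob (?S \<union> G \<union> (\<Union>j\<in>{m<..n}. Jump j)) \<le> prob (?S \<union> G) + prob (\<Union>j\<in>{m<..n}. Jump j)"
      by (intro measure_Un_le J) auto
    moreover have "prob (?S \<union> G) \<le> prob ?S + prob G" by (intro measure_Un_le) auto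
    moreover have "prob (\<Union>j\<in>{m<..n}. Jump j) \<le> (\<Sum>j\<in>{m<..n}. prob (Jump j))"
      by (intro finite_measure_subadditive_finite) (auto intro: \<open>\<And>j. 1 \<le> j \<Longrightarrow> Jump j \<in> events\<close>)
    ultimately show ?thesis by linarith
  qed
  also have "(\<Sum>j\<in>{m<..n}. prob (Jump j)) \<le> (\<Sum>j\<in>{m<..n}. K * real m powr (- (p / 2)) / e powr p)"
    by (intro sum_mono PJ) auto
  also have "\<dots> = real (n - m) * (K * real m powr (- (p / 2)) / e powr p)" by simp
  also have "prob G \<le> (start + d) / B" using T surv0 B0 by (simp add: le_divide_eq mult.commute)
  finally show "prob Cr \<le> prob ?S + (start + d) / B + real (n - m) * (K * real m powr (- (p / 2)) / e powr p)"
    by simp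
  have SG: "?S \<inter> G = {}"
  proof -
    have "\<omega> \<notin> ?S" if "\<omega> \<in> F j" "j \<in> {m<..n}" for \<omega> j
    proof -
      have "m \<in> {m..j - 1}" using that by auto
      then show ?thesis using that unfolding F_def A_def Alive_alt by fastforce
    qed
    then show ?thesis unfolding G_def by blast
  qed
  have "(start - surv - d) / B' \<le> prob G" using T BB' by (simp add: divide_le_eq mult.commute)
  then have "prob ?S + (start - surv - d) / B' \<le> prob ?S + prob G" by simp
  also have "\<dots> = prob (?S \<union> G)" using SG by (intro finite_measure_Union[symmetric]) auto
  also have "\<dots> \<le> prob Cr"
  proof (intro finite_measure_mono subsetI)
    fix \<omega> assume "\<omega> \<in> ?S \<union> G"
    then show "\<omega> \<in> Cr" unfolding Cr_def
    proof
      assume "\<omega> \<in> ?S" then show "\<omega> \<in> {\<omega> \<in> space M. \<exists>k\<in>{m..n}. B \<le> U m k \<omega>}" using m by auto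
    next
      assume "\<omega> \<in> G"
      then obtain j where "j \<in> {m<..n}" "\<omega> \<in> F j" unfolding G_def by auto
      then show "\<omega> \<in> {\<omega> \<in> space M. \<exists>k\<in>{m..n}. B \<le> U m k \<omega>}"
        unfolding F_def A_def Alive_alt by (auto intro!: bexI[of _ j])
    qed
  qed auto
  finally show "prob ?S + (start - surv - d) / (B + 4 * C * (e + 1 / real m)) \<le> prob Cr" unfolding B'_def .
qed

text \<open>A surviving path is below the level \<open>B\<close>; and at time \<open>n = T * m\<close> the value of \<open>U\<close> is close to zero
  with high probability because the factor \<open>1 / sqrt T\<close> is not compensated by \<open>S n\<close>.\<close>

lemma survivors:
  assumes m: "1 \<le> m" and T: "2 \<le> T" and B: "0 < B"
  shows "expectation (\<lambda>\<omega>. indicator (Alive m e B (T * m)) \<omega> * U m (T * m) \<omega>)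
    \<le> exp (- (ln (real T) / 4)) + B * (2 / ln (real T))"
proof -
  let ?n = "T * m" and ?L = "ln (real T)"
  define H where "H = {\<omega> \<in> space M. ?L / 2 \<le> (S ?n \<omega>)\<^sup>2 / real ?n}"
  have n: "1 \<le> ?n" using m T by simp
  have L: "0 < ?L" using T by simp
  have rT: "real ?n / real m = real T" using m by simp
  have H_ev [measurable]: "H \<in> events" unfolding H_def by measurable
  have [measurable]: "Alive m e B ?n \<in> events" using m by measurable
  have U0: "0 < U m ?n \<omega>" for \<omega> unfolding U_def rT using T by (intro heat_pos) simp
  have low: "U m ?n \<omega> \<le> exp (- (?L / 4))" if "\<omega> \<in> space M" "\<omega> \<notin> H" for \<omega>
  proof -
    have "\<not> exp ((- ?L / 2) / 2) \<le> U m ?n \<omega>"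
    proof -
      have "\<not> ?L / 2 \<le> (S ?n \<omega>)\<^sup>2 / real ?n" using that unfolding H_def by blast
      then show ?thesis unfolding U_ge_iff[OF m n] rT by argo
    qed
    then show ?thesis by simp
  qed
  have pt: "indicator (Alive m e B ?n) \<omega> * U m ?n \<omega> \<le> exp (- (?L / 4)) + B * indicator H \<omega>" if "\<omega> \<in> space M" for \<omega>
  proof (cases "\<omega> \<in> Alive m e B ?n")
    case True
    have "m \<le> ?n" using T by simp
    then have "U m ?n \<omega> < B" using True unfolding Alive_alt by auto
    moreover have "0 < exp (- (?L / 4))" by simp
    ultimately have "U m ?n \<omega> \<le> exp (- (?L / 4)) + B" by linarith
    then show ?thesis using low[OF that] True by (cases "\<omega> \<in> H") auto
  qed (use B in \<open>auto simp: indicator_def\<close>)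
  have "expectation (\<lambda>\<omega>. indicator (Alive m e B ?n) \<omega> * U m ?n \<omega>) \<le> expectation (\<lambda>\<omega>. exp (- (?L / 4)) + B * indicator H \<omega>)"
  proof (intro integral_mono_AE AE_I2 pt)
    show "integrable M (\<lambda>\<omega>. indicator (Alive m e B ?n) \<omega> * U m ?n \<omega>)"
    proof (rule integrable_const_bound[of _ "exp (- (?L / 4)) + B"])
      show "AE \<omega> in M. norm (indicator (Alive m e B ?n) \<omega> * U m ?n \<omega>) \<le> exp (- (?L / 4)) + B"
      proof (intro AE_I2)
        fix \<omega> assume w: "\<omega> \<in> space M"
        have "B * indicator H \<omega> \<le> B" using B by (simp add: indicator_def)
        then have "indicator (Alive m e B ?n) \<omega> * U m ?n \<omega> \<le> exp (- (?L / 4)) + B" using pt[OF w] by linarith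
        moreover have "0 \<le> indicator (Alive m e B ?n) \<omega> * U m ?n \<omega>" using U0[of \<omega>] by simp
        ultimately show "norm (indicator (Alive m e B ?n) \<omega> * U m ?n \<omega>) \<le> exp (- (?L / 4)) + B" by simp
      qed
    qed measurable
    show "integrable M (\<lambda>\<omega>. exp (- (?L / 4)) + B * indicator H \<omega>)"
      by (intro Bochner_Integration.integrable_add integrable_mult_right integrable_real_indicator H_ev)
         (auto simp: emeasure_eq_measure)
  qed
  also have "\<dots> = exp (- (?L / 4)) + B * prob H"
  proof -
    have "integrable M (indicator H :: 'a \<Rightarrow> real)"
      by (intro integrable_real_indicator H_ev) (simp add: emeasure_eq_measure)
    then show ?thesis using sets.sets_into_space[OF H_ev] by (simp add: prob_space Int_absorb2)
  qed
  also have "prob H \<le> 2 / ?L"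
  proof -
    have "prob H = prob {\<omega> \<in> space M. real ?n * (?L / 2) \<le> (S ?n \<omega>)\<^sup>2}"
      unfolding H_def using n by (intro arg_cong[where f=prob]) (auto simp: le_divide_eq mult.commute)
    also have "\<dots> \<le> expectation (\<lambda>\<omega>. (S ?n \<omega>)\<^sup>2) / (real ?n * (?L / 2))"
      using integral_Markov_inequality_measure[OF S_second_moment(1)[of ?n], of "{}" "real ?n * (?L / 2)"] n L
      by simp
    also have "\<dots> = 2 / ?L" unfolding S_second_moment(2) using n L m T by simp
    finally show ?thesis .
  qed
  finally show ?thesis using B by simp
qed

end

section \<open>The Robbins--Siegmund law\<close>

text \<open>The probability that a variable with the Robbins--Siegmund distribution exceeds \<open>a\<^sup>2\<close>. Parametrising the level
  \<open>\<alpha> = rs_tail a\<close> by \<open>a\<close> turns the event that a p-value is at most \<open>\<alpha>\<close> into a boundary crossing event.\<close>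

definition rs_tail :: "real \<Rightarrow> real" where
  "rs_tail a = 2 * (1 - cdf std_normal_distribution a + a * std_normal_density a)"

interpretation normal: real_distribution std_normal_distribution
  by (rule real_dist_normal_dist)

lemma integral_std_normal:
  fixes f :: "real \<Rightarrow> real"
  assumes "f \<in> borel_measurable borel"
  shows "(\<integral>x. f x \<partial>std_normal_distribution) = (\<integral>x. std_normal_density x * f x \<partial>lborel)"
  using assms by (subst integral_real_density) auto

lemma std_normal_density_deriv:
  "(std_normal_density has_real_derivative - x * std_normal_density x) (at x)"
proof -
  have "((\<lambda>x. 1 / sqrt (2 * pi) * exp (- x\<^sup>2 / 2)) has_real_derivative
      1 / sqrt (2 * pi) * (exp (- x\<^sup>2 / 2) * (- (2 * x) / 2))) (at x)"
    by (intro DERIV_cmult) (auto intro!: derivative_eq_intros)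
  then show ?thesis by (simp add: std_normal_density_def[abs_def] mult_ac)
qed

lemma cdf_std_normal_deriv:
  "(cdf std_normal_distribution has_real_derivative std_normal_density x) (at x)"
proof -
  let ?\<phi> = "std_normal_density"
  have cont: "continuous_on A ?\<phi>" for A
    by (intro continuous_at_imp_continuous_on ballI DERIV_isCont[OF std_normal_density_deriv])
  have cdf: "cdf std_normal_distribution u = cdf std_normal_distribution (x - 1) + integral {x - 1..u} ?\<phi>"
    if "x - 1 \<le> u" for u
  proof -
    have "cdf std_normal_distribution u - cdf std_normal_distribution (x - 1) = measure std_normal_distribution {x - 1<..u}"
    proof (cases "x - 1 < u")
      case True then show ?thesis by (rule normal.cdf_diff_eq)
    qed (use that in simp)
    also have "\<dots> = (\<integral>y. indicator {x - 1<..u} y \<partial>std_normal_distribution)" by simp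
    also have "\<dots> = (\<integral>y. ?\<phi> y * indicator {x - 1<..u} y \<partial>lborel)" by (rule integral_std_normal) simp
    also have "\<dots> = (LINT y:{x - 1..u}|lborel. ?\<phi> y)"
      unfolding set_lebesgue_integral_def
    proof (intro integral_cong_AE)
      show "AE y in lborel. ?\<phi> y * indicator {x - 1<..u} y = indicator {x - 1..u} y *\<^sub>R ?\<phi> y"
        using AE_lborel_singleton[of "x - 1"] by eventually_elim (auto simp: indicator_def)
    qed measurable
    also have "\<dots> = integral {x - 1..u} ?\<phi>"
      by (intro set_borel_integral_eq_integral borel_integrable_atLeastAtMost')
         (rule cont)
    finally show ?thesis by simp
  qed
  have "((\<lambda>u. integral {x - 1..u} ?\<phi>) has_real_derivative ?\<phi> x) (at x within {x - 1..x + 1})"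
    by (rule integral_has_real_derivative[OF cont]) auto
  then have "((\<lambda>u. cdf std_normal_distribution (x - 1) + integral {x - 1..u} ?\<phi>) has_real_derivative ?\<phi> x) (at x within {x - 1..x + 1})"
    by (auto intro!: derivative_eq_intros)
  then have "(cdf std_normal_distribution has_real_derivative ?\<phi> x) (at x within {x - 1..x + 1})"
    by (rule has_field_derivative_transform_within[OF _ zero_less_one]) (auto intro!: cdf[symmetric])
  then show ?thesis by (simp add: at_within_Icc_at)
qed

text \<open>The first order terms of \<open>\<Phi>\<close> and of \<open>a * \<phi> a\<close> cancel because \<open>\<phi>' x = - x * \<phi> x\<close>; what is left has a sign.\<close>

lemma rs_tail_deriv:
  "(rs_tail has_real_derivative - (2 * x\<^sup>2 * std_normal_density x)) (at x)"
proof -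
  have "((\<lambda>a. 2 * (1 - cdf std_normal_distribution a + a * std_normal_density a)) has_real_derivative
      2 * (0 - std_normal_density x + (1 * std_normal_density x + (- x * std_normal_density x) * x))) (at x)"
    by (intro DERIV_cmult DERIV_add DERIV_diff DERIV_const DERIV_mult DERIV_ident cdf_std_normal_deriv std_normal_density_deriv)
  then show ?thesis unfolding rs_tail_def[abs_def] by (simp add: power2_eq_square algebra_simps)
qed

lemma rs_tail_isCont: "isCont rs_tail x"
  by (rule DERIV_isCont[OF rs_tail_deriv])

lemma rs_tail_strict_antimono:
  assumes "0 \<le> a" "a < b"
  shows "rs_tail b < rs_tail a"
proof (rule DERIV_neg_imp_decreasing_open[OF assms(2)])
  fix x assume "a < x" "x < b"
  then have "0 < 2 * x\<^sup>2 * std_normal_density x"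
    using assms normal_density_pos[of 1 0 x] by (intro mult_pos_pos) auto
  then show "\<exists>y. (rs_tail has_real_derivative y) (at x) \<and> y < 0"
    using rs_tail_deriv[of x] by (intro exI[of _ "- (2 * x\<^sup>2 * std_normal_density x)"]) simp
qed (auto intro: continuous_at_imp_continuous_on rs_tail_isCont)

lemma std_normal_two_sided:
  assumes "0 \<le> a"
  shows "measure std_normal_distribution {x. a \<le> \<bar>x\<bar>} = 2 * (1 - cdf std_normal_distribution a)"
proof -
  let ?N = "std_normal_distribution"
  have pt: "measure ?N {x} = 0" for x
  proof -
    have "measure ?N {x} = (\<integral>y. indicator {x} y \<partial>?N)" by simp
    also have "\<dots> = (\<integral>y. std_normal_density y * indicator {x} y \<partial>lborel)" by (rule integral_std_normal) simp
    also have "\<dots> = (\<integral>y. 0 \<partial>(lborel :: real measure))"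
    proof (intro integral_cong_AE)
      show "AE y in lborel. std_normal_density y * indicator {x} y = 0"
        using AE_lborel_singleton[of x] by eventually_elim (auto simp: indicator_def)
    qed measurable
    finally show ?thesis by simp
  qed
  have up: "measure ?N {a..} = 1 - cdf ?N a"
  proof -
    have "measure ?N ({a} \<union> {a<..}) = measure ?N {a} + measure ?N {a<..}"
      by (intro normal.finite_measure_Union) auto
    moreover have "{a} \<union> {a<..} = {a..}" by auto
    moreover have "measure ?N (space ?N - {..a}) = 1 - measure ?N {..a}" by (intro normal.prob_compl) auto
    moreover have "space ?N - {..a} = {a<..}" by auto
    ultimately show ?thesis using pt by (simp add: cdf_def)
  qed
  have "measure ?N {..-a} = (\<integral>y. indicator {..-a} y \<partial>?N)" by simp
  also have "\<dots> = (\<integral>y. std_normal_density y * indicator {..-a} y \<partial>lborel)" by (rule integral_std_normal) simp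
  also have "\<dots> = (\<integral>y. std_normal_density (- y) * indicator {..-a} (- y) \<partial>lborel)"
    using lborel_integral_real_affine[of "-1" "\<lambda>y. std_normal_density y * indicator {..-a} y" 0] by simp
  also have "\<dots> = (\<integral>y. std_normal_density y * indicator {a..} y \<partial>lborel)"
    by (intro Bochner_Integration.integral_cong) (auto simp: std_normal_density_def indicator_def)
  also have "\<dots> = (\<integral>y. indicator {a..} y \<partial>?N)" by (rule integral_std_normal[symmetric]) simp
  also have "\<dots> = measure ?N {a..}" by simp
  finally have lo: "measure ?N {..-a} = measure ?N {a..}" .
  show ?thesis
  proof (cases "a = 0")
    case True
    have "measure ?N {..0} + measure ?N {0..} \<ge> measure ?N ({..0} \<union> {0..})"
      by (intro measure_Un_le) auto
    moreover have "{..0} \<union> {0..} = (UNIV :: real set)" by auto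
    moreover have "measure ?N {..0} = cdf ?N 0" by (simp add: cdf_def)
    ultimately show ?thesis using lo up True normal.prob_space by simp
  next
    case False
    have "measure ?N ({..-a} \<union> {a..}) = measure ?N {..-a} + measure ?N {a..}"
      using assms False by (intro normal.finite_measure_Union) auto
    moreover have "{..-a} \<union> {a..} = {x. a \<le> \<bar>x\<bar>}" using assms by auto
    ultimately show ?thesis using lo up by simp
  qed
qed

lemma rs_tail_0: "rs_tail 0 = 1"
proof -
  have "{x::real. 0 \<le> \<bar>x\<bar>} = UNIV" by auto
  then show ?thesis using std_normal_two_sided[of 0] normal.prob_space unfolding rs_tail_def by simp
qed

lemma rs_tail_at_top: "(rs_tail \<longlongrightarrow> 0) at_top"
proof -
  have "((\<lambda>a. a * std_normal_density a) \<longlongrightarrow> 0) at_top"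
    unfolding std_normal_density_def by real_asymp
  then have "(rs_tail \<longlongrightarrow> 2 * (1 - 1 + 0)) at_top"
    unfolding rs_tail_def[abs_def] by (intro tendsto_intros normal.cdf_lim_at_top_prob)
  then show ?thesis by simp
qed

lemma rs_tail_surj:
  assumes "0 < \<alpha>" "\<alpha> < 1"
  obtains a where "0 < a" "rs_tail a = \<alpha>"
proof -
  have "eventually (\<lambda>b. rs_tail b < \<alpha> \<and> 0 \<le> b) at_top"
    using order_tendstoD(2)[OF rs_tail_at_top \<open>0 < \<alpha>\<close>] eventually_ge_at_top[of 0] by eventually_elim auto
  then obtain b where b: "rs_tail b < \<alpha>" "0 \<le> b" by (auto dest: eventually_happens)
  obtain a where a: "0 \<le> a" "a \<le> b" "rs_tail a = \<alpha>"
    using IVT2[of rs_tail b \<alpha> 0] b assms rs_tail_0 rs_tail_isCont by auto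
  then have "a \<noteq> 0" using rs_tail_0 assms by auto
  with a(1) have "0 < a" by simp
  from that[OF this a(3)] show ?thesis .
qed

text \<open>Where the argument of the distribution function is negative the p-value is \<open>1\<close>, which exceeds every level \<open>rs_tail a\<close>
  with \<open>a > 0\<close>; elsewhere \<open>rs_tail\<close> is strictly decreasing.\<close>

lemma gcm_pvalue_le_iff:
  assumes "0 < a"
  shows "gcm_pvalue R k m \<omega> \<le> rs_tail a \<longleftrightarrow> a\<^sup>2 \<le> real k * (gcm_stat R k \<omega>)\<^sup>2 - ln (real k / real m)"
proof -
  define y where "y = real k * (gcm_stat R k \<omega>)\<^sup>2 - ln (real k / real m)"
  have p: "gcm_pvalue R k m \<omega> = (if 0 \<le> y then rs_tail (sqrt y) else 1)"
    unfolding gcm_pvalue_def robbins_siegmund_cdf_def y_def rs_tail_def by simp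
  have "rs_tail a < 1" using rs_tail_strict_antimono[of 0 a] assms rs_tail_0 by simp
  moreover have "rs_tail (sqrt y) \<le> rs_tail a \<longleftrightarrow> a \<le> sqrt y" if "0 \<le> y"
    using rs_tail_strict_antimono[of a "sqrt y"] rs_tail_strict_antimono[of "sqrt y" a] assms that
    by (cases "a < sqrt y"; cases "a = sqrt y") auto
  moreover have "a \<le> sqrt y \<longleftrightarrow> a\<^sup>2 \<le> y" if "0 \<le> y"
    using assms that real_sqrt_le_iff[of "a\<^sup>2" y] by simp
  moreover have "\<not> a\<^sup>2 \<le> y" if "\<not> 0 \<le> y" using that zero_le_power2[of a] by linarith
  ultimately show ?thesis unfolding p y_def[symmetric] by auto
qed

section \<open>The central limit theorem for arrays of walks\<close>

text \<open>Interpolation between the two arguments of the minimum: for small \<open>\<bar>\<tau> x\<bar>\<close> the cubic one is used, for large \<open>\<bar>\<tau> x\<bar>\<close>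
  the quadratic one.\<close>

lemma min_moment_bound:
  fixes \<tau> x p :: real
  assumes p: "2 < p" "p \<le> 3"
  shows "min (6 * x\<^sup>2) (\<bar>\<tau>\<bar> * \<bar>x\<bar> ^ 3) \<le> 6 * \<bar>\<tau>\<bar> powr (p - 2) * \<bar>x\<bar> powr p"
proof (cases "x = 0 \<or> \<tau> = 0")
  case True
  then show ?thesis by auto
next
  case False
  define z where "z = \<bar>\<tau>\<bar> * \<bar>x\<bar>"
  have z: "0 < z" using False unfolding z_def by simp
  have xp: "\<bar>x\<bar> powr p = \<bar>x\<bar> powr (p - 2) * x\<^sup>2"
    using False powr_add[of "\<bar>x\<bar>" "p - 2" 2] by (simp add: powr_numeral)
  have eq: "6 * \<bar>\<tau>\<bar> powr (p - 2) * \<bar>x\<bar> powr p = 6 * (z powr (p - 2) * x\<^sup>2)"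
    unfolding z_def xp by (simp add: powr_mult)
  show ?thesis
  proof (cases "z \<le> 1")
    case True
    have "z powr 1 \<le> z powr (p - 2)" using z True p by (intro powr_mono') auto
    then have "z \<le> 6 * z powr (p - 2)" using z by simp
    then have "z * x\<^sup>2 \<le> 6 * z powr (p - 2) * x\<^sup>2" by (intro mult_right_mono) auto
    moreover have "\<bar>\<tau>\<bar> * \<bar>x\<bar> ^ 3 = z * x\<^sup>2"
      unfolding z_def by (simp add: power3_eq_cube power2_eq_square)
    ultimately show ?thesis unfolding eq by simp
  next
    case False
    then have "1 \<le> z powr (p - 2)" using p by (intro ge_one_powr_ge_zero) auto
    then have "1 * x\<^sup>2 \<le> z powr (p - 2) * x\<^sup>2" by (intro mult_right_mono) auto
    then show ?thesis unfolding eq by simp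
  qed
qed

text \<open>The law of the steps may change with \<open>m\<close>, so this is a statement about arrays. The error of the quadratic approximation of
  the characteristic function of one step is controlled by \<open>p\<close> and \<open>K\<close> alone.\<close>

lemma walk_clt:
  fixes P :: "nat \<Rightarrow> 'a measure"
  assumes walk: "\<And>m. std_walk (P m) (X m) p K"
  shows "weak_conv_m (\<lambda>m. distr (P m) borel (\<lambda>\<omega>. psum (X m) m \<omega> / sqrt (real m))) std_normal_distribution"
proof (rule levy_continuity)
  fix m
  interpret std_walk "P m" "X m" p K by (rule walk)
  show "real_distribution (distr (P m) borel (\<lambda>\<omega>. psum (X m) m \<omega> / sqrt (real m)))"
    by (intro real_distribution_distr) measurable
next
  fix t :: real
  have p: "2 < p" using std_walk.p(1)[OF walk] .
  define \<phi> where "\<phi> m = char (distr (P m) borel (\<lambda>\<omega>. psum (X m) m \<omega> / sqrt (real m))) t" for m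
  have main: "\<forall>\<^sub>F m in sequentially. cmod (\<phi> m - (1 + (-(t^2) / 2) / m)^m)
      \<le> t\<^sup>2 * K * \<bar>t / sqrt (real m)\<bar> powr (p - 2)"
  proof (rule eventually_sequentiallyI)
    fix m :: nat
    assume "m \<ge> max 1 (nat (ceiling (t^2 / 4)))"
    then have m: "1 \<le> m" "t\<^sup>2 / 4 \<le> real m" by (auto simp: nat_ceiling_le_eq)
    interpret std_walk "P m" "X m" p K by (rule walk)
    let ?t = "t / sqrt (real m)"
    define \<psi> where "\<psi> = char (distr (P m) borel (X m 1)) ?t"
    have ch: "char (distr (P m) borel (\<lambda>\<omega>. X m i \<omega> / sqrt (real m))) t = \<psi>" if i: "i \<in> {1..m}" for i
    proof -
      have [measurable]: "X m i \<in> borel_measurable (P m)" using i by auto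
      have "char (distr (P m) borel (\<lambda>\<omega>. X m i \<omega> / sqrt (real m))) t = char (distr (P m) borel (X m i)) ?t"
        unfolding char_def by (simp add: integral_distr)
      also have "distr (P m) borel (X m i) = distr (P m) borel (X m 1)" using i by (intro ident) auto
      finally show ?thesis unfolding \<psi>_def .
    qed
    have "\<phi> m = char (distr (P m) borel (\<lambda>\<omega>. \<Sum>i\<in>{1..m}. X m i \<omega> / sqrt (real m))) t"
      unfolding \<phi>_def psum_def sum_divide_distrib ..
    also have "\<dots> = (\<Prod>i\<in>{1..m}. char (distr (P m) borel (\<lambda>\<omega>. X m i \<omega> / sqrt (real m))) t)"
    proof (rule char_distr_sum)
      have "indep_vars (\<lambda>_. borel) (X m) {1..m}" by (rule indep_vars_subset[OF indep]) auto
      then show "indep_vars (\<lambda>_. borel) (\<lambda>i \<omega>. X m i \<omega> / sqrt (real m)) {1..m}"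
        by (rule indep_vars_compose2) auto
    qed
    also have "\<dots> = \<psi> ^ m" using ch by simp
    finally have \<phi>_eq: "\<phi> m = \<psi> ^ m" .
    have var: "variance (X m 1) = 1" using mean_1 second_moment_1 by simp
    have "cmod (\<psi> - (1 - ?t\<^sup>2 * 1 / 2)) \<le> ?t\<^sup>2 / 6 * expectation (\<lambda>\<omega>. min (6 * (X m 1 \<omega>)\<^sup>2) (\<bar>?t\<bar> * \<bar>X m 1 \<omega>\<bar> ^ 3))"
      unfolding \<psi>_def
      by (rule char_approx3'[OF _ _ _ mean_1 var refl]) (auto intro: X_integrable square_integrable)
    also have "\<dots> \<le> ?t\<^sup>2 / 6 * expectation (\<lambda>\<omega>. 6 * \<bar>?t\<bar> powr (p - 2) * \<bar>X m 1 \<omega>\<bar> powr p)"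
    proof (intro mult_left_mono integral_mono min_moment_bound std_walk.p[OF walk])
      show "integrable (P m) (\<lambda>\<omega>. min (6 * (X m 1 \<omega>)\<^sup>2) (\<bar>?t\<bar> * \<bar>X m 1 \<omega>\<bar> ^ 3))"
        by (rule Bochner_Integration.integrable_bound[of _ "\<lambda>\<omega>. 6 * (X m 1 \<omega>)\<^sup>2"])
           (use square_integrable_1 in \<open>auto simp: abs_le_iff min_le_iff_disj\<close>)
      show "integrable (P m) (\<lambda>\<omega>. 6 * \<bar>?t\<bar> powr (p - 2) * \<bar>X m 1 \<omega>\<bar> powr p)"
        using moment_integrable_1 by auto
    qed auto
    also have "\<dots> = ?t\<^sup>2 * (\<bar>?t\<bar> powr (p - 2) * expectation (\<lambda>\<omega>. \<bar>X m 1 \<omega>\<bar> powr p))" by simp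
    also have "\<dots> \<le> ?t\<^sup>2 * (\<bar>?t\<bar> powr (p - 2) * K)" using moment_1 by (intro mult_left_mono) auto
    also have "?t\<^sup>2 = t\<^sup>2 / m" by (simp add: power_divide)
    finally have **: "cmod (\<psi> - (1 + (-(t^2) / 2) / m)) \<le> t\<^sup>2 / m * (\<bar>?t\<bar> powr (p - 2) * K)"
      by (simp add: mult_ac)
    have "norm (\<phi> m - (complex_of_real (1 + (-(t^2) / 2) / m))^m)
      \<le> m * norm (\<psi> - (complex_of_real (1 + (-(t^2) / 2) / m)))"
      unfolding \<phi>_eq
    proof (rule norm_power_diff)
      have "real_distribution (distr (P m) borel (X m 1))" by (intro real_distribution_distr) auto
      then show "cmod \<psi> \<le> 1" unfolding \<psi>_def by (rule real_distribution.cmod_char_le_1)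
      have "t\<^sup>2 \<le> 4 * real m" using m(2) by simp
      then have "\<bar>1 + (-(t^2) / 2) / m\<bar> \<le> 1"
        using m(1) by (intro abs_leI) (auto simp: field_simps)
      then show "cmod (complex_of_real (1 + (-(t^2) / 2) / m)) \<le> 1" by (simp only: norm_of_real)
    qed
    also have "\<dots> \<le> m * (t\<^sup>2 / m * (\<bar>?t\<bar> powr (p - 2) * K))"
      using ** by (intro mult_left_mono) auto
    also have "\<dots> = t\<^sup>2 * K * \<bar>?t\<bar> powr (p - 2)" using m by simp
    finally show "cmod (\<phi> m - (1 + (-(t^2) / 2) / m)^m) \<le> t\<^sup>2 * K * \<bar>?t\<bar> powr (p - 2)" by simp
  qed
  have "(\<lambda>m. \<bar>t / sqrt (real m)\<bar>) \<longlonglongrightarrow> 0"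
    by (intro tendsto_rabs_zero) real_asymp
  then have "(\<lambda>m. \<bar>t / sqrt (real m)\<bar> powr (p - 2)) \<longlonglongrightarrow> 0"
    using p by (intro tendsto_zero_powrI[where b="p - 2"] tendsto_const always_eventually) auto
  then have *: "(\<lambda>m. t\<^sup>2 * K * \<bar>t / sqrt (real m)\<bar> powr (p - 2)) \<longlonglongrightarrow> 0"
    by (rule tendsto_mult_right_zero)
  have "(\<lambda>n. complex_of_real ((1 + (-(t^2) / 2) / n)^n)) \<longlonglongrightarrow> complex_of_real (exp (-(t^2) / 2))"
    by (rule isCont_tendsto_compose [OF _ tendsto_exp_limit_sequentially]) auto
  then have "\<phi> \<longlonglongrightarrow> complex_of_real (exp (-(t^2) / 2))"
    by (rule Lim_transform) (rule Lim_null_comparison [OF main *])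
  then show "(\<lambda>m. char (distr (P m) borel (\<lambda>\<omega>. psum (X m) m \<omega> / sqrt (real m))) t) \<longlonglongrightarrow> char std_normal_distribution t"
    by (simp add: \<phi>_def[abs_def] char_std_normal_distribution)
qed (rule real_dist_normal_dist)

text \<open>The two quantities at time \<open>m\<close> from which the crossing probability is computed. Both are integrals of bounded functions of
  \<open>S m / sqrt m\<close> with discontinuities at \<open>- a\<close> and \<open>a\<close> only; in the second one the Gaussian density cancels the
  exponential, which leaves the length of the interval from \<open>- a\<close> to \<open>a\<close>.\<close>

lemma walk_start_limits:
  fixes P :: "nat \<Rightarrow> 'a measure"
  assumes walk: "\<And>m. std_walk (P m) (X m) p K" and a: "0 < a"
  shows "(\<lambda>m. measure (P m) {\<omega> \<in> space (P m). exp (a\<^sup>2 / 2) \<le> std_walk.U (X m) m m \<omega>})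
      \<longlonglongrightarrow> 2 * (1 - cdf std_normal_distribution a)"
    and "(\<lambda>m. \<integral>\<omega>. indicator {\<omega> \<in> space (P m). std_walk.U (X m) m m \<omega> < exp (a\<^sup>2 / 2)} \<omega> * std_walk.U (X m) m m \<omega> \<partial>P m)
      \<longlonglongrightarrow> 2 * a * std_normal_density a * exp (a\<^sup>2 / 2)"
proof -
  let ?\<mu> = "\<lambda>m. distr (P m) borel (\<lambda>\<omega>. psum (X m) m \<omega> / sqrt (real m))"
  let ?N = "std_normal_distribution"
  have rd: "real_distribution (?\<mu> m)" for m
  proof -
    interpret std_walk "P m" "X m" p K by (rule walk)
    show ?thesis by (intro real_distribution_distr) measurable
  qed
  have U: "std_walk.U (X m) m m \<omega> = exp ((psum (X m) m \<omega> / sqrt (real m))\<^sup>2 / 2)" if "1 \<le> m" for m \<omega>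
    using that unfolding std_walk.U_def[OF walk] heat_def by simp
  have null: "measure ?N {-a, a} = 0"
  proof -
    have "measure ?N {-a, a} = (\<integral>y. indicator {-a, a} y \<partial>?N)" by simp
    also have "\<dots> = (\<integral>y. std_normal_density y * indicator {-a, a} y \<partial>lborel)" by (rule integral_std_normal) simp
    also have "\<dots> = (\<integral>y. 0 \<partial>(lborel :: real measure))"
    proof (intro integral_cong_AE)
      show "AE y in lborel. std_normal_density y * indicator {-a, a} y = 0"
        using AE_lborel_singleton[of a] AE_lborel_singleton[of "- a"] by eventually_elim (auto simp: indicator_def)
    qed measurable
    finally show ?thesis by simp
  qed
  have conv: "(\<lambda>m. integral\<^sup>L (?\<mu> m) f) \<longlonglongrightarrow> integral\<^sup>L ?N f"
    if f: "f \<in> borel_measurable borel" "\<And>x. norm (f x) \<le> C" "\<And>x. x \<notin> {-a, a} \<Longrightarrow> isCont f x"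
    for f :: "real \<Rightarrow> real" and C
  proof (rule weak_conv_imp_bdd_ae_continuous_conv[OF rd real_dist_normal_dist walk_clt[OF walk]])
    have "{x. \<not> isCont f x} \<subseteq> {-a, a}" using f(3) by auto
    then have "emeasure ?N {x. \<not> isCont f x} \<le> emeasure ?N {-a, a}" by (intro emeasure_mono) auto
    also have "\<dots> = 0" using null by (simp add: normal.emeasure_eq_measure)
    finally show "emeasure ?N {x. \<not> isCont f x} = 0" by simp
  qed (use f in auto)
  have Bx: "exp (a\<^sup>2 / 2) \<le> exp (x\<^sup>2 / 2) \<longleftrightarrow> a \<le> \<bar>x\<bar>" for x :: real
    using a by (simp add: abs_le_square_iff[symmetric])
  have "(\<lambda>m. integral\<^sup>L (?\<mu> m) (indicator {x. a \<le> \<bar>x\<bar>} :: real \<Rightarrow> real)) \<longlonglongrightarrow> integral\<^sup>L ?N (indicator {x. a \<le> \<bar>x\<bar>})"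
  proof (rule conv[where C=1])
    fix x :: real assume x: "x \<notin> {-a, a}"
    have "frontier {x. a \<le> \<bar>x\<bar>} \<subseteq> {-a, a}"
    proof -
      have "{x. a \<le> \<bar>x\<bar>} = {..-a} \<union> {a..}" using a by auto
      moreover have "frontier ({..-a} \<union> {a..}) \<subseteq> frontier {..-a} \<union> frontier {a..}" by (rule frontier_Un_subset)
      ultimately show ?thesis by (auto simp: frontier_real_atMost frontier_def)
    qed
    then show "isCont (indicator {x. a \<le> \<bar>x\<bar>} :: real \<Rightarrow> real) x" using x by (subst isCont_indicator) auto
  qed (auto simp: indicator_def)
  then have lim1: "(\<lambda>m. measure (?\<mu> m) {x. a \<le> \<bar>x\<bar>}) \<longlonglongrightarrow> measure ?N {x. a \<le> \<bar>x\<bar>}"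
    by simp
  have ev1: "measure (?\<mu> m) {x. a \<le> \<bar>x\<bar>} = measure (P m) {\<omega> \<in> space (P m). exp (a\<^sup>2 / 2) \<le> std_walk.U (X m) m m \<omega>}"
    if "1 \<le> m" for m
  proof -
    interpret std_walk "P m" "X m" p K by (rule walk)
    show ?thesis unfolding U[OF that] Bx
      by (subst measure_distr) (auto intro!: arg_cong[where f=prob])
  qed
  have "(\<lambda>m. measure (P m) {\<omega> \<in> space (P m). exp (a\<^sup>2 / 2) \<le> std_walk.U (X m) m m \<omega>})
      \<longlonglongrightarrow> measure ?N {x. a \<le> \<bar>x\<bar>}"
    by (rule Lim_transform_eventually[OF lim1]) (use ev1 in \<open>auto intro!: eventually_sequentiallyI[of 1]\<close>)
  then show "(\<lambda>m. measure (P m) {\<omega> \<in> space (P m). exp (a\<^sup>2 / 2) \<le> std_walk.U (X m) m m \<omega>})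
      \<longlonglongrightarrow> 2 * (1 - cdf std_normal_distribution a)"
    using std_normal_two_sided[of a] a by simp
  define g where "g x = indicator {-a<..<a} x * exp (x\<^sup>2 / 2)" for x :: real
  have gm [measurable]: "g \<in> borel_measurable borel" unfolding g_def by measurable
  have "(\<lambda>m. integral\<^sup>L (?\<mu> m) g) \<longlonglongrightarrow> integral\<^sup>L ?N g"
  proof (rule conv[OF gm, where C="exp (a\<^sup>2 / 2)"])
    fix x :: real
    show "norm (g x) \<le> exp (a\<^sup>2 / 2)"
      using Bx[of x] by (cases "x \<in> {-a<..<a}") (auto simp: g_def)
    assume x: "x \<notin> {-a, a}"
    have "isCont (indicator {-a<..<a} :: real \<Rightarrow> real) x"
      using x a by (subst isCont_indicator) (auto simp: frontier_def)
    then show "isCont g x" unfolding g_def by (intro continuous_intros) auto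
  qed
  moreover have "integral\<^sup>L ?N g = 2 * a * std_normal_density a * exp (a\<^sup>2 / 2)"
  proof -
    have "integral\<^sup>L ?N g = (\<integral>x. std_normal_density x * g x \<partial>lborel)" by (rule integral_std_normal[OF gm])
    also have "\<dots> = (\<integral>x. (1 / sqrt (2 * pi)) * indicator {-a<..<a} x \<partial>lborel)"
      by (intro Bochner_Integration.integral_cong) (auto simp: g_def std_normal_density_def exp_add[symmetric] indicator_def)
    also have "\<dots> = (1 / sqrt (2 * pi)) * (2 * a)" using a by simp
    also have "\<dots> = 2 * a * std_normal_density a * exp (a\<^sup>2 / 2)"
      by (simp add: std_normal_density_def exp_add[symmetric])
    finally show ?thesis .
  qed
  ultimately have lim2: "(\<lambda>m. integral\<^sup>L (?\<mu> m) g) \<longlonglongrightarrow> 2 * a * std_normal_density a * exp (a\<^sup>2 / 2)" by simp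
  have ev2: "integral\<^sup>L (?\<mu> m) g = (\<integral>\<omega>. indicator {\<omega> \<in> space (P m). std_walk.U (X m) m m \<omega> < exp (a\<^sup>2 / 2)} \<omega> * std_walk.U (X m) m m \<omega> \<partial>P m)"
    if "1 \<le> m" for m
  proof -
    interpret std_walk "P m" "X m" p K by (rule walk)
    have "integral\<^sup>L (?\<mu> m) g = expectation (\<lambda>\<omega>. g (psum (X m) m \<omega> / sqrt (real m)))"
      by (rule integral_distr) auto
    also have "\<dots> = expectation (\<lambda>\<omega>. indicator {\<omega> \<in> space (P m). std_walk.U (X m) m m \<omega> < exp (a\<^sup>2 / 2)} \<omega> * std_walk.U (X m) m m \<omega>)"
    proof (intro Bochner_Integration.integral_cong refl)
      fix \<omega> assume w: "\<omega> \<in> space (P m)"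
      define x where "x = psum (X m) m \<omega> / sqrt (real m)"
      have "x \<in> {-a<..<a} \<longleftrightarrow> exp (x\<^sup>2 / 2) < exp (a\<^sup>2 / 2)"
        using Bx[of x] by (auto simp: not_le[symmetric])
      then show "g (psum (X m) m \<omega> / sqrt (real m)) = indicator {\<omega> \<in> space (P m). std_walk.U (X m) m m \<omega> < exp (a\<^sup>2 / 2)} \<omega> * std_walk.U (X m) m m \<omega>"
        unfolding g_def U[OF that] x_def[symmetric] using w by (simp add: indicator_def U[OF that] x_def)
    qed
    finally show ?thesis .
  qed
  show "(\<lambda>m. \<integral>\<omega>. indicator {\<omega> \<in> space (P m). std_walk.U (X m) m m \<omega> < exp (a\<^sup>2 / 2)} \<omega> * std_walk.U (X m) m m \<omega> \<partial>P m)
      \<longlonglongrightarrow> 2 * a * std_normal_density a * exp (a\<^sup>2 / 2)"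
    by (rule Lim_transform_eventually[OF lim2]) (use ev2 in \<open>auto intro!: eventually_sequentiallyI[of 1]\<close>)
qed

section \<open>Crossing limits, uniformly over arrays of walks\<close>

lemma step_errors_vanish:
  fixes p :: real
  assumes "2 < p"
  shows "(\<lambda>m. real m * real m powr (- (p / 2))) \<longlonglongrightarrow> 0"
proof -
  have "(\<lambda>m. real m powr (- (p / 2 - 1))) \<longlonglongrightarrow> 0"
    using assms by (intro tendsto_neg_powr filterlim_real_sequentially) auto
  moreover have "real m powr (- (p / 2 - 1)) = real m * real m powr (- (p / 2))" if "1 \<le> m" for m
    using that powr_add[of "real m" 1 "- (p / 2)"] by simp
  ultimately show ?thesis
    by (elim Lim_transform_eventually) (auto intro!: eventually_sequentiallyI[of 1])
qed

lemma total_error_vanishes: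
  fixes p K D c :: real
  assumes "2 < p" "1 \<le> T"
  shows "(\<lambda>m. real (T * m - m) * (D * (K * real m powr (- (p / 2)) + c / (real m)\<^sup>2))) \<longlonglongrightarrow> 0"
proof -
  have "(\<lambda>m. (real T - 1) * D * (K * (real m * real m powr (- (p / 2))) + c * (real m / (real m)\<^sup>2)))
      \<longlonglongrightarrow> (real T - 1) * D * (K * 0 + c * 0)"
    by (intro tendsto_intros step_errors_vanish assms) real_asymp
  moreover have "(\<lambda>m. real (T * m - m) * (D * (K * real m powr (- (p / 2)) + c / (real m)\<^sup>2)))
      = (\<lambda>m. (real T - 1) * D * (K * (real m * real m powr (- (p / 2))) + c * (real m / (real m)\<^sup>2)))"
    using assms(2) by (intro ext) (simp add: of_nat_diff algebra_simps)
  ultimately show ?thesis by (simp only: mult_zero_right add_0_right)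
qed

lemma (in std_walk) crossing_event:
  assumes "1 \<le> m"
  shows "{\<omega> \<in> space M. \<exists>k\<in>{m..n}. c \<le> (S k \<omega>)\<^sup>2 / real k - ln (real k / real m)}
    = {\<omega> \<in> space M. \<exists>k\<in>{m..n}. exp (c / 2) \<le> U m k \<omega>}"
  using assms U_ge_iff by auto

text \<open>The start contributes \<open>2 * (1 - \<Phi> a)\<close>, and the expectation of \<open>heat\<close> below the level, divided by \<open>exp (a\<^sup>2 / 2)\<close>,
  contributes \<open>2 * a * \<phi> a\<close>; the sum is \<open>rs_tail a\<close>.\<close>

lemma crossing_limsup:
  fixes P :: "nat \<Rightarrow> 'a measure"
  assumes walk: "\<And>m. std_walk (P m) (X m) p K" and a: "0 < a" and T: "1 \<le> T" and \<eta>: "0 < \<eta>"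
  shows "\<forall>\<^sub>F m in sequentially. measure (P m) {\<omega> \<in> space (P m). \<exists>k\<in>{m..T * m}.
      a\<^sup>2 \<le> (psum (X m) k \<omega>)\<^sup>2 / real k - ln (real k / real m)} \<le> rs_tail a + \<eta>"
proof -
  define B where "B = exp (a\<^sup>2 / 2)"
  define R where "R = sqrt (real T * (a\<^sup>2 + ln (real T)))"
  define C where "C = (4 * (R + 1) ^ 4 + 4) * exp ((R + 1)\<^sup>2 / 2)"
  define d where "d m = real (T * m - m) * (3 * C / 1 powr p * (K * real m powr (- (p / 2)) + 1 / (real m)\<^sup>2))" for m
  define s1 where "s1 m = measure (P m) {\<omega> \<in> space (P m). B \<le> std_walk.U (X m) m m \<omega>}" for m
  define s2 where "s2 m = (\<integral>\<omega>. indicator {\<omega> \<in> space (P m). std_walk.U (X m) m m \<omega> < B} \<omega> * std_walk.U (X m) m m \<omega> \<partial>P m)" for m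
  define r where "r m = real (T * m - m) * (K * real m powr (- (p / 2)) / 1 powr p)" for m
  have p: "2 < p" using std_walk.p(1)[OF walk] .
  have B0: "0 < B" unfolding B_def by simp
  have d0: "d \<longlonglongrightarrow> 0" unfolding d_def[abs_def] by (rule total_error_vanishes[OF p T])
  have r0: "r \<longlonglongrightarrow> 0"
    unfolding r_def[abs_def] using total_error_vanishes[OF p T, of 1 K 0] by simp
  have "(\<lambda>m. s1 m + (s2 m + d m) / B + r m) \<longlonglongrightarrow> 2 * (1 - cdf std_normal_distribution a)
      + (2 * a * std_normal_density a * B + 0) / B + 0"
    unfolding s1_def s2_def B_def
    by (intro tendsto_intros walk_start_limits[OF walk a] d0 r0) simp
  also have "2 * (1 - cdf std_normal_distribution a) + (2 * a * std_normal_density a * B + 0) / B + 0 = rs_tail a"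
    using B0 unfolding rs_tail_def by (simp add: algebra_simps)
  finally have "\<forall>\<^sub>F m in sequentially. s1 m + (s2 m + d m) / B + r m < rs_tail a + \<eta>"
    using \<eta> by (intro order_tendstoD) auto
  then show ?thesis using eventually_ge_at_top[of 1]
  proof eventually_elim
    case (elim m)
    interpret std_walk "P m" "X m" p K by (rule walk)
    have n: "m \<le> T * m" "real (T * m) \<le> real T * real m" using T by auto
    show ?case unfolding crossing_event[OF elim(2)]
      using crossing_bounds(1)[OF elim(2) n less_imp_le[OF a] zero_less_one order_refl R_def C_def B_def] elim(1)
      unfolding s1_def s2_def d_def r_def B_def by simp
  qed
qed

text \<open>First \<open>T\<close> is chosen so large that the surviving paths carry little mass of \<open>heat\<close>, and then the bound \<open>e\<close> on the steps
  so small that the overshoot over the level is negligible.\<close>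

lemma crossing_liminf:
  fixes P :: "nat \<Rightarrow> 'a measure"
  assumes walk: "\<And>m. std_walk (P m) (X m) p K" and a: "0 < a" and \<eta>: "0 < \<eta>"
  shows "\<exists>T\<ge>1. \<forall>\<^sub>F m in sequentially. rs_tail a - \<eta> \<le> measure (P m) {\<omega> \<in> space (P m). \<exists>k\<in>{m..T * m}.
      a\<^sup>2 \<le> (psum (X m) k \<omega>)\<^sup>2 / real k - ln (real k / real m)}"
proof -
  define B where "B = exp (a\<^sup>2 / 2)"
  have B0: "0 < B" unfolding B_def by simp
  have p: "2 < p" using std_walk.p(1)[OF walk] .
  define \<kappa> where "\<kappa> T = exp (- (ln (real T) / 4)) + B * (2 / ln (real T))" for T
  have "\<kappa> \<longlonglongrightarrow> 0" unfolding \<kappa>_def[abs_def] by real_asymp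
  then have "(\<lambda>T. \<kappa> T / B) \<longlonglongrightarrow> 0" by (rule tendsto_divide_zero)
  then have "\<forall>\<^sub>F T in sequentially. \<kappa> T / B < \<eta>" using \<eta> by (rule order_tendstoD)
  then have "\<forall>\<^sub>F T in sequentially. \<kappa> T / B < \<eta> \<and> 2 \<le> T" using eventually_ge_at_top[of 2] by eventually_elim auto
  then obtain T where T: "\<kappa> T / B < \<eta>" "2 \<le> T" by (auto dest: eventually_happens)
  define R where "R = sqrt (real T * (a\<^sup>2 + ln (real T)))"
  define C where "C = (4 * (R + 1) ^ 4 + 4) * exp ((R + 1)\<^sup>2 / 2)"
  have C0: "0 \<le> C" unfolding C_def by simp
  have rs: "rs_tail a = 2 * (1 - cdf std_normal_distribution a) + 2 * a * std_normal_density a * B / B"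
    using B0 unfolding rs_tail_def by (simp add: algebra_simps)
  let ?lim = "\<lambda>e. 2 * (1 - cdf std_normal_distribution a) + (2 * a * std_normal_density a * B - \<kappa> T - 0) / (B + 4 * C * (e + 0))"
  have "(?lim \<longlongrightarrow> ?lim 0) (at_right 0)"
    using B0 by (intro tendsto_intros) auto
  moreover have "rs_tail a - \<eta> < ?lim 0" using T(1) unfolding rs by (simp add: diff_divide_distrib)
  ultimately have "\<forall>\<^sub>F e in at_right 0. rs_tail a - \<eta> < ?lim e" by (rule order_tendstoD)
  then have "\<forall>\<^sub>F e in at_right 0. rs_tail a - \<eta> < ?lim e \<and> e \<in> {0<..<1}"
    using eventually_at_right_real[OF zero_less_one] by eventually_elim auto
  then obtain e where e: "rs_tail a - \<eta> < ?lim e" "0 < e" "e \<le> 1"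
    by (auto dest: eventually_happens)
  define d where "d m = real (T * m - m) * (3 * C / e powr p * (K * real m powr (- (p / 2)) + 1 / (real m)\<^sup>2))" for m
  define s1 where "s1 m = measure (P m) {\<omega> \<in> space (P m). B \<le> std_walk.U (X m) m m \<omega>}" for m
  define s2 where "s2 m = (\<integral>\<omega>. indicator {\<omega> \<in> space (P m). std_walk.U (X m) m m \<omega> < B} \<omega> * std_walk.U (X m) m m \<omega> \<partial>P m)" for m
  have d0: "d \<longlonglongrightarrow> 0" unfolding d_def[abs_def] using T(2) by (intro total_error_vanishes[OF p]) auto
  have BC: "B + 4 * C * (e + 0) \<noteq> 0"
  proof -
    have "0 < B + 4 * C * (e + 0)" using B0 C0 e by (intro add_pos_nonneg) auto
    then show ?thesis by simp
  qed
  have "(\<lambda>m. s1 m + (s2 m - \<kappa> T - d m) / (B + 4 * C * (e + 1 / real m))) \<longlonglongrightarrow> ?lim e"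
    unfolding s1_def s2_def unfolding B_def
    by (intro tendsto_intros walk_start_limits[OF walk a] d0 BC[unfolded B_def])
  then have "\<forall>\<^sub>F m in sequentially. rs_tail a - \<eta> < s1 m + (s2 m - \<kappa> T - d m) / (B + 4 * C * (e + 1 / real m))"
    using e(1) by (rule order_tendstoD)
  then have "\<forall>\<^sub>F m in sequentially. rs_tail a - \<eta> \<le> measure (P m) {\<omega> \<in> space (P m). \<exists>k\<in>{m..T * m}.
      a\<^sup>2 \<le> (psum (X m) k \<omega>)\<^sup>2 / real k - ln (real k / real m)}"
    using eventually_ge_at_top[of 1]
  proof eventually_elim
    case (elim m)
    interpret std_walk "P m" "X m" p K by (rule walk)
    have n: "m \<le> T * m" "real (T * m) \<le> real T * real m" using T by auto
    have pos: "0 < B + 4 * C * (e + 1 / real m)" using B0 C0 e by (intro add_pos_nonneg) auto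
    have "(s2 m - \<kappa> T - d m) / (B + 4 * C * (e + 1 / real m))
      \<le> (s2 m - expectation (\<lambda>\<omega>. indicator (Alive m e B (T * m)) \<omega> * U m (T * m) \<omega>) - d m) / (B + 4 * C * (e + 1 / real m))"
      using survivors[OF elim(2) T(2) B0, of e] pos unfolding \<kappa>_def by (intro divide_right_mono) auto
    then show ?case unfolding crossing_event[OF elim(2)]
      using crossing_bounds(2)[OF elim(2) n less_imp_le[OF a] e(2,3) R_def C_def B_def] elim(1)
      unfolding s1_def s2_def d_def B_def by simp
  qed
  then show ?thesis using T(2) by (intro exI[of _ T]) auto
qed

text \<open>The threshold \<open>T\<close> is the same for all walks with the same \<open>p\<close> and \<open>K\<close> because the bound is the tail of a fixed
  convergent series. It is at least \<open>3\<close> so that \<open>ln T \<ge> 1\<close>.\<close>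

lemma far_tail_uniform:
  assumes p: "2 < p" and c: "0 < c" and \<eta>: "0 < \<eta>"
  shows "\<exists>T\<ge>3. \<forall>m\<ge>1. \<forall>(M :: 'a measure) X. std_walk M X p K \<longrightarrow>
    measure M {\<omega> \<in> space M. \<exists>k\<ge>T * m. c * real k * ln (real k / real m) \<le> (psum X k \<omega>)\<^sup>2} \<le> \<eta>"
proof -
  define b where "b j = 2 * (19 + 6 * K) * (8 / (c * ln 2)) powr (p / 2) * real j powr (- (p / 2))" for j :: nat
  have "summable b" unfolding b_def using p by (intro summable_mult) (simp add: summable_real_powr_iff)
  from suminf_exist_split[OF \<eta> this] obtain N where N: "\<And>n. n \<ge> N \<Longrightarrow> norm (\<Sum>i. b (i + n)) < \<eta>" by auto
  define J where "J = max (max 2 N) (nat \<lceil>16 / (c * ln 2)\<rceil>)"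
  have J: "1 \<le> J" "2 \<le> J" "16 / (c * ln 2) \<le> real J" "N \<le> J" unfolding J_def by linarith+
  have "(3::nat) \<le> 2 ^ 2" by simp
  also have "\<dots> \<le> 2 ^ J" using J(2) by (intro power_increasing) auto
  finally have "3 \<le> (2::nat) ^ J" .
  moreover have "measure M {\<omega> \<in> space M. \<exists>k\<ge>2 ^ J * m. c * real k * ln (real k / real m) \<le> (psum X k \<omega>)\<^sup>2} \<le> \<eta>"
    if "1 \<le> m" "std_walk M X p K" for m and M :: "'a measure" and X
  proof -
    interpret std_walk M X p K by fact
    have "prob {\<omega> \<in> space M. \<exists>k\<ge>2 ^ J * m. c * real k * ln (real k / real m) \<le> (S k \<omega>)\<^sup>2} \<le> (\<Sum>j. b (j + J))"
      using far_tail[OF c that(1) J(1,3)] unfolding b_def by simp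
    also have "\<dots> \<le> \<eta>" using N[OF J(4)] by simp
    finally show ?thesis .
  qed
  ultimately show ?thesis by (intro exI[of _ "2 ^ J"]) auto
qed

section \<open>Stability under perturbation of the walk\<close>

lemma sqrt_gap:
  assumes "0 \<le> b" "b < a" "0 \<le> L" "L \<le> N"
  shows "(a\<^sup>2 - b\<^sup>2) / (2 * sqrt (a\<^sup>2 + N)) \<le> sqrt (a\<^sup>2 + L) - sqrt (b\<^sup>2 + L)"
proof -
  define x where "x = sqrt (a\<^sup>2 + L)"
  define y where "y = sqrt (b\<^sup>2 + L)"
  have ab: "b\<^sup>2 < a\<^sup>2" using assms by (intro power_strict_mono) auto
  have a2: "0 < a\<^sup>2" using ab zero_le_power2[of b] by linarith
  have xy: "0 < x" "0 \<le> y" "y \<le> x" "x \<le> sqrt (a\<^sup>2 + N)" unfolding x_def y_def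
    using add_pos_nonneg[OF a2 assms(3)] ab assms by auto
  have "x\<^sup>2 - y\<^sup>2 = a\<^sup>2 - b\<^sup>2" unfolding x_def y_def using assms by simp
  then have "a\<^sup>2 - b\<^sup>2 = (x - y) * (x + y)" by (simp add: power2_eq_square algebra_simps)
  also have "\<dots> \<le> (x - y) * (2 * sqrt (a\<^sup>2 + N))" using xy by (intro mult_left_mono) auto
  finally have "a\<^sup>2 - b\<^sup>2 \<le> (x - y) * (2 * sqrt (a\<^sup>2 + N))" .
  moreover have "0 < 2 * sqrt (a\<^sup>2 + N)" using xy by linarith
  ultimately show ?thesis unfolding x_def[symmetric] y_def[symmetric] by (simp only: pos_divide_le_eq)
qed

text \<open>With \<open>s = S k / sqrt k\<close>, \<open>r\<close> the same quantity for the perturbed walk, \<open>v\<close> its sample variance and \<open>L = ln (k / m)\<close>: a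
  crossing of the perturbed statistic is a crossing of \<open>s\<close> at the lower level \<open>b\<close> when \<open>L\<close> is bounded by \<open>N\<close>, and a crossing of
  half the boundary in any case. The room between the levels is measured by \<open>sqrt_gap\<close>.\<close>

lemma upward_perturbation:
  assumes b: "0 < b" "b < a" and N: "0 \<le> N" and L: "0 \<le> L" and \<epsilon>: "0 < \<epsilon>" "\<epsilon> \<le> 1 / 4"
    and small: "\<epsilon> * (sqrt (a\<^sup>2 + N) + 1) \<le> (a\<^sup>2 - b\<^sup>2) / (2 * sqrt (a\<^sup>2 + N))"
    and r: "v * (a\<^sup>2 + L) \<le> r\<^sup>2" and v: "\<bar>v - 1\<bar> \<le> \<epsilon>" and s: "\<bar>r - s\<bar> \<le> \<epsilon>"
  shows "L \<le> N \<Longrightarrow> b\<^sup>2 + L \<le> s\<^sup>2" and "1 \<le> L \<Longrightarrow> L / 4 \<le> s\<^sup>2"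
proof -
  define q where "q = sqrt (a\<^sup>2 + L)"
  have q0: "0 \<le> q" and q2: "q\<^sup>2 = a\<^sup>2 + L" unfolding q_def using L by auto
  have "((1 - \<epsilon>) * q)\<^sup>2 = ((1 - \<epsilon>) * (1 - \<epsilon>)) * q\<^sup>2" by (simp add: power2_eq_square)
  also have "\<dots> \<le> (1 * v) * q\<^sup>2" using \<epsilon> v by (intro mult_right_mono mult_mono) auto
  also have "\<dots> \<le> r\<^sup>2" using r unfolding q2 by simp
  finally have "(1 - \<epsilon>) * q \<le> \<bar>r\<bar>" using \<epsilon> q0 by (simp add: abs_le_square_iff[symmetric])
  then have sq: "q - \<epsilon> * q - \<epsilon> \<le> \<bar>s\<bar>" using s by (simp add: algebra_simps)
  show "b\<^sup>2 + L \<le> s\<^sup>2" if LN: "L \<le> N"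
  proof -
    have "q \<le> sqrt (a\<^sup>2 + N)" unfolding q_def using LN by simp
    then have "\<epsilon> * (q + 1) \<le> \<epsilon> * (sqrt (a\<^sup>2 + N) + 1)" using \<epsilon> by simp
    also note small
    also have "(a\<^sup>2 - b\<^sup>2) / (2 * sqrt (a\<^sup>2 + N)) \<le> q - sqrt (b\<^sup>2 + L)"
      unfolding q_def using b L LN by (intro sqrt_gap) auto
    finally have "sqrt (b\<^sup>2 + L) \<le> \<bar>s\<bar>" using sq by (simp add: algebra_simps)
    then have "(sqrt (b\<^sup>2 + L))\<^sup>2 \<le> \<bar>s\<bar>\<^sup>2" using L by (intro power_mono) auto
    then show ?thesis using L by simp
  qed
  show "L / 4 \<le> s\<^sup>2" if L1: "1 \<le> L"
  proof -
    have "1 \<le> q" unfolding q_def using add_mono[OF zero_le_power2[of a] L1] by simp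
    have "\<epsilon> * q \<le> q / 4" "\<epsilon> \<le> q / 4" using \<epsilon> \<open>1 \<le> q\<close> q0 mult_right_mono[OF \<epsilon>(2) q0] by auto
    then have "q / 2 \<le> \<bar>s\<bar>" using sq by linarith
    then have "(q / 2)\<^sup>2 \<le> \<bar>s\<bar>\<^sup>2" using q0 by (intro power_mono) auto
    then have "q\<^sup>2 / 4 \<le> s\<^sup>2" by (simp add: power_divide)
    then show ?thesis unfolding q2 using zero_le_power2[of a] by argo
  qed
qed

lemma downward_perturbation:
  assumes a: "0 < a" "a < b" and L: "0 \<le> L" "L \<le> N" and \<epsilon>: "0 < \<epsilon>"
    and small: "\<epsilon> * (sqrt (b\<^sup>2 + N) + 1) \<le> (b\<^sup>2 - a\<^sup>2) / (2 * sqrt (b\<^sup>2 + N))"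
    and s: "b\<^sup>2 + L \<le> s\<^sup>2" and v: "\<bar>v - 1\<bar> \<le> \<epsilon>" and rs: "\<bar>r - s\<bar> \<le> \<epsilon>"
  shows "v * (a\<^sup>2 + L) \<le> r\<^sup>2"
proof -
  define q where "q = sqrt (a\<^sup>2 + L)"
  have q0: "0 \<le> q" and q2: "q\<^sup>2 = a\<^sup>2 + L" unfolding q_def using L by auto
  have "q \<le> sqrt (b\<^sup>2 + N)" unfolding q_def
  proof (intro real_sqrt_le_mono add_mono L(2))
    show "a\<^sup>2 \<le> b\<^sup>2" using a by (intro power_mono) auto
  qed
  then have "\<epsilon> * (q + 1) \<le> \<epsilon> * (sqrt (b\<^sup>2 + N) + 1)" using \<epsilon> by simp
  also note small
  also have "(b\<^sup>2 - a\<^sup>2) / (2 * sqrt (b\<^sup>2 + N)) \<le> sqrt (b\<^sup>2 + L) - q"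
    unfolding q_def using a L by (intro sqrt_gap) auto
  also have "sqrt (b\<^sup>2 + L) \<le> \<bar>s\<bar>" using real_sqrt_le_mono[OF s] by simp
  finally have "(1 + \<epsilon>) * q \<le> \<bar>r\<bar>" using rs by (simp add: algebra_simps)
  then have "((1 + \<epsilon>) * q)\<^sup>2 \<le> \<bar>r\<bar>\<^sup>2" using \<epsilon> q0 by (intro power_mono) auto
  moreover have "v * q\<^sup>2 \<le> (1 + \<epsilon>)\<^sup>2 * q\<^sup>2"
  proof (intro mult_right_mono)
    have "1 + \<epsilon> \<le> (1 + \<epsilon>)\<^sup>2" using \<epsilon> by (simp add: power2_eq_square algebra_simps)
    then show "v \<le> (1 + \<epsilon>)\<^sup>2" using v by linarith
  qed simp
  ultimately show ?thesis unfolding q2[symmetric] by (simp add: power_mult_distrib)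
qed

lemma gcm_square:
  assumes "0 < sample_variance R k \<omega>" "1 \<le> k"
  shows "real k * (gcm_stat R k \<omega>)\<^sup>2 = (psum R k \<omega> / sqrt (real k))\<^sup>2 / sample_variance R k \<omega>"
  using assms unfolding gcm_stat_def psum_def[symmetric]
  by (simp add: power_mult_distrib power_divide power2_eq_square)

lemma sample_variance_measurable:
  assumes "\<And>i. 1 \<le> i \<Longrightarrow> R i \<in> borel_measurable M"
  shows "(\<lambda>\<omega>. psum R k \<omega>) \<in> borel_measurable M" "(\<lambda>\<omega>. sample_variance R k \<omega>) \<in> borel_measurable M"
    "(\<lambda>\<omega>. gcm_stat R k \<omega>) \<in> borel_measurable M"
proof -
  have [measurable]: "(\<lambda>\<omega>. \<Sum>i=1..k. R i \<omega>) \<in> borel_measurable M" "(\<lambda>\<omega>. \<Sum>i=1..k. (R i \<omega>)\<^sup>2) \<in> borel_measurable M"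
    by (intro borel_measurable_sum borel_measurable_power assms; simp)+
  show v [measurable]: "(\<lambda>\<omega>. sample_variance R k \<omega>) \<in> borel_measurable M" unfolding sample_variance_def by measurable
  show "(\<lambda>\<omega>. psum R k \<omega>) \<in> borel_measurable M" unfolding psum_def by measurable
  show "(\<lambda>\<omega>. gcm_stat R k \<omega>) \<in> borel_measurable M" unfolding gcm_stat_def by measurable
qed

text \<open>On \<open>[m, T * m]\<close> the boundary is bounded and an error of size \<open>\<epsilon> * sqrt k\<close> only changes the level
  slightly; beyond \<open>T * m\<close> even half the boundary is crossed with small probability.\<close>

lemma perturbed_crossing_limit:
  fixes P :: "nat \<Rightarrow> 'a measure"
  assumes walk: "\<And>m. std_walk (P m) (X m) p K" and a: "0 < a"
    and R: "\<And>m i. 1 \<le> i \<Longrightarrow> R m i \<in> borel_measurable (P m)"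
    and close: "\<And>\<epsilon>. 0 < \<epsilon> \<Longrightarrow> (\<lambda>m. measure (P m) {\<omega> \<in> space (P m). \<exists>k\<ge>m.
      \<epsilon> * sqrt (real k) < \<bar>psum (R m) k \<omega> - psum (X m) k \<omega>\<bar> \<or> \<epsilon> < \<bar>sample_variance (R m) k \<omega> - 1\<bar>}) \<longlonglongrightarrow> 0"
  shows "(\<lambda>m. measure (P m) {\<omega> \<in> space (P m). \<exists>k\<ge>m.
      a\<^sup>2 \<le> real k * (gcm_stat (R m) k \<omega>)\<^sup>2 - ln (real k / real m)}) \<longlonglongrightarrow> rs_tail a"
proof -
  define E where "E m = {\<omega> \<in> space (P m). \<exists>k\<ge>m. a\<^sup>2 \<le> real k * (gcm_stat (R m) k \<omega>)\<^sup>2 - ln (real k / real m)}" for m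
  define bad where "bad \<epsilon> m = {\<omega> \<in> space (P m). \<exists>k\<ge>m.
      \<epsilon> * sqrt (real k) < \<bar>psum (R m) k \<omega> - psum (X m) k \<omega>\<bar> \<or> \<epsilon> < \<bar>sample_variance (R m) k \<omega> - 1\<bar>}" for \<epsilon> m
  define Cr where "Cr b T m = {\<omega> \<in> space (P m). \<exists>k\<in>{m..T * m}. b\<^sup>2 \<le> (psum (X m) k \<omega>)\<^sup>2 / real k - ln (real k / real m)}"
    for b T m
  define Far where "Far T m = {\<omega> \<in> space (P m). \<exists>k\<ge>T * m. (1 / 4) * real k * ln (real k / real m) \<le> (psum (X m) k \<omega>)\<^sup>2}"
    for T m
  note [measurable] = sample_variance_measurable[OF R]
  have [measurable]: "psum (X m) k \<in> borel_measurable (P m)" for m k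
    by (rule std_walk.S_measurable[OF walk])
  have [measurable]: "E m \<in> sets (P m)" "bad \<epsilon> m \<in> sets (P m)" "Cr b T m \<in> sets (P m)" "Far T m \<in> sets (P m)" for m \<epsilon> b T
    unfolding E_def bad_def Cr_def Far_def by measurable
  have p: "2 < p" using std_walk.p(1)[OF walk] .
  have good: "\<bar>psum (R m) k \<omega> / sqrt (real k) - psum (X m) k \<omega> / sqrt (real k)\<bar> \<le> \<epsilon>"
    "\<bar>sample_variance (R m) k \<omega> - 1\<bar> \<le> \<epsilon>"
    if "\<omega> \<in> space (P m)" "\<omega> \<notin> bad \<epsilon> m" "m \<le> k" "1 \<le> m" for m k \<omega> \<epsilon>
  proof -
    have "\<bar>psum (R m) k \<omega> - psum (X m) k \<omega>\<bar> \<le> \<epsilon> * sqrt (real k)" "\<bar>sample_variance (R m) k \<omega> - 1\<bar> \<le> \<epsilon>"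
      using that unfolding bad_def by (auto simp: not_less)
    then show "\<bar>psum (R m) k \<omega> / sqrt (real k) - psum (X m) k \<omega> / sqrt (real k)\<bar> \<le> \<epsilon>"
      "\<bar>sample_variance (R m) k \<omega> - 1\<bar> \<le> \<epsilon>"
      using that by (auto simp: diff_divide_distrib[symmetric] abs_divide divide_le_eq)
  qed
  have upper: "\<forall>\<^sub>F m in sequentially. measure (P m) (E m) < rs_tail a + \<eta>" if \<eta>: "0 < \<eta>" for \<eta>
  proof -
    have "(rs_tail \<longlongrightarrow> rs_tail a) (at_left a)"
      using rs_tail_isCont[of a] unfolding isCont_def by (rule filterlim_mono) (auto simp: at_le)
    then have "\<forall>\<^sub>F b in at_left a. rs_tail b < rs_tail a + \<eta> / 4" using \<eta> by (intro order_tendstoD) auto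
    then have "\<forall>\<^sub>F b in at_left a. rs_tail b < rs_tail a + \<eta> / 4 \<and> b \<in> {0<..<a}"
      using eventually_at_left_real[OF a] by eventually_elim auto
    then obtain b where b: "rs_tail b < rs_tail a + \<eta> / 4" "0 < b" "b < a" by (auto dest: eventually_happens)
    have "\<exists>T\<ge>3. \<forall>m\<ge>1. \<forall>(M :: 'a measure) X. std_walk M X p K \<longrightarrow>
      measure M {\<omega> \<in> space M. \<exists>k\<ge>T * m. (1 / 4) * real k * ln (real k / real m) \<le> (psum X k \<omega>)\<^sup>2} \<le> \<eta> / 4"
      using \<eta> by (intro far_tail_uniform p) auto
    then obtain T where T: "3 \<le> T" and far: "\<And>m. 1 \<le> m \<Longrightarrow> measure (P m) (Far T m) \<le> \<eta> / 4"
      unfolding Far_def using walk by blast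
    define N where "N = ln (real T)"
    have N1: "1 \<le> N"
    proof -
      have "exp 1 \<le> real T" using T exp_le by linarith
      then show ?thesis unfolding N_def using T by (subst ln_ge_iff) auto
    qed
    \<comment> \<open>Small enough to fit between the levels \<open>b\<close> and \<open>a\<close> on the whole range of \<open>L\<close> up to \<open>N\<close>.\<close>
    define \<epsilon> where "\<epsilon> = min (1 / 4) ((a\<^sup>2 - b\<^sup>2) / (2 * sqrt (a\<^sup>2 + N)) / (sqrt (a\<^sup>2 + N) + 1))"
    have q0: "0 < sqrt (a\<^sup>2 + N)" using add_nonneg_pos[OF zero_le_power2[of a], of N] N1 by simp
    have ab: "b\<^sup>2 < a\<^sup>2" using b by (intro power_strict_mono) auto
    have "0 < (a\<^sup>2 - b\<^sup>2) / (2 * sqrt (a\<^sup>2 + N)) / (sqrt (a\<^sup>2 + N) + 1)"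
      using ab by (intro divide_pos_pos add_pos_pos mult_pos_pos q0) auto
    then have \<epsilon>: "0 < \<epsilon>" "\<epsilon> \<le> 1 / 4"
      unfolding \<epsilon>_def by (simp_all only: min_less_iff_conj min.cobounded1) simp
    have "\<epsilon> \<le> (a\<^sup>2 - b\<^sup>2) / (2 * sqrt (a\<^sup>2 + N)) / (sqrt (a\<^sup>2 + N) + 1)" unfolding \<epsilon>_def by simp
    then have small: "\<epsilon> * (sqrt (a\<^sup>2 + N) + 1) \<le> (a\<^sup>2 - b\<^sup>2) / (2 * sqrt (a\<^sup>2 + N))"
      using add_pos_pos[OF q0 zero_less_one] by (simp only: pos_le_divide_eq)
    have "\<forall>\<^sub>F m in sequentially. measure (P m) (Cr b T m) \<le> rs_tail b + \<eta> / 4"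
      unfolding Cr_def using crossing_limsup[OF walk b(2), of T "\<eta> / 4"] T \<eta> by auto
    moreover have "\<forall>\<^sub>F m in sequentially. measure (P m) (bad \<epsilon> m) < \<eta> / 4"
      using close[OF \<epsilon>(1)] \<eta> unfolding bad_def by (intro order_tendstoD) auto
    ultimately show ?thesis using eventually_ge_at_top[of 1]
    proof eventually_elim
      case (elim m)
      interpret std_walk "P m" "X m" p K by (rule walk)
      have "E m \<subseteq> bad \<epsilon> m \<union> (Cr b T m \<union> Far T m)"
      proof
        fix \<omega> assume "\<omega> \<in> E m"
        then obtain k where w: "\<omega> \<in> space (P m)" and k: "m \<le> k"
          "a\<^sup>2 \<le> real k * (gcm_stat (R m) k \<omega>)\<^sup>2 - ln (real k / real m)" unfolding E_def by auto
        show "\<omega> \<in> bad \<epsilon> m \<union> (Cr b T m \<union> Far T m)"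
        proof (cases "\<omega> \<in> bad \<epsilon> m")
          case False
          define L where "L = ln (real k / real m)"
          define s where "s = psum (X m) k \<omega> / sqrt (real k)"
          define v where "v = sample_variance (R m) k \<omega>"
          have k1: "1 \<le> k" using k elim by linarith
          have L0: "0 \<le> L" unfolding L_def using k elim by simp
          note g = good[OF w False k(1) elim(3), folded s_def v_def]
          have v0: "0 < v" using g(2) \<epsilon> by linarith
          have "a\<^sup>2 + L \<le> (psum (R m) k \<omega> / sqrt (real k))\<^sup>2 / v"
            using k(2) gcm_square[of "R m" k \<omega>] v0 k1 unfolding v_def L_def by simp
          then have r: "v * (a\<^sup>2 + L) \<le> (psum (R m) k \<omega> / sqrt (real k))\<^sup>2"
            using v0 by (simp add: le_divide_eq mult.commute)
          have s2: "s\<^sup>2 = (psum (X m) k \<omega>)\<^sup>2 / real k" unfolding s_def by (simp add: power_divide)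
          have N0: "0 \<le> N" using N1 by simp
          note up = upward_perturbation[OF b(2,3) N0 L0 \<epsilon> small r g(2,1)]
          show ?thesis
          proof (cases "k \<le> T * m")
            case True
            then have "real k / real m \<le> real T" using elim(3) by (simp add: divide_le_eq flip: of_nat_mult)
            then have "L \<le> N" unfolding L_def N_def using k1 elim(3) by (intro ln_mono) auto
            then have "\<omega> \<in> Cr b T m" using up(1) True w k(1) unfolding Cr_def s2 L_def by force
            then show ?thesis by simp
          next
            case False
            then have "real T \<le> real k / real m" using elim(3) by (simp add: le_divide_eq flip: of_nat_mult)
            then have "N \<le> L" unfolding L_def N_def using T by (intro ln_mono) auto
            then have "L / 4 \<le> (psum (X m) k \<omega>)\<^sup>2 / real k" using up(2) N1 unfolding s2 by simp
            then have "(1 / 4) * real k * L \<le> (psum (X m) k \<omega>)\<^sup>2"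
              using k1 by (simp add: le_divide_eq algebra_simps)
            then have "\<omega> \<in> Far T m" using False w unfolding Far_def L_def by (auto intro!: exI[of _ k])
            then show ?thesis by simp
          qed
        qed simp
      qed
      then have "prob (E m) \<le> prob (bad \<epsilon> m \<union> (Cr b T m \<union> Far T m))" by (intro finite_measure_mono) auto
      also have "\<dots> \<le> prob (bad \<epsilon> m) + (prob (Cr b T m) + prob (Far T m))"
        by (intro order_trans[OF measure_Un_le] add_left_mono measure_Un_le) auto
      finally show ?case using elim far[OF elim(3)] b(1) by linarith
    qed
  qed
  have lower: "\<forall>\<^sub>F m in sequentially. rs_tail a - \<eta> < measure (P m) (E m)" if \<eta>: "0 < \<eta>" for \<eta>
  proof -
    have "(rs_tail \<longlongrightarrow> rs_tail a) (at_right a)"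
      using rs_tail_isCont[of a] unfolding isCont_def by (rule filterlim_mono) (auto simp: at_le)
    then have "\<forall>\<^sub>F b in at_right a. rs_tail a - \<eta> / 4 < rs_tail b" using \<eta> by (intro order_tendstoD) auto
    then have "\<forall>\<^sub>F b in at_right a. rs_tail a - \<eta> / 4 < rs_tail b \<and> b \<in> {a<..<a + 1}"
      using eventually_at_right_real[OF less_add_one] by eventually_elim auto
    then obtain b where b: "rs_tail a - \<eta> / 4 < rs_tail b" "a < b" by (auto dest: eventually_happens)
    have b0: "0 < b" using a b by simp
    have "\<exists>T\<ge>1. \<forall>\<^sub>F m in sequentially. rs_tail b - \<eta> / 4 \<le> measure (P m) (Cr b T m)"
      unfolding Cr_def using \<eta> by (intro crossing_liminf[OF walk b0]) auto
    then obtain T where T: "1 \<le> T" and cr: "\<forall>\<^sub>F m in sequentially. rs_tail b - \<eta> / 4 \<le> measure (P m) (Cr b T m)"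
      by blast
    define N where "N = ln (real T)"
    have N0: "0 \<le> N" unfolding N_def using T by simp
    define \<epsilon> where "\<epsilon> = min (1 / 4) ((b\<^sup>2 - a\<^sup>2) / (2 * sqrt (b\<^sup>2 + N)) / (sqrt (b\<^sup>2 + N) + 1))"
    have ab: "a\<^sup>2 < b\<^sup>2" using a b by (intro power_strict_mono) auto
    have "0 < b\<^sup>2" using b0 by simp
    then have "0 < b\<^sup>2 + N" using N0 by linarith
    then have q0: "0 < sqrt (b\<^sup>2 + N)" by simp
    have "0 < (b\<^sup>2 - a\<^sup>2) / (2 * sqrt (b\<^sup>2 + N)) / (sqrt (b\<^sup>2 + N) + 1)"
      using ab by (intro divide_pos_pos add_pos_pos mult_pos_pos q0) auto
    then have \<epsilon>: "0 < \<epsilon>" "\<epsilon> \<le> 1 / 4"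
      unfolding \<epsilon>_def by (simp_all only: min_less_iff_conj min.cobounded1) simp
    have "\<epsilon> \<le> (b\<^sup>2 - a\<^sup>2) / (2 * sqrt (b\<^sup>2 + N)) / (sqrt (b\<^sup>2 + N) + 1)" unfolding \<epsilon>_def by simp
    then have small: "\<epsilon> * (sqrt (b\<^sup>2 + N) + 1) \<le> (b\<^sup>2 - a\<^sup>2) / (2 * sqrt (b\<^sup>2 + N))"
      using add_pos_pos[OF q0 zero_less_one] by (simp only: pos_le_divide_eq)
    have "\<forall>\<^sub>F m in sequentially. measure (P m) (bad \<epsilon> m) < \<eta> / 4"
      using close[OF \<epsilon>(1)] \<eta> unfolding bad_def by (intro order_tendstoD) auto
    with cr show ?thesis using eventually_ge_at_top[of 1]
    proof eventually_elim
      case (elim m)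
      interpret std_walk "P m" "X m" p K by (rule walk)
      have "Cr b T m \<subseteq> E m \<union> bad \<epsilon> m"
      proof
        fix \<omega> assume "\<omega> \<in> Cr b T m"
        then obtain k where w: "\<omega> \<in> space (P m)" and k: "m \<le> k" "k \<le> T * m"
          "b\<^sup>2 \<le> (psum (X m) k \<omega>)\<^sup>2 / real k - ln (real k / real m)" unfolding Cr_def by auto
        show "\<omega> \<in> E m \<union> bad \<epsilon> m"
        proof (cases "\<omega> \<in> bad \<epsilon> m")
          case False
          define L where "L = ln (real k / real m)"
          define s where "s = psum (X m) k \<omega> / sqrt (real k)"
          define v where "v = sample_variance (R m) k \<omega>"
          have k1: "1 \<le> k" using k elim by linarith
          have L0: "0 \<le> L" unfolding L_def using k elim by simp
          have "real k / real m \<le> real T" using elim(3) k(2) by (simp add: divide_le_eq flip: of_nat_mult)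
          then have LN: "L \<le> N" unfolding L_def N_def using k1 elim(3) by (intro ln_mono) auto
          note g = good[OF w False k(1) elim(3), folded s_def v_def]
          have v0: "0 < v" using g(2) \<epsilon> by linarith
          have s2: "b\<^sup>2 + L \<le> s\<^sup>2" using k(3) unfolding s_def L_def by (simp add: power_divide)
          have "v * (a\<^sup>2 + L) \<le> (psum (R m) k \<omega> / sqrt (real k))\<^sup>2"
            by (rule downward_perturbation[OF a b(2) L0 LN \<epsilon>(1) small s2 g(2,1)])
          then have "a\<^sup>2 + L \<le> (psum (R m) k \<omega> / sqrt (real k))\<^sup>2 / v"
            using v0 by (simp add: le_divide_eq mult.commute)
          then have "a\<^sup>2 \<le> real k * (gcm_stat (R m) k \<omega>)\<^sup>2 - L"
            using gcm_square[of "R m" k \<omega>] v0 k1 unfolding v_def by simp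
          then show ?thesis using w k(1) unfolding E_def L_def by auto
        qed simp
      qed
      then have "prob (Cr b T m) \<le> prob (E m \<union> bad \<epsilon> m)" by (intro finite_measure_mono) auto
      also have "\<dots> \<le> prob (E m) + prob (bad \<epsilon> m)" by (intro measure_Un_le) auto
      finally show ?case using elim b(1) \<eta> by linarith
    qed
  qed
  have "(\<lambda>m. measure (P m) (E m)) \<longlonglongrightarrow> rs_tail a"
  proof (rule order_tendstoI)
    fix y assume "y < rs_tail a"
    then show "\<forall>\<^sub>F m in sequentially. y < measure (P m) (E m)" using lower[of "rs_tail a - y"] by simp
  next
    fix y assume "rs_tail a < y"
    then show "\<forall>\<^sub>F m in sequentially. measure (P m) (E m) < y" using upper[of "y - rs_tail a"] by simp
  qed
  then show ?thesis unfolding E_def .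
qed

section \<open>Weighted series\<close>

text \<open>Each term tends to \<open>0\<close> and is dominated by the corresponding term of the convergent series without truncation.\<close>

lemma truncated_series_vanishes:
  fixes v w :: "nat \<Rightarrow> real"
  assumes v: "\<And>i. 0 \<le> v i" and w: "\<And>i. 1 \<le> i \<Longrightarrow> 0 < w i"
    and top: "filterlim w at_top sequentially" and sum: "summable (\<lambda>i. v i / w i)"
  shows "(\<lambda>m. \<Sum>i. if 1 \<le> i then ennreal (v i / max (w i) (w m)) else 0) \<longlonglongrightarrow> 0"
proof -
  define a where "a k n = (if 1 \<le> k then v k / max (w k) (w n) else 0)" for k n :: nat
  define b where "b k = (if 1 \<le> k then v k / w k else 0)" for k :: nat
  have b: "summable b"
    by (rule summable_cong[THEN iffD1, OF _ sum]) (auto simp: b_def intro!: eventually_sequentiallyI[of 1])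
  have ab: "0 \<le> a k n" "a k n \<le> b k" for k n
  proof -
    have pos: "0 < max (w k) (w n)" "0 < w k" if "1 \<le> k" using w[OF that] by auto
    show "0 \<le> a k n" unfolding a_def using v[of k] pos by auto
    show "a k n \<le> b k" unfolding a_def b_def using v[of k] pos by (auto intro!: divide_left_mono mult_pos_pos)
  qed
  have lim: "(\<lambda>n. a k n) \<longlonglongrightarrow> 0" for k
  proof (cases "1 \<le> k")
    case True
    have "filterlim (\<lambda>n. max (w k) (w n)) at_top sequentially"
      by (rule filterlim_at_top_mono[OF top]) simp
    then have "(\<lambda>n. v k / max (w k) (w n)) \<longlonglongrightarrow> 0"
      by (intro tendsto_divide_0[OF tendsto_const] filterlim_at_top_imp_at_infinity)
    then show ?thesis unfolding a_def using True by simp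
  qed (simp add: a_def)
  have "(\<lambda>n. suminf (\<lambda>k. a k n)) \<longlonglongrightarrow> suminf (\<lambda>k. 0)"
    by (rule tannerys_theorem[THEN conjunct2, THEN conjunct2, OF lim _ b])
       (use ab in \<open>auto intro!: always_eventually\<close>)
  then have "(\<lambda>n. ennreal (suminf (\<lambda>k. a k n))) \<longlonglongrightarrow> ennreal 0" by (intro tendsto_ennrealI) simp
  moreover have "ennreal (suminf (\<lambda>k. a k n)) = (\<Sum>i. if 1 \<le> i then ennreal (v i / max (w i) (w n)) else 0)" for n
  proof -
    have "summable (\<lambda>k. a k n)" by (rule summable_comparison_test'[OF b, of 0]) (use ab in auto)
    then have "ennreal (suminf (\<lambda>k. a k n)) = (\<Sum>k. ennreal (a k n))"
      using ab by (intro suminf_ennreal2[symmetric]) auto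
    also have "\<dots> = (\<Sum>i. if 1 \<le> i then ennreal (v i / max (w i) (w n)) else 0)"
      by (intro suminf_cong) (auto simp: a_def)
    finally show ?thesis .
  qed
  ultimately show ?thesis by simp
qed

lemma max_power2:
  fixes x y :: real
  assumes "0 \<le> x" "0 \<le> y"
  shows "(max x y)\<^sup>2 = max (x\<^sup>2) (y\<^sup>2)"
  using assms by (auto simp: max_def power2_le_iff_abs_le not_le intro: power_mono antisym dest: power_mono[of x y 2] power_mono[of y x 2])

lemma ennreal_bounds_vanish:
  fixes f :: "nat \<Rightarrow> real" and g :: "nat \<Rightarrow> ennreal"
  assumes "\<And>m. 0 \<le> f m" "\<And>m. 1 \<le> m \<Longrightarrow> ennreal (f m) \<le> g m" "g \<longlonglongrightarrow> 0"
  shows "f \<longlonglongrightarrow> 0"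
proof -
  have "(\<lambda>m. ennreal (f m)) \<longlonglongrightarrow> 0"
    by (rule tendsto_sandwich[OF _ _ tendsto_const assms(3)])
       (auto intro!: always_eventually eventually_sequentiallyI[of 1] assms(2))
  then show ?thesis using assms(1) by (simp flip: ennreal_0 add: tendsto_ennreal_iff)
qed

text \<open>The Bertrand series; the condensation test turns it into \<open>\<Sum> n powr (- r)\<close>.\<close>

lemma summable_bertrand:
  assumes "1 < r"
  shows "summable (\<lambda>n. 1 / (real n * ln (real n) powr r))"
proof -
  define f where "f n = 1 / (real n * (1 + ln (real n)) powr r)" for n :: nat
  have "summable f"
  proof (rule condensation_test[THEN iffD2])
    fix m :: nat assume m: "0 < m"
    define n where "n = Suc m"
    have mn: "0 < m" "m \<le> n" using m unfolding n_def by auto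
    then have "ln (real m) \<le> ln (real n)" "0 \<le> ln (real m)" by auto
    then have le: "real m * (1 + ln (real m)) powr r \<le> real n * (1 + ln (real n)) powr r"
      using mn assms by (intro mult_mono powr_mono2) auto
    have pos: "0 < real m * (1 + ln (real m)) powr r"
    proof -
      have "0 < 1 + ln (real m)" using \<open>0 \<le> ln (real m)\<close> by linarith
      then show ?thesis using mn by simp
    qed
    show "f (Suc m) \<le> f m" unfolding n_def[symmetric] f_def by (rule frac_le[OF zero_le_one order_refl pos le])
  next
    fix n :: nat show "0 \<le> f n" unfolding f_def by simp
  next
    have "2 ^ n * f (2 ^ n) = (1 + real n * ln 2) powr (- r)" for n
      unfolding f_def by (simp add: ln_realpow powr_minus_divide)
    moreover have "summable (\<lambda>n. (1 + real n * ln 2) powr (- r))"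
    proof (rule summable_comparison_test')
      show "summable (\<lambda>n. (ln 2) powr (- r) * real n powr (- r))"
        using assms by (intro summable_mult) (simp add: summable_real_powr_iff)
      fix n :: nat assume n: "1 \<le> n"
      have "(1 + real n * ln 2) powr (- r) \<le> (ln 2 * real n) powr (- r)"
        using n assms by (intro powr_mono2') (auto simp: mult.commute)
      also have "\<dots> = (ln 2) powr (- r) * real n powr (- r)" by (simp add: powr_mult)
      finally show "norm ((1 + real n * ln 2) powr (- r)) \<le> (ln 2) powr (- r) * real n powr (- r)" by simp
    qed
    ultimately show "summable (\<lambda>n. 2 ^ n * f (2 ^ n))" by simp
  qed
  then have "summable (\<lambda>n. 2 powr r * f n)" by (rule summable_mult)
  then show ?thesis
  proof (rule summable_comparison_test'[where N=3])
    fix n :: nat assume n: "3 \<le> n"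
    have "1 \<le> ln (real n)"
      using n exp_le by (subst ln_ge_iff) auto
    then have l: "1 + ln (real n) \<le> 2 * ln (real n)" "0 < ln (real n)" by auto
    then have "(1 + ln (real n)) powr r \<le> (2 * ln (real n)) powr r" using assms by (intro powr_mono2) auto
    also have "\<dots> = 2 powr r * ln (real n) powr r" by (simp add: powr_mult)
    finally have "(1 + ln (real n)) powr r / ln (real n) powr r \<le> 2 powr r" using l by (simp add: divide_le_eq)
    moreover have "0 < (1 + ln (real n)) powr r" using l by simp
    ultimately have "1 / ln (real n) powr r \<le> 2 powr r / (1 + ln (real n)) powr r"
      using l by (simp add: field_simps)
    then have "1 / ln (real n) powr r / real n \<le> 2 powr r / (1 + ln (real n)) powr r / real n"
      using n by (intro divide_right_mono) auto
    then show "norm (1 / (real n * ln (real n) powr r)) \<le> 2 powr r * f n"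
      unfolding f_def by (simp add: mult.commute)
  qed
qed

lemma summable_variance_rate:
  assumes "0 < \<delta>" "f \<in> O(\<lambda>n. 1 / ln (real n) powr (2 + \<delta>))"
  shows "summable (\<lambda>n. f n / real n)"
proof (rule summable_comparison_test_bigo)
  show "summable (\<lambda>n. norm (1 / (real n * ln (real n) powr (2 + \<delta>))))"
    using summable_bertrand[of "2 + \<delta>"] assms(1) by simp
  have "(\<lambda>n. f n * (1 / real n)) \<in> O(\<lambda>n. 1 / ln (real n) powr (2 + \<delta>) * (1 / real n))"
    by (intro landau_o.big.mult assms(2)) simp
  then show "(\<lambda>n. f n / real n) \<in> O(\<lambda>n. 1 / (real n * ln (real n) powr (2 + \<delta>)))"
    by (simp add: mult.commute)
qed

text \<open>Dividing the rate by \<open>sqrt n\<close> gives the Bertrand series with exponent \<open>1 + \<delta> / 2\<close>; this is where an exponent larger than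
  two on the logarithm is used.\<close>

lemma summable_bias_rate:
  assumes "0 < \<delta>" "f \<in> O(\<lambda>n. 1 / sqrt (real n * ln (real n) powr (2 + \<delta>)))"
  shows "summable (\<lambda>n. f n / sqrt (real n))"
proof (rule summable_comparison_test_bigo)
  show "summable (\<lambda>n. norm (1 / (real n * ln (real n) powr (1 + \<delta> / 2))))"
    using summable_bertrand[of "1 + \<delta> / 2"] assms(1) by simp
  have "(\<lambda>n. f n * (1 / sqrt (real n))) \<in> O(\<lambda>n. 1 / sqrt (real n * ln (real n) powr (2 + \<delta>)) * (1 / sqrt (real n)))"
    by (intro landau_o.big.mult assms(2)) simp
  moreover have "1 / sqrt (real n * ln (real n) powr (2 + \<delta>)) * (1 / sqrt (real n)) = 1 / (real n * ln (real n) powr (1 + \<delta> / 2))" for n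
  proof -
    have "sqrt (ln (real n) powr (2 + \<delta>)) = ln (real n) powr (1 + \<delta> / 2)"
      by (simp add: powr_half_sqrt[symmetric] powr_powr add_divide_distrib)
    then show ?thesis by (simp add: real_sqrt_mult)
  qed
  ultimately show "(\<lambda>n. f n / sqrt (real n)) \<in> O(\<lambda>n. 1 / (real n * ln (real n) powr (1 + \<delta> / 2)))"
    by simp
qed

section \<open>Uniform laws of large numbers\<close>

context std_walk
begin

lemma mean_tail:
  assumes e: "0 < e" and m: "1 \<le> m"
  shows "ennreal (prob {\<omega> \<in> space M. \<exists>k\<ge>m. e * real k < \<bar>S k \<omega>\<bar>})
    \<le> (\<Sum>i. if 1 \<le> i then ennreal (50 / e\<^sup>2 / max ((real i)\<^sup>2) ((real m)\<^sup>2)) else 0)"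
proof -
  have "ennreal (prob {\<omega> \<in> space M. \<exists>k\<ge>m. 5 * (e / 5) * real k < \<bar>\<Sum>i\<in>{1..k}. X i \<omega>\<bar>})
    \<le> (\<Sum>i. if 1 \<le> i then ennreal (2 / (e / 5)\<^sup>2 * expectation (\<lambda>\<omega>. (X i \<omega>)\<^sup>2) / (max (real i) (real m))\<^sup>2) else 0)"
    using e m by (intro weighted_partial_sums_tail indep X_integrable square_integrable mean) auto
  also have "\<dots> = (\<Sum>i. if 1 \<le> i then ennreal (50 / e\<^sup>2 / max ((real i)\<^sup>2) ((real m)\<^sup>2)) else 0)"
  proof (intro suminf_cong)
    fix i
    show "(if 1 \<le> i then ennreal (2 / (e / 5)\<^sup>2 * expectation (\<lambda>\<omega>. (X i \<omega>)\<^sup>2) / (max (real i) (real m))\<^sup>2) else 0)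
      = (if 1 \<le> i then ennreal (50 / e\<^sup>2 / max ((real i)\<^sup>2) ((real m)\<^sup>2)) else 0)"
      by (auto simp: second_moment max_power2 power_divide)
  qed
  finally show ?thesis unfolding psum_def by simp
qed

text \<open>Truncation of \<open>(X i)\<^sup>2\<close> at level \<open>i\<close>: the truncated parts have variances that are summable against
  \<open>1 / i\<^sup>2\<close>, and the remainders have expectations that are summable against \<open>1 / i\<close>.\<close>

lemma square_mean_tail:
  assumes e: "0 < e" and m: "1 \<le> m"
  shows "ennreal (prob {\<omega> \<in> space M. \<exists>k\<ge>m. e * real k < \<bar>(\<Sum>i\<in>{1..k}. (X i \<omega>)\<^sup>2) - real k\<bar>})
    \<le> (\<Sum>i. if 1 \<le> i then ennreal (200 / e\<^sup>2 * (K * real i powr (2 - p / 2)) / max ((real i)\<^sup>2) ((real m)\<^sup>2)) else 0)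
    + (\<Sum>i. if 1 \<le> i then ennreal (4 / e * (K * real i powr (1 - p / 2)) / max (real i) (real m)) else 0)"
proof -
  define lo where "lo i x = (if x\<^sup>2 \<le> real i then x\<^sup>2 else 0)" for i and x :: real
  define hi where "hi i x = (if x\<^sup>2 \<le> real i then 0 else x\<^sup>2)" for i and x :: real
  have [measurable]: "lo i \<in> borel_measurable borel" "hi i \<in> borel_measurable borel" for i
    unfolding lo_def[abs_def] hi_def[abs_def] by measurable
  have split: "x\<^sup>2 = lo i x + hi i x" for i x unfolding lo_def hi_def by simp
  have root: "\<bar>x\<bar> = (x\<^sup>2) powr (1 / 2)" for x :: real by (simp add: powr_half_sqrt)
  have hi_le: "0 \<le> hi i x" "hi i x \<le> real i powr (1 - p / 2) * \<bar>x\<bar> powr p" if i: "1 \<le> i" for i x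
  proof -
    show "0 \<le> hi i x" unfolding hi_def by simp
    show "hi i x \<le> real i powr (1 - p / 2) * \<bar>x\<bar> powr p"
    proof (cases "x\<^sup>2 \<le> real i")
      case False
      have "x \<noteq> 0" using False by auto
      have "x\<^sup>2 = (x\<^sup>2) powr (1 - p / 2) * (x\<^sup>2) powr (p / 2)"
        using \<open>x \<noteq> 0\<close> by (simp add: powr_add[symmetric])
      also have "\<dots> \<le> real i powr (1 - p / 2) * (x\<^sup>2) powr (p / 2)"
        using False p i by (intro mult_right_mono powr_mono2') auto
      also have "(x\<^sup>2) powr (p / 2) = \<bar>x\<bar> powr p" by (simp only: root powr_powr) simp
      finally show ?thesis using False unfolding hi_def by simp
    qed (simp add: hi_def)
  qed
  have lo_le: "0 \<le> lo i x" "lo i x \<le> real i" "(lo i x)\<^sup>2 \<le> real i powr (2 - p / 2) * \<bar>x\<bar> powr p" for i x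
  proof -
    show "0 \<le> lo i x" "lo i x \<le> real i" unfolding lo_def by auto
    show "(lo i x)\<^sup>2 \<le> real i powr (2 - p / 2) * \<bar>x\<bar> powr p"
    proof (cases "x\<^sup>2 \<le> real i \<and> x \<noteq> 0")
      case True
      have "(x\<^sup>2)\<^sup>2 = (x\<^sup>2) powr 2" using True by (simp add: powr_numeral)
      also have "\<dots> = (x\<^sup>2) powr (2 - p / 2) * (x\<^sup>2) powr (p / 2)"
        by (simp only: powr_add[symmetric]) simp
      also have "\<dots> \<le> real i powr (2 - p / 2) * (x\<^sup>2) powr (p / 2)"
        using True p by (intro mult_right_mono powr_mono2) auto
      also have "(x\<^sup>2) powr (p / 2) = \<bar>x\<bar> powr p" by (simp only: root powr_powr) simp
      finally show ?thesis using True unfolding lo_def by simp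
    qed (auto simp: lo_def)
  qed
  define \<mu> where "\<mu> i = expectation (\<lambda>\<omega>. lo i (X i \<omega>))" for i
  define \<nu> where "\<nu> i = expectation (\<lambda>\<omega>. hi i (X i \<omega>))" for i
  have lo_int: "integrable M (\<lambda>\<omega>. lo i (X i \<omega>))" "integrable M (\<lambda>\<omega>. (lo i (X i \<omega>))\<^sup>2)" if i: "1 \<le> i" for i
  proof -
    have [measurable]: "X i \<in> borel_measurable M" using i by simp
    show "integrable M (\<lambda>\<omega>. lo i (X i \<omega>))"
      by (rule integrable_const_bound[of _ "real i"]) (use lo_le in auto)
    have "(lo i x)\<^sup>2 \<le> (real i)\<^sup>2" for x using lo_le[of i x] by (intro power_mono) auto
    then show "integrable M (\<lambda>\<omega>. (lo i (X i \<omega>))\<^sup>2)"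
      by (intro integrable_const_bound[of _ "(real i)\<^sup>2"]) auto
  qed
  have hi_int: "integrable M (\<lambda>\<omega>. hi i (X i \<omega>))" if i: "1 \<le> i" for i
  proof -
    have eq: "hi i (X i \<omega>) = (X i \<omega>)\<^sup>2 - lo i (X i \<omega>)" for \<omega> using split[of "X i \<omega>" i] by simp
    show ?thesis unfolding eq using lo_int[OF i] square_integrable[OF i] by auto
  qed
  have \<mu>\<nu>: "\<mu> i + \<nu> i = 1" if i: "1 \<le> i" for i
  proof -
    have "1 = expectation (\<lambda>\<omega>. lo i (X i \<omega>) + hi i (X i \<omega>))"
      unfolding split[symmetric] using second_moment[OF i] by simp
    then show ?thesis unfolding \<mu>_def \<nu>_def using lo_int[OF i] hi_int[OF i] by simp
  qed
  have \<nu>: "0 \<le> \<nu> i" "\<nu> i \<le> K * real i powr (1 - p / 2)" if i: "1 \<le> i" for i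
  proof -
    show "0 \<le> \<nu> i" unfolding \<nu>_def by (intro Bochner_Integration.integral_nonneg hi_le(1)[OF i])
    have "\<nu> i \<le> expectation (\<lambda>\<omega>. real i powr (1 - p / 2) * \<bar>X i \<omega>\<bar> powr p)"
      unfolding \<nu>_def using i by (intro integral_mono hi_int hi_le(2) integrable_mult_right moment_integrable)
    also have "\<dots> \<le> real i powr (1 - p / 2) * K" using moment[OF i] by (simp add: mult_left_mono)
    finally show "\<nu> i \<le> K * real i powr (1 - p / 2)" by (simp add: mult.commute)
  qed
  define Y where "Y i \<omega> = lo i (X i \<omega>) - \<mu> i" for i \<omega>
  have Yint: "integrable M (Y i)" "integrable M (\<lambda>\<omega>. (Y i \<omega>)\<^sup>2)" "expectation (Y i) = 0"
    "expectation (\<lambda>\<omega>. (Y i \<omega>)\<^sup>2) \<le> K * real i powr (2 - p / 2)" if i: "1 \<le> i" for i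
  proof -
    note l = lo_int[OF i]
    show "integrable M (Y i)" unfolding Y_def[abs_def] using l by auto
    have eq: "(Y i \<omega>)\<^sup>2 = (lo i (X i \<omega>))\<^sup>2 - 2 * \<mu> i * lo i (X i \<omega>) + (\<mu> i)\<^sup>2" for \<omega>
      unfolding Y_def by (simp add: power2_diff)
    show "integrable M (\<lambda>\<omega>. (Y i \<omega>)\<^sup>2)" unfolding eq using l by auto
    show "expectation (Y i) = 0" unfolding Y_def[abs_def] using l by (simp add: \<mu>_def prob_space)
    have "expectation (\<lambda>\<omega>. (Y i \<omega>)\<^sup>2) = expectation (\<lambda>\<omega>. (lo i (X i \<omega>))\<^sup>2) - (\<mu> i)\<^sup>2"
      unfolding eq using l by (simp add: prob_space \<mu>_def power2_eq_square)
    also have "\<dots> \<le> expectation (\<lambda>\<omega>. (lo i (X i \<omega>))\<^sup>2)" by simp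
    also have "\<dots> \<le> expectation (\<lambda>\<omega>. real i powr (2 - p / 2) * \<bar>X i \<omega>\<bar> powr p)"
      using i by (intro integral_mono l lo_le(3) integrable_mult_right moment_integrable)
    also have "\<dots> \<le> real i powr (2 - p / 2) * K" using moment[OF i] by (simp add: mult_left_mono)
    finally show "expectation (\<lambda>\<omega>. (Y i \<omega>)\<^sup>2) \<le> K * real i powr (2 - p / 2)" by (simp add: mult.commute)
  qed
  have Yindep: "indep_vars (\<lambda>_. borel) Y {1..}"
    unfolding Y_def by (rule indep_vars_compose2[OF indep]) measurable
  define b where "b i \<omega> = hi i (X i \<omega>) + \<nu> i" for i \<omega>
  have [measurable]: "1 \<le> i \<Longrightarrow> X i \<in> borel_measurable M" for i by simp
  have [measurable]: "1 \<le> i \<Longrightarrow> Y i \<in> borel_measurable M" "1 \<le> i \<Longrightarrow> b i \<in> borel_measurable M" for i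
    unfolding Y_def[abs_def] b_def[abs_def] by measurable
  \<comment> \<open>Half of \<open>e\<close> is left to the centred truncated parts and half to the remainders together with their means.\<close>
  define EY where "EY = {\<omega> \<in> space M. \<exists>k\<ge>m. 5 * (e / 10) * real k < \<bar>\<Sum>i\<in>{1..k}. Y i \<omega>\<bar>}"
  define Eb where "Eb = {\<omega> \<in> space M. \<exists>k\<ge>m. e / 2 * real k < (\<Sum>i\<in>{1..k}. b i \<omega>)}"
  have [measurable]: "EY \<in> events" "Eb \<in> events" unfolding EY_def Eb_def by measurable
  have "ennreal (prob EY) \<le> (\<Sum>i. if 1 \<le> i then ennreal (2 / (e / 10)\<^sup>2 * expectation (\<lambda>\<omega>. (Y i \<omega>)\<^sup>2) / (max (real i) (real m))\<^sup>2) else 0)"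
    unfolding EY_def using e m by (intro weighted_partial_sums_tail Yindep Yint) auto
  also have "\<dots> \<le> (\<Sum>i. if 1 \<le> i then ennreal (200 / e\<^sup>2 * (K * real i powr (2 - p / 2)) / max ((real i)\<^sup>2) ((real m)\<^sup>2)) else 0)"
  proof (intro suminf_le summableI)
    fix i
    show "(if 1 \<le> i then ennreal (2 / (e / 10)\<^sup>2 * expectation (\<lambda>\<omega>. (Y i \<omega>)\<^sup>2) / (max (real i) (real m))\<^sup>2) else 0)
      \<le> (if 1 \<le> i then ennreal (200 / e\<^sup>2 * (K * real i powr (2 - p / 2)) / max ((real i)\<^sup>2) ((real m)\<^sup>2)) else 0)"
    proof (cases "1 \<le> i")
      case True
      have "2 / (e / 10)\<^sup>2 * expectation (\<lambda>\<omega>. (Y i \<omega>)\<^sup>2) / (max (real i) (real m))\<^sup>2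
        \<le> 200 / e\<^sup>2 * (K * real i powr (2 - p / 2)) / max ((real i)\<^sup>2) ((real m)\<^sup>2)"
        unfolding max_power2[OF of_nat_0_le_iff of_nat_0_le_iff]
        using Yint(4)[OF True] by (intro divide_right_mono mult_mono) (auto simp: power_divide max_def)
      then show ?thesis using True by (simp add: ennreal_leI)
    qed simp
  qed
  finally have PY: "ennreal (prob EY) \<le> \<dots>" .
  have "ennreal (prob Eb) \<le> (\<Sum>i. if 1 \<le> i then ennreal (1 / (e / 2 * max (real i) (real m))) * (\<integral>\<^sup>+\<omega>. ennreal (b i \<omega>) \<partial>M) else 0)"
    unfolding Eb_def using e m hi_le \<nu> by (intro nonneg_partial_sums_tail) (auto simp: b_def intro!: add_nonneg_nonneg)
  also have "\<dots> \<le> (\<Sum>i. if 1 \<le> i then ennreal (4 / e * (K * real i powr (1 - p / 2)) / max (real i) (real m)) else 0)"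
  proof (intro suminf_le summableI)
    fix i
    show "(if 1 \<le> i then ennreal (1 / (e / 2 * max (real i) (real m))) * (\<integral>\<^sup>+\<omega>. ennreal (b i \<omega>) \<partial>M) else 0)
      \<le> (if 1 \<le> i then ennreal (4 / e * (K * real i powr (1 - p / 2)) / max (real i) (real m)) else 0)"
    proof (cases "1 \<le> i")
      case True
      have "(\<integral>\<^sup>+\<omega>. ennreal (b i \<omega>) \<partial>M) = ennreal (expectation (b i))"
        using hi_int[OF True] hi_le[OF True] \<nu>[OF True] unfolding b_def[abs_def]
        by (intro nn_integral_eq_integral) (auto intro!: add_nonneg_nonneg)
      also have "expectation (b i) = 2 * \<nu> i"
        unfolding b_def using hi_int[OF True] by (simp add: \<nu>_def prob_space)
      finally have "ennreal (1 / (e / 2 * max (real i) (real m))) * (\<integral>\<^sup>+\<omega>. ennreal (b i \<omega>) \<partial>M)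
        = ennreal (1 / (e / 2 * max (real i) (real m)) * (2 * \<nu> i))"
        using \<nu>[OF True] by (simp add: ennreal_mult''[symmetric])
      also have "1 / (e / 2 * max (real i) (real m)) * (2 * \<nu> i) = 4 / e * \<nu> i / max (real i) (real m)" by simp
      also have "ennreal \<dots> \<le> ennreal (4 / e * (K * real i powr (1 - p / 2)) / max (real i) (real m))"
        using \<nu>[OF True] e by (intro ennreal_leI divide_right_mono mult_left_mono) auto
      finally show ?thesis using True by simp
    qed simp
  qed
  finally have Pb: "ennreal (prob Eb) \<le> \<dots>" .
  have "prob {\<omega> \<in> space M. \<exists>k\<ge>m. e * real k < \<bar>(\<Sum>i\<in>{1..k}. (X i \<omega>)\<^sup>2) - real k\<bar>} \<le> prob (EY \<union> Eb)"
  proof (intro finite_measure_mono subsetI)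
    fix \<omega> assume "\<omega> \<in> {\<omega> \<in> space M. \<exists>k\<ge>m. e * real k < \<bar>(\<Sum>i\<in>{1..k}. (X i \<omega>)\<^sup>2) - real k\<bar>}"
    then obtain k where k: "m \<le> k" "e * real k < \<bar>(\<Sum>i\<in>{1..k}. (X i \<omega>)\<^sup>2) - real k\<bar>" and w: "\<omega> \<in> space M" by auto
    have "(\<Sum>i\<in>{1..k}. (X i \<omega>)\<^sup>2) - real k = (\<Sum>i\<in>{1..k}. (X i \<omega>)\<^sup>2 - 1)" by (simp add: sum_subtractf)
    also have "\<dots> = (\<Sum>i\<in>{1..k}. Y i \<omega> + (hi i (X i \<omega>) - \<nu> i))"
    proof (intro sum.cong refl)
      fix i assume "i \<in> {1..k}"
      then show "(X i \<omega>)\<^sup>2 - 1 = Y i \<omega> + (hi i (X i \<omega>) - \<nu> i)"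
        using \<mu>\<nu>[of i] unfolding Y_def split[of "X i \<omega>" i] by auto
    qed
    finally have eq: "(\<Sum>i\<in>{1..k}. (X i \<omega>)\<^sup>2) - real k = (\<Sum>i\<in>{1..k}. Y i \<omega>) + (\<Sum>i\<in>{1..k}. hi i (X i \<omega>) - \<nu> i)"
      by (simp add: sum.distrib)
    have "\<bar>\<Sum>i\<in>{1..k}. hi i (X i \<omega>) - \<nu> i\<bar> \<le> (\<Sum>i\<in>{1..k}. b i \<omega>)"
    proof (intro order_trans[OF sum_abs] sum_mono)
      fix i assume "i \<in> {1..k}"
      then show "\<bar>hi i (X i \<omega>) - \<nu> i\<bar> \<le> b i \<omega>"
        using hi_le(1)[of i "X i \<omega>"] \<nu>(1)[of i] unfolding b_def by auto
    qed
    then have "e * real k < \<bar>\<Sum>i\<in>{1..k}. Y i \<omega>\<bar> + (\<Sum>i\<in>{1..k}. b i \<omega>)" using k(2) unfolding eq by linarith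
    then have "5 * (e / 10) * real k < \<bar>\<Sum>i\<in>{1..k}. Y i \<omega>\<bar> \<or> e / 2 * real k < (\<Sum>i\<in>{1..k}. b i \<omega>)" by argo
    then show "\<omega> \<in> EY \<union> Eb" using w k(1) unfolding EY_def Eb_def by auto
  qed measurable
  also have "\<dots> \<le> prob EY + prob Eb" by (intro measure_Un_le) auto
  finally have "ennreal (prob {\<omega> \<in> space M. \<exists>k\<ge>m. e * real k < \<bar>(\<Sum>i\<in>{1..k}. (X i \<omega>)\<^sup>2) - real k\<bar>})
    \<le> ennreal (prob EY) + ennreal (prob Eb)"
    by (simp add: ennreal_leI flip: ennreal_plus)
  also note add_mono[OF PY Pb]
  finally show ?thesis .
qed

end

lemma walk_laws_of_large_numbers:
  fixes P :: "nat \<Rightarrow> 'a measure"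
  assumes walk: "\<And>m. std_walk (P m) (X m) p K" and e: "0 < e"
  shows "(\<lambda>m. measure (P m) {\<omega> \<in> space (P m). \<exists>k\<ge>m. e * real k < \<bar>psum (X m) k \<omega>\<bar>}) \<longlonglongrightarrow> 0"
    and "(\<lambda>m. measure (P m) {\<omega> \<in> space (P m). \<exists>k\<ge>m. e * real k < \<bar>(\<Sum>i\<in>{1..k}. (X m i \<omega>)\<^sup>2) - real k\<bar>}) \<longlonglongrightarrow> 0"
proof -
  have p: "2 < p" "p \<le> 3" using std_walk.p[OF walk] by auto
  have K: "0 \<le> K" using std_walk.K_nonneg[OF walk] .
  have top: "filterlim (\<lambda>i. (real i)\<^sup>2) at_top sequentially" by real_asymp
  show "(\<lambda>m. measure (P m) {\<omega> \<in> space (P m). \<exists>k\<ge>m. e * real k < \<bar>psum (X m) k \<omega>\<bar>}) \<longlonglongrightarrow> 0"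
  proof (rule ennreal_bounds_vanish)
    show "(\<lambda>m. \<Sum>i. if 1 \<le> i then ennreal (50 / e\<^sup>2 / max ((real i)\<^sup>2) ((real m)\<^sup>2)) else 0) \<longlonglongrightarrow> 0"
    proof (rule truncated_series_vanishes[OF _ _ top])
      show "summable (\<lambda>i. 50 / e\<^sup>2 / (real i)\<^sup>2)"
        using summable_mult[OF inverse_power_summable[of 2, where 'a=real], of "50 / e\<^sup>2"] by (simp add: divide_inverse)
    qed auto
  qed (use std_walk.mean_tail[OF walk e] in auto)
  have a: "(\<lambda>m. \<Sum>i. if 1 \<le> i then ennreal (200 / e\<^sup>2 * (K * real i powr (2 - p / 2)) / max ((real i)\<^sup>2) ((real m)\<^sup>2)) else 0) \<longlonglongrightarrow> 0"
  proof (rule truncated_series_vanishes[OF _ _ top])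
    have "summable (\<lambda>i. 200 / e\<^sup>2 * K * real i powr (- (p / 2)))"
      using p by (intro summable_mult) (simp add: summable_real_powr_iff)
    moreover have "200 / e\<^sup>2 * K * real i powr (- (p / 2)) = 200 / e\<^sup>2 * (K * real i powr (2 - p / 2)) / (real i)\<^sup>2" for i
    proof (cases "i = 0")
      case False
      then have "real i powr (2 - p / 2) = (real i)\<^sup>2 * real i powr (- (p / 2))"
        using powr_add[of "real i" 2 "- (p / 2)"] by (simp add: powr_numeral)
      then show ?thesis using False by simp
    qed simp
    ultimately show "summable (\<lambda>i. 200 / e\<^sup>2 * (K * real i powr (2 - p / 2)) / (real i)\<^sup>2)" by (simp only:)
  qed (use K in auto)
  have b: "(\<lambda>m. \<Sum>i. if 1 \<le> i then ennreal (4 / e * (K * real i powr (1 - p / 2)) / max (real i) (real m)) else 0) \<longlonglongrightarrow> 0"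
  proof (rule truncated_series_vanishes[OF _ _ filterlim_real_sequentially])
    have "summable (\<lambda>i. 4 / e * K * real i powr (- (p / 2)))"
      using p by (intro summable_mult) (simp add: summable_real_powr_iff)
    moreover have "4 / e * K * real i powr (- (p / 2)) = 4 / e * (K * real i powr (1 - p / 2)) / real i" for i
    proof (cases "i = 0")
      case False
      then have "real i powr (1 - p / 2) = real i * real i powr (- (p / 2))"
        using powr_add[of "real i" 1 "- (p / 2)"] by simp
      then show ?thesis using False by simp
    qed simp
    ultimately show "summable (\<lambda>i. 4 / e * (K * real i powr (1 - p / 2)) / real i)" by (simp only:)
  qed (use K e in auto)
  show "(\<lambda>m. measure (P m) {\<omega> \<in> space (P m). \<exists>k\<ge>m. e * real k < \<bar>(\<Sum>i\<in>{1..k}. (X m i \<omega>)\<^sup>2) - real k\<bar>}) \<longlonglongrightarrow> 0"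
    by (rule ennreal_bounds_vanish[OF _ std_walk.square_mean_tail[OF walk e]])
       (use tendsto_add[OF a b] in auto)
qed

section \<open>Regression residuals under conditional independence\<close>

context prob_space
begin

lemma sigma_rv_subalgebra:
  assumes "Z \<in> borel_measurable M"
  shows "subalgebra M (sigma_rv M Z)"
  using assms unfolding subalgebra_def sigma_rv_def
  by (auto simp: sets_vimage_algebra2 measurable_sets intro: measurable_sets)

lemma sigma_rv_sigma_finite:
  assumes "Z \<in> borel_measurable M"
  shows "sigma_finite_subalgebra M (sigma_rv M Z)"
  using sigma_rv_subalgebra[OF assms]
  by (intro finite_measure_subalgebra_is_sigma_finite finite_measure_subalgebra.intro
        finite_measure_subalgebra_axioms.intro finite_measure_axioms)

lemma measurable_sigma_rv:
  assumes "Z \<in> borel_measurable M"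
  shows "Z \<in> measurable (sigma_rv M Z) borel"
  unfolding sigma_rv_def by (intro measurable_vimage_algebra1) auto

text \<open>The residual has conditional expectation \<open>0\<close> given \<open>Z\<close>, and integrability of the product
  allows \<open>g (Z \<omega>)\<close> to be taken out of the conditional expectation.\<close>

lemma residual_orthogonal:
  fixes Z :: "'a \<Rightarrow> 'b::topological_space" and g :: "'b \<Rightarrow> real"
  assumes reg: "is_regression_function M Y Z f" and Z: "Z \<in> borel_measurable M"
    and g: "g \<in> borel_measurable borel"
    and int: "integrable M (\<lambda>\<omega>. g (Z \<omega>) * (Y \<omega> - f (Z \<omega>)))"
  shows "expectation (\<lambda>\<omega>. g (Z \<omega>) * (Y \<omega> - f (Z \<omega>))) = 0"
proof -
  let ?F = "sigma_rv M Z"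
  have sub: "subalgebra M ?F" by (rule sigma_rv_subalgebra[OF Z])
  interpret sigma_finite_subalgebra M ?F by (rule sigma_rv_sigma_finite[OF Z])
  have Y: "integrable M Y" and f: "f \<in> borel_measurable borel"
    and eq: "AE \<omega> in M. f (Z \<omega>) = real_cond_exp M ?F Y \<omega>"
    using reg unfolding is_regression_function_def by auto
  have fZ: "(\<lambda>\<omega>. f (Z \<omega>)) \<in> borel_measurable ?F" "(\<lambda>\<omega>. g (Z \<omega>)) \<in> borel_measurable ?F"
    using measurable_compose[OF measurable_sigma_rv[OF Z]] f g by auto
  have fZM: "(\<lambda>\<omega>. f (Z \<omega>)) \<in> borel_measurable M" by (rule measurable_compose[OF Z f])
  have fi: "integrable M (\<lambda>\<omega>. f (Z \<omega>))"
    using real_cond_exp_int(1)[OF Y] eq fZM by (subst integrable_cong_AE[OF _ _ eq]) auto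
  have z: "AE \<omega> in M. real_cond_exp M ?F (\<lambda>\<omega>. Y \<omega> - f (Z \<omega>)) \<omega> = 0"
    using real_cond_exp_diff[OF Y fi] real_cond_exp_F_meas[OF fi fZ(1)] eq by eventually_elim auto
  have "expectation (\<lambda>\<omega>. g (Z \<omega>) * (Y \<omega> - f (Z \<omega>)))
    = expectation (\<lambda>\<omega>. g (Z \<omega>) * real_cond_exp M ?F (\<lambda>\<omega>. Y \<omega> - f (Z \<omega>)) \<omega>)"
    using Y fZM by (intro real_cond_exp_intg(2)[symmetric] int fZ) auto
  also have "\<dots> = expectation (\<lambda>\<omega>. 0)"
    using z g fZM measurable_compose[OF Z g] by (intro integral_cong_AE) auto
  finally show ?thesis by simp
qed

text \<open>Both sides are finite measures in the set of values of \<open>Y\<close>, so conditional independence, which speaks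
  of indicators, extends to the integrable variable \<open>Y\<close>.\<close>

lemma cond_indep_residual_rectangle:
  fixes X Y :: "'a \<Rightarrow> real" and Z :: "'a \<Rightarrow> 'b::topological_space"
  assumes reg: "is_regression_function M Y Z f" and ci: "cond_indep_given M X Y Z"
    and X [measurable]: "X \<in> borel_measurable M" and Z: "Z \<in> borel_measurable M"
    and A: "A \<in> sets borel" and D: "D \<in> sets borel"
  shows "expectation (\<lambda>\<omega>. indicator {\<omega>. X \<omega> \<in> A \<and> Z \<omega> \<in> D} \<omega> * (Y \<omega> - f (Z \<omega>))) = 0"
proof -
  let ?F = "sigma_rv M Z"
  have sub: "subalgebra M ?F" by (rule sigma_rv_subalgebra[OF Z])
  interpret sigma_finite_subalgebra M ?F by (rule sigma_rv_sigma_finite[OF Z])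
  have Y: "integrable M Y" and f: "f \<in> borel_measurable borel"
    and eq: "AE \<omega> in M. f (Z \<omega>) = real_cond_exp M ?F Y \<omega>"
    using reg unfolding is_regression_function_def by auto
  have Ym [measurable]: "Y \<in> borel_measurable M" using Y by simp
  note Z [measurable] f [measurable] A [measurable] D [measurable]
  define C where "C = Z -` D \<inter> space M"
  have C: "C \<in> sets ?F"
  proof -
    have "Z -` D \<inter> space ?F \<in> sets ?F" by (rule measurable_sets[OF measurable_sigma_rv[OF Z] D])
    then show ?thesis unfolding C_def sigma_rv_def by simp
  qed
  have CM [measurable]: "C \<in> events" using C sub unfolding subalgebra_def by auto
  have iX: "integrable M (indicator {w. X w \<in> A} :: 'a \<Rightarrow> real)"
    "integrable M (indicator {w. X w \<in> A \<and> Y w \<in> B} :: 'a \<Rightarrow> real)" "integrable M (indicator {w. Y w \<in> B} :: 'a \<Rightarrow> real)"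
    if [measurable]: "B \<in> sets borel" for B
  proof -
    have m: "(\<lambda>w. indicator {w. X w \<in> A} w :: real) \<in> borel_measurable M"
      "(\<lambda>w. indicator {w. X w \<in> A \<and> Y w \<in> B} w :: real) \<in> borel_measurable M"
      "(\<lambda>w. indicator {w. Y w \<in> B} w :: real) \<in> borel_measurable M"
      unfolding indicator_def mem_Collect_eq by measurable
    show "integrable M (indicator {w. X w \<in> A} :: 'a \<Rightarrow> real)" "integrable M (indicator {w. X w \<in> A \<and> Y w \<in> B} :: 'a \<Rightarrow> real)"
      "integrable M (indicator {w. Y w \<in> B} :: 'a \<Rightarrow> real)"
      by (intro integrable_const_bound[of _ 1] m; simp add: indicator_def)+
  qed
  define e where "e \<omega> = max 0 (min 1 (real_cond_exp M ?F (indicator {w. X w \<in> A}) \<omega>))" for \<omega>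
  have eF [measurable]: "e \<in> borel_measurable ?F" unfolding e_def by measurable
  have eM [measurable]: "e \<in> borel_measurable M" by (rule measurable_from_subalg[OF sub eF])
  have e01: "0 \<le> e \<omega>" "e \<omega> \<le> 1" for \<omega> unfolding e_def by auto
  have e_eq: "AE \<omega> in M. e \<omega> = real_cond_exp M ?F (indicator {w. X w \<in> A}) \<omega>"
  proof -
    have "AE \<omega> in M. 0 \<le> real_cond_exp M ?F (indicator {w. X w \<in> A}) \<omega>"
      using iX(1)[of UNIV] by (intro real_cond_exp_pos) auto
    moreover have "AE \<omega> in M. real_cond_exp M ?F (indicator {w. X w \<in> A}) \<omega> \<le> 1"
      using iX(1)[of UNIV] by (intro real_cond_exp_le_c) auto
    ultimately show ?thesis unfolding e_def by eventually_elim auto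
  qed
  define I where "I \<omega> = (indicator {\<omega>. X \<omega> \<in> A \<and> Z \<omega> \<in> D} \<omega> :: real)" for \<omega>
  define J where "J \<omega> = indicator C \<omega> * e \<omega>" for \<omega>
  have [measurable]: "I \<in> borel_measurable M" unfolding I_def[abs_def] indicator_def mem_Collect_eq by measurable
  have [measurable]: "J \<in> borel_measurable M" "J \<in> borel_measurable ?F" unfolding J_def[abs_def] using C by measurable
  have I01: "0 \<le> I \<omega>" "I \<omega> \<le> 1" and J01: "0 \<le> J \<omega>" "J \<omega> \<le> 1" for \<omega>
    using e01[of \<omega>] unfolding I_def J_def by (auto simp: indicator_def)
  have I_alt: "I \<omega> = indicator C \<omega> * indicator {w. X w \<in> A} \<omega>" if "\<omega> \<in> space M" for \<omega>
    using that unfolding I_def C_def by (auto simp: indicator_def)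
  \<comment> \<open>Testing \<open>Y\<close> against \<open>I\<close> or against its conditional expectation \<open>J\<close> given \<open>Z\<close> is the same.\<close>
  have key: "expectation (\<lambda>\<omega>. I \<omega> * indicator {w. Y w \<in> B} \<omega>) = expectation (\<lambda>\<omega>. J \<omega> * indicator {w. Y w \<in> B} \<omega>)"
    if B: "B \<in> sets borel" for B
  proof -
    note [measurable] = B
    have ci': "AE \<omega> in M. real_cond_exp M ?F (indicator {w. X w \<in> A \<and> Y w \<in> B}) \<omega> =
        real_cond_exp M ?F (indicator {w. X w \<in> A}) \<omega> * real_cond_exp M ?F (indicator {w. Y w \<in> B}) \<omega>"
      using ci A B unfolding cond_indep_given_def by auto
    have iC: "(\<lambda>\<omega>. indicator C \<omega> :: real) \<in> borel_measurable ?F" using C by measurable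
    have b: "integrable M (\<lambda>\<omega>. h \<omega> * indicator G \<omega>)" if "integrable M (indicator G :: 'a \<Rightarrow> real)"
      "h \<in> borel_measurable M" "\<And>\<omega>. 0 \<le> h \<omega> \<and> h \<omega> \<le> 1" for h :: "'a \<Rightarrow> real" and G :: "'a set"
    proof (rule integrable_const_bound[of _ 1])
      have [measurable]: "(indicator G :: 'a \<Rightarrow> real) \<in> borel_measurable M" using that(1) by simp
      show "(\<lambda>\<omega>. h \<omega> * indicator G \<omega>) \<in> borel_measurable M" using that(2) by measurable
      show "AE \<omega> in M. norm (h \<omega> * indicator G \<omega>) \<le> 1" using that(3) by (intro AE_I2) (auto simp: indicator_def)
    qed
    have "expectation (\<lambda>\<omega>. I \<omega> * indicator {w. Y w \<in> B} \<omega>)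
      = expectation (\<lambda>\<omega>. indicator C \<omega> * indicator {w. X w \<in> A \<and> Y w \<in> B} \<omega>)"
      by (intro Bochner_Integration.integral_cong refl) (auto simp: I_alt indicator_def)
    also have "\<dots> = expectation (\<lambda>\<omega>. indicator C \<omega> * real_cond_exp M ?F (indicator {w. X w \<in> A \<and> Y w \<in> B}) \<omega>)"
      using iX(2)[OF B] by (intro real_cond_exp_intg(2)[symmetric] iC b) (auto simp: indicator_def)
    also have "\<dots> = expectation (\<lambda>\<omega>. J \<omega> * real_cond_exp M ?F (indicator {w. Y w \<in> B}) \<omega>)"
    proof (intro integral_cong_AE)
      show "AE \<omega> in M. indicator C \<omega> * real_cond_exp M ?F (indicator {w. X w \<in> A \<and> Y w \<in> B}) \<omega>
          = J \<omega> * real_cond_exp M ?F (indicator {w. Y w \<in> B}) \<omega>"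
        using ci' e_eq by eventually_elim (simp add: J_def)
    qed measurable
    also have "\<dots> = expectation (\<lambda>\<omega>. J \<omega> * indicator {w. Y w \<in> B} \<omega>)"
      using iX(3)[OF B] J01 by (intro real_cond_exp_intg(2) b) auto
    finally show ?thesis .
  qed
  define \<mu>I where "\<mu>I = distr (density M (\<lambda>\<omega>. ennreal (I \<omega>))) borel Y"
  define \<mu>J where "\<mu>J = distr (density M (\<lambda>\<omega>. ennreal (J \<omega>))) borel Y"
  have "\<mu>I = \<mu>J"
  proof (rule measure_eqI)
    fix B assume "B \<in> sets \<mu>I"
    then have B [measurable]: "B \<in> sets borel" unfolding \<mu>I_def by simp
    have em: "emeasure (distr (density M (\<lambda>\<omega>. ennreal (h \<omega>))) borel Y) B
      = ennreal (expectation (\<lambda>\<omega>. h \<omega> * indicator {w. Y w \<in> B} \<omega>))"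
      if [measurable]: "h \<in> borel_measurable M" and h: "\<And>\<omega>. 0 \<le> h \<omega>" "\<And>\<omega>. h \<omega> \<le> 1" for h
    proof -
      have "emeasure (distr (density M (\<lambda>\<omega>. ennreal (h \<omega>))) borel Y) B = emeasure (density M (\<lambda>\<omega>. ennreal (h \<omega>))) (Y -` B \<inter> space M)"
        by (subst emeasure_distr) auto
      also have "\<dots> = (\<integral>\<^sup>+\<omega>. ennreal (h \<omega>) * indicator (Y -` B \<inter> space M) \<omega> \<partial>M)"
        by (subst emeasure_density) auto
      also have "\<dots> = (\<integral>\<^sup>+\<omega>. ennreal (h \<omega> * indicator {w. Y w \<in> B} \<omega>) \<partial>M)"
        by (intro nn_integral_cong) (auto simp: indicator_def)
      also have "\<dots> = ennreal (expectation (\<lambda>\<omega>. h \<omega> * indicator {w. Y w \<in> B} \<omega>))"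
      proof (rule nn_integral_eq_integral)
        have "(\<lambda>w. indicator {w. Y w \<in> B} w :: real) \<in> borel_measurable M"
          unfolding indicator_def mem_Collect_eq by measurable
        then show "integrable M (\<lambda>\<omega>. h \<omega> * indicator {w. Y w \<in> B} \<omega>)"
          using h by (intro integrable_const_bound[of _ 1]) (auto simp: indicator_def)
      qed (use h in auto)
      finally show ?thesis .
    qed
    show "emeasure \<mu>I B = emeasure \<mu>J B"
      unfolding \<mu>I_def \<mu>J_def using I01 J01 by (simp add: em key[OF B])
  qed (simp add: \<mu>I_def \<mu>J_def)
  have tr: "integral\<^sup>L (distr (density M (\<lambda>\<omega>. ennreal (h \<omega>))) borel Y) (\<lambda>y. y) = expectation (\<lambda>\<omega>. h \<omega> * Y \<omega>)"
    if [measurable]: "h \<in> borel_measurable M" and h: "\<And>\<omega>. 0 \<le> h \<omega>" for h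
    by (subst integral_distr) (use h in \<open>auto simp: integral_real_density\<close>)
  have IJ: "expectation (\<lambda>\<omega>. I \<omega> * Y \<omega>) = expectation (\<lambda>\<omega>. J \<omega> * Y \<omega>)"
    using tr[of I] tr[of J] \<open>\<mu>I = \<mu>J\<close> I01 J01 unfolding \<mu>I_def \<mu>J_def by simp
  have fi: "integrable M (\<lambda>\<omega>. f (Z \<omega>))"
    using real_cond_exp_int(1)[OF Y] eq by (subst integrable_cong_AE[OF _ _ eq]) auto
  have bd: "integrable M (\<lambda>\<omega>. h \<omega> * g \<omega>)" if "integrable M g" "h \<in> borel_measurable M" "\<And>\<omega>. 0 \<le> h \<omega>" "\<And>\<omega>. h \<omega> \<le> 1"
    for h g :: "'a \<Rightarrow> real"
    by (rule Bochner_Integration.integrable_bound[OF that(1)])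
       (use that borel_measurable_integrable[OF that(1)] in \<open>auto simp: abs_mult mult_left_le_one_le\<close>)
  have "expectation (\<lambda>\<omega>. J \<omega> * Y \<omega>) = expectation (\<lambda>\<omega>. J \<omega> * real_cond_exp M ?F Y \<omega>)"
    using J01 Y by (intro real_cond_exp_intg(2)[symmetric] bd) auto
  also have "\<dots> = expectation (\<lambda>\<omega>. (indicator C \<omega> * f (Z \<omega>)) * real_cond_exp M ?F (indicator {w. X w \<in> A}) \<omega>)"
  proof (intro integral_cong_AE)
    show "AE \<omega> in M. J \<omega> * real_cond_exp M ?F Y \<omega> = (indicator C \<omega> * f (Z \<omega>)) * real_cond_exp M ?F (indicator {w. X w \<in> A}) \<omega>"
      using eq e_eq by eventually_elim (simp add: J_def)
  qed measurable
  also have "\<dots> = expectation (\<lambda>\<omega>. (indicator C \<omega> * f (Z \<omega>)) * indicator {w. X w \<in> A} \<omega>)"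
  proof (intro real_cond_exp_intg(2))
    have [measurable]: "(\<lambda>\<omega>. f (Z \<omega>)) \<in> borel_measurable ?F"
      by (rule measurable_compose[OF measurable_sigma_rv[OF Z] f])
    show "(\<lambda>\<omega>. indicator C \<omega> * f (Z \<omega>)) \<in> borel_measurable ?F" using C by measurable
    have "integrable M (\<lambda>\<omega>. I \<omega> * f (Z \<omega>))" using fi I01 by (intro bd) auto
    then show "integrable M (\<lambda>\<omega>. (indicator C \<omega> * f (Z \<omega>)) * indicator {w. X w \<in> A} \<omega>)"
      by (rule Bochner_Integration.integrable_cong[THEN iffD1, rotated 2]) (auto simp: I_alt)
  qed (use iX(1)[of UNIV] in auto)
  also have "\<dots> = expectation (\<lambda>\<omega>. I \<omega> * f (Z \<omega>))"
    by (intro Bochner_Integration.integral_cong refl) (auto simp: I_alt)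
  finally have "expectation (\<lambda>\<omega>. I \<omega> * Y \<omega>) = expectation (\<lambda>\<omega>. I \<omega> * f (Z \<omega>))" unfolding IJ .
  moreover have "integrable M (\<lambda>\<omega>. I \<omega> * Y \<omega>)" "integrable M (\<lambda>\<omega>. I \<omega> * f (Z \<omega>))"
    using I01 Y fi by (auto intro!: bd)
  ultimately show ?thesis unfolding I_def[symmetric] by (simp add: right_diff_distrib)
qed

text \<open>By the previous lemma, the positive and the negative part of the residual of \<open>Y\<close>, used as densities,
  induce the same law of \<open>(X, Z)\<close>.\<close>

lemma cond_indep_residual_product:
  fixes X Y :: "'a \<Rightarrow> real" and Z :: "'a \<Rightarrow> 'b::{second_countable_topology, t2_space}"
  assumes reg: "is_regression_function M Y Z f" and ci: "cond_indep_given M X Y Z"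
    and X [measurable]: "X \<in> borel_measurable M" and Z [measurable]: "Z \<in> borel_measurable M"
    and g [measurable]: "g \<in> borel_measurable borel"
    and int: "integrable M (\<lambda>\<omega>. (X \<omega> - g (Z \<omega>)) * (Y \<omega> - f (Z \<omega>)))"
  shows "expectation (\<lambda>\<omega>. (X \<omega> - g (Z \<omega>)) * (Y \<omega> - f (Z \<omega>))) = 0"
proof -
  have Y: "integrable M Y" and f [measurable]: "f \<in> borel_measurable borel"
    and eq: "AE \<omega> in M. f (Z \<omega>) = real_cond_exp M (sigma_rv M Z) Y \<omega>"
    using reg unfolding is_regression_function_def by auto
  have [measurable]: "Y \<in> borel_measurable M" using Y by simp
  interpret F: sigma_finite_subalgebra M "sigma_rv M Z" by (rule sigma_rv_sigma_finite[OF Z])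
  have fi: "integrable M (\<lambda>\<omega>. f (Z \<omega>))"
    using F.real_cond_exp_int(1)[OF Y] eq by (subst integrable_cong_AE[OF _ _ eq]) auto
  define r where "r \<omega> = Y \<omega> - f (Z \<omega>)" for \<omega>
  have r: "integrable M r" unfolding r_def using Y fi by auto
  have [measurable]: "r \<in> borel_measurable M" unfolding r_def by measurable
  define u where "u \<omega> = max 0 (r \<omega>)" for \<omega>
  define v where "v \<omega> = max 0 (- r \<omega>)" for \<omega>
  have uv: "0 \<le> u \<omega>" "0 \<le> v \<omega>" "r \<omega> = u \<omega> - v \<omega>" for \<omega> unfolding u_def v_def by auto
  have [measurable]: "u \<in> borel_measurable M" "v \<in> borel_measurable M" unfolding u_def v_def by measurable
  have uvi: "integrable M u" "integrable M v"
    by (rule Bochner_Integration.integrable_bound[OF r]; simp add: u_def v_def)+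
  let ?XZ = "\<lambda>\<omega>. (X \<omega>, Z \<omega>)"
  define \<mu>u where "\<mu>u = distr (density M (\<lambda>\<omega>. ennreal (u \<omega>))) (borel \<Otimes>\<^sub>M borel) ?XZ"
  define \<mu>v where "\<mu>v = distr (density M (\<lambda>\<omega>. ennreal (v \<omega>))) (borel \<Otimes>\<^sub>M borel) ?XZ"
  have em: "emeasure (distr (density M (\<lambda>\<omega>. ennreal (h \<omega>))) (borel \<Otimes>\<^sub>M borel) ?XZ) (A \<times> D)
      = ennreal (expectation (\<lambda>\<omega>. indicator {\<omega>. X \<omega> \<in> A \<and> Z \<omega> \<in> D} \<omega> * h \<omega>))"
    if [measurable]: "A \<in> sets borel" "D \<in> sets borel" and h: "integrable M h" "\<And>\<omega>. 0 \<le> h \<omega>" for A D h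
  proof -
    have [measurable]: "h \<in> borel_measurable M" using h by simp
    have "emeasure (distr (density M (\<lambda>\<omega>. ennreal (h \<omega>))) (borel \<Otimes>\<^sub>M borel) ?XZ) (A \<times> D)
      = emeasure (density M (\<lambda>\<omega>. ennreal (h \<omega>))) (?XZ -` (A \<times> D) \<inter> space M)"
      by (subst emeasure_distr) auto
    also have "\<dots> = (\<integral>\<^sup>+\<omega>. ennreal (h \<omega>) * indicator (?XZ -` (A \<times> D) \<inter> space M) \<omega> \<partial>M)"
      by (subst emeasure_density) auto
    also have "\<dots> = (\<integral>\<^sup>+\<omega>. ennreal (indicator {\<omega>. X \<omega> \<in> A \<and> Z \<omega> \<in> D} \<omega> * h \<omega>) \<partial>M)"
      by (intro nn_integral_cong) (auto simp: indicator_def)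
    also have "\<dots> = ennreal (expectation (\<lambda>\<omega>. indicator {\<omega>. X \<omega> \<in> A \<and> Z \<omega> \<in> D} \<omega> * h \<omega>))"
    proof (rule nn_integral_eq_integral)
      have [measurable]: "(\<lambda>\<omega>. indicator {\<omega>. X \<omega> \<in> A \<and> Z \<omega> \<in> D} \<omega> :: real) \<in> borel_measurable M"
        unfolding indicator_def mem_Collect_eq by measurable
      show "integrable M (\<lambda>\<omega>. indicator {\<omega>. X \<omega> \<in> A \<and> Z \<omega> \<in> D} \<omega> * h \<omega>)"
        by (rule Bochner_Integration.integrable_bound[OF h(1)]) (auto simp: indicator_def)
    qed (use h in auto)
    finally show ?thesis .
  qed
  have "\<mu>u = \<mu>v"
  proof (rule measure_eqI_generator_eq[where E="{A \<times> D |A D. A \<in> sets (borel :: real measure) \<and> D \<in> sets (borel :: 'b measure)}"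
        and \<Omega>=UNIV and A="\<lambda>_. UNIV"])
    show "Int_stable {A \<times> D |A D. A \<in> sets (borel :: real measure) \<and> D \<in> sets (borel :: 'b measure)}"
      unfolding Int_stable_def by (auto simp: Times_Int_Times) (metis sets.Int)
    fix G assume "G \<in> {A \<times> D |A D. A \<in> sets (borel :: real measure) \<and> D \<in> sets (borel :: 'b measure)}"
    then obtain A D where AD: "G = A \<times> D" "A \<in> sets borel" "D \<in> sets borel" by auto
    have "expectation (\<lambda>\<omega>. indicator {\<omega>. X \<omega> \<in> A \<and> Z \<omega> \<in> D} \<omega> * r \<omega>) = 0"
      unfolding r_def by (rule cond_indep_residual_rectangle[OF reg ci X Z AD(2,3)])
    moreover have "integrable M (\<lambda>\<omega>. indicator {\<omega>. X \<omega> \<in> A \<and> Z \<omega> \<in> D} \<omega> * h \<omega>)" if h: "integrable M h" for h :: "'a \<Rightarrow> real"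
    proof (rule Bochner_Integration.integrable_bound[OF h])
      note AD(2,3)[measurable]
      have [measurable]: "(\<lambda>\<omega>. indicator {\<omega>. X \<omega> \<in> A \<and> Z \<omega> \<in> D} \<omega> :: real) \<in> borel_measurable M"
        unfolding indicator_def mem_Collect_eq by measurable
      show "(\<lambda>\<omega>. indicator {\<omega>. X \<omega> \<in> A \<and> Z \<omega> \<in> D} \<omega> * h \<omega>) \<in> borel_measurable M"
        using borel_measurable_integrable[OF h] by measurable
    qed (auto simp: indicator_def)
    note this[OF uvi(1)] this[OF uvi(2)]
    ultimately have "expectation (\<lambda>\<omega>. indicator {\<omega>. X \<omega> \<in> A \<and> Z \<omega> \<in> D} \<omega> * u \<omega>)
        = expectation (\<lambda>\<omega>. indicator {\<omega>. X \<omega> \<in> A \<and> Z \<omega> \<in> D} \<omega> * v \<omega>)"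
      unfolding uv(3) by (simp add: right_diff_distrib)
    then show "emeasure \<mu>u G = emeasure \<mu>v G"
      unfolding \<mu>u_def \<mu>v_def AD(1) using AD uvi uv by (simp add: em)
  next
    show "sets \<mu>u = sigma_sets UNIV {A \<times> D |A D. A \<in> sets (borel :: real measure) \<and> D \<in> sets (borel :: 'b measure)}"
      "sets \<mu>v = sigma_sets UNIV {A \<times> D |A D. A \<in> sets (borel :: real measure) \<and> D \<in> sets (borel :: 'b measure)}"
      unfolding \<mu>u_def \<mu>v_def by (simp_all add: sets_pair_measure)
    fix i :: nat
    have "emeasure \<mu>u (UNIV \<times> UNIV) \<noteq> \<infinity>" unfolding \<mu>u_def using uvi uv by (subst em) auto
    then show "emeasure \<mu>u UNIV \<noteq> \<infinity>" by simp
  next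
    show "range (\<lambda>_. UNIV) \<subseteq> {A \<times> D |A D. A \<in> sets (borel :: real measure) \<and> D \<in> sets (borel :: 'b measure)}"
      by (auto intro!: exI[of _ UNIV] simp: UNIV_Times_UNIV)
  qed auto
  define s where "s xz = fst xz - g (snd xz)" for xz :: "real \<times> 'b"
  have sm: "s \<in> borel_measurable (borel \<Otimes>\<^sub>M borel)" unfolding s_def by measurable
  have tr: "integral\<^sup>L (distr (density M (\<lambda>\<omega>. ennreal (h \<omega>))) (borel \<Otimes>\<^sub>M borel) ?XZ) s = expectation (\<lambda>\<omega>. h \<omega> * s (X \<omega>, Z \<omega>))"
    if [measurable]: "h \<in> borel_measurable M" and h: "\<And>\<omega>. 0 \<le> h \<omega>" for h
  proof -
    have [measurable]: "(\<lambda>\<omega>. s (X \<omega>, Z \<omega>)) \<in> borel_measurable M" unfolding s_def by measurable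
    show ?thesis
      by (subst integral_distr) (use h sm in \<open>auto simp: integral_real_density\<close>)
  qed
  have "expectation (\<lambda>\<omega>. u \<omega> * s (X \<omega>, Z \<omega>)) = expectation (\<lambda>\<omega>. v \<omega> * s (X \<omega>, Z \<omega>))"
    using tr[of u] tr[of v] \<open>\<mu>u = \<mu>v\<close> uv unfolding \<mu>u_def \<mu>v_def by simp
  moreover have "integrable M (\<lambda>\<omega>. h \<omega> * s (X \<omega>, Z \<omega>))" if [measurable]: "h \<in> borel_measurable M" and "\<And>\<omega>. \<bar>h \<omega>\<bar> \<le> \<bar>r \<omega>\<bar>" for h
  proof (rule Bochner_Integration.integrable_bound[OF int])
    have [measurable]: "(\<lambda>\<omega>. s (X \<omega>, Z \<omega>)) \<in> borel_measurable M" unfolding s_def by measurable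
    show "(\<lambda>\<omega>. h \<omega> * s (X \<omega>, Z \<omega>)) \<in> borel_measurable M" by measurable
    show "AE \<omega> in M. norm (h \<omega> * s (X \<omega>, Z \<omega>)) \<le> norm ((X \<omega> - g (Z \<omega>)) * (Y \<omega> - f (Z \<omega>)))"
    proof (intro AE_I2)
      fix \<omega>
      have "\<bar>h \<omega>\<bar> * \<bar>s (X \<omega>, Z \<omega>)\<bar> \<le> \<bar>r \<omega>\<bar> * \<bar>s (X \<omega>, Z \<omega>)\<bar>" using that(2) by (intro mult_right_mono) auto
      then show "norm (h \<omega> * s (X \<omega>, Z \<omega>)) \<le> norm ((X \<omega> - g (Z \<omega>)) * (Y \<omega> - f (Z \<omega>)))"
        unfolding s_def r_def by (simp add: abs_mult mult.commute)
    qed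
  qed
  note this[of u] this[of v]
  moreover have "\<bar>u \<omega>\<bar> \<le> \<bar>r \<omega>\<bar>" "\<bar>v \<omega>\<bar> \<le> \<bar>r \<omega>\<bar>" for \<omega> unfolding u_def v_def by auto
  ultimately have "expectation (\<lambda>\<omega>. u \<omega> * s (X \<omega>, Z \<omega>) - v \<omega> * s (X \<omega>, Z \<omega>)) = 0" by simp
  moreover have "u \<omega> * s (X \<omega>, Z \<omega>) - v \<omega> * s (X \<omega>, Z \<omega>) = (X \<omega> - g (Z \<omega>)) * (Y \<omega> - f (Z \<omega>))" for \<omega>
    unfolding left_diff_distrib[symmetric] uv(3)[symmetric] by (simp add: s_def r_def mult.commute)
  ultimately show ?thesis by simp
qed

end

section \<open>Averaging over the training data\<close>

text \<open>For independent \<open>A\<close> and \<open>B\<close> the expectation may be computed by freezing \<open>B\<close> at an independent copy. This replaces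
  conditioning on the training data.\<close>

lemma (in prob_space) nn_integral_decouple:
  assumes iv: "indep_var S A T B" and f: "f \<in> borel_measurable (S \<Otimes>\<^sub>M T)"
  shows "(\<integral>\<^sup>+\<omega>. f (A \<omega>, B \<omega>) \<partial>M) = (\<integral>\<^sup>+\<omega>'. (\<integral>\<^sup>+\<omega>. f (A \<omega>, B \<omega>') \<partial>M) \<partial>M)"
proof -
  have A: "A \<in> measurable M S" and B: "B \<in> measurable M T"
    and eq: "distr M S A \<Otimes>\<^sub>M distr M T B = distr M (S \<Otimes>\<^sub>M T) (\<lambda>\<omega>. (A \<omega>, B \<omega>))"
    using iv unfolding indep_var_distribution_eq by auto
  interpret A: prob_space "distr M S A" by (rule prob_space_distr[OF A])
  interpret B: prob_space "distr M T B" by (rule prob_space_distr[OF B])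
  interpret pair_sigma_finite "distr M S A" "distr M T B" ..
  have f': "f \<in> borel_measurable (distr M S A \<Otimes>\<^sub>M distr M T B)"
    using f by (simp cong: measurable_cong_sets sets_pair_measure_cong)
  have "(\<integral>\<^sup>+\<omega>. f (A \<omega>, B \<omega>) \<partial>M) = (\<integral>\<^sup>+x. f x \<partial>distr M (S \<Otimes>\<^sub>M T) (\<lambda>\<omega>. (A \<omega>, B \<omega>)))"
    using A B f by (subst nn_integral_distr) auto
  also have "\<dots> = (\<integral>\<^sup>+y. (\<integral>\<^sup>+x. f (x, y) \<partial>distr M S A) \<partial>distr M T B)"
    unfolding eq[symmetric] by (rule nn_integral_snd[symmetric, OF f'])
  also have "\<dots> = (\<integral>\<^sup>+\<omega>'. (\<integral>\<^sup>+x. f (x, B \<omega>') \<partial>distr M S A) \<partial>M)"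
  proof (rule nn_integral_distr[OF B])
    have "(\<lambda>(y, x). f (x, y)) \<in> borel_measurable (T \<Otimes>\<^sub>M distr M S A)"
      using measurable_compose[OF measurable_pair_swap' f] by (simp add: split_def cong: measurable_cong_sets sets_pair_measure_cong)
    from A.borel_measurable_nn_integral[OF this]
    show "(\<lambda>y. \<integral>\<^sup>+x. f (x, y) \<partial>distr M S A) \<in> borel_measurable (distr M T B)" by simp
  qed
  also have "\<dots> = (\<integral>\<^sup>+\<omega>'. (\<integral>\<^sup>+\<omega>. f (A \<omega>, B \<omega>') \<partial>M) \<partial>M)"
  proof (intro nn_integral_cong)
    fix \<omega>' assume "\<omega>' \<in> space M"
    then have "B \<omega>' \<in> space T" by (rule measurable_space[OF B])
    from measurable_compose[OF measurable_Pair2'[OF this] f] show "(\<integral>\<^sup>+x. f (x, B \<omega>') \<partial>distr M S A) = (\<integral>\<^sup>+\<omega>. f (A \<omega>, B \<omega>') \<partial>M)"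
      by (intro nn_integral_distr[OF A]) simp
  qed
  finally show ?thesis .
qed

locale sample_split = prob_space M for M :: "'a measure" +
  fixes W W' :: "nat \<Rightarrow> 'a \<Rightarrow> 'b::topological_space"
  assumes iid: "iid_seq M W" and copy: "training_copy M W W'"
begin

abbreviation "D \<equiv> training_data W'"

lemma W_indep: "indep_vars (\<lambda>_. borel) W {1..}"
  using iid unfolding iid_seq_def by simp

lemma W_measurable [measurable]: "1 \<le> i \<Longrightarrow> W i \<in> measurable M borel"
  using W_indep unfolding indep_vars_def2 by auto

lemma W'_measurable [measurable]: "1 \<le> i \<Longrightarrow> W' i \<in> measurable M borel"
  using copy unfolding training_copy_def iid_seq_def indep_vars_def2 by auto

lemma W_ident: "1 \<le> i \<Longrightarrow> distr M borel (W i) = distr M borel (W 1)"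
  using iid unfolding iid_seq_def by blast

lemma D_measurable [measurable]: "D n \<in> measurable M (PiM {1..n} (\<lambda>_. borel))"
  unfolding training_data_def[abs_def] by (intro measurable_restrict W'_measurable) auto

lemma D_space: "D n \<omega> \<in> space (PiM {1..n} (\<lambda>_. borel))"
  unfolding training_data_def by (auto simp: space_PiM)

lemma decouple_paths:
  assumes "f \<in> borel_measurable (PiM {1..} (\<lambda>_. borel) \<Otimes>\<^sub>M PiM {1..} (\<lambda>_. borel))"
  shows "(\<integral>\<^sup>+\<omega>. f ((\<lambda>i\<in>{1..}. W i \<omega>), (\<lambda>i\<in>{1..}. W' i \<omega>)) \<partial>M)
    = (\<integral>\<^sup>+\<omega>'. (\<integral>\<^sup>+\<omega>. f ((\<lambda>i\<in>{1..}. W i \<omega>), (\<lambda>i\<in>{1..}. W' i \<omega>')) \<partial>M) \<partial>M)"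
  by (rule nn_integral_decouple[OF _ assms]) (use copy in \<open>simp add: training_copy_def\<close>)

lemma restrict_training [measurable]:
  "(\<lambda>w'. restrict w' {1..n}) \<in> measurable (PiM {1..} (\<lambda>_. borel)) (PiM {1..n} (\<lambda>_. borel))"
  by (intro measurable_restrict measurable_component_singleton) auto

lemma restrict_path: "restrict (\<lambda>i\<in>{1..}. W' i \<omega>) {1..n} = D n \<omega>"
  unfolding training_data_def by (auto simp: restrict_def)

lemma decouple_point:
  assumes g: "g \<in> borel_measurable (borel \<Otimes>\<^sub>M PiM {1..n} (\<lambda>_. borel))" and i: "1 \<le> i"
  shows "(\<integral>\<^sup>+\<omega>. g (W i \<omega>, D n \<omega>) \<partial>M) = (\<integral>\<^sup>+\<omega>'. (\<integral>\<^sup>+\<omega>. g (W 1 \<omega>, D n \<omega>') \<partial>M) \<partial>M)"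
proof -
  define f where "f ww = g (fst ww i, restrict (snd ww) {1..n})" for ww :: "(nat \<Rightarrow> 'b) \<times> (nat \<Rightarrow> 'b)"
  have [measurable]: "(\<lambda>w. w i) \<in> measurable (PiM {1..} (\<lambda>_. borel :: 'b measure)) borel"
    using i by (intro measurable_component_singleton) auto
  have "f \<in> borel_measurable (PiM {1..} (\<lambda>_. borel) \<Otimes>\<^sub>M PiM {1..} (\<lambda>_. borel))"
    unfolding f_def by (rule measurable_compose[OF _ g]) measurable
  from decouple_paths[OF this]
  have "(\<integral>\<^sup>+\<omega>. g (W i \<omega>, D n \<omega>) \<partial>M) = (\<integral>\<^sup>+\<omega>'. (\<integral>\<^sup>+\<omega>. g (W i \<omega>, D n \<omega>') \<partial>M) \<partial>M)"
    unfolding f_def fst_conv snd_conv restrict_path using i by simp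
  also have "\<dots> = (\<integral>\<^sup>+\<omega>'. (\<integral>\<^sup>+\<omega>. g (W 1 \<omega>, D n \<omega>') \<partial>M) \<partial>M)"
  proof (rule nn_integral_cong)
    fix \<omega>'
    have m: "(\<lambda>w. g (w, D n \<omega>')) \<in> borel_measurable borel"
      by (rule measurable_compose[OF measurable_Pair2'[OF D_space] g])
    have tr: "(\<integral>\<^sup>+\<omega>. g (W j \<omega>, D n \<omega>') \<partial>M) = (\<integral>\<^sup>+w. g (w, D n \<omega>') \<partial>distr M borel (W j))" if "1 \<le> j" for j
      using m by (intro nn_integral_distr[OF W_measurable[OF that], symmetric]) simp
    show "(\<integral>\<^sup>+\<omega>. g (W i \<omega>, D n \<omega>') \<partial>M) = (\<integral>\<^sup>+\<omega>. g (W 1 \<omega>, D n \<omega>') \<partial>M)"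
      unfolding tr[OF i] tr[OF order_refl] W_ident[OF i] ..
  qed
  finally show ?thesis .
qed

corollary same_law:
  assumes g: "g \<in> borel_measurable (borel \<Otimes>\<^sub>M PiM {1..n} (\<lambda>_. borel))" and i: "1 \<le> i"
  shows "(\<integral>\<^sup>+\<omega>. g (W i \<omega>, D n \<omega>) \<partial>M) = (\<integral>\<^sup>+\<omega>. g (W 1 \<omega>, D n \<omega>) \<partial>M)"
  by (rule trans[OF decouple_point[OF g i] decouple_point[OF g order_refl, symmetric]])

text \<open>Given the training data the summands are independent and centred, so the maximal inequality applies
  to almost every realisation; as its right-hand side is linear in the second moments, it can be averaged.\<close>

lemma cross_terms_tail:
  fixes G :: "nat \<Rightarrow> (nat \<Rightarrow> 'b) \<Rightarrow> 'b \<Rightarrow> real"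
  assumes G: "\<And>i. 1 \<le> i \<Longrightarrow> (\<lambda>(w, d). G i d w) \<in> borel_measurable (borel \<Otimes>\<^sub>M PiM {1..i} (\<lambda>_. borel))"
    and centred: "\<And>i d. 1 \<le> i \<Longrightarrow> d \<in> space (PiM {1..i} (\<lambda>_. borel)) \<Longrightarrow>
      integrable M (\<lambda>\<omega>. G i d (W 1 \<omega>)) \<Longrightarrow> expectation (\<lambda>\<omega>. G i d (W 1 \<omega>)) = 0"
    and V: "\<And>i. 1 \<le> i \<Longrightarrow> (\<integral>\<^sup>+\<omega>. ennreal ((G i (D i \<omega>) (W 1 \<omega>))\<^sup>2) \<partial>M) \<le> ennreal (V i)"
    and V0: "\<And>i. 0 \<le> V i"
    and w: "\<And>i. 1 \<le> i \<Longrightarrow> 0 < w i" and mono: "\<And>i j. 1 \<le> i \<Longrightarrow> i \<le> j \<Longrightarrow> w i \<le> w j"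
    and e: "0 < e" and m: "1 \<le> m"
  shows "ennreal (prob {\<omega> \<in> space M. \<exists>k\<ge>m. 5 * e * w k < \<bar>\<Sum>i\<in>{1..k}. G i (D i \<omega>) (W i \<omega>)\<bar>})
    \<le> (\<Sum>i. if 1 \<le> i then ennreal (2 / e\<^sup>2 * V i / (max (w i) (w m))\<^sup>2) else 0)"
proof -
  define c where "c i = ennreal (2 / e\<^sup>2 / (max (w i) (w m))\<^sup>2)" for i
  define v where "v i \<omega>' = (\<integral>\<^sup>+\<omega>. ennreal ((G i (D i \<omega>') (W 1 \<omega>))\<^sup>2) \<partial>M)" for i \<omega>'
  have G2: "(\<lambda>(w, d). ennreal ((G i d w)\<^sup>2)) \<in> borel_measurable (borel \<Otimes>\<^sub>M PiM {1..i} (\<lambda>_. borel))" if "1 \<le> i" for i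
    using G[OF that] unfolding split_def by measurable
  have v_int: "(\<integral>\<^sup>+\<omega>'. v i \<omega>' \<partial>M) \<le> ennreal (V i)" if i: "1 \<le> i" for i
    using V[OF i] decouple_point[OF G2[OF i] order_refl] unfolding v_def by simp
  have v_meas: "v i \<in> borel_measurable M" if i: "1 \<le> i" for i
  proof -
    have "(\<lambda>(d, \<omega>). ennreal ((G i d (W 1 \<omega>))\<^sup>2)) \<in> borel_measurable (PiM {1..i} (\<lambda>_. borel) \<Otimes>\<^sub>M M)"
    proof -
      have [measurable]: "W 1 \<in> measurable M borel" by simp
      have "(\<lambda>x. (W 1 (snd x), fst x)) \<in> measurable (PiM {1..i} (\<lambda>_. borel) \<Otimes>\<^sub>M M) (borel \<Otimes>\<^sub>M PiM {1..i} (\<lambda>_. borel))"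
        by measurable
      from measurable_compose[OF this G2[OF i]] show ?thesis by (simp add: split_def)
    qed
    from borel_measurable_nn_integral[OF this]
    have "(\<lambda>d. \<integral>\<^sup>+\<omega>. ennreal ((G i d (W 1 \<omega>))\<^sup>2) \<partial>M) \<in> borel_measurable (PiM {1..i} (\<lambda>_. borel))" .
    from measurable_compose[OF D_measurable this] show ?thesis unfolding v_def .
  qed
  have fin: "AE \<omega>' in M. \<forall>i. 1 \<le> i \<longrightarrow> v i \<omega>' < \<infinity>"
  proof (subst AE_all_countable, intro allI)
    fix i
    show "AE \<omega>' in M. 1 \<le> i \<longrightarrow> v i \<omega>' < \<infinity>"
    proof (cases "1 \<le> i")
      case True
      have "(\<integral>\<^sup>+\<omega>'. v i \<omega>' \<partial>M) < \<infinity>" using v_int[OF True] by (rule order_le_less_trans) simp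
      then have "AE \<omega>' in M. v i \<omega>' \<noteq> \<infinity>" using v_meas[OF True] by (intro nn_integral_PInf_AE) auto
      then show ?thesis by eventually_elim (simp add: less_top)
    qed simp
  qed
  have Gd: "(\<lambda>x. G i d x) \<in> borel_measurable borel" if "1 \<le> i" "d \<in> space (PiM {1..i} (\<lambda>_. borel))" for i d
    using measurable_compose[OF measurable_Pair2'[OF that(2)] G[OF that(1)]] by simp
  have cond: "emeasure M {\<omega> \<in> space M. \<exists>k\<ge>m. 5 * e * w k < \<bar>\<Sum>i\<in>{1..k}. G i (D i \<omega>') (W i \<omega>)\<bar>}
      \<le> (\<Sum>i. if 1 \<le> i then c i * v i \<omega>' else 0)" if f: "\<forall>i. 1 \<le> i \<longrightarrow> v i \<omega>' < \<infinity>" for \<omega>'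
  proof -
    define Y where "Y i \<omega> = G i (D i \<omega>') (W i \<omega>)" for i \<omega>
    have Yindep: "indep_vars (\<lambda>_. borel) Y {1..}"
      unfolding Y_def by (rule indep_vars_compose2[OF W_indep]) (auto intro: Gd D_space)
    have sq: "(\<integral>\<^sup>+\<omega>. ennreal ((Y i \<omega>)\<^sup>2) \<partial>M) = v i \<omega>'" and
      Y1: "integrable M (Y i) \<longleftrightarrow> integrable M (\<lambda>\<omega>. G i (D i \<omega>') (W 1 \<omega>))"
        "expectation (Y i) = expectation (\<lambda>\<omega>. G i (D i \<omega>') (W 1 \<omega>))" if i: "1 \<le> i" for i
    proof -
      note gm = Gd[OF i D_space]
      have g2: "(\<lambda>x. ennreal ((G i (D i \<omega>') x)\<^sup>2)) \<in> borel_measurable borel" using gm by measurable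
      have tr: "(\<integral>\<^sup>+\<omega>. ennreal ((G i (D i \<omega>') (W j \<omega>))\<^sup>2) \<partial>M) = (\<integral>\<^sup>+x. ennreal ((G i (D i \<omega>') x)\<^sup>2) \<partial>distr M borel (W j))"
        if "1 \<le> j" for j using g2 by (intro nn_integral_distr[OF W_measurable[OF that], symmetric]) simp
      show "(\<integral>\<^sup>+\<omega>. ennreal ((Y i \<omega>)\<^sup>2) \<partial>M) = v i \<omega>'"
        unfolding Y_def v_def tr[OF i] tr[OF order_refl] W_ident[OF i] ..
      show "integrable M (Y i) \<longleftrightarrow> integrable M (\<lambda>\<omega>. G i (D i \<omega>') (W 1 \<omega>))"
        unfolding Y_def integrable_distr_eq[OF W_measurable[OF i] gm, symmetric]
          integrable_distr_eq[OF W_measurable[OF order_refl] gm, symmetric] W_ident[OF i] ..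
      show "expectation (Y i) = expectation (\<lambda>\<omega>. G i (D i \<omega>') (W 1 \<omega>))"
        unfolding Y_def integral_distr[OF W_measurable[OF i] gm, symmetric]
          integral_distr[OF W_measurable[OF order_refl] gm, symmetric] W_ident[OF i] ..
    qed
    have Ym: "Y i \<in> borel_measurable M" if "1 \<le> i" for i
      using Yindep that unfolding indep_vars_def2 by auto
    have Ysq: "integrable M (\<lambda>\<omega>. (Y i \<omega>)\<^sup>2)" if i: "1 \<le> i" for i
      using f sq[OF i] i Ym[OF i] by (intro integrableI_bounded) auto
    have Yint: "integrable M (Y i)" if i: "1 \<le> i" for i
      by (rule square_integrable_imp_integrable[OF Ym[OF i] Ysq[OF i]])
    have Ymean: "expectation (Y i) = 0" if i: "1 \<le> i" for i
      using centred[OF i D_space] Yint[OF i] Y1[OF i] by simp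
    have "emeasure M {\<omega> \<in> space M. \<exists>k\<ge>m. 5 * e * w k < \<bar>\<Sum>i\<in>{1..k}. Y i \<omega>\<bar>}
      \<le> (\<Sum>i. if 1 \<le> i then ennreal (2 / e\<^sup>2 * expectation (\<lambda>\<omega>. (Y i \<omega>)\<^sup>2) / (max (w i) (w m))\<^sup>2) else 0)"
      unfolding emeasure_eq_measure by (intro weighted_partial_sums_tail Yindep Yint Ysq Ymean w mono e m)
    also have "\<dots> = (\<Sum>i. if 1 \<le> i then c i * v i \<omega>' else 0)"
    proof (intro suminf_cong)
      fix i
      show "(if 1 \<le> i then ennreal (2 / e\<^sup>2 * expectation (\<lambda>\<omega>. (Y i \<omega>)\<^sup>2) / (max (w i) (w m))\<^sup>2) else 0)
        = (if 1 \<le> i then c i * v i \<omega>' else 0)"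
      proof (cases "1 \<le> i")
        case True
        have "v i \<omega>' = ennreal (expectation (\<lambda>\<omega>. (Y i \<omega>)\<^sup>2))"
          unfolding sq[OF True, symmetric] by (intro nn_integral_eq_integral Ysq True) auto
        then have "c i * v i \<omega>' = ennreal (2 / e\<^sup>2 / (max (w i) (w m))\<^sup>2 * expectation (\<lambda>\<omega>. (Y i \<omega>)\<^sup>2))"
          unfolding c_def by (simp add: ennreal_mult''[symmetric])
        then show ?thesis using True by (simp add: mult_ac)
      qed simp
    qed
    finally show ?thesis unfolding Y_def .
  qed
  define Ev where "Ev = (\<lambda>ww :: (nat \<Rightarrow> 'b) \<times> (nat \<Rightarrow> 'b). \<exists>k\<ge>m. 5 * e * w k < \<bar>\<Sum>i\<in>{1..k}. G i (restrict (snd ww) {1..i}) (fst ww i)\<bar>)"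
  have Ev_meas: "Measurable.pred (PiM {1..} (\<lambda>_. borel) \<Otimes>\<^sub>M PiM {1..} (\<lambda>_. borel)) Ev"
  proof -
    have s [measurable]: "(\<lambda>ww. G i (restrict (snd ww) {1..i}) (fst ww i))
        \<in> borel_measurable (PiM {1..} (\<lambda>_. borel) \<Otimes>\<^sub>M PiM {1..} (\<lambda>_. borel))" if i: "1 \<le> i" for i
    proof -
      have [measurable]: "(\<lambda>w. w i) \<in> measurable (PiM {1..} (\<lambda>_. borel :: 'b measure)) borel"
        using i by (intro measurable_component_singleton) auto
      have "(\<lambda>ww :: (nat \<Rightarrow> 'b) \<times> (nat \<Rightarrow> 'b). (fst ww i, restrict (snd ww) {1..i}))
        \<in> measurable (PiM {1..} (\<lambda>_. borel) \<Otimes>\<^sub>M PiM {1..} (\<lambda>_. borel)) (borel \<Otimes>\<^sub>M PiM {1..i} (\<lambda>_. borel :: 'b measure))"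
        by measurable
      from measurable_compose[OF this G[OF i]] show ?thesis by simp
    qed
    have [measurable]: "(\<lambda>ww. \<Sum>i\<in>{1..k}. G i (restrict (snd ww) {1..i}) (fst ww i))
        \<in> borel_measurable (PiM {1..} (\<lambda>_. borel) \<Otimes>\<^sub>M PiM {1..} (\<lambda>_. borel))" for k
      by (intro borel_measurable_sum s) auto
    show ?thesis unfolding Ev_def by measurable
  qed
  have Ev_eq: "Ev ((\<lambda>i\<in>{1..}. W i \<omega>), (\<lambda>i\<in>{1..}. W' i \<omega>')) \<longleftrightarrow>
      (\<exists>k\<ge>m. 5 * e * w k < \<bar>\<Sum>i\<in>{1..k}. G i (D i \<omega>') (W i \<omega>)\<bar>)" for \<omega> \<omega>'
  proof -
    have "(\<Sum>i\<in>{1..k}. G i (restrict (\<lambda>i\<in>{1..}. W' i \<omega>') {1..i}) ((\<lambda>i\<in>{1..}. W i \<omega>) i))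
      = (\<Sum>i\<in>{1..k}. G i (D i \<omega>') (W i \<omega>))" for k
      unfolding restrict_path by (intro sum.cong refl) simp
    then show ?thesis unfolding Ev_def by simp
  qed
  have pathW: "(\<lambda>\<omega>. (\<lambda>i\<in>{1..}. W i \<omega>)) \<in> measurable M (PiM {1..} (\<lambda>_. borel))"
    "(\<lambda>\<omega>. (\<lambda>i\<in>{1..}. W' i \<omega>)) \<in> measurable M (PiM {1..} (\<lambda>_. borel))"
    by (intro measurable_restrict W_measurable W'_measurable; simp)+
  have as_int: "emeasure M {\<omega> \<in> space M. P \<omega>} = (\<integral>\<^sup>+\<omega>. (if P \<omega> then 1 else 0) \<partial>M)"
    if "{\<omega> \<in> space M. P \<omega>} \<in> events" for P
  proof -
    have "emeasure M {\<omega> \<in> space M. P \<omega>} = (\<integral>\<^sup>+\<omega>. indicator {\<omega> \<in> space M. P \<omega>} \<omega> \<partial>M)" using that by simp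
    also have "\<dots> = (\<integral>\<^sup>+\<omega>. (if P \<omega> then 1 else 0) \<partial>M)" by (intro nn_integral_cong) (auto simp: indicator_def)
    finally show ?thesis .
  qed
  have ev1: "{\<omega> \<in> space M. Ev ((\<lambda>i\<in>{1..}. W i \<omega>), (\<lambda>i\<in>{1..}. W' i \<omega>))} \<in> events"
    using measurable_compose[OF measurable_Pair[OF pathW] Ev_meas] by (simp add: pred_def)
  have ev2: "{\<omega> \<in> space M. Ev ((\<lambda>i\<in>{1..}. W i \<omega>), (\<lambda>i\<in>{1..}. W' i \<omega>'))} \<in> events" for \<omega>'
  proof -
    have "(\<lambda>i\<in>{1..}. W' i \<omega>') \<in> space (PiM {1..} (\<lambda>_. borel))" by (auto simp: space_PiM)
    from measurable_compose[OF measurable_compose[OF pathW(1) measurable_Pair2'[OF this]] Ev_meas]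
    show ?thesis by (simp add: pred_def)
  qed
  have "ennreal (prob {\<omega> \<in> space M. \<exists>k\<ge>m. 5 * e * w k < \<bar>\<Sum>i\<in>{1..k}. G i (D i \<omega>) (W i \<omega>)\<bar>})
    = (\<integral>\<^sup>+\<omega>. (if Ev ((\<lambda>i\<in>{1..}. W i \<omega>), (\<lambda>i\<in>{1..}. W' i \<omega>)) then 1 else 0) \<partial>M)"
    using as_int[OF ev1] unfolding Ev_eq emeasure_eq_measure by simp
  also have "\<dots> = (\<integral>\<^sup>+\<omega>'. (\<integral>\<^sup>+\<omega>. (if Ev ((\<lambda>i\<in>{1..}. W i \<omega>), (\<lambda>i\<in>{1..}. W' i \<omega>')) then 1 else 0) \<partial>M) \<partial>M)"
    by (rule decouple_paths[where f="\<lambda>ww. if Ev ww then 1 else 0"]) (use Ev_meas in measurable)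
  also have "\<dots> = (\<integral>\<^sup>+\<omega>'. emeasure M {\<omega> \<in> space M. \<exists>k\<ge>m. 5 * e * w k < \<bar>\<Sum>i\<in>{1..k}. G i (D i \<omega>') (W i \<omega>)\<bar>} \<partial>M)"
    using as_int[OF ev2] unfolding Ev_eq by simp
  also have "\<dots> \<le> (\<integral>\<^sup>+\<omega>'. (\<Sum>i. if 1 \<le> i then c i * v i \<omega>' else 0) \<partial>M)"
  proof (rule nn_integral_mono_AE)
    show "AE \<omega>' in M. emeasure M {\<omega> \<in> space M. \<exists>k\<ge>m. 5 * e * w k < \<bar>\<Sum>i\<in>{1..k}. G i (D i \<omega>') (W i \<omega>)\<bar>}
      \<le> (\<Sum>i. if 1 \<le> i then c i * v i \<omega>' else 0)"
      using fin by eventually_elim (rule cond)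
  qed
  also have "\<dots> = (\<Sum>i. \<integral>\<^sup>+\<omega>'. (if 1 \<le> i then c i * v i \<omega>' else 0) \<partial>M)"
  proof (rule nn_integral_suminf)
    fix i
    show "(\<lambda>\<omega>'. if 1 \<le> i then c i * v i \<omega>' else 0) \<in> borel_measurable M"
      using v_meas[of i] by (cases "1 \<le> i") auto
  qed
  also have "\<dots> \<le> (\<Sum>i. if 1 \<le> i then ennreal (2 / e\<^sup>2 * V i / (max (w i) (w m))\<^sup>2) else 0)"
  proof (intro suminf_le summableI)
    fix i
    show "(\<integral>\<^sup>+\<omega>'. (if 1 \<le> i then c i * v i \<omega>' else 0) \<partial>M)
      \<le> (if 1 \<le> i then ennreal (2 / e\<^sup>2 * V i / (max (w i) (w m))\<^sup>2) else 0)"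
    proof (cases "1 \<le> i")
      case True
      have "(\<integral>\<^sup>+\<omega>'. c i * v i \<omega>' \<partial>M) = c i * (\<integral>\<^sup>+\<omega>'. v i \<omega>' \<partial>M)"
        by (rule nn_integral_cmult[OF v_meas[OF True]])
      also have "\<dots> \<le> c i * ennreal (V i)" by (intro mult_left_mono v_int True) simp
      also have "\<dots> = ennreal (2 / e\<^sup>2 / (max (w i) (w m))\<^sup>2 * V i)"
        unfolding c_def using V0 by (simp add: ennreal_mult''[symmetric])
      finally show ?thesis using True by (simp add: mult_ac)
    qed simp
  qed
  finally show ?thesis .
qed

text \<open>Almost every realisation of the training data has an integrable section, which has mean \<open>0\<close>. Positive and negative parts
  are averaged separately so that only integrals of nonnegative functions are decoupled.\<close>

lemma centred_average:
  fixes G :: "(nat \<Rightarrow> 'b) \<Rightarrow> 'b \<Rightarrow> real"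
  assumes G: "(\<lambda>(w, d). G d w) \<in> borel_measurable (borel \<Otimes>\<^sub>M PiM {1..n} (\<lambda>_. borel))"
    and centred: "\<And>d. d \<in> space (PiM {1..n} (\<lambda>_. borel)) \<Longrightarrow>
      integrable M (\<lambda>\<omega>. G d (W 1 \<omega>)) \<Longrightarrow> expectation (\<lambda>\<omega>. G d (W 1 \<omega>)) = 0"
    and int: "integrable M (\<lambda>\<omega>. G (D n \<omega>) (W 1 \<omega>))"
  shows "expectation (\<lambda>\<omega>. G (D n \<omega>) (W 1 \<omega>)) = 0"
proof -
  have W1 [measurable]: "W 1 \<in> measurable M borel" by simp
  have Gf: "(\<lambda>(w, d). ennreal (f (G d w))) \<in> borel_measurable (borel \<Otimes>\<^sub>M PiM {1..n} (\<lambda>_. borel))"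
    if [measurable]: "f \<in> borel_measurable borel" for f :: "real \<Rightarrow> real"
    using G unfolding split_def by measurable
  have dec: "(\<integral>\<^sup>+\<omega>. ennreal (f (G (D n \<omega>) (W 1 \<omega>))) \<partial>M)
    = (\<integral>\<^sup>+\<omega>'. (\<integral>\<^sup>+\<omega>. ennreal (f (G (D n \<omega>') (W 1 \<omega>))) \<partial>M) \<partial>M)"
    if "f \<in> borel_measurable borel" for f :: "real \<Rightarrow> real"
    using decouple_point[OF Gf[OF that] order_refl] by simp
  define A where "A \<omega>' = (\<integral>\<^sup>+\<omega>. ennreal \<bar>G (D n \<omega>') (W 1 \<omega>)\<bar> \<partial>M)" for \<omega>'
  have A_meas: "A \<in> borel_measurable M"
  proof -
    have "(\<lambda>x. (W 1 (snd x), fst x)) \<in> measurable (PiM {1..n} (\<lambda>_. borel) \<Otimes>\<^sub>M M) (borel \<Otimes>\<^sub>M PiM {1..n} (\<lambda>_. borel))"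
      by measurable
    from measurable_compose[OF this Gf[of abs]]
    have "(\<lambda>(d, \<omega>). ennreal \<bar>G d (W 1 \<omega>)\<bar>) \<in> borel_measurable (PiM {1..n} (\<lambda>_. borel) \<Otimes>\<^sub>M M)"
      by (simp add: split_def)
    from measurable_compose[OF D_measurable borel_measurable_nn_integral[OF this]]
    show ?thesis unfolding A_def .
  qed
  have "(\<integral>\<^sup>+\<omega>'. A \<omega>' \<partial>M) = (\<integral>\<^sup>+\<omega>. ennreal \<bar>G (D n \<omega>) (W 1 \<omega>)\<bar> \<partial>M)"
    unfolding A_def by (rule dec[symmetric]) simp
  also have "\<dots> < \<infinity>" using int by (simp add: integrable_iff_bounded)
  finally have "AE \<omega>' in M. A \<omega>' \<noteq> \<infinity>" using A_meas by (intro nn_integral_PInf_AE) auto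
  then have "AE \<omega>' in M. (\<integral>\<^sup>+\<omega>. ennreal (G (D n \<omega>') (W 1 \<omega>)) \<partial>M) = (\<integral>\<^sup>+\<omega>. ennreal (- G (D n \<omega>') (W 1 \<omega>)) \<partial>M)"
  proof eventually_elim
    case (elim \<omega>')
    let ?g = "\<lambda>\<omega>. G (D n \<omega>') (W 1 \<omega>)"
    have gm: "?g \<in> borel_measurable M"
      using measurable_compose[OF W1 measurable_compose[OF measurable_Pair2'[OF D_space] G]] by simp
    have gi: "integrable M ?g"
      using elim gm unfolding A_def by (intro integrableI_bounded) (auto simp: less_top)
    have "(\<integral>\<^sup>+\<omega>. ennreal (?g \<omega>) \<partial>M) \<le> A \<omega>'" "(\<integral>\<^sup>+\<omega>. ennreal (- ?g \<omega>) \<partial>M) \<le> A \<omega>'"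
      unfolding A_def by (intro nn_integral_mono ennreal_leI; simp)+
    then have fin: "(\<integral>\<^sup>+\<omega>. ennreal (?g \<omega>) \<partial>M) < \<infinity>" "(\<integral>\<^sup>+\<omega>. ennreal (- ?g \<omega>) \<partial>M) < \<infinity>"
      using elim by (auto simp: less_top[symmetric] top_unique)
    have "0 = enn2real (\<integral>\<^sup>+\<omega>. ennreal (?g \<omega>) \<partial>M) - enn2real (\<integral>\<^sup>+\<omega>. ennreal (- ?g \<omega>) \<partial>M)"
      using centred[OF D_space gi] real_lebesgue_integral_def[OF gi] by simp
    then show ?case using fin by (metis eq_iff_diff_eq_0 ennreal_enn2real infinity_ennreal_def)
  qed
  then have "(\<integral>\<^sup>+\<omega>. ennreal (G (D n \<omega>) (W 1 \<omega>)) \<partial>M) = (\<integral>\<^sup>+\<omega>. ennreal (- G (D n \<omega>) (W 1 \<omega>)) \<partial>M)"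
    using dec[of "\<lambda>x. x"] dec[of uminus] by (simp cong: nn_integral_cong_AE)
  then show ?thesis unfolding real_lebesgue_integral_def[OF int] by simp
qed

lemma nonneg_terms_tail:
  fixes G :: "nat \<Rightarrow> (nat \<Rightarrow> 'b) \<Rightarrow> 'b \<Rightarrow> real"
  assumes G: "\<And>i. 1 \<le> i \<Longrightarrow> (\<lambda>(w, d). G i d w) \<in> borel_measurable (borel \<Otimes>\<^sub>M PiM {1..i} (\<lambda>_. borel))"
    and G0: "\<And>i d x. 0 \<le> G i d x"
    and V: "\<And>i. 1 \<le> i \<Longrightarrow> (\<integral>\<^sup>+\<omega>. ennreal (G i (D i \<omega>) (W 1 \<omega>)) \<partial>M) \<le> ennreal (V i)"
    and V0: "\<And>i. 0 \<le> V i"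
    and w: "\<And>i. 1 \<le> i \<Longrightarrow> 0 < w i" and mono: "\<And>i j. 1 \<le> i \<Longrightarrow> i \<le> j \<Longrightarrow> w i \<le> w j"
    and e: "0 < e" and m: "1 \<le> m"
  shows "ennreal (prob {\<omega> \<in> space M. \<exists>k\<ge>m. e * w k < (\<Sum>i\<in>{1..k}. G i (D i \<omega>) (W i \<omega>))})
    \<le> (\<Sum>i. if 1 \<le> i then ennreal (1 / e * V i / max (w i) (w m)) else 0)"
proof -
  have meas: "(\<lambda>\<omega>. G i (D i \<omega>) (W i \<omega>)) \<in> borel_measurable M" if "1 \<le> i" for i
    using measurable_compose[OF measurable_Pair[OF W_measurable[OF that] D_measurable] G[OF that]] by simp
  have "ennreal (prob {\<omega> \<in> space M. \<exists>k\<ge>m. e * w k < (\<Sum>i\<in>{1..k}. G i (D i \<omega>) (W i \<omega>))})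
    \<le> (\<Sum>i. if 1 \<le> i then ennreal (1 / (e * max (w i) (w m))) * (\<integral>\<^sup>+\<omega>. ennreal (G i (D i \<omega>) (W i \<omega>)) \<partial>M) else 0)"
    by (rule nonneg_partial_sums_tail[OF meas G0 w mono e m])
  also have "\<dots> \<le> (\<Sum>i. if 1 \<le> i then ennreal (1 / e * V i / max (w i) (w m)) else 0)"
  proof (intro suminf_le summableI)
    fix i
    show "(if 1 \<le> i then ennreal (1 / (e * max (w i) (w m))) * (\<integral>\<^sup>+\<omega>. ennreal (G i (D i \<omega>) (W i \<omega>)) \<partial>M) else 0)
      \<le> (if 1 \<le> i then ennreal (1 / e * V i / max (w i) (w m)) else 0)"
    proof (cases "1 \<le> i")
      case True
      have g: "(\<lambda>(w, d). ennreal (G i d w)) \<in> borel_measurable (borel \<Otimes>\<^sub>M PiM {1..i} (\<lambda>_. borel))"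
        using G[OF True] unfolding split_def by measurable
      have "(\<integral>\<^sup>+\<omega>. ennreal (G i (D i \<omega>) (W i \<omega>)) \<partial>M) \<le> ennreal (V i)"
        using same_law[OF g True] V[OF True] by simp
      then have "ennreal (1 / (e * max (w i) (w m))) * (\<integral>\<^sup>+\<omega>. ennreal (G i (D i \<omega>) (W i \<omega>)) \<partial>M)
        \<le> ennreal (1 / (e * max (w i) (w m))) * ennreal (V i)" by (intro mult_left_mono) auto
      also have "\<dots> = ennreal (1 / (e * max (w i) (w m)) * V i)" using V0 by (simp add: ennreal_mult''[symmetric])
      finally show ?thesis using True by simp
    qed simp
  qed
  finally show ?thesis .
qed

end

lemma ennsqrt_power2: "(ennsqrt x)\<^sup>2 = x"
proof (cases "x = \<infinity>")
  case True
  then show ?thesis by (simp add: ennsqrt_def)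
next
  case False
  then obtain r where "x = ennreal r" "0 \<le> r" by (cases x) auto
  then show ?thesis by (simp add: ennsqrt_def ennreal_power)
qed

lemma ennreal_power2_le_imp_le:
  fixes x y :: ennreal
  assumes "x\<^sup>2 \<le> y\<^sup>2"
  shows "x \<le> y"
proof (rule ccontr)
  assume "\<not> x \<le> y"
  then have "y < x" by simp
  then obtain r where r: "y = ennreal r" "0 \<le> r" by (cases y) auto
  then obtain s where s: "r < s" "ennreal s \<le> x"
  proof (cases x)
    case (real q)
    then show thesis using \<open>y < x\<close> r that[of q] by (simp add: ennreal_less_iff)
  next
    case top
    then show thesis using that[of "r + 1"] by simp
  qed
  have "y\<^sup>2 = ennreal (r\<^sup>2)" using r by (simp add: ennreal_power)
  also have "\<dots> < ennreal (s\<^sup>2)" using r s by (intro ennreal_lessI) (auto intro: power_strict_mono)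
  also have "\<dots> = (ennreal s)\<^sup>2" using r s by (simp add: ennreal_power)
  also have "\<dots> \<le> x\<^sup>2" using s by (intro power_mono) auto
  finally show False using assms by simp
qed

text \<open>The inequality also holds when one of the second moments is infinite and the other is \<open>0\<close>: then one of the functions
  vanishes almost everywhere, in agreement with \<open>0 * \<infinity> = 0\<close>.\<close>

lemma Cauchy_Schwarz_ennsqrt:
  fixes f g :: "'a \<Rightarrow> real"
  assumes [measurable]: "f \<in> borel_measurable M" "g \<in> borel_measurable M"
  shows "(\<integral>\<^sup>+x. ennreal \<bar>f x * g x\<bar> \<partial>M)
    \<le> ennsqrt (\<integral>\<^sup>+x. ennreal ((f x)\<^sup>2) \<partial>M) * ennsqrt (\<integral>\<^sup>+x. ennreal ((g x)\<^sup>2) \<partial>M)"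
proof (rule ennreal_power2_le_imp_le)
  have sq: "(ennreal \<bar>r\<bar>)\<^sup>2 = ennreal (r\<^sup>2)" for r by (simp add: ennreal_power)
  have "(\<integral>\<^sup>+x. ennreal \<bar>f x\<bar> * ennreal \<bar>g x\<bar> \<partial>M)\<^sup>2
      \<le> (\<integral>\<^sup>+x. (ennreal \<bar>f x\<bar>)\<^sup>2 \<partial>M) * (\<integral>\<^sup>+x. (ennreal \<bar>g x\<bar>)\<^sup>2 \<partial>M)"
    by (intro Cauchy_Schwarz_nn_integral) auto
  then show "(\<integral>\<^sup>+x. ennreal \<bar>f x * g x\<bar> \<partial>M)\<^sup>2
    \<le> (ennsqrt (\<integral>\<^sup>+x. ennreal ((f x)\<^sup>2) \<partial>M) * ennsqrt (\<integral>\<^sup>+x. ennreal ((g x)\<^sup>2) \<partial>M))\<^sup>2"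
    unfolding power_mult_distrib ennsqrt_power2 sq by (simp add: abs_mult ennreal_mult)
qed

section \<open>The generalised covariance measure as a perturbed walk\<close>

text \<open>Here \<open>x\<close> is the standardised walk, \<open>u\<close> and \<open>v\<close> are the cross terms and \<open>b\<close> is the bias. For the second moments, with
  \<open>c = r - x\<close>,
  \<open>2 * x * c \<le> q * x\<^sup>2 + c\<^sup>2 / q\<close> with \<open>q = sqrt \<eta>\<close> balances a bounded mean of \<open>x\<^sup>2\<close> against a mean of \<open>c\<^sup>2\<close> of order \<open>\<eta>\<close>.\<close>

lemma perturbation_bounds:
  fixes x u v b r :: "nat \<Rightarrow> real"
  assumes k: "1 \<le> k" and \<eta>: "0 < \<eta>" "\<eta> \<le> 1"
    and r: "\<And>i. r i = x i - u i - v i + b i"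
    and x2: "\<bar>(\<Sum>i\<in>{1..k}. (x i)\<^sup>2) - real k\<bar> \<le> \<eta> * real k" and x1: "\<bar>\<Sum>i\<in>{1..k}. x i\<bar> \<le> \<eta> * real k"
    and u1: "\<bar>\<Sum>i\<in>{1..k}. u i\<bar> \<le> \<eta> * sqrt (real k)" and u2: "(\<Sum>i\<in>{1..k}. (u i)\<^sup>2) \<le> \<eta> * real k"
    and v1: "\<bar>\<Sum>i\<in>{1..k}. v i\<bar> \<le> \<eta> * sqrt (real k)" and v2: "(\<Sum>i\<in>{1..k}. (v i)\<^sup>2) \<le> \<eta> * real k"
    and b1: "(\<Sum>i\<in>{1..k}. \<bar>b i\<bar>) \<le> \<eta> * sqrt (real k)"
  shows "\<bar>(\<Sum>i\<in>{1..k}. r i) - (\<Sum>i\<in>{1..k}. x i)\<bar> \<le> 3 * \<eta> * sqrt (real k)"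
    and "\<bar>1 / real k * (\<Sum>i\<in>{1..k}. (r i)\<^sup>2) - (1 / real k * (\<Sum>i\<in>{1..k}. r i))\<^sup>2 - 1\<bar> \<le> 37 * sqrt \<eta>"
proof -
  define q where "q = sqrt \<eta>"
  have q: "0 < q" "q \<le> 1" "q * q = \<eta>" unfolding q_def using \<eta> by auto
  have eq: "\<eta> \<le> q" using mult_left_mono[OF q(2), of q] q by simp
  have rk: "0 < real k" "1 \<le> sqrt (real k)" "sqrt (real k) \<le> real k"
  proof -
    show "0 < real k" "1 \<le> sqrt (real k)" using k by auto
    have "sqrt (real k) * 1 \<le> sqrt (real k) * sqrt (real k)" using k by (intro mult_left_mono) auto
    then show "sqrt (real k) \<le> real k" by simp
  qed
  have b_abs: "\<bar>\<Sum>i\<in>{1..k}. b i\<bar> \<le> \<eta> * sqrt (real k)" using order_trans[OF sum_abs b1] .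
  have b2: "(\<Sum>i\<in>{1..k}. (b i)\<^sup>2) \<le> \<eta> * real k"
  proof -
    have "(\<Sum>i\<in>{1..k}. (b i)\<^sup>2) = (L2_set b {1..k})\<^sup>2"
      unfolding L2_set_def by (simp add: sum_nonneg)
    also have "\<dots> \<le> (\<eta> * sqrt (real k))\<^sup>2"
      using order_trans[OF L2_set_le_sum_abs b1] by (intro power_mono) (auto simp: L2_set_nonneg)
    also have "\<dots> = \<eta> * (\<eta> * real k)" by (simp add: power_mult_distrib power2_eq_square)
    also have "\<dots> \<le> 1 * (\<eta> * real k)" using \<eta> by (intro mult_right_mono) auto
    finally show ?thesis by simp
  qed
  have sr: "(\<Sum>i\<in>{1..k}. r i) = (\<Sum>i\<in>{1..k}. x i) - (\<Sum>i\<in>{1..k}. u i) - (\<Sum>i\<in>{1..k}. v i) + (\<Sum>i\<in>{1..k}. b i)"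
    unfolding r by (simp add: sum.distrib sum_subtractf)
  show A: "\<bar>(\<Sum>i\<in>{1..k}. r i) - (\<Sum>i\<in>{1..k}. x i)\<bar> \<le> 3 * \<eta> * sqrt (real k)"
    unfolding sr using u1 v1 b_abs by (simp add: algebra_simps)
  have pt: "\<bar>(r i)\<^sup>2 - (x i)\<^sup>2\<bar> \<le> q * (x i)\<^sup>2 + 6 / q * ((u i)\<^sup>2 + (v i)\<^sup>2 + (b i)\<^sup>2)" for i
  proof -
    define c where "c = - u i - v i + b i"
    have c2: "c\<^sup>2 \<le> 3 * ((u i)\<^sup>2 + (v i)\<^sup>2 + (b i)\<^sup>2)"
    proof -
      have "0 \<le> (u i - v i)\<^sup>2" "0 \<le> (u i + b i)\<^sup>2" "0 \<le> (v i + b i)\<^sup>2" by simp_all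
      then show ?thesis unfolding c_def by (simp add: power2_eq_square algebra_simps)
    qed
    have "(r i)\<^sup>2 - (x i)\<^sup>2 = 2 * x i * c + c\<^sup>2" unfolding r c_def by (simp add: power2_eq_square algebra_simps)
    moreover have "\<bar>2 * x i * c\<bar> \<le> q * (x i)\<^sup>2 + c\<^sup>2 / q"
    proof -
      have "0 \<le> (q * \<bar>x i\<bar> - \<bar>c\<bar>)\<^sup>2 / q" using q by simp
      also have "\<dots> = q * (x i)\<^sup>2 + c\<^sup>2 / q - 2 * \<bar>x i\<bar> * \<bar>c\<bar>"
        using q by (simp add: power2_eq_square field_simps)
      finally show ?thesis by (simp add: abs_mult)
    qed
    moreover have "c\<^sup>2 \<le> c\<^sup>2 / q" using q by (simp add: le_divide_eq mult_left_le)
    moreover have "2 * (c\<^sup>2 / q) \<le> 6 / q * ((u i)\<^sup>2 + (v i)\<^sup>2 + (b i)\<^sup>2)"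
    proof -
      have "2 * c\<^sup>2 / q \<le> 2 * (3 * ((u i)\<^sup>2 + (v i)\<^sup>2 + (b i)\<^sup>2)) / q"
        using c2 q by (intro divide_right_mono mult_left_mono) auto
      then show ?thesis by simp
    qed
    moreover have "0 \<le> c\<^sup>2" by simp
    ultimately show ?thesis by linarith
  qed
  have "\<bar>(\<Sum>i\<in>{1..k}. (r i)\<^sup>2) - (\<Sum>i\<in>{1..k}. (x i)\<^sup>2)\<bar> \<le> (\<Sum>i\<in>{1..k}. \<bar>(r i)\<^sup>2 - (x i)\<^sup>2\<bar>)"
    unfolding sum_subtractf[symmetric] by (rule sum_abs)
  also have "\<dots> \<le> (\<Sum>i\<in>{1..k}. q * (x i)\<^sup>2 + 6 / q * ((u i)\<^sup>2 + (v i)\<^sup>2 + (b i)\<^sup>2))"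
    by (intro sum_mono pt)
  also have "\<dots> = q * (\<Sum>i\<in>{1..k}. (x i)\<^sup>2) + 6 / q * ((\<Sum>i\<in>{1..k}. (u i)\<^sup>2) + (\<Sum>i\<in>{1..k}. (v i)\<^sup>2) + (\<Sum>i\<in>{1..k}. (b i)\<^sup>2))"
    by (simp only: sum.distrib sum_distrib_left[symmetric])
  also have "\<dots> \<le> q * (2 * real k) + 6 / q * (\<eta> * real k + \<eta> * real k + \<eta> * real k)"
  proof (intro add_mono mult_left_mono u2 v2 b2)
    have "\<eta> * real k \<le> 1 * real k" using \<eta> by (intro mult_right_mono) auto
    then show "(\<Sum>i\<in>{1..k}. (x i)\<^sup>2) \<le> 2 * real k" using x2 by linarith
  qed (use q in auto)
  also have "\<dots> = 20 * q * real k" unfolding q(3)[symmetric] using q(1) by (simp add: field_simps)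
  finally have d: "\<bar>(\<Sum>i\<in>{1..k}. (r i)\<^sup>2) - (\<Sum>i\<in>{1..k}. (x i)\<^sup>2)\<bar> \<le> 20 * q * real k" .
  have "\<eta> * real k \<le> q * real k" using eq by (intro mult_right_mono) auto
  then have "\<bar>(\<Sum>i\<in>{1..k}. (r i)\<^sup>2) - real k\<bar> \<le> 21 * q * real k" using d x2 by (simp add: algebra_simps)
  then have "\<bar>(\<Sum>i\<in>{1..k}. (r i)\<^sup>2) - real k\<bar> / real k \<le> 21 * q" using rk by (simp add: divide_le_eq)
  moreover have "\<bar>(\<Sum>i\<in>{1..k}. (r i)\<^sup>2) - real k\<bar> / real k = \<bar>1 / real k * (\<Sum>i\<in>{1..k}. (r i)\<^sup>2) - 1\<bar>"
  proof -
    have "\<bar>(\<Sum>i\<in>{1..k}. (r i)\<^sup>2) - real k\<bar> / real k = \<bar>((\<Sum>i\<in>{1..k}. (r i)\<^sup>2) - real k) / real k\<bar>" using rk by simp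
    also have "((\<Sum>i\<in>{1..k}. (r i)\<^sup>2) - real k) / real k = 1 / real k * (\<Sum>i\<in>{1..k}. (r i)\<^sup>2) - 1"
      using rk by (simp add: diff_divide_distrib)
    finally show ?thesis .
  qed
  moreover have "\<bar>(1 / real k * (\<Sum>i\<in>{1..k}. r i))\<^sup>2\<bar> \<le> 16 * q"
  proof -
    have "\<eta> * sqrt (real k) \<le> \<eta> * real k" using rk \<eta> by (intro mult_left_mono) auto
    then have "\<bar>\<Sum>i\<in>{1..k}. r i\<bar> \<le> 4 * \<eta> * real k" using A x1 by linarith
    then have "\<bar>1 / real k * (\<Sum>i\<in>{1..k}. r i)\<bar> \<le> 4 * \<eta>" using rk by (simp add: abs_mult divide_le_eq)
    then have "\<bar>1 / real k * (\<Sum>i\<in>{1..k}. r i)\<bar>\<^sup>2 \<le> (4 * \<eta>)\<^sup>2" by (intro power_mono) auto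
    also have "(4 * \<eta>)\<^sup>2 = 16 * (\<eta> * \<eta>)" by (simp add: power2_eq_square)
    also have "\<dots> \<le> 16 * (q * 1)" using eq \<eta> q by (intro mult_left_mono mult_mono) auto
    finally show ?thesis by (simp only: power2_abs abs_power2 mult_1_right)
  qed
  ultimately show "\<bar>1 / real k * (\<Sum>i\<in>{1..k}. (r i)\<^sup>2) - (1 / real k * (\<Sum>i\<in>{1..k}. r i))\<^sup>2 - 1\<bar> \<le> 37 * sqrt \<eta>"
    unfolding q_def[symmetric] by linarith
qed

lemma gcm_stat_scale:
  assumes "0 < \<sigma>"
  shows "gcm_stat (\<lambda>i \<omega>. R i \<omega> / \<sigma>) k \<omega> = gcm_stat R k \<omega>"
proof -
  have "sample_variance (\<lambda>i \<omega>. R i \<omega> / \<sigma>) k \<omega> = sample_variance R k \<omega> / \<sigma>\<^sup>2"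
    unfolding sample_variance_def
    by (simp add: power_divide sum_divide_distrib[symmetric] diff_divide_distrib power_mult_distrib)
  then show ?thesis
    unfolding gcm_stat_def using assms by (simp add: real_sqrt_divide sum_divide_distrib[symmetric])
qed

text \<open>One distribution of the class. Estimation errors and residuals are written as functions of the observation \<open>w = (x, y, z)\<close>
  and of the training data \<open>d\<close>, so that the training data can be frozen.\<close>

locale gcm_data = sample_split M W W'
  for M :: "'a measure" and W W' :: "nat \<Rightarrow> 'a \<Rightarrow> real \<times> real \<times> (real ^ 'd)" +
  fixes hx hy :: "(real \<times> real \<times> (real ^ 'd), real ^ 'd) estimator" and \<mu>x \<mu>y :: "real ^ 'd \<Rightarrow> real"
  assumes est: "measurable_estimator hx" "measurable_estimator hy"
    and regx: "is_regression_function M (\<lambda>\<omega>. fst (W 1 \<omega>)) (\<lambda>\<omega>. snd (snd (W 1 \<omega>))) \<mu>x"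
    and regy: "is_regression_function M (\<lambda>\<omega>. fst (snd (W 1 \<omega>))) (\<lambda>\<omega>. snd (snd (W 1 \<omega>))) \<mu>y"
    and ci: "cond_indep_given M (\<lambda>\<omega>. fst (W 1 \<omega>)) (\<lambda>\<omega>. fst (snd (W 1 \<omega>))) (\<lambda>\<omega>. snd (snd (W 1 \<omega>)))"
begin

definition rx :: "real \<times> real \<times> (real ^ 'd) \<Rightarrow> real" where "rx w = fst w - \<mu>x (snd (snd w))"
definition ry :: "real \<times> real \<times> (real ^ 'd) \<Rightarrow> real" where "ry w = fst (snd w) - \<mu>y (snd (snd w))"
definition dx :: "nat \<Rightarrow> (nat \<Rightarrow> real \<times> real \<times> (real ^ 'd)) \<Rightarrow> real \<times> real \<times> (real ^ 'd) \<Rightarrow> real" where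
  "dx i d w = hx i d (snd (snd w)) - \<mu>x (snd (snd w))"
definition dy :: "nat \<Rightarrow> (nat \<Rightarrow> real \<times> real \<times> (real ^ 'd)) \<Rightarrow> real \<times> real \<times> (real ^ 'd) \<Rightarrow> real" where
  "dy i d w = hy i d (snd (snd w)) - \<mu>y (snd (snd w))"

lemma proj_measurable:
  "(\<lambda>w :: real \<times> real \<times> (real ^ 'd). fst w) \<in> borel_measurable borel"
  "(\<lambda>w :: real \<times> real \<times> (real ^ 'd). fst (snd w)) \<in> borel_measurable borel"
  "(\<lambda>w :: real \<times> real \<times> (real ^ 'd). snd (snd w)) \<in> measurable borel borel"
  by (intro borel_measurable_continuous_onI continuous_intros)+

lemma \<mu>_measurable: "\<mu>x \<in> borel_measurable borel" "\<mu>y \<in> borel_measurable borel"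
  using regx regy unfolding is_regression_function_def by auto

lemma r_measurable [measurable]: "rx \<in> borel_measurable borel" "ry \<in> borel_measurable borel"
  unfolding rx_def[abs_def] ry_def[abs_def]
  by (intro borel_measurable_diff proj_measurable measurable_compose[OF proj_measurable(3)] \<mu>_measurable)+

lemma d_measurable:
  assumes "1 \<le> i"
  shows "(\<lambda>wd. dx i (snd wd) (fst wd)) \<in> borel_measurable (borel \<Otimes>\<^sub>M PiM {1..i} (\<lambda>_. borel))"
    "(\<lambda>wd. dy i (snd wd) (fst wd)) \<in> borel_measurable (borel \<Otimes>\<^sub>M PiM {1..i} (\<lambda>_. borel))"
proof -
  have z: "(\<lambda>wd. snd (snd (fst wd))) 
      \<in> measurable ((borel :: (real \<times> real \<times> (real ^ 'd)) measure) \<Otimes>\<^sub>M PiM {1..i} (\<lambda>_. borel :: (real \<times> real \<times> (real ^ 'd)) measure)) borel"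
    by (rule measurable_compose[OF measurable_fst proj_measurable(3)])
  have h: "(\<lambda>wd :: (real \<times> real \<times> (real ^ 'd)) \<times> _. h i (snd wd) (snd (snd (fst wd)))) \<in> borel_measurable (borel \<Otimes>\<^sub>M PiM {1..i} (\<lambda>_. borel))"
    if "measurable_estimator h" for h :: "(real \<times> real \<times> (real ^ 'd), real ^ 'd) estimator"
  proof -
    have "(\<lambda>(D, z). h i D z) \<in> borel_measurable (PiM {1..i} (\<lambda>_. borel) \<Otimes>\<^sub>M borel)"
      using that assms unfolding measurable_estimator_def by auto
    from measurable_compose[OF measurable_Pair[OF measurable_snd z] this] show ?thesis by simp
  qed
  show "(\<lambda>wd. dx i (snd wd) (fst wd)) \<in> borel_measurable (borel \<Otimes>\<^sub>M PiM {1..i} (\<lambda>_. borel))"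
    "(\<lambda>wd. dy i (snd wd) (fst wd)) \<in> borel_measurable (borel \<Otimes>\<^sub>M PiM {1..i} (\<lambda>_. borel))"
    unfolding dx_def dy_def
    by (intro borel_measurable_diff h est measurable_compose[OF z] \<mu>_measurable)+
qed

lemma products_measurable:
  assumes "1 \<le> i"
  shows "(\<lambda>(w, d). dx i d w * ry w) \<in> borel_measurable (borel \<Otimes>\<^sub>M PiM {1..i} (\<lambda>_. borel))"
    "(\<lambda>(w, d). dy i d w * rx w) \<in> borel_measurable (borel \<Otimes>\<^sub>M PiM {1..i} (\<lambda>_. borel))"
    "(\<lambda>(w, d). dx i d w * dy i d w) \<in> borel_measurable (borel \<Otimes>\<^sub>M PiM {1..i} (\<lambda>_. borel))"
proof -
  note [measurable] = d_measurable[OF assms]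
  show "(\<lambda>(w, d). dx i d w * ry w) \<in> borel_measurable (borel \<Otimes>\<^sub>M PiM {1..i} (\<lambda>_. borel))"
    "(\<lambda>(w, d). dy i d w * rx w) \<in> borel_measurable (borel \<Otimes>\<^sub>M PiM {1..i} (\<lambda>_. borel))"
    "(\<lambda>(w, d). dx i d w * dy i d w) \<in> borel_measurable (borel \<Otimes>\<^sub>M PiM {1..i} (\<lambda>_. borel))"
    unfolding split_def by measurable
qed

lemma at_data_measurable:
  assumes "(\<lambda>(w, d). G d w) \<in> borel_measurable (borel \<Otimes>\<^sub>M PiM {1..i} (\<lambda>_. borel))" "1 \<le> j"
  shows "(\<lambda>\<omega>. G (D i \<omega>) (W j \<omega>)) \<in> borel_measurable M"
  using measurable_compose[OF measurable_Pair[OF W_measurable[OF assms(2)] D_measurable] assms(1)] by simp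

lemma Z1_measurable: "(\<lambda>\<omega>. snd (snd (W 1 \<omega>))) \<in> measurable M borel"
  by (rule measurable_compose[OF W_measurable[OF order_refl] proj_measurable(3)])

lemma centred:
  assumes "1 \<le> i" "d \<in> space (PiM {1..i} (\<lambda>_. borel))"
  shows "integrable M (\<lambda>\<omega>. dx i d (W 1 \<omega>) * ry (W 1 \<omega>)) \<Longrightarrow> expectation (\<lambda>\<omega>. dx i d (W 1 \<omega>) * ry (W 1 \<omega>)) = 0"
    and "integrable M (\<lambda>\<omega>. dy i d (W 1 \<omega>) * rx (W 1 \<omega>)) \<Longrightarrow> expectation (\<lambda>\<omega>. dy i d (W 1 \<omega>) * rx (W 1 \<omega>)) = 0"
proof -
  have h: "(\<lambda>z. h i d z - \<mu> z) \<in> borel_measurable borel" if "measurable_estimator h" "\<mu> \<in> borel_measurable borel"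
    for h :: "(real \<times> real \<times> (real ^ 'd), real ^ 'd) estimator" and \<mu>
  proof -
    have "(\<lambda>(D, z). h i D z) \<in> borel_measurable (PiM {1..i} (\<lambda>_. borel) \<Otimes>\<^sub>M borel)"
      using that assms unfolding measurable_estimator_def by auto
    from measurable_compose[OF measurable_Pair1'[OF assms(2)] this] that(2) show ?thesis by simp
  qed
  show "expectation (\<lambda>\<omega>. dx i d (W 1 \<omega>) * ry (W 1 \<omega>)) = 0" if "integrable M (\<lambda>\<omega>. dx i d (W 1 \<omega>) * ry (W 1 \<omega>))"
    using residual_orthogonal[OF regy Z1_measurable h[OF est(1) \<mu>_measurable(1)]] that
    unfolding dx_def ry_def by simp
  show "expectation (\<lambda>\<omega>. dy i d (W 1 \<omega>) * rx (W 1 \<omega>)) = 0" if "integrable M (\<lambda>\<omega>. dy i d (W 1 \<omega>) * rx (W 1 \<omega>))"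
    using residual_orthogonal[OF regx Z1_measurable h[OF est(2) \<mu>_measurable(2)]] that
    unfolding dy_def rx_def by simp
qed

text \<open>A finite extended variance includes integrability, so the variance of a centred variable is its second moment.\<close>

lemma ext_variance_finite_centred:
  assumes "ext_variance M V \<le> ennreal v" "integrable M V \<Longrightarrow> expectation V = 0"
  shows "(\<integral>\<^sup>+\<omega>. ennreal ((V \<omega>)\<^sup>2) \<partial>M) \<le> ennreal v"
proof -
  have "integrable M V" using assms(1) unfolding ext_variance_def by (auto split: if_splits simp: top_unique)
  then show ?thesis using assms unfolding ext_variance_def by simp
qed

lemma cross_second_moments:
  assumes i: "1 \<le> i"
  shows "ext_variance M (\<lambda>\<omega>. dx i (D i \<omega>) (W 1 \<omega>) * ry (W 1 \<omega>)) \<le> ennreal v \<Longrightarrow>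
      (\<integral>\<^sup>+\<omega>. ennreal ((dx i (D i \<omega>) (W 1 \<omega>) * ry (W 1 \<omega>))\<^sup>2) \<partial>M) \<le> ennreal v"
    and "ext_variance M (\<lambda>\<omega>. dy i (D i \<omega>) (W 1 \<omega>) * rx (W 1 \<omega>)) \<le> ennreal v \<Longrightarrow>
      (\<integral>\<^sup>+\<omega>. ennreal ((dy i (D i \<omega>) (W 1 \<omega>) * rx (W 1 \<omega>))\<^sup>2) \<partial>M) \<le> ennreal v"
proof -
  show "(\<integral>\<^sup>+\<omega>. ennreal ((dx i (D i \<omega>) (W 1 \<omega>) * ry (W 1 \<omega>))\<^sup>2) \<partial>M) \<le> ennreal v"
    if "ext_variance M (\<lambda>\<omega>. dx i (D i \<omega>) (W 1 \<omega>) * ry (W 1 \<omega>)) \<le> ennreal v"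
    by (rule ext_variance_finite_centred[OF that])
       (rule centred_average[where G="\<lambda>d w. dx i d w * ry w", OF products_measurable(1)[OF i] centred(1)[OF i]])
  show "(\<integral>\<^sup>+\<omega>. ennreal ((dy i (D i \<omega>) (W 1 \<omega>) * rx (W 1 \<omega>))\<^sup>2) \<partial>M) \<le> ennreal v"
    if "ext_variance M (\<lambda>\<omega>. dy i (D i \<omega>) (W 1 \<omega>) * rx (W 1 \<omega>)) \<le> ennreal v"
    by (rule ext_variance_finite_centred[OF that])
       (rule centred_average[where G="\<lambda>d w. dy i d w * rx w", OF products_measurable(2)[OF i] centred(2)[OF i]])
qed

lemma bias_first_moment:
  assumes i: "1 \<le> i"
  shows "(\<integral>\<^sup>+\<omega>. ennreal \<bar>dx i (D i \<omega>) (W 1 \<omega>) * dy i (D i \<omega>) (W 1 \<omega>)\<bar> \<partial>M)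
    \<le> ennsqrt (expected_L2_error M (\<lambda>\<omega>. snd (snd (W 1 \<omega>))) (D i) (hx i) \<mu>x)
    * ennsqrt (expected_L2_error M (\<lambda>\<omega>. snd (snd (W 1 \<omega>))) (D i) (hy i) \<mu>y)"
proof -
  note d = d_measurable[OF i]
  have err: "expected_L2_error M (\<lambda>\<omega>. snd (snd (W 1 \<omega>))) (D i) (h i) \<mu>
    = (\<integral>\<^sup>+\<omega>. ennreal ((h i (D i \<omega>) (snd (snd (W 1 \<omega>))) - \<mu> (snd (snd (W 1 \<omega>))))\<^sup>2) \<partial>M)"
    if h: "measurable_estimator h" and \<mu>: "\<mu> \<in> borel_measurable borel"
      and m: "(\<lambda>wd :: (real \<times> real \<times> (real ^ 'd)) \<times> _. h i (snd wd) (snd (snd (fst wd))) - \<mu> (snd (snd (fst wd)))) \<in> borel_measurable (borel \<Otimes>\<^sub>M PiM {1..i} (\<lambda>_. borel))"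
    for h :: "(real \<times> real \<times> (real ^ 'd), real ^ 'd) estimator" and \<mu>
  proof -
    have g: "(\<lambda>wd :: (real \<times> real \<times> (real ^ 'd)) \<times> _. ennreal ((h i (snd wd) (snd (snd (fst wd))) - \<mu> (snd (snd (fst wd))))\<^sup>2))
        \<in> borel_measurable (borel \<Otimes>\<^sub>M PiM {1..i} (\<lambda>_. borel))"
      by (rule measurable_compose[OF m, of "\<lambda>r. ennreal (r\<^sup>2)"]) measurable
    have "(\<integral>\<^sup>+z. ennreal ((h i (D i \<omega>') z - \<mu> z)\<^sup>2) \<partial>distr M borel (\<lambda>\<omega>. snd (snd (W 1 \<omega>))))
      = (\<integral>\<^sup>+\<omega>. ennreal ((h i (D i \<omega>') (snd (snd (W 1 \<omega>))) - \<mu> (snd (snd (W 1 \<omega>))))\<^sup>2) \<partial>M)" for \<omega>'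
    proof (rule nn_integral_distr[OF Z1_measurable])
      have "(\<lambda>(D, z). h i D z) \<in> borel_measurable (PiM {1..i} (\<lambda>_. borel) \<Otimes>\<^sub>M borel)"
        using h i unfolding measurable_estimator_def by auto
      from measurable_compose[OF measurable_Pair1'[OF D_space] this]
      have "(\<lambda>z. h i (D i \<omega>') z) \<in> borel_measurable borel" by simp
      then show "(\<lambda>z. ennreal ((h i (D i \<omega>') z - \<mu> z)\<^sup>2)) \<in> borel_measurable (distr M borel (\<lambda>\<omega>. snd (snd (W 1 \<omega>))))"
        using \<mu> by simp
    qed
    then show ?thesis unfolding expected_L2_error_def using decouple_point[OF g order_refl] by simp
  qed
  have ex: "expected_L2_error M (\<lambda>\<omega>. snd (snd (W 1 \<omega>))) (D i) (hx i) \<mu>x = (\<integral>\<^sup>+\<omega>. ennreal ((dx i (D i \<omega>) (W 1 \<omega>))\<^sup>2) \<partial>M)"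
    using err[OF est(1) \<mu>_measurable(1)] d(1) unfolding dx_def by simp
  have ey: "expected_L2_error M (\<lambda>\<omega>. snd (snd (W 1 \<omega>))) (D i) (hy i) \<mu>y = (\<integral>\<^sup>+\<omega>. ennreal ((dy i (D i \<omega>) (W 1 \<omega>))\<^sup>2) \<partial>M)"
    using err[OF est(2) \<mu>_measurable(2)] d(2) unfolding dy_def by simp
  have "(\<lambda>\<omega>. dx i (D i \<omega>) (W 1 \<omega>)) \<in> borel_measurable M" "(\<lambda>\<omega>. dy i (D i \<omega>) (W 1 \<omega>)) \<in> borel_measurable M"
    using at_data_measurable[of "dx i" i 1] at_data_measurable[of "dy i" i 1] d unfolding split_def by auto
  then show ?thesis unfolding ex ey by (rule Cauchy_Schwarz_ennsqrt)
qed

definition \<xi> :: "nat \<Rightarrow> 'a \<Rightarrow> real" where "\<xi> i \<omega> = rx (W i \<omega>) * ry (W i \<omega>)"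

text \<open>The products of the true residuals, divided by their standard deviation. The lower bound \<open>c\<close> on the variance bounds the moment
  of order \<open>p\<close> after division.\<close>

lemma standardised_walk:
  assumes p: "2 < p" "p \<le> 3" and c: "0 < c"
    and K: "(\<integral>\<^sup>+\<omega>. ennreal (\<bar>\<xi> 1 \<omega>\<bar> powr p) \<partial>M) \<le> ennreal K" "0 \<le> K"
    and var: "ennreal c \<le> ext_variance M (\<xi> 1)"
  obtains \<sigma> where "sqrt c \<le> \<sigma>" "std_walk M (\<lambda>i \<omega>. \<xi> i \<omega> / \<sigma>) p (K / c powr (p / 2))"
proof -
  have W1: "W 1 \<in> measurable M borel" by simp
  have xym: "(\<lambda>w. rx w * ry w) \<in> borel_measurable borel" by measurable
  have \<xi>m: "\<xi> i \<in> borel_measurable M" if "1 \<le> i" for i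
    unfolding \<xi>_def[abs_def] by (rule measurable_compose[OF W_measurable[OF that] xym])
  note \<xi>1 [measurable] = \<xi>m[OF order_refl]
  have pm: "(\<lambda>\<omega>. \<bar>\<xi> 1 \<omega>\<bar> powr p) \<in> borel_measurable M" by measurable
  have pint: "integrable M (\<lambda>\<omega>. \<bar>\<xi> 1 \<omega>\<bar> powr p)"
    using K(1) by (intro integrableI_bounded[OF pm]) (auto intro: order_le_less_trans)
  have pE: "expectation (\<lambda>\<omega>. \<bar>\<xi> 1 \<omega>\<bar> powr p) \<le> K"
    using K(1) nn_integral_eq_integral[OF pint] K(2) by (simp add: ennreal_le_iff)
  have sint: "integrable M (\<lambda>\<omega>. (\<xi> 1 \<omega>)\<^sup>2)"
  proof (rule Bochner_Integration.integrable_bound[of M "\<lambda>\<omega>. 1 + \<bar>\<xi> 1 \<omega>\<bar> powr p"])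
    show "integrable M (\<lambda>\<omega>. 1 + \<bar>\<xi> 1 \<omega>\<bar> powr p)" using pint by auto
    have "r\<^sup>2 \<le> 1 + \<bar>r\<bar> powr p" for r :: real
    proof (cases "\<bar>r\<bar> \<le> 1")
      case True
      then have "\<bar>r\<bar>\<^sup>2 \<le> 1\<^sup>2" by (intro power_mono) auto
      then show ?thesis by (simp add: add_increasing2)
    next
      case False
      then have "\<bar>r\<bar> powr 2 \<le> \<bar>r\<bar> powr p" using p by (intro powr_mono) auto
      moreover have "\<bar>r\<bar> powr 2 = r\<^sup>2" by (cases "r = 0") (auto simp: powr_numeral)
      ultimately show ?thesis by simp
    qed
    then show "AE \<omega> in M. norm ((\<xi> 1 \<omega>)\<^sup>2) \<le> norm (1 + \<bar>\<xi> 1 \<omega>\<bar> powr p)" by (intro AE_I2) simp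
  qed measurable
  have int: "integrable M (\<xi> 1)" by (rule square_integrable_imp_integrable[OF \<xi>1 sint])
  have mean: "expectation (\<xi> 1) = 0"
  proof -
    have "(\<lambda>\<omega>. fst (W 1 \<omega>)) \<in> borel_measurable M" by (rule measurable_compose[OF W1 proj_measurable(1)])
    from cond_indep_residual_product[OF regy ci this Z1_measurable \<mu>_measurable(1)] int
    show ?thesis unfolding \<xi>_def[abs_def] rx_def ry_def by simp
  qed
  define s where "s = expectation (\<lambda>\<omega>. (\<xi> 1 \<omega>)\<^sup>2)"
  have "ext_variance M (\<xi> 1) = ennreal s"
    unfolding ext_variance_def s_def using int mean nn_integral_eq_integral[OF sint] by simp
  then have cs: "c \<le> s" using var c unfolding s_def by (simp add: ennreal_le_iff)
  define \<sigma> where "\<sigma> = sqrt s"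
  have \<sigma>: "sqrt c \<le> \<sigma>" "0 < \<sigma>" "\<sigma>\<^sup>2 = s" unfolding \<sigma>_def using cs c by auto
  have "std_walk M (\<lambda>i \<omega>. \<xi> i \<omega> / \<sigma>) p (K / c powr (p / 2))"
  proof (intro std_walk.intro std_walk_axioms.intro prob_space_axioms p)
    have xys: "(\<lambda>w. rx w * ry w / \<sigma>) \<in> borel_measurable borel" by measurable
    show "indep_vars (\<lambda>_. borel) (\<lambda>i \<omega>. \<xi> i \<omega> / \<sigma>) {1..}"
      unfolding \<xi>_def using xys by (intro indep_vars_compose2[OF W_indep, of "\<lambda>_ w. rx w * ry w / \<sigma>"])
    have tr: "distr M borel (\<lambda>\<omega>. \<xi> j \<omega> / \<sigma>) = distr (distr M borel (W j)) borel (\<lambda>w. rx w * ry w / \<sigma>)" if "1 \<le> j" for j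
      unfolding distr_distr[OF xys W_measurable[OF that]] by (simp add: \<xi>_def comp_def)
    show "distr M borel (\<lambda>\<omega>. \<xi> i \<omega> / \<sigma>) = distr M borel (\<lambda>\<omega>. \<xi> 1 \<omega> / \<sigma>)" if i: "1 \<le> i" for i
      unfolding tr[OF i] tr[OF order_refl] W_ident[OF i] by (rule refl)
    show "integrable M (\<lambda>\<omega>. (\<xi> 1 \<omega> / \<sigma>)\<^sup>2)" using sint by (simp add: power_divide)
    show "expectation (\<lambda>\<omega>. \<xi> 1 \<omega> / \<sigma>) = 0" using mean by simp
    show "expectation (\<lambda>\<omega>. (\<xi> 1 \<omega> / \<sigma>)\<^sup>2) = 1"
      unfolding power_divide \<sigma>(3) integral_divide_zero s_def[symmetric] using cs c by simp
    have ab: "\<bar>\<xi> 1 \<omega> / \<sigma>\<bar> powr p = \<bar>\<xi> 1 \<omega>\<bar> powr p / \<sigma> powr p" for \<omega>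
      using \<sigma> by (simp add: powr_divide)
    show "integrable M (\<lambda>\<omega>. \<bar>\<xi> 1 \<omega> / \<sigma>\<bar> powr p)" unfolding ab using pint by simp
    have "expectation (\<lambda>\<omega>. \<bar>\<xi> 1 \<omega> / \<sigma>\<bar> powr p) \<le> K / \<sigma> powr p"
      unfolding ab using pE by (simp add: divide_right_mono)
    also have "\<dots> \<le> K / c powr (p / 2)"
    proof (intro divide_left_mono K(2))
      have "c powr (p / 2) = sqrt c powr p" using c by (simp add: powr_half_sqrt[symmetric] powr_powr)
      also have "\<dots> \<le> \<sigma> powr p" using \<sigma> c p by (intro powr_mono2) auto
      finally show "c powr (p / 2) \<le> \<sigma> powr p" .
      show "0 < \<sigma> powr p * c powr (p / 2)" using \<sigma> c by simp
    qed
    finally show "expectation (\<lambda>\<omega>. \<bar>\<xi> 1 \<omega> / \<sigma>\<bar> powr p) \<le> K / c powr (p / 2)" .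
  qed
  with \<sigma>(1) that show thesis by blast
qed

end

context gcm_data
begin

definition u :: "nat \<Rightarrow> 'a \<Rightarrow> real" where "u i \<omega> = dx i (D i \<omega>) (W i \<omega>) * ry (W i \<omega>)"
definition v :: "nat \<Rightarrow> 'a \<Rightarrow> real" where "v i \<omega> = dy i (D i \<omega>) (W i \<omega>) * rx (W i \<omega>)"
definition b :: "nat \<Rightarrow> 'a \<Rightarrow> real" where "b i \<omega> = dx i (D i \<omega>) (W i \<omega>) * dy i (D i \<omega>) (W i \<omega>)"
definition R :: "nat \<Rightarrow> 'a \<Rightarrow> real" where
  "R i \<omega> = (fst (W i \<omega>) - hx i (D i \<omega>) (snd (snd (W i \<omega>)))) * (fst (snd (W i \<omega>)) - hy i (D i \<omega>) (snd (snd (W i \<omega>))))"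

lemma R_decomposition: "R i \<omega> = \<xi> i \<omega> - u i \<omega> - v i \<omega> + b i \<omega>"
  unfolding R_def \<xi>_def u_def v_def b_def dx_def dy_def rx_def ry_def by (simp add: algebra_simps)

lemma terms_measurable [measurable]:
  assumes "1 \<le> i"
  shows "u i \<in> borel_measurable M" "v i \<in> borel_measurable M" "b i \<in> borel_measurable M" "\<xi> i \<in> borel_measurable M"
    "R i \<in> borel_measurable M"
proof -
  show uvb [measurable]: "u i \<in> borel_measurable M" "v i \<in> borel_measurable M" "b i \<in> borel_measurable M"
    unfolding u_def[abs_def] v_def[abs_def] b_def[abs_def]
    using at_data_measurable[OF products_measurable(1)[OF assms] assms]
      at_data_measurable[OF products_measurable(2)[OF assms] assms]
      at_data_measurable[OF products_measurable(3)[OF assms] assms] by auto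
  have "(\<lambda>w. rx w * ry w) \<in> borel_measurable borel" by measurable
  from measurable_compose[OF W_measurable[OF assms] this]
  show [measurable]: "\<xi> i \<in> borel_measurable M" unfolding \<xi>_def[abs_def] .
  show "R i \<in> borel_measurable M" unfolding R_decomposition[abs_def] by measurable
qed

end

text \<open>The series that bound the probabilities of the five perturbing events; \<open>g\<close> and \<open>h\<close> are the levels for
  the linear and the quadratic terms.\<close>

definition perturbation_series :: "real \<Rightarrow> real \<Rightarrow> (nat \<Rightarrow> real) \<Rightarrow> (nat \<Rightarrow> real) \<Rightarrow> (nat \<Rightarrow> real) \<Rightarrow> nat \<Rightarrow> ennreal" where
  "perturbation_series g h Vx Vy B m =
    (\<Sum>i. if 1 \<le> i then ennreal (50 / g\<^sup>2 * Vx i / max (real i) (real m)) else 0) +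
    (\<Sum>i. if 1 \<le> i then ennreal (50 / g\<^sup>2 * Vy i / max (real i) (real m)) else 0) +
    (\<Sum>i. if 1 \<le> i then ennreal (1 / h * Vx i / max (real i) (real m)) else 0) +
    (\<Sum>i. if 1 \<le> i then ennreal (1 / h * Vy i / max (real i) (real m)) else 0) +
    (\<Sum>i. if 1 \<le> i then ennreal (1 / g * B i / max (sqrt (real i)) (sqrt (real m))) else 0)"

lemma perturbation_series_vanishes:
  assumes "0 < g" "0 < h" "\<And>i. 0 \<le> Vx i" "\<And>i. 0 \<le> Vy i" "\<And>i. 0 \<le> B i"
    and sums: "summable (\<lambda>i. Vx i / real i)" "summable (\<lambda>i. Vy i / real i)" "summable (\<lambda>i. B i / sqrt (real i))"
  shows "perturbation_series g h Vx Vy B \<longlonglongrightarrow> 0"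
proof -
  have lin: "(\<lambda>m. \<Sum>i. if 1 \<le> i then ennreal (c * V i / max (real i) (real m)) else 0) \<longlonglongrightarrow> 0"
    if "0 \<le> c" "\<And>i. 0 \<le> V i" "summable (\<lambda>i. V i / real i)" for c V
    using summable_mult[OF that(3), of c] that
    by (intro truncated_series_vanishes filterlim_real_sequentially) auto
  have bias: "(\<lambda>m. \<Sum>i. if 1 \<le> i then ennreal (1 / g * B i / max (sqrt (real i)) (sqrt (real m))) else 0) \<longlonglongrightarrow> 0"
  proof (rule truncated_series_vanishes)
    show "filterlim (\<lambda>i. sqrt (real i)) at_top sequentially" by real_asymp
    show "summable (\<lambda>i. 1 / g * B i / sqrt (real i))" using summable_mult[OF sums(3), of "1 / g"] by simp
  qed (use assms in auto)
  have "perturbation_series g h Vx Vy B \<longlonglongrightarrow> 0 + 0 + 0 + 0 + 0"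
    unfolding perturbation_series_def[abs_def]
    by (intro tendsto_add lin bias) (use assms in auto)
  then show ?thesis by simp
qed

context gcm_data
begin

text \<open>Outside the two events about the walk itself and the five events about cross terms and bias, \<open>perturbation_bounds\<close> applies
  at every \<open>k \<ge> m\<close>. The bound \<open>sqrt c\<close> replaces the standard deviation \<open>\<sigma>\<close>, which depends on the distribution.\<close>

lemma perturbation_event:
  assumes \<eta>: "0 < \<eta>" "\<eta> \<le> 1" and c: "0 < c" "sqrt c \<le> \<sigma>" and m: "1 \<le> m"
    and Vx: "\<And>i. 1 \<le> i \<Longrightarrow> ext_variance M (\<lambda>\<omega>. dx i (D i \<omega>) (W 1 \<omega>) * ry (W 1 \<omega>)) \<le> ennreal (Vx i)" "\<And>i. 0 \<le> Vx i"
    and Vy: "\<And>i. 1 \<le> i \<Longrightarrow> ext_variance M (\<lambda>\<omega>. dy i (D i \<omega>) (W 1 \<omega>) * rx (W 1 \<omega>)) \<le> ennreal (Vy i)" "\<And>i. 0 \<le> Vy i"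
    and B: "\<And>i. 1 \<le> i \<Longrightarrow> ennsqrt (expected_L2_error M (\<lambda>\<omega>. snd (snd (W 1 \<omega>))) (D i) (hx i) \<mu>x)
      * ennsqrt (expected_L2_error M (\<lambda>\<omega>. snd (snd (W 1 \<omega>))) (D i) (hy i) \<mu>y) \<le> ennreal (B i)" "\<And>i. 0 \<le> B i"
  defines "Xs \<equiv> \<lambda>i \<omega>. \<xi> i \<omega> / \<sigma>" and "Rs \<equiv> \<lambda>i \<omega>. R i \<omega> / \<sigma>"
  shows "ennreal (prob {\<omega> \<in> space M. \<exists>k\<ge>m. 3 * \<eta> * sqrt (real k) < \<bar>psum Rs k \<omega> - psum Xs k \<omega>\<bar> \<or>
      37 * sqrt \<eta> < \<bar>sample_variance Rs k \<omega> - 1\<bar>})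
    \<le> ennreal (prob {\<omega> \<in> space M. \<exists>k\<ge>m. \<eta> * real k < \<bar>psum Xs k \<omega>\<bar>})
    + ennreal (prob {\<omega> \<in> space M. \<exists>k\<ge>m. \<eta> * real k < \<bar>(\<Sum>i\<in>{1..k}. (Xs i \<omega>)\<^sup>2) - real k\<bar>})
    + perturbation_series (\<eta> * sqrt c) (\<eta> * c) Vx Vy B m"
proof -
  define g where "g = \<eta> * sqrt c"
  define h where "h = \<eta> * c"
  have gh: "0 < g" "0 < h" unfolding g_def h_def using \<eta> c by auto
  have \<sigma>0: "0 < \<sigma>" using c real_sqrt_gt_zero[of c] by linarith
  have c\<sigma>: "c \<le> \<sigma>\<^sup>2"
  proof -
    have "(sqrt c)\<^sup>2 \<le> \<sigma>\<^sup>2" using c by (intro power_mono) auto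
    then show ?thesis using c by simp
  qed
  define E1 where "E1 = {\<omega> \<in> space M. \<exists>k\<ge>m. \<eta> * real k < \<bar>psum Xs k \<omega>\<bar>}"
  define E2 where "E2 = {\<omega> \<in> space M. \<exists>k\<ge>m. \<eta> * real k < \<bar>(\<Sum>i\<in>{1..k}. (Xs i \<omega>)\<^sup>2) - real k\<bar>}"
  define F1 where "F1 = {\<omega> \<in> space M. \<exists>k\<ge>m. 5 * (g / 5) * sqrt (real k) < \<bar>\<Sum>i\<in>{1..k}. u i \<omega>\<bar>}"
  define F2 where "F2 = {\<omega> \<in> space M. \<exists>k\<ge>m. 5 * (g / 5) * sqrt (real k) < \<bar>\<Sum>i\<in>{1..k}. v i \<omega>\<bar>}"
  define F3 where "F3 = {\<omega> \<in> space M. \<exists>k\<ge>m. h * real k < (\<Sum>i\<in>{1..k}. (u i \<omega>)\<^sup>2)}"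
  define F4 where "F4 = {\<omega> \<in> space M. \<exists>k\<ge>m. h * real k < (\<Sum>i\<in>{1..k}. (v i \<omega>)\<^sup>2)}"
  define F5 where "F5 = {\<omega> \<in> space M. \<exists>k\<ge>m. g * sqrt (real k) < (\<Sum>i\<in>{1..k}. \<bar>b i \<omega>\<bar>)}"
  have Xm [measurable]: "Xs i \<in> borel_measurable M" if "1 \<le> i" for i
    unfolding Xs_def using terms_measurable(4)[OF that] by measurable
  have [measurable]: "psum Xs k \<in> borel_measurable M" for k
    unfolding psum_def[abs_def] by (intro borel_measurable_sum Xm) auto
  have ev [measurable]: "E1 \<in> events" "E2 \<in> events" "F1 \<in> events" "F2 \<in> events" "F3 \<in> events" "F4 \<in> events" "F5 \<in> events"
    unfolding E1_def E2_def F1_def F2_def F3_def F4_def F5_def by measurable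
  have sq: "(max (sqrt (real i)) (sqrt (real m)))\<^sup>2 = max (real i) (real m)" for i
    by (simp add: max_power2)
  have g5: "2 / (g / 5)\<^sup>2 * V / x = 50 / g\<^sup>2 * V / x" for V x by (simp add: power_divide)
  have P1: "ennreal (prob F1) \<le> (\<Sum>i. if 1 \<le> i then ennreal (50 / g\<^sup>2 * Vx i / max (real i) (real m)) else 0)"
  proof -
    have "ennreal (prob F1) \<le> (\<Sum>i. if 1 \<le> i then ennreal (2 / (g / 5)\<^sup>2 * Vx i / (max (sqrt (real i)) (sqrt (real m)))\<^sup>2) else 0)"
      unfolding F1_def u_def using gh m
      by (intro cross_terms_tail[where G="\<lambda>i d w. dx i d w * ry w"] products_measurable(1) centred(1)
            cross_second_moments(1) Vx) auto
    then show ?thesis unfolding sq g5 .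
  qed
  have P2: "ennreal (prob F2) \<le> (\<Sum>i. if 1 \<le> i then ennreal (50 / g\<^sup>2 * Vy i / max (real i) (real m)) else 0)"
  proof -
    have "ennreal (prob F2) \<le> (\<Sum>i. if 1 \<le> i then ennreal (2 / (g / 5)\<^sup>2 * Vy i / (max (sqrt (real i)) (sqrt (real m)))\<^sup>2) else 0)"
      unfolding F2_def v_def using gh m
      by (intro cross_terms_tail[where G="\<lambda>i d w. dy i d w * rx w"] products_measurable(2) centred(2)
            cross_second_moments(2) Vy) auto
    then show ?thesis unfolding sq g5 .
  qed
  have P3: "ennreal (prob F3) \<le> (\<Sum>i. if 1 \<le> i then ennreal (1 / h * Vx i / max (real i) (real m)) else 0)"
    unfolding F3_def u_def
  proof (rule nonneg_terms_tail[where G="\<lambda>i d w. (dx i d w * ry w)\<^sup>2"])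
    show "(\<lambda>(w, d). (dx i d w * ry w)\<^sup>2) \<in> borel_measurable (borel \<Otimes>\<^sub>M PiM {1..i} (\<lambda>_. borel))" if "1 \<le> i" for i
      using products_measurable(1)[OF that] unfolding split_def by measurable
  qed (use gh m cross_second_moments(1) Vx in auto)
  have P4: "ennreal (prob F4) \<le> (\<Sum>i. if 1 \<le> i then ennreal (1 / h * Vy i / max (real i) (real m)) else 0)"
    unfolding F4_def v_def
  proof (rule nonneg_terms_tail[where G="\<lambda>i d w. (dy i d w * rx w)\<^sup>2"])
    show "(\<lambda>(w, d). (dy i d w * rx w)\<^sup>2) \<in> borel_measurable (borel \<Otimes>\<^sub>M PiM {1..i} (\<lambda>_. borel))" if "1 \<le> i" for i
      using products_measurable(2)[OF that] unfolding split_def by measurable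
  qed (use gh m cross_second_moments(2) Vy in auto)
  have P5: "ennreal (prob F5) \<le> (\<Sum>i. if 1 \<le> i then ennreal (1 / g * B i / max (sqrt (real i)) (sqrt (real m))) else 0)"
    unfolding F5_def b_def
  proof (rule nonneg_terms_tail[where G="\<lambda>i d w. \<bar>dx i d w * dy i d w\<bar>"])
    show "(\<lambda>(w, d). \<bar>dx i d w * dy i d w\<bar>) \<in> borel_measurable (borel \<Otimes>\<^sub>M PiM {1..i} (\<lambda>_. borel))" if "1 \<le> i" for i
      using products_measurable(3)[OF that] unfolding split_def by measurable
    show "(\<integral>\<^sup>+\<omega>. ennreal \<bar>dx i (D i \<omega>) (W 1 \<omega>) * dy i (D i \<omega>) (W 1 \<omega>)\<bar> \<partial>M) \<le> ennreal (B i)" if "1 \<le> i" for i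
      by (rule order_trans[OF bias_first_moment[OF that] B(1)[OF that]])
  qed (use gh m B(2) in auto)
  let ?bad = "{\<omega> \<in> space M. \<exists>k\<ge>m. 3 * \<eta> * sqrt (real k) < \<bar>psum Rs k \<omega> - psum Xs k \<omega>\<bar> \<or>
      37 * sqrt \<eta> < \<bar>sample_variance Rs k \<omega> - 1\<bar>}"
  let ?U = "E1 \<union> (E2 \<union> (F1 \<union> (F2 \<union> (F3 \<union> (F4 \<union> F5)))))"
  have "?bad \<subseteq> ?U"
  proof
    fix \<omega> assume "\<omega> \<in> ?bad"
    then obtain k where w: "\<omega> \<in> space M" and k: "m \<le> k" "3 * \<eta> * sqrt (real k) < \<bar>psum Rs k \<omega> - psum Xs k \<omega>\<bar> \<or>
      37 * sqrt \<eta> < \<bar>sample_variance Rs k \<omega> - 1\<bar>" by auto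
    have k1: "1 \<le> k" using k m by simp
    show "\<omega> \<in> ?U"
    proof (rule ccontr)
      assume no: "\<omega> \<notin> ?U"
      have e1: "\<bar>\<Sum>i\<in>{1..k}. Xs i \<omega>\<bar> \<le> \<eta> * real k"
        and e2: "\<bar>(\<Sum>i\<in>{1..k}. (Xs i \<omega>)\<^sup>2) - real k\<bar> \<le> \<eta> * real k"
        and f1: "\<bar>\<Sum>i\<in>{1..k}. u i \<omega>\<bar> \<le> g * sqrt (real k)" and f2: "\<bar>\<Sum>i\<in>{1..k}. v i \<omega>\<bar> \<le> g * sqrt (real k)"
        and f3: "(\<Sum>i\<in>{1..k}. (u i \<omega>)\<^sup>2) \<le> h * real k" and f4: "(\<Sum>i\<in>{1..k}. (v i \<omega>)\<^sup>2) \<le> h * real k"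
        and f5: "(\<Sum>i\<in>{1..k}. \<bar>b i \<omega>\<bar>) \<le> g * sqrt (real k)"
        using no w k(1) unfolding E1_def E2_def F1_def F2_def F3_def F4_def F5_def psum_def by (auto simp: not_less)
      have lin: "x / \<sigma> \<le> \<eta> * sqrt (real k)" if "x \<le> g * sqrt (real k)" for x
      proof -
        have "g * sqrt (real k) \<le> \<eta> * \<sigma> * sqrt (real k)"
          unfolding g_def using c \<eta> by (intro mult_right_mono mult_left_mono) auto
        then have "x \<le> (\<eta> * sqrt (real k)) * \<sigma>" using that by (simp add: mult_ac)
        then show ?thesis using \<sigma>0 by (simp only: pos_divide_le_eq)
      qed
      have quad: "x / \<sigma>\<^sup>2 \<le> \<eta> * real k" if "x \<le> h * real k" for x
      proof -
        have "h * real k \<le> \<eta> * \<sigma>\<^sup>2 * real k"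
          unfolding h_def using c\<sigma> \<eta> by (intro mult_right_mono mult_left_mono) auto
        then have "x \<le> (\<eta> * real k) * \<sigma>\<^sup>2" using that by (simp add: mult_ac)
        moreover have "0 < \<sigma>\<^sup>2" using \<sigma>0 by simp
        ultimately show ?thesis by (simp only: pos_divide_le_eq)
      qed
      have s1: "\<bar>\<Sum>i\<in>{1..k}. y i / \<sigma>\<bar> = \<bar>\<Sum>i\<in>{1..k}. y i\<bar> / \<sigma>" for y :: "nat \<Rightarrow> real"
        using \<sigma>0 by (simp add: sum_divide_distrib[symmetric])
      have s2: "(\<Sum>i\<in>{1..k}. (y i / \<sigma>)\<^sup>2) = (\<Sum>i\<in>{1..k}. (y i)\<^sup>2) / \<sigma>\<^sup>2" for y :: "nat \<Rightarrow> real"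
        by (simp add: power_divide sum_divide_distrib[symmetric])
      have s3: "(\<Sum>i\<in>{1..k}. \<bar>y i / \<sigma>\<bar>) = (\<Sum>i\<in>{1..k}. \<bar>y i\<bar>) / \<sigma>" for y :: "nat \<Rightarrow> real"
        using \<sigma>0 by (simp add: sum_divide_distrib[symmetric])
      have r: "Rs i \<omega> = Xs i \<omega> - u i \<omega> / \<sigma> - v i \<omega> / \<sigma> + b i \<omega> / \<sigma>" for i
        unfolding Rs_def Xs_def R_decomposition by (simp add: diff_divide_distrib add_divide_distrib)
      have pert: "\<bar>(\<Sum>i\<in>{1..k}. Rs i \<omega>) - (\<Sum>i\<in>{1..k}. Xs i \<omega>)\<bar> \<le> 3 * \<eta> * sqrt (real k)"
        "\<bar>1 / real k * (\<Sum>i\<in>{1..k}. (Rs i \<omega>)\<^sup>2) - (1 / real k * (\<Sum>i\<in>{1..k}. Rs i \<omega>))\<^sup>2 - 1\<bar> \<le> 37 * sqrt \<eta>"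
        by (rule perturbation_bounds[OF k1 \<eta> r e2 e1]; simp only: s1 s2 s3; intro lin quad f1 f2 f3 f4 f5)+
      then show False using k(2) unfolding psum_def sample_variance_def by linarith
    qed
  qed
  then have "prob ?bad \<le> prob ?U" by (intro finite_measure_mono) auto
  also have "\<dots> \<le> prob E1 + (prob E2 + (prob F1 + (prob F2 + (prob F3 + (prob F4 + prob F5)))))"
    by (intro order_trans[OF measure_Un_le] add_left_mono order_trans[OF measure_Un_le, OF _ _ add_left_mono] order_refl ev sets.Un)
  finally have "ennreal (prob ?bad) \<le> ennreal (prob E1 + (prob E2 + (prob F1 + (prob F2 + (prob F3 + (prob F4 + prob F5))))))"
    by (rule ennreal_leI)
  also have "\<dots> = ennreal (prob E1) + ennreal (prob E2) + (ennreal (prob F1) + ennreal (prob F2) + ennreal (prob F3) + ennreal (prob F4) + ennreal (prob F5))"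
    by (simp add: ennreal_plus add.assoc)
  also have "\<dots> \<le> ennreal (prob E1) + ennreal (prob E2) + perturbation_series g h Vx Vy B m"
    unfolding perturbation_series_def by (intro add_mono order_refl P1 P2 P3 P4 P5)
  finally show ?thesis unfolding E1_def E2_def g_def h_def .
qed

end

text \<open>The statement for one selection of distributions. The statistic is invariant under division of the residual products by
  \<open>\<sigma> m\<close>, which turns their leading part into a standardised walk.\<close>

lemma gcm_array_limit:
  fixes P :: "nat \<Rightarrow> 'a measure" and W W' :: "nat \<Rightarrow> 'a \<Rightarrow> real \<times> real \<times> (real ^ 'd)"
  assumes data: "\<And>m. gcm_data (P m) W W' hx hy (\<mu>x m) (\<mu>y m)"
    and p: "2 < p" "p \<le> 3" and c: "0 < c" and K0: "0 \<le> K" and a: "0 < a"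
    and K: "\<And>m. (\<integral>\<^sup>+\<omega>. ennreal (\<bar>gcm_data.\<xi> W (\<mu>x m) (\<mu>y m) 1 \<omega>\<bar> powr p) \<partial>P m) \<le> ennreal K"
    and var: "\<And>m. ennreal c \<le> ext_variance (P m) (gcm_data.\<xi> W (\<mu>x m) (\<mu>y m) 1)"
    and Vx: "\<And>m i. 1 \<le> i \<Longrightarrow> ext_variance (P m) (\<lambda>\<omega>. gcm_data.dx hx (\<mu>x m) i (training_data W' i \<omega>) (W 1 \<omega>) * gcm_data.ry (\<mu>y m) (W 1 \<omega>)) \<le> ennreal (Vx i)"
    and Vy: "\<And>m i. 1 \<le> i \<Longrightarrow> ext_variance (P m) (\<lambda>\<omega>. gcm_data.dy hy (\<mu>y m) i (training_data W' i \<omega>) (W 1 \<omega>) * gcm_data.rx (\<mu>x m) (W 1 \<omega>)) \<le> ennreal (Vy i)"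
    and B: "\<And>m i. 1 \<le> i \<Longrightarrow> ennsqrt (expected_L2_error (P m) (\<lambda>\<omega>. snd (snd (W 1 \<omega>))) (training_data W' i) (hx i) (\<mu>x m))
      * ennsqrt (expected_L2_error (P m) (\<lambda>\<omega>. snd (snd (W 1 \<omega>))) (training_data W' i) (hy i) (\<mu>y m)) \<le> ennreal (B i)"
    and nonneg: "\<And>i. 0 \<le> Vx i" "\<And>i. 0 \<le> Vy i" "\<And>i. 0 \<le> B i"
    and sums: "summable (\<lambda>i. Vx i / real i)" "summable (\<lambda>i. Vy i / real i)" "summable (\<lambda>i. B i / sqrt (real i))"
  shows "(\<lambda>m. measure (P m) {\<omega> \<in> space (P m). \<exists>k\<ge>m. gcm_pvalue (gcm_data.R W W' hx hy) k m \<omega> \<le> rs_tail a})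
    \<longlonglongrightarrow> rs_tail a"
proof -
  define K' where "K' = K / c powr (p / 2)"
  let ?\<xi> = "\<lambda>m. gcm_data.\<xi> W (\<mu>x m) (\<mu>y m)"
  let ?R = "gcm_data.R W W' hx hy"
  have "\<exists>\<sigma>. sqrt c \<le> \<sigma> \<and> std_walk (P m) (\<lambda>i \<omega>. ?\<xi> m i \<omega> / \<sigma>) p K'" for m
    using gcm_data.standardised_walk[OF data p c K K0 var, of m] unfolding K'_def by blast
  then obtain \<sigma> where \<sigma>: "\<And>m. sqrt c \<le> \<sigma> m" and walk: "\<And>m. std_walk (P m) (\<lambda>i \<omega>. ?\<xi> m i \<omega> / \<sigma> m) p K'"
    by metis
  have \<sigma>0: "0 < \<sigma> m" for m using \<sigma>[of m] c real_sqrt_gt_zero[of c] by linarith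
  have "(\<lambda>m. measure (P m) {\<omega> \<in> space (P m). \<exists>k\<ge>m.
      a\<^sup>2 \<le> real k * (gcm_stat (\<lambda>i \<omega>. ?R i \<omega> / \<sigma> m) k \<omega>)\<^sup>2 - ln (real k / real m)}) \<longlonglongrightarrow> rs_tail a"
  proof (rule perturbed_crossing_limit[OF walk a])
    show "(\<lambda>\<omega>. ?R i \<omega> / \<sigma> m) \<in> borel_measurable (P m)" if "1 \<le> i" for m i
      using gcm_data.terms_measurable(5)[OF data that] by simp
    fix \<epsilon> :: real assume \<epsilon>: "0 < \<epsilon>"
    \<comment> \<open>Chosen such that \<open>3 * \<eta>\<close> and \<open>37 * sqrt \<eta>\<close> are at most \<open>\<epsilon>\<close>.\<close>
    define \<eta> where "\<eta> = min 1 ((\<epsilon> / 37)\<^sup>2)"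
    have \<eta>: "0 < \<eta>" "\<eta> \<le> 1" unfolding \<eta>_def using \<epsilon> by auto
    have s\<eta>: "sqrt \<eta> \<le> \<epsilon> / 37"
    proof -
      have "sqrt \<eta> \<le> sqrt ((\<epsilon> / 37)\<^sup>2)" unfolding \<eta>_def by (intro real_sqrt_le_mono) simp
      then show ?thesis using \<epsilon> by simp
    qed
    have "\<eta> \<le> sqrt \<eta>" using \<eta> by (intro real_le_rsqrt) (simp add: power2_eq_square mult_left_le)
    then have lev: "3 * \<eta> \<le> \<epsilon>" "37 * sqrt \<eta> \<le> \<epsilon>" using s\<eta> \<epsilon> by auto
    let ?Xs = "\<lambda>m i \<omega>. ?\<xi> m i \<omega> / \<sigma> m" and ?Rs = "\<lambda>m i \<omega>. ?R i \<omega> / \<sigma> m"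
    let ?bound = "\<lambda>m. ennreal (measure (P m) {\<omega> \<in> space (P m). \<exists>k\<ge>m. \<eta> * real k < \<bar>psum (?Xs m) k \<omega>\<bar>})
        + ennreal (measure (P m) {\<omega> \<in> space (P m). \<exists>k\<ge>m. \<eta> * real k < \<bar>(\<Sum>i\<in>{1..k}. (?Xs m i \<omega>)\<^sup>2) - real k\<bar>})
        + perturbation_series (\<eta> * sqrt c) (\<eta> * c) Vx Vy B m"
    show "(\<lambda>m. measure (P m) {\<omega> \<in> space (P m). \<exists>k\<ge>m.
      \<epsilon> * sqrt (real k) < \<bar>psum (?Rs m) k \<omega> - psum (?Xs m) k \<omega>\<bar> \<or> \<epsilon> < \<bar>sample_variance (?Rs m) k \<omega> - 1\<bar>}) \<longlonglongrightarrow> 0"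
    proof (rule ennreal_bounds_vanish[where g="?bound"])
      have "?bound \<longlonglongrightarrow> ennreal 0 + ennreal 0 + 0"
        using \<eta> c nonneg sums
        by (intro tendsto_add tendsto_ennrealI walk_laws_of_large_numbers[OF walk] perturbation_series_vanishes) auto
      then show "?bound \<longlonglongrightarrow> 0" by simp
      fix m :: nat assume m: "1 \<le> m"
      interpret gcm_data "P m" W W' hx hy "\<mu>x m" "\<mu>y m" by (rule data)
      have Rm: "?Rs m i \<in> borel_measurable (P m)" "?Xs m i \<in> borel_measurable (P m)" if "1 \<le> i" for i
        using terms_measurable[OF that] by auto
      note [measurable] = sample_variance_measurable[of "?Rs m", OF Rm(1)] sample_variance_measurable(1)[of "?Xs m", OF Rm(2)]
      have "prob {\<omega> \<in> space (P m). \<exists>k\<ge>m. \<epsilon> * sqrt (real k) < \<bar>psum (?Rs m) k \<omega> - psum (?Xs m) k \<omega>\<bar> \<or> \<epsilon> < \<bar>sample_variance (?Rs m) k \<omega> - 1\<bar>}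
        \<le> prob {\<omega> \<in> space (P m). \<exists>k\<ge>m. 3 * \<eta> * sqrt (real k) < \<bar>psum (?Rs m) k \<omega> - psum (?Xs m) k \<omega>\<bar> \<or>
            37 * sqrt \<eta> < \<bar>sample_variance (?Rs m) k \<omega> - 1\<bar>}"
      proof (intro finite_measure_mono subsetI)
        fix \<omega> assume "\<omega> \<in> {\<omega> \<in> space (P m). \<exists>k\<ge>m. \<epsilon> * sqrt (real k) < \<bar>psum (?Rs m) k \<omega> - psum (?Xs m) k \<omega>\<bar> \<or> \<epsilon> < \<bar>sample_variance (?Rs m) k \<omega> - 1\<bar>}"
        then obtain k where w: "\<omega> \<in> space (P m)" "m \<le> k"
          and k: "\<epsilon> * sqrt (real k) < \<bar>psum (?Rs m) k \<omega> - psum (?Xs m) k \<omega>\<bar> \<or> \<epsilon> < \<bar>sample_variance (?Rs m) k \<omega> - 1\<bar>" by blast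
        have "3 * \<eta> * sqrt (real k) \<le> \<epsilon> * sqrt (real k)" using lev by (intro mult_right_mono) auto
        then have "3 * \<eta> * sqrt (real k) < \<bar>psum (?Rs m) k \<omega> - psum (?Xs m) k \<omega>\<bar> \<or> 37 * sqrt \<eta> < \<bar>sample_variance (?Rs m) k \<omega> - 1\<bar>"
          using k lev by linarith
        then show "\<omega> \<in> {\<omega> \<in> space (P m). \<exists>k\<ge>m. 3 * \<eta> * sqrt (real k) < \<bar>psum (?Rs m) k \<omega> - psum (?Xs m) k \<omega>\<bar> \<or>
            37 * sqrt \<eta> < \<bar>sample_variance (?Rs m) k \<omega> - 1\<bar>}" using w by blast
      qed measurable
      then have "ennreal (prob {\<omega> \<in> space (P m). \<exists>k\<ge>m. \<epsilon> * sqrt (real k) < \<bar>psum (?Rs m) k \<omega> - psum (?Xs m) k \<omega>\<bar> \<or> \<epsilon> < \<bar>sample_variance (?Rs m) k \<omega> - 1\<bar>})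
        \<le> ennreal (prob {\<omega> \<in> space (P m). \<exists>k\<ge>m. 3 * \<eta> * sqrt (real k) < \<bar>psum (?Rs m) k \<omega> - psum (?Xs m) k \<omega>\<bar> \<or>
            37 * sqrt \<eta> < \<bar>sample_variance (?Rs m) k \<omega> - 1\<bar>})" by (rule ennreal_leI)
      also have "\<dots> \<le> ?bound m"
        by (rule perturbation_event[OF \<eta> c \<sigma> m Vx nonneg(1) Vy nonneg(2) B nonneg(3)])
      finally show "ennreal (prob {\<omega> \<in> space (P m). \<exists>k\<ge>m. \<epsilon> * sqrt (real k) < \<bar>psum (?Rs m) k \<omega> - psum (?Xs m) k \<omega>\<bar> \<or> \<epsilon> < \<bar>sample_variance (?Rs m) k \<omega> - 1\<bar>})
        \<le> ?bound m" .
    qed simp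
  qed
  then show ?thesis unfolding gcm_pvalue_le_iff[OF a] gcm_stat_scale[OF \<sigma>0] .
qed

section \<open>Uniformity over the class and over the level\<close>

text \<open>A failure of uniformity would be witnessed by one distribution for each \<open>m\<close>.\<close>

lemma uniform_limit_by_selections:
  fixes q :: "nat \<Rightarrow> 'b \<Rightarrow> real"
  assumes lim: "\<And>P. (\<And>m. P m \<in> A) \<Longrightarrow> (\<lambda>m. q m (P m)) \<longlonglongrightarrow> l" and e: "0 < e"
  shows "\<forall>\<^sub>F m in sequentially. \<forall>P\<in>A. \<bar>q m P - l\<bar> < e"
proof (cases "A = {}")
  case False
  then obtain P0 where P0: "P0 \<in> A" by auto
  define P where "P m = (if \<exists>Q\<in>A. \<not> \<bar>q m Q - l\<bar> < e then SOME Q. Q \<in> A \<and> \<not> \<bar>q m Q - l\<bar> < e else P0)" for m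
  have sel: "P m \<in> A \<and> \<not> \<bar>q m (P m) - l\<bar> < e" if "\<exists>Q\<in>A. \<not> \<bar>q m Q - l\<bar> < e" for m
    using someI_ex[of "\<lambda>Q. Q \<in> A \<and> \<not> \<bar>q m Q - l\<bar> < e"] that unfolding P_def by auto
  have "P m \<in> A" for m
    using sel[of m] P0 by (cases "\<exists>Q\<in>A. \<not> \<bar>q m Q - l\<bar> < e") (auto simp: P_def)
  from tendstoD[OF lim[OF this] e]
  have "\<forall>\<^sub>F m in sequentially. \<bar>q m (P m) - l\<bar> < e" by (simp add: dist_real_def)
  then show ?thesis by eventually_elim (use sel in blast)
qed simp

text \<open>Monotone functions of \<open>\<alpha>\<close> that converge pointwise to the identity converge uniformly.\<close>

lemma uniform_in_level:
  fixes q :: "nat \<Rightarrow> 'b \<Rightarrow> real \<Rightarrow> real"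
  assumes pointwise: "\<And>\<alpha> e. 0 < \<alpha> \<Longrightarrow> \<alpha> < 1 \<Longrightarrow> 0 < e \<Longrightarrow> \<forall>\<^sub>F m in sequentially. \<forall>P\<in>A. \<bar>q m P \<alpha> - \<alpha>\<bar> < e"
    and mono: "\<And>m P \<alpha> \<beta>. P \<in> A \<Longrightarrow> 0 < \<alpha> \<Longrightarrow> \<alpha> \<le> \<beta> \<Longrightarrow> \<beta> < 1 \<Longrightarrow> q m P \<alpha> \<le> q m P \<beta>"
    and range: "\<And>m P \<alpha>. P \<in> A \<Longrightarrow> 0 \<le> q m P \<alpha> \<and> q m P \<alpha> \<le> 1" and e: "0 < e"
  shows "\<forall>\<^sub>F m in sequentially. \<forall>P\<in>A. \<forall>\<alpha>\<in>{0<..<1}. \<bar>q m P \<alpha> - \<alpha>\<bar> \<le> e"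
proof -
  obtain N :: nat where N: "2 / e < real N" using reals_Archimedean2 by blast
  have N0: "0 < real N" using N e by (meson divide_pos_pos less_trans zero_less_numeral)
  have gap: "1 / real N \<le> e / 2" using N e N0 by (simp add: field_simps)
  have "\<forall>\<^sub>F m in sequentially. \<forall>j\<in>{1..<N}. \<forall>P\<in>A. \<bar>q m P (real j / real N) - real j / real N\<bar> < e / 2"
    using e by (intro eventually_ball_finite ballI pointwise) auto
  then show ?thesis
  proof eventually_elim
    case (elim m)
    show ?case
    proof (intro ballI)
      fix P and \<alpha> :: real assume P: "P \<in> A" and "\<alpha> \<in> {0<..<1}"
      then have \<alpha>: "0 < \<alpha>" "\<alpha> < 1" by auto
      \<comment> \<open>The grid points \<open>j / N\<close> and \<open>(j + 1) / N\<close> enclose \<open>\<alpha>\<close>; at \<open>0\<close> and \<open>1\<close> the trivial bounds on a probability take over.\<close>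
      define j where "j = nat \<lfloor>\<alpha> * real N\<rfloor>"
      have fl: "real j \<le> \<alpha> * real N" "\<alpha> * real N < real j + 1"
        unfolding j_def using \<alpha> N0 by (auto simp: of_nat_nat)
      have "\<alpha> * real N < real N" using \<alpha> N0 by simp
      then have jN: "j < N" using fl by linarith
      have lo: "real j / real N \<le> \<alpha>" using fl(1) N0 by (simp only: pos_divide_le_eq)
      have hi: "\<alpha> < real (Suc j) / real N" unfolding pos_less_divide_eq[OF N0] using fl(2) by simp
      have sj: "real (Suc j) / real N = real j / real N + 1 / real N" by (simp add: add_divide_distrib)
      have "\<alpha> - e \<le> q m P \<alpha>"
      proof (cases "j = 0")
        case True
        then show ?thesis using hi sj gap range[OF P, of m \<alpha>] e by simp
      next
        case False
        then have "q m P (real j / real N) \<le> q m P \<alpha>" using lo \<alpha> N0 by (intro mono P) auto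
        moreover have "\<bar>q m P (real j / real N) - real j / real N\<bar> < e / 2" using elim False jN P by auto
        ultimately show ?thesis using hi sj gap by linarith
      qed
      moreover have "q m P \<alpha> \<le> \<alpha> + e"
      proof (cases "Suc j = N")
        case True
        then have "real (Suc j) / real N = 1" using N0 by simp
        then show ?thesis using lo sj gap range[OF P, of m \<alpha>] e by linarith
      next
        case False
        then have S: "Suc j \<in> {1..<N}" using jN by auto
        then have "real (Suc j) / real N < 1" using N0 by simp
        then have "q m P \<alpha> \<le> q m P (real (Suc j) / real N)" using hi \<alpha> by (intro mono P) auto
        moreover have "\<bar>q m P (real (Suc j) / real N) - real (Suc j) / real N\<bar> < e / 2" using elim S P by blast
        ultimately show ?thesis using lo sj gap by linarith
      qed
      ultimately show "\<bar>q m P \<alpha> - \<alpha>\<bar> \<le> e" by linarith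
    qed
  qed
qed

theorem theorem4p3:
  fixes M :: "'w measure"
    and \<P> \<P>\<^sub>0 :: "'w measure set"
    and X Y X' Y' :: "nat \<Rightarrow> 'w \<Rightarrow> real"
    and Z Z' :: "nat \<Rightarrow> 'w \<Rightarrow> real ^ 'd"
    and W W' :: "nat \<Rightarrow> 'w \<Rightarrow> real \<times> real \<times> (real ^ 'd)"
    and hx hy :: "(real \<times> real \<times> (real ^ 'd), real ^ 'd) estimator"
    and \<mu>x \<mu>y :: "'w measure \<Rightarrow> real ^ 'd \<Rightarrow> real"
    and \<xi>x \<xi>y :: "'w measure \<Rightarrow> 'w \<Rightarrow> real"
  defines "W \<equiv> \<lambda>i \<omega>. (X i \<omega>, Y i \<omega>, Z i \<omega>)"
    and "W' \<equiv> \<lambda>i \<omega>. (X' i \<omega>, Y' i \<omega>, Z' i \<omega>)"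
    and "\<xi>x \<equiv> \<lambda>P \<omega>. X 1 \<omega> - \<mu>x P (Z 1 \<omega>)"
    and "\<xi>y \<equiv> \<lambda>P \<omega>. Y 1 \<omega> - \<mu>y P (Z 1 \<omega>)"
  assumes "\<And>P. P \<in> \<P> \<Longrightarrow> prob_space P \<and> sets P = sets M"
    and "\<And>P. P \<in> \<P> \<Longrightarrow> iid_seq P W"
    and "\<And>P. P \<in> \<P> \<Longrightarrow> training_copy P W W'"
    and "measurable_estimator hx" and "measurable_estimator hy"
    and "\<P>\<^sub>0 \<subseteq> \<P>"
    and "\<And>P. P \<in> \<P>\<^sub>0 \<Longrightarrow> is_regression_function P (X 1) (Z 1) (\<mu>x P)"
    and "\<And>P. P \<in> \<P>\<^sub>0 \<Longrightarrow> is_regression_function P (Y 1) (Z 1) (\<mu>y P)"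
    and "\<And>P. P \<in> \<P>\<^sub>0 \<Longrightarrow> cond_indep_given P (X 1) (Y 1) (Z 1)"
    and "\<exists>\<delta>>0. finite_bigo
           (\<lambda>n. SUP P\<in>\<P>\<^sub>0.
              ennsqrt (expected_L2_error P (Z 1) (training_data W' n) (hx n) (\<mu>x P)) *
              ennsqrt (expected_L2_error P (Z 1) (training_data W' n) (hy n) (\<mu>y P)))
           (\<lambda>n. 1 / sqrt (real n * ln (real n) powr (2 + \<delta>)))"
    and "\<exists>\<delta>>0.
           finite_bigo
             (\<lambda>n. SUP P\<in>\<P>\<^sub>0. ext_variance P
                (\<lambda>\<omega>. (hx n (training_data W' n \<omega>) (Z 1 \<omega>) - \<mu>x P (Z 1 \<omega>)) * \<xi>y P \<omega>))
             (\<lambda>n. 1 / ln (real n) powr (2 + \<delta>)) \<and>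
           finite_bigo
             (\<lambda>n. SUP P\<in>\<P>\<^sub>0. ext_variance P
                (\<lambda>\<omega>. (hy n (training_data W' n \<omega>) (Z 1 \<omega>) - \<mu>y P (Z 1 \<omega>)) * \<xi>x P \<omega>))
             (\<lambda>n. 1 / ln (real n) powr (2 + \<delta>))"
    and "\<exists>\<delta>>0.
           (SUP P\<in>\<P>\<^sub>0. \<integral>\<^sup>+\<omega>. ennreal (\<bar>\<xi>x P \<omega> * \<xi>y P \<omega>\<bar> powr (2 + \<delta>)) \<partial>P) < \<infinity> \<and>
           (INF P\<in>\<P>\<^sub>0. ext_variance P (\<lambda>\<omega>. \<xi>x P \<omega> * \<xi>y P \<omega>)) > 0"
  shows "(\<lambda>m. SUP P\<in>\<P>\<^sub>0. SUP \<alpha>\<in>{0<..<1::real}.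
            ennreal \<bar>measure P {\<omega> \<in> space P. \<exists>k\<ge>m.
                gcm_pvalue (residual_product X Y Z W' hx hy) k m \<omega> \<le> \<alpha>} - \<alpha>\<bar>)
          \<longlonglongrightarrow> 0"
proof -
  let ?R = "residual_product X Y Z W' hx hy"
  have fW: "fst (W i \<omega>) = X i \<omega>" "fst (snd (W i \<omega>)) = Y i \<omega>" "snd (snd (W i \<omega>)) = Z i \<omega>" for i \<omega>
    unfolding W_def by simp_all
  have data: "gcm_data P W W' hx hy (\<mu>x P) (\<mu>y P)" if P: "P \<in> \<P>\<^sub>0" for P
  proof -
    have "P \<in> \<P>" using P assms(10) by auto
    then show ?thesis
      unfolding gcm_data_def sample_split_def sample_split_axioms_def gcm_data_axioms_def fW
      using assms(5,6,7)[of P] assms(8,9) assms(11,12,13)[OF P] by auto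
  qed
  have R_eq: "gcm_data.R W W' hx hy = ?R" if P: "P \<in> \<P>\<^sub>0" for P
    unfolding gcm_data.R_def[OF data[OF P], abs_def] residual_product_def[abs_def] fW ..
  have \<xi>_eq: "gcm_data.\<xi> W (\<mu>x P) (\<mu>y P) 1 = (\<lambda>\<omega>. \<xi>x P \<omega> * \<xi>y P \<omega>)"
    and dx_eq: "gcm_data.dx hx (\<mu>x P) i d (W 1 \<omega>) = hx i d (Z 1 \<omega>) - \<mu>x P (Z 1 \<omega>)"
    and dy_eq: "gcm_data.dy hy (\<mu>y P) i d (W 1 \<omega>) = hy i d (Z 1 \<omega>) - \<mu>y P (Z 1 \<omega>)"
    and rx_eq: "gcm_data.rx (\<mu>x P) (W 1 \<omega>) = \<xi>x P \<omega>" and ry_eq: "gcm_data.ry (\<mu>y P) (W 1 \<omega>) = \<xi>y P \<omega>"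
    if P: "P \<in> \<P>\<^sub>0" for P i d \<omega>
    unfolding gcm_data.\<xi>_def[OF data[OF P], abs_def] gcm_data.dx_def[OF data[OF P]] gcm_data.dy_def[OF data[OF P]]
      gcm_data.rx_def[OF data[OF P]] gcm_data.ry_def[OF data[OF P]] fW \<xi>x_def \<xi>y_def by (rule refl)+
  define fB where "fB n = (SUP P\<in>\<P>\<^sub>0.
      ennsqrt (expected_L2_error P (Z 1) (training_data W' n) (hx n) (\<mu>x P)) *
      ennsqrt (expected_L2_error P (Z 1) (training_data W' n) (hy n) (\<mu>y P)))" for n
  define fX where "fX n = (SUP P\<in>\<P>\<^sub>0. ext_variance P
      (\<lambda>\<omega>. (hx n (training_data W' n \<omega>) (Z 1 \<omega>) - \<mu>x P (Z 1 \<omega>)) * \<xi>y P \<omega>))" for n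
  define fY where "fY n = (SUP P\<in>\<P>\<^sub>0. ext_variance P
      (\<lambda>\<omega>. (hy n (training_data W' n \<omega>) (Z 1 \<omega>) - \<mu>y P (Z 1 \<omega>)) * \<xi>x P \<omega>))" for n
  obtain \<delta>1 where \<delta>1: "\<delta>1 > 0" "finite_bigo fB (\<lambda>n. 1 / sqrt (real n * ln (real n) powr (2 + \<delta>1)))"
    using assms(14) unfolding fB_def by auto
  obtain \<delta>2 where \<delta>2: "\<delta>2 > 0" "finite_bigo fX (\<lambda>n. 1 / ln (real n) powr (2 + \<delta>2))"
    "finite_bigo fY (\<lambda>n. 1 / ln (real n) powr (2 + \<delta>2))"
    using assms(15) unfolding fX_def fY_def by auto
  obtain \<delta>3 where \<delta>3: "\<delta>3 > 0"
    and mom: "(SUP P\<in>\<P>\<^sub>0. \<integral>\<^sup>+\<omega>. ennreal (\<bar>\<xi>x P \<omega> * \<xi>y P \<omega>\<bar> powr (2 + \<delta>3)) \<partial>P) < \<infinity>"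
    and var: "(INF P\<in>\<P>\<^sub>0. ext_variance P (\<lambda>\<omega>. \<xi>x P \<omega> * \<xi>y P \<omega>)) > 0"
    using assms(16) by auto
  have below: "g P \<le> ennreal (enn2real (SUP P\<in>\<P>\<^sub>0. g P))" if "(SUP P\<in>\<P>\<^sub>0. g P) < \<infinity>" "P \<in> \<P>\<^sub>0" for g P
    using that SUP_upper[of P \<P>\<^sub>0 g] by simp
  have bB: "ennsqrt (expected_L2_error P (Z 1) (training_data W' n) (hx n) (\<mu>x P)) *
      ennsqrt (expected_L2_error P (Z 1) (training_data W' n) (hy n) (\<mu>y P)) \<le> ennreal (enn2real (fB n))"
    and bX: "ext_variance P (\<lambda>\<omega>. (hx n (training_data W' n \<omega>) (Z 1 \<omega>) - \<mu>x P (Z 1 \<omega>)) * \<xi>y P \<omega>) \<le> ennreal (enn2real (fX n))"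
    and bY: "ext_variance P (\<lambda>\<omega>. (hy n (training_data W' n \<omega>) (Z 1 \<omega>) - \<mu>y P (Z 1 \<omega>)) * \<xi>x P \<omega>) \<le> ennreal (enn2real (fY n))"
    if "1 \<le> n" "P \<in> \<P>\<^sub>0" for n P
  proof -
    have fin: "fB n < \<infinity>" "fX n < \<infinity>" "fY n < \<infinity>" using \<delta>1(2) \<delta>2(2,3) that(1) unfolding finite_bigo_def by auto
    show "ennsqrt (expected_L2_error P (Z 1) (training_data W' n) (hx n) (\<mu>x P)) *
      ennsqrt (expected_L2_error P (Z 1) (training_data W' n) (hy n) (\<mu>y P)) \<le> ennreal (enn2real (fB n))"
      using below[OF fin(1)[unfolded fB_def] that(2)] unfolding fB_def .
    show "ext_variance P (\<lambda>\<omega>. (hx n (training_data W' n \<omega>) (Z 1 \<omega>) - \<mu>x P (Z 1 \<omega>)) * \<xi>y P \<omega>) \<le> ennreal (enn2real (fX n))"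
      using below[OF fin(2)[unfolded fX_def] that(2)] unfolding fX_def .
    show "ext_variance P (\<lambda>\<omega>. (hy n (training_data W' n \<omega>) (Z 1 \<omega>) - \<mu>y P (Z 1 \<omega>)) * \<xi>x P \<omega>) \<le> ennreal (enn2real (fY n))"
      using below[OF fin(3)[unfolded fY_def] that(2)] unfolding fY_def .
  qed
  have sums: "summable (\<lambda>n. enn2real (fX n) / real n)" "summable (\<lambda>n. enn2real (fY n) / real n)"
    "summable (\<lambda>n. enn2real (fB n) / sqrt (real n))"
    using \<delta>1 \<delta>2 unfolding finite_bigo_def by (auto intro: summable_variance_rate summable_bias_rate)
  obtain c where c: "0 < c" "ennreal c \<le> (INF P\<in>\<P>\<^sub>0. ext_variance P (\<lambda>\<omega>. \<xi>x P \<omega> * \<xi>y P \<omega>))"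
  proof (cases "INF P\<in>\<P>\<^sub>0. ext_variance P (\<lambda>\<omega>. \<xi>x P \<omega> * \<xi>y P \<omega>)")
    case (real r)
    then show thesis using var that[of r] by simp
  next
    case top
    then show thesis using that[of 1] by simp
  qed
  \<comment> \<open>The arguments about the walk use a moment exponent of at most \<open>3\<close>.\<close>
  define p where "p = 2 + min \<delta>3 1"
  have p: "2 < p" "p \<le> 3" "p \<le> 2 + \<delta>3" unfolding p_def using \<delta>3 by auto
  define K where "K = 1 + enn2real (SUP P\<in>\<P>\<^sub>0. \<integral>\<^sup>+\<omega>. ennreal (\<bar>\<xi>x P \<omega> * \<xi>y P \<omega>\<bar> powr (2 + \<delta>3)) \<partial>P)"
  have K0: "0 \<le> K" unfolding K_def by simp
  have K: "(\<integral>\<^sup>+\<omega>. ennreal (\<bar>\<xi>x P \<omega> * \<xi>y P \<omega>\<bar> powr p) \<partial>P) \<le> ennreal K" if P: "P \<in> \<P>\<^sub>0" for P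
  proof -
    interpret gcm_data P W W' hx hy "\<mu>x P" "\<mu>y P" by (rule data[OF P])
    have [measurable]: "(\<lambda>\<omega>. \<xi>x P \<omega> * \<xi>y P \<omega>) \<in> borel_measurable P"
      using terms_measurable(4)[OF order_refl] unfolding \<xi>_eq[OF P] .
    have pw: "r powr p \<le> 1 + r powr (2 + \<delta>3)" if "0 \<le> r" for r :: real
    proof (cases "r \<le> 1")
      case True
      then have "r powr p \<le> 1" using that p by (intro powr_le1) auto
      then show ?thesis by (simp add: add_increasing2)
    next
      case False
      then have "r powr p \<le> r powr (2 + \<delta>3)" using p by (intro powr_mono) auto
      then show ?thesis by simp
    qed
    have "(\<integral>\<^sup>+\<omega>. ennreal (\<bar>\<xi>x P \<omega> * \<xi>y P \<omega>\<bar> powr p) \<partial>P)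
      \<le> (\<integral>\<^sup>+\<omega>. 1 + ennreal (\<bar>\<xi>x P \<omega> * \<xi>y P \<omega>\<bar> powr (2 + \<delta>3)) \<partial>P)"
    proof (intro nn_integral_mono)
      fix \<omega>
      have "ennreal (\<bar>\<xi>x P \<omega> * \<xi>y P \<omega>\<bar> powr p) \<le> ennreal (1 + \<bar>\<xi>x P \<omega> * \<xi>y P \<omega>\<bar> powr (2 + \<delta>3))"
        by (intro ennreal_leI pw) simp
      then show "ennreal (\<bar>\<xi>x P \<omega> * \<xi>y P \<omega>\<bar> powr p) \<le> 1 + ennreal (\<bar>\<xi>x P \<omega> * \<xi>y P \<omega>\<bar> powr (2 + \<delta>3))"
        by (simp add: ennreal_plus)
    qed
    also have "\<dots> = 1 + (\<integral>\<^sup>+\<omega>. ennreal (\<bar>\<xi>x P \<omega> * \<xi>y P \<omega>\<bar> powr (2 + \<delta>3)) \<partial>P)"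
      by (subst nn_integral_add) (auto simp: emeasure_space_1)
    also have "\<dots> \<le> 1 + ennreal (enn2real (SUP P\<in>\<P>\<^sub>0. \<integral>\<^sup>+\<omega>. ennreal (\<bar>\<xi>x P \<omega> * \<xi>y P \<omega>\<bar> powr (2 + \<delta>3)) \<partial>P))"
      by (intro add_left_mono below[OF mom P])
    also have "\<dots> = ennreal K" unfolding K_def by (simp add: ennreal_plus)
    finally show ?thesis .
  qed
  define q where "q m P \<alpha> = measure P {\<omega> \<in> space P. \<exists>k\<ge>m. gcm_pvalue ?R k m \<omega> \<le> \<alpha>}" for m \<alpha> and P :: "'w measure"
  have "\<forall>\<^sub>F m in sequentially. \<forall>P\<in>\<P>\<^sub>0. \<forall>\<alpha>\<in>{0<..<1}. \<bar>q m P \<alpha> - \<alpha>\<bar> \<le> e" if e: "0 < e" for e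
  proof (rule uniform_in_level[OF _ _ _ e])
    fix \<alpha> e :: real assume \<alpha>: "0 < \<alpha>" "\<alpha> < 1" and e: "0 < e"
    obtain a where a: "0 < a" "rs_tail a = \<alpha>" using rs_tail_surj[OF \<alpha>] .
    show "\<forall>\<^sub>F m in sequentially. \<forall>P\<in>\<P>\<^sub>0. \<bar>q m P \<alpha> - \<alpha>\<bar> < e"
    proof (rule uniform_limit_by_selections[OF _ e])
      fix Q :: "nat \<Rightarrow> 'w measure" assume Q: "\<And>m. Q m \<in> \<P>\<^sub>0"
      have Z1: "(\<lambda>\<omega>. snd (snd (W 1 \<omega>))) = Z 1" unfolding fW ..
      have "(\<lambda>m. measure (Q m) {\<omega> \<in> space (Q m). \<exists>k\<ge>m. gcm_pvalue (gcm_data.R W W' hx hy) k m \<omega> \<le> rs_tail a})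
        \<longlonglongrightarrow> rs_tail a"
      proof (rule gcm_array_limit[OF data[OF Q] p(1,2) c(1) K0 a(1) _ _ _ _ _ _ _ _ sums])
        show "ennreal c \<le> ext_variance (Q m) (gcm_data.\<xi> W (\<mu>x (Q m)) (\<mu>y (Q m)) 1)" for m
          unfolding \<xi>_eq[OF Q] using c(2) by (rule order_trans) (intro INF_lower Q)
        show "(\<integral>\<^sup>+\<omega>. ennreal (\<bar>gcm_data.\<xi> W (\<mu>x (Q m)) (\<mu>y (Q m)) 1 \<omega>\<bar> powr p) \<partial>Q m) \<le> ennreal K" for m
          unfolding \<xi>_eq[OF Q] by (rule K[OF Q])
        fix m i :: nat assume i: "1 \<le> i"
        show "ext_variance (Q m) (\<lambda>\<omega>. gcm_data.dx hx (\<mu>x (Q m)) i (training_data W' i \<omega>) (W 1 \<omega>) * gcm_data.ry (\<mu>y (Q m)) (W 1 \<omega>))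
            \<le> ennreal (enn2real (fX i))"
          unfolding dx_eq[OF Q] ry_eq[OF Q] by (rule bX[OF i Q])
        show "ext_variance (Q m) (\<lambda>\<omega>. gcm_data.dy hy (\<mu>y (Q m)) i (training_data W' i \<omega>) (W 1 \<omega>) * gcm_data.rx (\<mu>x (Q m)) (W 1 \<omega>))
            \<le> ennreal (enn2real (fY i))"
          unfolding dy_eq[OF Q] rx_eq[OF Q] by (rule bY[OF i Q])
        show "ennsqrt (expected_L2_error (Q m) (\<lambda>\<omega>. snd (snd (W 1 \<omega>))) (training_data W' i) (hx i) (\<mu>x (Q m)))
          * ennsqrt (expected_L2_error (Q m) (\<lambda>\<omega>. snd (snd (W 1 \<omega>))) (training_data W' i) (hy i) (\<mu>y (Q m)))
            \<le> ennreal (enn2real (fB i))"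
          unfolding Z1 by (rule bB[OF i Q])
      qed simp_all
      then show "(\<lambda>m. q m (Q m) \<alpha>) \<longlonglongrightarrow> \<alpha>" unfolding R_eq[OF Q[of 0]] a(2) q_def .
    qed
  next
    fix m P and \<alpha> \<beta> :: real assume P: "P \<in> \<P>\<^sub>0" and \<alpha>: "0 < \<alpha>" "\<alpha> \<le> \<beta>" "\<beta> < 1"
    interpret gcm_data P W W' hx hy "\<mu>x P" "\<mu>y P" by (rule data[OF P])
    obtain a where a: "0 < a" "rs_tail a = \<beta>" using rs_tail_surj[of \<beta>] \<alpha> by auto
    have "?R i \<in> borel_measurable P" if "1 \<le> i" for i
      using terms_measurable(5)[OF that] unfolding R_eq[OF P] .
    note [measurable] = sample_variance_measurable(3)[of ?R, OF this]
    have ev: "{\<omega> \<in> space P. \<exists>k\<ge>m. gcm_pvalue ?R k m \<omega> \<le> \<beta>} \<in> sets P"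
      unfolding a(2)[symmetric] gcm_pvalue_le_iff[OF a(1)] by measurable
    show "q m P \<alpha> \<le> q m P \<beta>"
      unfolding q_def
    proof (rule finite_measure_mono[OF _ ev], rule subsetI)
      fix \<omega> assume "\<omega> \<in> {\<omega> \<in> space P. \<exists>k\<ge>m. gcm_pvalue ?R k m \<omega> \<le> \<alpha>}"
      then obtain k where "\<omega> \<in> space P" "m \<le> k" "gcm_pvalue ?R k m \<omega> \<le> \<alpha>" by blast
      moreover from this(3) have "gcm_pvalue ?R k m \<omega> \<le> \<beta>" using \<alpha>(2) by (rule order_trans)
      ultimately show "\<omega> \<in> {\<omega> \<in> space P. \<exists>k\<ge>m. gcm_pvalue ?R k m \<omega> \<le> \<beta>}" by blast
    qed
  next
    fix m P and \<alpha> :: real assume P: "P \<in> \<P>\<^sub>0"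
    interpret gcm_data P W W' hx hy "\<mu>x P" "\<mu>y P" by (rule data[OF P])
    show "0 \<le> q m P \<alpha> \<and> q m P \<alpha> \<le> 1" unfolding q_def by simp
  qed
  note uniform = this
  have "(\<lambda>m. SUP P\<in>\<P>\<^sub>0. SUP \<alpha>\<in>{0<..<1::real}. ennreal \<bar>q m P \<alpha> - \<alpha>\<bar>) \<longlonglongrightarrow> 0"
  proof (rule tendsto_zero_ennreal)
    fix r :: real assume r: "0 < r"
    then have "\<forall>\<^sub>F m in sequentially. \<forall>P\<in>\<P>\<^sub>0. \<forall>\<alpha>\<in>{0<..<1}. \<bar>q m P \<alpha> - \<alpha>\<bar> \<le> r / 2"
      by (intro uniform) simp
    then show "\<forall>\<^sub>F m in sequentially. (SUP P\<in>\<P>\<^sub>0. SUP \<alpha>\<in>{0<..<1::real}. ennreal \<bar>q m P \<alpha> - \<alpha>\<bar>) < ennreal r"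
    proof eventually_elim
      case (elim m)
      have "(SUP P\<in>\<P>\<^sub>0. SUP \<alpha>\<in>{0<..<1::real}. ennreal \<bar>q m P \<alpha> - \<alpha>\<bar>) \<le> ennreal (r / 2)"
        using elim by (intro SUP_least ennreal_leI) auto
      also have "\<dots> < ennreal r" using r by (intro ennreal_lessI) auto
      finally show ?case .
    qed
  qed
  then show ?thesis unfolding q_def .
qed

end
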